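(* Let $(Y^7,\varphi)$ be a torsion-free $G_2$ manifold (no compactness or full-holonomy hypothesis is made), let $E=\operatorname{End}_0(TY)$, and let $(B_\tau^\bullet,D)$ be the weighted coefficient complex $B_\tau^k=G_1^k\oplus E^k\oplus G_0^k$ at the minimal standard embedding, with differential $$D^k=\begin{pmatrix}d_1^k&b^k&c^k\\0&e^k&f^k\\0&0&d_0^k\end{pmatrix}$$ (all objects as defined in the context). For every canonical degree $k=0,1,2,3$, the maps $$V^k=\begin{pmatrix}1&-L_E^k&0\\0&1&\mathcal K^k\\0&0&1\end{pmatrix},\qquad W^k=\begin{pmatrix}1&L_E^k&-L_E^k\mathcal K^k\\0&1&-\mathcal K^k\\0&0&1\end{pmatrix}$$ on $G_1^k\oplus E^k\oplus G_0^k$ are mutually inverse differential operators on smooth sections and satisfy $$W^{k+1}D^kV^k=\operatorname{diag}(d_1^k,e^k,d_0^k)$$ (all spaces and maps in degree $4$ being zero). In particular, $$(B_\tau^\bullet,D)\cong(G_1^\bullet,d_1)\oplus(E^\bullet,e)\oplus(G_0^\bullet,d_0)$$ as complexes of real smooth sections. The maps $V^k,W^k$ also preserve the dual-number action, i.e. they commute with multiplication by $\epsilon$, and give an $S$-linear chain isomorphism $$(B_\tau^\bullet,D)\cong(G^\bullet\otimes_{\mathbb R}S,\;d\otimes1)\oplus(E^\bullet,e),\qquad S=\mathbb R[\epsilon]/(\epsilon^2).$$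
   Context: Geometry. $Y$ is a smooth seven-manifold with a positive three-form $\varphi$ (a $G_2$ structure), with associated metric $g$ and orientation, normalized so that locally there is an oriented $g$-orthonormal coframe with $\varphi=e^{123}+e^{145}+e^{167}+e^{246}-e^{257}-e^{347}-e^{356}$; $\psi=*\varphi$. Torsion-free means $\mathrm d\varphi=0$ and $\mathrm d\psi=0$; equivalently the Levi-Civita connection $\nabla$ preserves $\varphi$ and $\psi$. $R(X,Y)=[\nabla_X,\nabla_Y]-\nabla_{[X,Y]}$ is the Riemann curvature, regarded as an $\operatorname{End}(TY)$-valued two-form. Minimal standard embedding means that the gauge bundle is $V=TY$, its connection is $\nabla$, its curvature is $F=R$, and $H=0$. $(e_i)$ denotes a local $g$-orthonormal frame with dual coframe $(e^i)$. Canonical complexes. $\Lambda^2=\Lambda^2_7\oplus\Lambda^2_{14}$ with $\Lambda^2_7=\{\iota_X\varphi\}$, $\Lambda^2_{14}=\{\eta:\eta\wedge\psi=0\}$, and $\Lambda^3_1=\mathbb R\varphi\subset\Lambda^3$. Put $\Lambda^0_{\rm can}=\Lambda^0$, $\Lambda^1_{\rm can}=\Lambda^1$, $\Lambda^2_{\rm can}=\Lambda^2_7$, $\Lambda^3_{\rm can}=\Lambda^3_1$, and zero in other degrees; $\Pi_k:\Lambda^k\to\Lambda^k_{\rm can}$ is the orthogonal projection ($\Pi_0,\Pi_1$ are identities, $\Pi_4=0$). For a bundle $W$ with connection, $\mathcal C^k(W)=\Gamma(\Lambda^k_{\rm can}T^*Y\otimes W)$ and $\check{\mathrm d}_W^k=\Pi_{k+1}\mathrm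 d_W|_{\mathcal C^k(W)}$, where $\mathrm d_W$ is the exterior covariant derivative. $\mathrm d_\nabla$ and $\mathrm d_E$ are the exterior covariant derivatives on $T^*Y$-valued and $E$-valued forms induced by $\nabla$, where $E=\operatorname{End}_0(TY)$ is the bundle of trace-free endomorphisms. Coefficient spaces. $\epsilon$ is a formal parameter with $\epsilon^2=0$, $S=\mathbb R[\epsilon]/(\epsilon^2)$. $G^\bullet=\mathcal C^\bullet(T^*Y)$ with $d=\check{\mathrm d}_{T^*Y}$; $E^\bullet=\mathcal C^\bullet(E)$ with $e=\check{\mathrm d}_E$; $B_\tau^\bullet=(G^\bullet\otimes_{\mathbb R}S)\oplus E^\bullet$ as $S$-module with $\epsilon E^\bullet=0$. As real spaces $G_0^\bullet=G^\bullet$, $G_1^\bullet=\epsilon G^\bullet$; elements of $B_\tau^k=G_1^k\oplus E^k\oplus G_0^k$ are triples $(\epsilon x,a,m)$, with $d_0m=dm$, $d_1(\epsilon x)=\epsilon\,dx$, and multiplication by $\epsilon$ acts by $(\epsilon x,a,m)\mapsto(\epsilon m,0,0)$. Couplings. For a $T^*Y$-valued form $m$ write $m_X=m(\cdot,X)$ for the evaluation of the $T^*Y$ factor on $X$. $\tau(S,T)=\operatorname{tr}_7(ST)$ is the real matrix trace on $TY$; for matrix-valued forms $\tau(\alpha\wedge\beta)$ is the trace of the wedge–matrix product in the displayed order. $\iota_ZR$ is the $\operatorname{End}(TY)$-valued one-form $X\mapsto R(Z,X)$. For $m\in\Omega^p(Y,T^*Y)$, $\mathcal B(m)\in\Omega^p(Y,\operatorname{End}(TY))$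 is defined by $g(X,\mathcal B(m)Y)=(\nabla_Xm)_Y$. On unrestricted forms, $$\mathfrak f m=\sum_j(\iota_{e_j}R)\wedge m_{e_j},\quad(\mathfrak b a)(Z)=-\tfrac{\epsilon}{4}\tau(\iota_ZR\wedge a),\quad(\mathfrak c m)(Z)=-\tfrac{\epsilon}{2}\tau(\iota_ZR\wedge\mathcal B(m)),$$ where $(\cdot)(Z)$ is evaluation of the $T^*Y$ factor. The projected maps are $f^k=\Pi_{k+1}\mathfrak f:G_0^k\to E^{k+1}$, $b^k=\Pi_{k+1}\mathfrak b:E^k\to G_1^{k+1}$, $c^k=\Pi_{k+1}\mathfrak c:G_0^k\to G_1^{k+1}$; all maps out of degree $3$ are zero. Homotopies. For $m\in\Omega^p(Y,T^*Y)$, $\mathcal Km\in\Omega^p(Y,\mathfrak{so}(TY))\subset\Omega^p(Y,E)$ is $(\mathcal Km)(X,Y)=(\nabla_Ym)_X-(\nabla_Xm)_Y$, where a two-form $A$ is identified with the skew endomorphism $A^\sharp$ by $g(X,A^\sharp Y)=A(X,Y)$. For $a\in\Omega^p(Y,E)$, $a^-(X,Y)=\frac12(g(X,aY)-g(Y,aX))$ is its metric-skew part, viewed as a $\Lambda^pT^*Y$-valued two-form, and $\ell a=\frac12d_\nabla^*a^-$, i.e. $(\ell a)(Z)=-\frac12\sum_j(\nabla_{e_j}a^-)(e_j,Z)$, viewed in $\Omega^p(Y,T^*Y)$. Since $\nabla\Pi_k=0$, these operators commute with the $\Pi_k$ and restrict to $\mathcal K^k:G_0^k\to E^k$ and $L_E^k=\epsilon\ell:E^k\to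 G_1^k$. *)

theory Defs
  imports "HOL-Analysis.Analysis" "HOL-Library.Function_Algebras"
begin

text \<open>
  Addition of sections is the pointwise addition of HOL-Library.Function_Algebras.
  For a smooth seven-manifold, every tangent space is modelled on \<open>real^7\<close>: a vector
  \<open>v\<close> at \<open>p\<close> is given by its components in a chart chosen once and for all around \<open>p\<close>.
  Tensors at \<open>p\<close> are thus multilinear maps on \<open>real^7\<close>; smoothness of tensor fields is
  chart-independent and always takes the change of coordinates into account.
\<close>

type_synonym tvec = "real^7"
type_synonym covec = "tvec \<Rightarrow>\<^sub>L real"
type_synonym endo = "tvec \<Rightarrow>\<^sub>L tvec"

text \<open>
  A \<open>W\<close>-valued form: at each point a function of the list of arguments, which is zero
  unless the length of the list is the degree of the form.
\<close>
type_synonym 'w form = "tvec list \<Rightarrow> 'w"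
type_synonym ('a, 'w) forms = "'a \<Rightarrow> 'w form"


section \<open>Smooth functions on open subsets of the model space\<close>

primrec cont_diff :: "nat \<Rightarrow> tvec set \<Rightarrow> (tvec \<Rightarrow> real) \<Rightarrow> bool" where
  "cont_diff 0 U f \<longleftrightarrow> continuous_on U f"
| "cont_diff (Suc n) U f \<longleftrightarrow> (\<forall>x\<in>U. f differentiable (at x)) \<and>
     (\<forall>i. cont_diff n U (\<lambda>x. frechet_derivative f (at x) (axis i 1)))"

definition smooth_on :: "tvec set \<Rightarrow> (tvec \<Rightarrow> real) \<Rightarrow> bool" where
  "smooth_on U f \<longleftrightarrow> (\<forall>n. cont_diff n U f)"


section \<open>Multilinear algebra\<close>

definition omit :: "nat \<Rightarrow> 'b list \<Rightarrow> 'b list" where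
  "omit i xs = take i xs @ drop (Suc i) xs"

definition alternating_form :: "nat \<Rightarrow> real form \<Rightarrow> bool" where
  "alternating_form k \<alpha> \<longleftrightarrow>
     (\<forall>vs. length vs \<noteq> k \<longrightarrow> \<alpha> vs = 0) \<and>
     (\<forall>vs i. length vs = k \<longrightarrow> i < k \<longrightarrow> linear (\<lambda>x. \<alpha> (vs[i := x]))) \<and>
     (\<forall>vs i j. length vs = k \<longrightarrow> i < j \<longrightarrow> j < k \<longrightarrow> vs ! i = vs ! j \<longrightarrow> \<alpha> vs = 0)"

text \<open>\<open>coframe_wedge e [i\<^sub>1, \<dots>, i\<^sub>k]\<close> is the form \<open>e i\<^sub>1 \<and> \<dots> \<and> e i\<^sub>k\<close>.\<close>
definition coframe_wedge :: "(7 \<Rightarrow> covec) \<Rightarrow> 7 list \<Rightarrow> real form" where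
  "coframe_wedge e js vs = (if length vs = length js then
     (\<Sum>\<pi> | \<pi> permutes {..<length js}.
        of_int (sign \<pi>) * (\<Prod>n<length js. blinfun_apply (e (js ! n)) (vs ! \<pi> n)))
     else 0)"

text \<open>In the index type 7, the numeral 7 denotes the same element as 0, so 1, ..., 7 are
  its seven elements.\<close>
definition standard_G2_form :: "(7 \<Rightarrow> covec) \<Rightarrow> real form" where
  "standard_G2_form e vs =
     coframe_wedge e [1,2,3] vs + coframe_wedge e [1,4,5] vs + coframe_wedge e [1,6,7] vs
   + coframe_wedge e [2,4,6] vs - coframe_wedge e [2,5,7] vs - coframe_wedge e [3,4,7] vs
   - coframe_wedge e [3,5,6] vs"

text \<open>Wedge product of a one-form with a form, the values being multiplied by \<open>mul\<close>.\<close>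
definition wedge1 :: "('u \<Rightarrow> 'v \<Rightarrow> 'w::real_vector) \<Rightarrow> (tvec \<Rightarrow> 'u) \<Rightarrow> 'v form \<Rightarrow> 'w form" where
  "wedge1 mul A \<beta> vs = (\<Sum>i<length vs. (-1)^i *\<^sub>R mul (A (vs ! i)) (\<beta> (omit i vs)))"

definition tr7 :: "endo \<Rightarrow> real" where
  "tr7 A = trace (matrix (blinfun_apply A))"

definition scale_form :: "('a \<Rightarrow> real) \<Rightarrow> ('a, 'w::real_vector) forms \<Rightarrow> ('a, 'w) forms" where
  "scale_form f \<alpha> = (\<lambda>p vs. f p *\<^sub>R \<alpha> p vs)"


section \<open>Smooth seven-manifolds\<close>

text \<open>A chart is a pair \<open>(U, \<kappa>)\<close>, where only the values of \<open>\<kappa>\<close> on \<open>U\<close> matter.\<close>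
locale smooth_manifold7 =
  fixes atlas :: "('a::{t2_space, second_countable_topology} set \<times> ('a \<Rightarrow> tvec)) set"
  assumes charts_cover: "(\<Union>c\<in>atlas. fst c) = UNIV"
    and chart_open: "c \<in> atlas \<Longrightarrow> open (fst c) \<and> open (snd c ` fst c)"
    and chart_homeomorphism:
      "c \<in> atlas \<Longrightarrow> homeomorphism (fst c) (snd c ` fst c) (snd c) (inv_into (fst c) (snd c))"
    and smooth_transitions:
      "c \<in> atlas \<Longrightarrow> c' \<in> atlas \<Longrightarrow>
         smooth_on (snd c ` (fst c \<inter> fst c')) (\<lambda>x. snd c' (inv_into (fst c) (snd c) x) $ i)"
begin

definition chart_at :: "'a \<Rightarrow> 'a set \<times> ('a \<Rightarrow> tvec)" where
  "chart_at p = (SOME c. c \<in> atlas \<and> p \<in> fst c)"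

definition smooth_fun_on :: "'a set \<Rightarrow> ('a \<Rightarrow> real) \<Rightarrow> bool" where
  "smooth_fun_on U f \<longleftrightarrow>
     (\<forall>c\<in>atlas. smooth_on (snd c ` (fst c \<inter> U)) (f \<circ> inv_into (fst c) (snd c)))"

definition smooth_funs :: "('a \<Rightarrow> real) set" where
  "smooth_funs = {f. smooth_fun_on UNIV f}"

text \<open>The differential of \<open>f\<close> at \<open>p\<close> applied to the tangent vector \<open>v\<close> at \<open>p\<close>.\<close>
definition dfun :: "('a \<Rightarrow> real) \<Rightarrow> 'a \<Rightarrow> tvec \<Rightarrow> real" where
  "dfun f p v = frechet_derivative (f \<circ> inv_into (fst (chart_at p)) (snd (chart_at p)))
                  (at (snd (chart_at p) p)) v"

definition deriv_along :: "('a \<Rightarrow> tvec) \<Rightarrow> ('a \<Rightarrow> real) \<Rightarrow> 'a \<Rightarrow> real" where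
  "deriv_along X f p = dfun f p (X p)"

text \<open>The components of a vector field \<open>X\<close> in a chart \<open>\<kappa>\<close> are the derivatives along \<open>X\<close> of the
  coordinate functions \<open>\<kappa>\<^sup>i\<close>.\<close>
definition vector_fields :: "('a \<Rightarrow> tvec) set" where
  "vector_fields =
     {X. \<forall>c\<in>atlas. \<forall>i. smooth_fun_on (fst c) (deriv_along X (\<lambda>q. snd c q $ i))}"

text \<open>A globally defined smooth vector field with a prescribed value at a point. All
  expressions below in which it is used depend on its value at \<open>p\<close> only.\<close>
definition ext :: "'a \<Rightarrow> tvec \<Rightarrow> 'a \<Rightarrow> tvec" where
  "ext p v = (SOME X. X \<in> vector_fields \<and> X p = v)"

text \<open>Here \<open>[X, Y] f = X (Y f) - Y (X f)\<close>, for the coordinate functions \<open>f\<close> of the chart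
  at \<open>p\<close> which identifies the tangent space at \<open>p\<close> with \<open>real^7\<close>.\<close>
definition lie_bracket :: "('a \<Rightarrow> tvec) \<Rightarrow> ('a \<Rightarrow> tvec) \<Rightarrow> 'a \<Rightarrow> tvec" where
  "lie_bracket X Y p = (\<chi> i. let f = (\<lambda>q. snd (chart_at p) q $ i) in
     deriv_along X (deriv_along Y f) p - deriv_along Y (deriv_along X f) p)"

text \<open>
  The exterior covariant derivative of a form with values in a vector bundle whose connection
  on sections is \<open>nabW\<close>. With \<open>nabW = deriv_along\<close> this is the exterior derivative of real
  forms.
\<close>
definition ext_cov_deriv ::
  "(('a \<Rightarrow> tvec) \<Rightarrow> ('a \<Rightarrow> 'w::real_vector) \<Rightarrow> 'a \<Rightarrow> 'w) \<Rightarrow> ('a, 'w) forms \<Rightarrow> ('a, 'w) forms" where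
  "ext_cov_deriv nabW \<alpha> p vs = (let n = length vs; Xs = map (ext p) vs in
     (\<Sum>i<n. (-1)^i *\<^sub>R nabW (Xs ! i) (\<lambda>q. \<alpha> q (map (\<lambda>X. X q) (omit i Xs))) p)
   + (\<Sum>j<n. \<Sum>i<j. (-1)^(i+j) *\<^sub>R
        \<alpha> p (lie_bracket (Xs ! i) (Xs ! j) p # omit i (omit j vs))))"

text \<open>Smooth sections of the cotangent bundle and of the bundle \<open>E\<close> of trace-free
  endomorphisms of the tangent bundle.\<close>
definition cotangent_sections :: "('a \<Rightarrow> covec) set" where
  "cotangent_sections =
     {s. \<forall>Z\<in>vector_fields. (\<lambda>q. blinfun_apply (s q) (Z q)) \<in> smooth_funs}"

definition End0_sections :: "('a \<Rightarrow> endo) set" where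
  "End0_sections =
     {a. (\<forall>Z\<in>vector_fields. (\<lambda>q. blinfun_apply (a q) (Z q)) \<in> vector_fields) \<and>
         (\<forall>q. tr7 (a q) = 0)}"

end


section \<open>Riemannian metric and Levi-Civita connection\<close>

locale riemannian_manifold7 = smooth_manifold7 atlas
  for atlas :: "('a::{t2_space, second_countable_topology} set \<times> ('a \<Rightarrow> tvec)) set" +
  fixes g :: "'a \<Rightarrow> tvec \<Rightarrow> tvec \<Rightarrow> real"
    and nab :: "('a \<Rightarrow> tvec) \<Rightarrow> ('a \<Rightarrow> tvec) \<Rightarrow> 'a \<Rightarrow> tvec"
  assumes metric_bilinear: "bilinear (g p)"
    and metric_sym: "g p u v = g p v u"
    and metric_pos: "u \<noteq> 0 \<Longrightarrow> g p u u > 0"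
    and metric_smooth:
      "X \<in> vector_fields \<Longrightarrow> Y \<in> vector_fields \<Longrightarrow> (\<lambda>p. g p (X p) (Y p)) \<in> smooth_funs"
    \<comment> \<open>\<open>nab\<close> is the Levi-Civita connection of \<open>g\<close>\<close>
    and nab_vector_field:
      "X \<in> vector_fields \<Longrightarrow> Y \<in> vector_fields \<Longrightarrow> nab X Y \<in> vector_fields"
    and nab_add_left:
      "X \<in> vector_fields \<Longrightarrow> X' \<in> vector_fields \<Longrightarrow> Y \<in> vector_fields \<Longrightarrow>
         nab (X + X') Y = nab X Y + nab X' Y"
    and nab_scale_left:
      "f \<in> smooth_funs \<Longrightarrow> X \<in> vector_fields \<Longrightarrow> Y \<in> vector_fields \<Longrightarrow>
         nab (\<lambda>p. f p *\<^sub>R X p) Y = (\<lambda>p. f p *\<^sub>R nab X Y p)"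
    and nab_add_right:
      "X \<in> vector_fields \<Longrightarrow> Y \<in> vector_fields \<Longrightarrow> Y' \<in> vector_fields \<Longrightarrow>
         nab X (Y + Y') = nab X Y + nab X Y'"
    and nab_leibniz:
      "f \<in> smooth_funs \<Longrightarrow> X \<in> vector_fields \<Longrightarrow> Y \<in> vector_fields \<Longrightarrow>
         nab X (\<lambda>p. f p *\<^sub>R Y p) = (\<lambda>p. deriv_along X f p *\<^sub>R Y p + f p *\<^sub>R nab X Y p)"
    and nab_torsion_free:
      "X \<in> vector_fields \<Longrightarrow> Y \<in> vector_fields \<Longrightarrow> nab X Y - nab Y X = lie_bracket X Y"
    and nab_metric:
      "X \<in> vector_fields \<Longrightarrow> Y \<in> vector_fields \<Longrightarrow> Z \<in> vector_fields \<Longrightarrow>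
         deriv_along X (\<lambda>p. g p (Y p) (Z p)) p = g p (nab X Y p) (Z p) + g p (Y p) (nab X Z p)"
begin

text \<open>An orthonormal basis of the tangent space at \<open>p\<close>; the sums over it below are
  independent of the choice.\<close>
definition onb :: "'a \<Rightarrow> 7 \<Rightarrow> tvec" where
  "onb p = (SOME b. \<forall>i j. g p (b i) (b j) = (if i = j then 1 else 0))"

definition curvature_field ::
  "('a \<Rightarrow> tvec) \<Rightarrow> ('a \<Rightarrow> tvec) \<Rightarrow> ('a \<Rightarrow> tvec) \<Rightarrow> 'a \<Rightarrow> tvec" where
  "curvature_field X Y Z = nab X (nab Y Z) - nab Y (nab X Z) - nab (lie_bracket X Y) Z"

definition Riem :: "'a \<Rightarrow> tvec \<Rightarrow> tvec \<Rightarrow> endo" where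
  "Riem p u v = Blinfun (\<lambda>z. curvature_field (ext p u) (ext p v) (ext p z) p)"

text \<open>The induced connections on the cotangent bundle, on endomorphisms of the tangent bundle,
  and on bilinear forms on the tangent bundle.\<close>
definition nab_cotangent :: "('a \<Rightarrow> tvec) \<Rightarrow> ('a \<Rightarrow> covec) \<Rightarrow> 'a \<Rightarrow> covec" where
  "nab_cotangent X s p = Blinfun (\<lambda>z.
     deriv_along X (\<lambda>q. blinfun_apply (s q) (ext p z q)) p
   - blinfun_apply (s p) (nab X (ext p z) p))"

definition nab_End :: "('a \<Rightarrow> tvec) \<Rightarrow> ('a \<Rightarrow> endo) \<Rightarrow> 'a \<Rightarrow> endo" where
  "nab_End X a p = Blinfun (\<lambda>z.
     nab X (\<lambda>q. blinfun_apply (a q) (ext p z q)) p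
   - blinfun_apply (a p) (nab X (ext p z) p))"

definition nab_bilinear ::
  "('a \<Rightarrow> tvec) \<Rightarrow> ('a \<Rightarrow> tvec \<Rightarrow>\<^sub>L covec) \<Rightarrow> 'a \<Rightarrow> tvec \<Rightarrow>\<^sub>L covec" where
  "nab_bilinear X s p = Blinfun (\<lambda>y. Blinfun (\<lambda>z.
     deriv_along X (\<lambda>q. blinfun_apply (blinfun_apply (s q) (ext p y q)) (ext p z q)) p
   - blinfun_apply (blinfun_apply (s p) (nab X (ext p y) p)) z
   - blinfun_apply (blinfun_apply (s p) y) (nab X (ext p z) p)))"

text \<open>The full covariant derivative \<open>(\<nabla>\<^sub>v \<alpha>)(vs)\<close> at \<open>p\<close> of a form \<open>\<alpha>\<close> with values in a bundle
  with connection \<open>nabW\<close>: the connection also acts on the form part.\<close>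
definition cov_deriv ::
  "(('a \<Rightarrow> tvec) \<Rightarrow> ('a \<Rightarrow> 'w::real_vector) \<Rightarrow> 'a \<Rightarrow> 'w) \<Rightarrow> ('a, 'w) forms \<Rightarrow> 'a \<Rightarrow> tvec \<Rightarrow> 'w form" where
  "cov_deriv nabW \<alpha> p v vs =
     nabW (ext p v) (\<lambda>q. \<alpha> q (map (\<lambda>x. ext p x q) vs)) p
   - (\<Sum>i<length vs. \<alpha> p (vs[i := nab (ext p v) (ext p (vs ! i)) p]))"

text \<open>The endomorphism \<open>T\<close> at \<open>p\<close> with \<open>g(x, T y) = A(x, y)\<close>.\<close>
definition sharp :: "'a \<Rightarrow> (tvec \<Rightarrow> tvec \<Rightarrow> real) \<Rightarrow> endo" where
  "sharp p A = (THE T. \<forall>x y. g p x (blinfun_apply T y) = A x y)"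

definition form_inner :: "'a \<Rightarrow> nat \<Rightarrow> real form \<Rightarrow> real form \<Rightarrow> real" where
  "form_inner p k \<beta> \<alpha> =
     (\<Sum>js | length js = k. \<beta> (map (onb p) js) * \<alpha> (map (onb p) js)) / fact k"

text \<open>Hodge star of three-forms with respect to the volume form \<open>vol\<close>.\<close>
definition hodge3 :: "('a, real) forms \<Rightarrow> ('a, real) forms \<Rightarrow> ('a, real) forms" where
  "hodge3 vol \<alpha> p vs =
     (\<Sum>js | length js = 3. \<alpha> p (map (onb p) js) * vol p (map (onb p) js @ vs)) / fact 3"

end


section \<open>\<open>G\<^sub>2\<close> structures\<close>

text \<open>\<open>vol\<close> is the Riemannian volume form, i.e. it stands for the orientation.\<close>
locale g2_manifold = riemannian_manifold7 atlas g nab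
  for atlas :: "('a::{t2_space, second_countable_topology} set \<times> ('a \<Rightarrow> tvec)) set"
    and g nab +
  fixes \<phi> vol :: "('a, real) forms"
  assumes adapted_coframe:
    "\<exists>U e. open U \<and> p \<in> U \<and>
       (\<forall>X\<in>vector_fields. \<forall>i. smooth_fun_on U (\<lambda>q. blinfun_apply (e q i) (X q))) \<and>
       (\<forall>q\<in>U. (\<forall>u v. g q u v = (\<Sum>i\<in>UNIV. blinfun_apply (e q i) u * blinfun_apply (e q i) v)) \<and>
               vol q = coframe_wedge (e q) [1,2,3,4,5,6,7] \<and>
               \<phi> q = standard_G2_form (e q))"
begin

definition \<psi> :: "('a, real) forms" where
  "\<psi> = hodge3 vol \<phi>"

text \<open>The canonical subspaces of real forms at \<open>p\<close>; in degree two, the contractions of \<open>\<phi>\<close>.\<close>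
definition can_forms :: "'a \<Rightarrow> nat \<Rightarrow> real form set" where
  "can_forms p k =
     (if k = 0 \<or> k = 1 then {\<alpha>. alternating_form k \<alpha>}
      else if k = 2 then {\<alpha>. \<exists>X. \<alpha> = (\<lambda>vs. \<phi> p (X # vs))}
      else if k = 3 then {\<alpha>. \<exists>c. \<alpha> = (\<lambda>vs. c * \<phi> p vs)}
      else {0})"

text \<open>Orthogonal projection onto the canonical forms, tensored with the identity of the
  coefficient space \<open>'w\<close>: after composition with any linear functional on \<open>'w\<close> it is the
  orthogonal projection of real forms.\<close>
definition can_proj :: "nat \<Rightarrow> ('a, 'w::real_vector) forms \<Rightarrow> ('a, 'w) forms" where
  "can_proj k \<alpha> p = (THE \<alpha>'. \<forall>l :: 'w \<Rightarrow> real. linear l \<longrightarrow>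
     (\<lambda>vs. l (\<alpha>' vs)) \<in> can_forms p k \<and>
     (\<forall>\<beta>\<in>can_forms p k. form_inner p k \<beta> (\<lambda>vs. l (\<alpha> p vs - \<alpha>' vs)) = 0))"

text \<open>The smooth sections of \<open>\<Lambda>\<^sup>k\<^sub>c\<^sub>a\<^sub>n \<otimes> W\<close>, where \<open>sec\<close> is the set of smooth sections of \<open>W\<close>.\<close>
definition can_sections :: "('a \<Rightarrow> 'w::real_vector) set \<Rightarrow> nat \<Rightarrow> ('a, 'w) forms set" where
  "can_sections sec k =
     {\<alpha>. (\<forall>p. \<forall>l :: 'w \<Rightarrow> real. linear l \<longrightarrow> (\<lambda>vs. l (\<alpha> p vs)) \<in> can_forms p k) \<and>
         (\<forall>Xs. set Xs \<subseteq> vector_fields \<longrightarrow> (\<lambda>q. \<alpha> q (map (\<lambda>X. X q) Xs)) \<in> sec)}"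

abbreviation "G_sp \<equiv> can_sections cotangent_sections"
abbreviation "E_sp \<equiv> can_sections End0_sections"

definition d_G :: "nat \<Rightarrow> ('a, covec) forms \<Rightarrow> ('a, covec) forms" where
  "d_G k m = can_proj (Suc k) (ext_cov_deriv nab_cotangent m)"

definition d_E :: "nat \<Rightarrow> ('a, endo) forms \<Rightarrow> ('a, endo) forms" where
  "d_E k a = can_proj (Suc k) (ext_cov_deriv nab_End a)"


subsection \<open>Couplings\<close>

text \<open>Maps into the summand \<open>\<epsilon> G\<close> are given by the coefficient of \<open>\<epsilon>\<close>.\<close>

definition BB :: "('a, covec) forms \<Rightarrow> ('a, endo) forms" where
  "BB m p vs = sharp p (\<lambda>x y. blinfun_apply (cov_deriv nab_cotangent m p x vs) y)"

definition ff :: "('a, covec) forms \<Rightarrow> ('a, endo) forms" where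
  "ff m p vs = (\<Sum>j\<in>UNIV. wedge1 (\<lambda>A r. r *\<^sub>R A) (\<lambda>x. Riem p (onb p j) x)
                  (\<lambda>ws. blinfun_apply (m p ws) (onb p j)) vs)"

definition tr_curv_wedge :: "('a, endo) forms \<Rightarrow> 'a \<Rightarrow> tvec \<Rightarrow> real form" where
  "tr_curv_wedge a p z = wedge1 (\<lambda>A C. tr7 (A o\<^sub>L C)) (\<lambda>x. Riem p z x) (a p)"

definition bb :: "('a, endo) forms \<Rightarrow> ('a, covec) forms" where
  "bb a p vs = Blinfun (\<lambda>z. - (1/4) * tr_curv_wedge a p z vs)"

definition cc :: "('a, covec) forms \<Rightarrow> ('a, covec) forms" where
  "cc m p vs = Blinfun (\<lambda>z. - (1/2) * tr_curv_wedge (BB m) p z vs)"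

definition f_map :: "nat \<Rightarrow> ('a, covec) forms \<Rightarrow> ('a, endo) forms" where
  "f_map k m = can_proj (Suc k) (ff m)"

definition b_map :: "nat \<Rightarrow> ('a, endo) forms \<Rightarrow> ('a, covec) forms" where
  "b_map k a = can_proj (Suc k) (bb a)"

definition c_map :: "nat \<Rightarrow> ('a, covec) forms \<Rightarrow> ('a, covec) forms" where
  "c_map k m = can_proj (Suc k) (cc m)"


subsection \<open>Homotopies\<close>

definition KK :: "('a, covec) forms \<Rightarrow> ('a, endo) forms" where
  "KK m p vs = sharp p (\<lambda>x y. blinfun_apply (cov_deriv nab_cotangent m p y vs) x
                             - blinfun_apply (cov_deriv nab_cotangent m p x vs) y)"

definition skew_part :: "('a, endo) forms \<Rightarrow> ('a, tvec \<Rightarrow>\<^sub>L covec) forms" where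
  "skew_part a p vs = Blinfun (\<lambda>x. Blinfun (\<lambda>y.
     (g p x (blinfun_apply (a p vs) y) - g p y (blinfun_apply (a p vs) x)) / 2))"

definition ell :: "('a, endo) forms \<Rightarrow> ('a, covec) forms" where
  "ell a p vs = Blinfun (\<lambda>z. - (1/2) * (\<Sum>j\<in>UNIV.
     blinfun_apply (blinfun_apply
       (cov_deriv nab_bilinear (skew_part a) p (onb p j) vs) (onb p j)) z))"


subsection \<open>The coefficient complex\<close>

text \<open>The element \<open>(\<epsilon> x, a, m)\<close> is represented by the triple \<open>(x, a, m)\<close>.\<close>

definition B_sp :: "nat \<Rightarrow> (('a, covec) forms \<times> ('a, endo) forms \<times> ('a, covec) forms) set" where
  "B_sp k = G_sp k \<times> E_sp k \<times> G_sp k"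

fun D_B :: "nat \<Rightarrow> ('a, covec) forms \<times> ('a, endo) forms \<times> ('a, covec) forms \<Rightarrow>
    ('a, covec) forms \<times> ('a, endo) forms \<times> ('a, covec) forms" where
  "D_B k (x, a, m) = (d_G k x + b_map k a + c_map k m, d_E k a + f_map k m, d_G k m)"

fun V_B :: "('a, covec) forms \<times> ('a, endo) forms \<times> ('a, covec) forms \<Rightarrow>
    ('a, covec) forms \<times> ('a, endo) forms \<times> ('a, covec) forms" where
  "V_B (x, a, m) = (x - ell a, a + KK m, m)"

fun W_B :: "('a, covec) forms \<times> ('a, endo) forms \<times> ('a, covec) forms \<Rightarrow>
    ('a, covec) forms \<times> ('a, endo) forms \<times> ('a, covec) forms" where
  "W_B (x, a, m) = (x + ell a - ell (KK m), a - KK m, m)"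

end

locale torsion_free_g2_manifold = g2_manifold atlas g nab \<phi> vol
  for atlas :: "('a::{t2_space, second_countable_topology} set \<times> ('a \<Rightarrow> tvec)) set"
    and g nab \<phi> vol +
  assumes phi_closed: "ext_cov_deriv deriv_along \<phi> = 0"
    and psi_closed: "ext_cov_deriv deriv_along \<psi> = 0"


section \<open>Dual numbers and complexes\<close>

text \<open>\<open>Dual s t\<close> is \<open>s + t \<epsilon>\<close> in \<open>\<real>[\<epsilon>]/(\<epsilon>\<^sup>2)\<close>.\<close>
datatype dual = Dual real real

instantiation dual :: comm_ring_1
begin

definition "0 = Dual 0 0"
definition "1 = Dual 1 0"
fun plus_dual where "Dual s t + Dual s' t' = Dual (s + s') (t + t')"
fun uminus_dual where "- Dual s t = Dual (- s) (- t)"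
fun minus_dual where "Dual s t - Dual s' t' = Dual (s - s') (t - t')"
fun times_dual where "Dual s t * Dual s' t' = Dual (s * s') (s * t' + t * s')"

instance
proof
  fix a b c :: dual
  show "a * b * c = a * (b * c)" by (cases a; cases b; cases c) (simp add: algebra_simps)
  show "a * b = b * a" by (cases a; cases b) (simp add: algebra_simps)
  show "1 * a = a" by (cases a) (simp add: one_dual_def)
  show "a + b + c = a + (b + c)" by (cases a; cases b; cases c) simp
  show "a + b = b + a" by (cases a; cases b) simp
  show "0 + a = a" by (cases a) (simp add: zero_dual_def)
  show "- a + a = 0" by (cases a) (simp add: zero_dual_def)
  show "a - b = a + - b" by (cases a; cases b) simp
  show "(a + b) * c = a * c + b * c" by (cases a; cases b; cases c) (simp add: algebra_simps)
  show "(0::dual) \<noteq> 1" by (simp add: zero_dual_def one_dual_def)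
qed

end

definition module_on :: "('r::comm_ring_1 \<Rightarrow> 's \<Rightarrow> 's) \<Rightarrow> 's::ab_group_add set \<Rightarrow> bool" where
  "module_on act M \<longleftrightarrow> 0 \<in> M \<and> (\<forall>x\<in>M. \<forall>y\<in>M. x + y \<in> M) \<and> (\<forall>r. \<forall>x\<in>M. act r x \<in> M) \<and>
     (\<forall>r. \<forall>x\<in>M. \<forall>y\<in>M. act r (x + y) = act r x + act r y) \<and>
     (\<forall>r s. \<forall>x\<in>M. act (r + s) x = act r x + act s x \<and> act (r * s) x = act r (act s x)) \<and>
     (\<forall>x\<in>M. act 1 x = x)"

definition linear_map_on ::
  "('r \<Rightarrow> 's \<Rightarrow> 's) \<Rightarrow> ('r \<Rightarrow> 't \<Rightarrow> 't) \<Rightarrow> 's::plus set \<Rightarrow> 't::plus set \<Rightarrow> ('s \<Rightarrow> 't) \<Rightarrow> bool" where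
  "linear_map_on act act' M N F \<longleftrightarrow> F ` M \<subseteq> N \<and>
     (\<forall>x\<in>M. \<forall>y\<in>M. F (x + y) = F x + F y) \<and> (\<forall>r. \<forall>x\<in>M. F (act r x) = act' r (F x))"

type_synonym 's cochains = "(nat \<Rightarrow> 's set) \<times> (nat \<Rightarrow> 's \<Rightarrow> 's)"

definition is_complex :: "('r::comm_ring_1 \<Rightarrow> 's::ab_group_add \<Rightarrow> 's) \<Rightarrow> 's cochains \<Rightarrow> bool" where
  "is_complex act CD \<longleftrightarrow> (case CD of (C, D) \<Rightarrow> \<forall>k. module_on act (C k) \<and>
     linear_map_on act act (C k) (C (Suc k)) (D k) \<and> (\<forall>x\<in>C k. D (Suc k) (D k x) = 0))"

definition complex_iso ::
  "('r::comm_ring_1 \<Rightarrow> 's::ab_group_add \<Rightarrow> 's) \<Rightarrow> ('r \<Rightarrow> 't::ab_group_add \<Rightarrow> 't) \<Rightarrow>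
   's cochains \<Rightarrow> 't cochains \<Rightarrow> (nat \<Rightarrow> 's \<Rightarrow> 't) \<Rightarrow> bool" where
  "complex_iso act act' CD CD' F \<longleftrightarrow> is_complex act CD \<and> is_complex act' CD' \<and>
     (case (CD, CD') of ((C, D), (C', D')) \<Rightarrow> \<forall>k.
        linear_map_on act act' (C k) (C' k) (F k) \<and> bij_betw (F k) (C k) (C' k) \<and>
        (\<forall>x\<in>C k. F (Suc k) (D k x) = D' k (F k x)))"

definition direct_sum :: "'s cochains \<Rightarrow> 't cochains \<Rightarrow> ('s \<times> 't) cochains" where
  "direct_sum CD CD' = (\<lambda>k. fst CD k \<times> fst CD' k, \<lambda>k. map_prod (snd CD k) (snd CD' k))"

text \<open>
  For a real complex \<open>C\<close>, the complex \<open>C \<otimes> S\<close> over the dual numbers \<open>S\<close>, with differential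
  \<open>d \<otimes> 1\<close>: as \<open>S\<close> has the real basis \<open>1, \<epsilon>\<close>, its elements are the
  \<open>m \<otimes> 1 + x \<otimes> \<epsilon>\<close>, represented by the pairs \<open>(m, x)\<close>.
\<close>
definition tensor_dual :: "'s cochains \<Rightarrow> ('s \<times> 's) cochains" where
  "tensor_dual CD = (\<lambda>k. fst CD k \<times> fst CD k, \<lambda>k. map_prod (snd CD k) (snd CD k))"

definition real_act :: "real \<Rightarrow> ('a, 'w::real_vector) forms \<Rightarrow> ('a, 'w) forms" where
  "real_act r \<alpha> = scale_form (\<lambda>_. r) \<alpha>"

text \<open>Actions on triples \<open>(\<epsilon> x, a, m)\<close>: multiplication by functions, by real numbers and
  by dual numbers.\<close>
fun scale3 :: "('a \<Rightarrow> real) \<Rightarrow>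
    ('a, 'u::real_vector) forms \<times> ('a, 'v::real_vector) forms \<times> ('a, 'w::real_vector) forms \<Rightarrow>
    ('a, 'u) forms \<times> ('a, 'v) forms \<times> ('a, 'w) forms" where
  "scale3 f (x, a, m) = (scale_form f x, scale_form f a, scale_form f m)"

definition real_act3 :: "real \<Rightarrow>
    ('a, 'u::real_vector) forms \<times> ('a, 'v::real_vector) forms \<times> ('a, 'w::real_vector) forms \<Rightarrow>
    ('a, 'u) forms \<times> ('a, 'v) forms \<times> ('a, 'w) forms" where
  "real_act3 r = scale3 (\<lambda>_. r)"

fun dual_act3 :: "dual \<Rightarrow>
    ('a, 'u::real_vector) forms \<times> ('a, 'v::real_vector) forms \<times> ('a, 'u) forms \<Rightarrow>
    ('a, 'u) forms \<times> ('a, 'v) forms \<times> ('a, 'u) forms" where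
  "dual_act3 (Dual s t) (x, a, m) =
     (real_act s x + real_act t m, real_act s a, real_act s m)"

text \<open>Action on \<open>(C \<otimes> S) \<oplus> C'\<close>, where \<open>\<epsilon>\<close> acts by zero on \<open>C'\<close>.\<close>
fun dual_act_split :: "dual \<Rightarrow>
    (('a, 'u::real_vector) forms \<times> ('a, 'u) forms) \<times> ('a, 'v::real_vector) forms \<Rightarrow>
    (('a, 'u) forms \<times> ('a, 'u) forms) \<times> ('a, 'v) forms" where
  "dual_act_split (Dual s t) ((m, x), a) =
     ((real_act s m, real_act s x + real_act t m), real_act s a)"

fun regroup :: "'u \<times> 'v \<times> 'w \<Rightarrow> ('w \<times> 'u) \<times> 'v" where
  "regroup (x, a, m) = ((m, x), a)"

text \<open>
  Linear differential operators of order at most \<open>n\<close> between modules over an algebra \<open>A\<close> of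
  smooth functions: the commutator with (multiplication by) any function has order at most
  \<open>n - 1\<close>, and operators of order at most zero are \<open>A\<close>-linear.
\<close>
primrec diff_op_order :: "nat \<Rightarrow> ('f \<Rightarrow> 's \<Rightarrow> 's) \<Rightarrow> ('f \<Rightarrow> 't \<Rightarrow> 't) \<Rightarrow> 'f set \<Rightarrow>
    's set \<Rightarrow> ('s \<Rightarrow> 't::minus) \<Rightarrow> bool" where
  "diff_op_order 0 sc sc' A M P \<longleftrightarrow> (\<forall>f\<in>A. \<forall>x\<in>M. P (sc f x) = sc' f (P x))"
| "diff_op_order (Suc n) sc sc' A M P \<longleftrightarrow>
     (\<forall>f\<in>A. diff_op_order n sc sc' A M (\<lambda>x. P (sc f x) - sc' f (P x)))"

definition diff_op3 :: "('a \<Rightarrow> real) set \<Rightarrow>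
    (('a, 'u::real_vector) forms \<times> ('a, 'v::real_vector) forms \<times> ('a, 'w::real_vector) forms) set \<Rightarrow>
    (('a, 'u) forms \<times> ('a, 'v) forms \<times> ('a, 'w) forms \<Rightarrow>
     ('a, 'u) forms \<times> ('a, 'v) forms \<times> ('a, 'w) forms) \<Rightarrow> bool" where
  "diff_op3 A M P \<longleftrightarrow> linear_map_on real_act3 real_act3 M M P \<and>
     (\<exists>n. diff_op_order n scale3 scale3 A M P)"

end

theory Submission
  imports Defs
begin

text \<open>
  The matrices \<open>V\<close> and \<open>W\<close> are inverse to each other because \<open>ell\<close> is additive, and they are
  differential operators of orders 1 and 2 because \<open>K\<close> and \<open>ell\<close> have order 1 (\<open>V_diff_op\<close>,
  \<open>W_diff_op\<close>). The rest of the theorem comes down to \<open>D V = V diag(d, e, d)\<close>. Entry by entry this is the three identities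
  \<open>e K + f = K d\<close>, \<open>b + l e = d l\<close> and \<open>b K + c = 0\<close> (\<open>d_E_KK\<close>, \<open>b_map_ell\<close>, \<open>b_map_KK\<close>). Then
  \<open>D = V diag W\<close> inherits linearity, \<open>D D = 0\<close> and compatibility with \<open>\<epsilon>\<close> from the diagonal
  complex (\<open>complex_iso_transport\<close>).

  The first two identities compare canonical projections of second covariant derivatives taken
  in different orders, so they are instances of the Ricci identity. The curvature that appears
  acts on value slots and on form arguments. On the value slots, the Bianchi identity and the pair
  symmetry turn it into the couplings \<open>f\<close> and \<open>b\<close>, up to a term with the Ricci tensor, which
  vanishes. On the form arguments it disappears: a projection sees a form only through
  contractions with \<open>\<phi>\<close> (\<open>prj_eqI\<close>), and these annihilate the curvature, whose two-form part lies
  in \<open>\<Lambda>\<^sup>2\<^sub>1\<^sub>4\<close> (\<open>Rm_L14\<close>, \<open>curvature_form_part\<close>). The same argument gives \<open>d d = 0\<close> and \<open>e e = 0\<close>. The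
  third identity is pointwise: the trace against the skew \<open>R\<close> sees only skew parts.

  All this rests on \<open>\<nabla>\<phi> = 0\<close> (\<open>nabla_phi_zero\<close>), derived from \<open>d\<phi> = 0\<close> and \<open>d\<psi> = 0\<close>: \<open>\<nabla>\<phi>\<close> is the
  action on \<open>\<phi>\<close> of the connection matrix of an adapted frame, so it is given by a torsion tensor
  with 49 components, which the two equations force to vanish. Consequently the projections,
  being contractions with \<open>\<phi>\<close>, commute with \<open>\<nabla>\<close>, and the curvature is Ricci-flat.

  Every bundle-valued form is turned into a real tensor field, a function of a point and a list
  of tangent vectors with the value slots first (\<open>TG\<close>, \<open>TE\<close>), so that one covariant derivative
  \<open>nabla\<close> serves for all bundles.
\<close>

abbreviation Sum7 :: "(7 \<Rightarrow> 'b::comm_monoid_add) \<Rightarrow> 'b" (binder "SUM7 " 10) where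
  "Sum7 f \<equiv> sum f UNIV"

section \<open>Smooth functions on Euclidean open sets\<close>

abbreviation pd :: "7 \<Rightarrow> (tvec \<Rightarrow> real) \<Rightarrow> tvec \<Rightarrow> real" where
  "pd i f x \<equiv> frechet_derivative f (at x) (axis i 1)"

lemma frechet_derivative_eqI:
  "(f has_derivative f') (at x) \<Longrightarrow> frechet_derivative f (at x) = f'"
  by (metis frechet_derivative_at)

lemma differentiable_cong_open:
  assumes "open U" "x \<in> U" "\<And>y. y \<in> U \<Longrightarrow> f y = g y"
  shows "f differentiable (at x) \<longleftrightarrow> g differentiable (at x)"
    "frechet_derivative f (at x) = frechet_derivative g (at x)"
proof -
  have "(f has_derivative f') (at x) \<longleftrightarrow> (g has_derivative f') (at x)" for f'
    using assms has_derivative_transform_within_open[of f f' x UNIV U g]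
      has_derivative_transform_within_open[of g f' x UNIV U f] by auto
  then show "f differentiable (at x) \<longleftrightarrow> g differentiable (at x)"
    "frechet_derivative f (at x) = frechet_derivative g (at x)"
    by (auto simp: differentiable_def frechet_derivative_def)
qed

lemma frechet_derivative_coordinates:
  fixes f :: "tvec \<Rightarrow> real"
  assumes "f differentiable (at x)"
  shows "frechet_derivative f (at x) v = (SUM7 i. v $ i * pd i f x)"
proof -
  interpret linear "frechet_derivative f (at x)"
    using assms linear_frechet_derivative by blast
  have "frechet_derivative f (at x) v = frechet_derivative f (at x) (SUM7 i. v $ i *\<^sub>R axis i 1)"
    using basis_expansion[of v] by (simp add: scalar_mult_eq_scaleR)
  also have "\<dots> = (SUM7 i. v $ i * pd i f x)"
    by (simp only: sum scale real_scaleR_def)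
  finally show ?thesis .
qed

lemma differentiable_vec7:
  fixes h :: "tvec \<Rightarrow> tvec"
  assumes "\<And>i. (\<lambda>x. h x $ i) differentiable (at x)"
  shows "(h has_derivative (\<lambda>v. \<chi> i. frechet_derivative (\<lambda>x. h x $ i) (at x) v)) (at x)"
proof (subst has_derivative_componentwise_within, safe)
  fix b :: tvec assume "b \<in> Basis"
  then obtain i where b: "b = axis i 1" by (auto simp: Basis_vec_def)
  show "((\<lambda>x. h x \<bullet> b) has_derivative
     (\<lambda>v. (\<chi> i. frechet_derivative (\<lambda>x. h x $ i) (at x) v) \<bullet> b)) (at x)"
    using assms[of i] by (simp add: b inner_axis frechet_derivative_works)
qed

lemma cont_diff_continuous: "cont_diff n U f \<Longrightarrow> continuous_on U f"
  by (cases n) (auto intro!: continuous_at_imp_continuous_on differentiable_imp_continuous_within)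

lemma cont_diff_SucD: "cont_diff (Suc n) U f \<Longrightarrow> cont_diff n U f"
proof (induction n arbitrary: f)
  case 0
  then show ?case using cont_diff_continuous[OF 0] by simp
next
  case (Suc n)
  have 1: "\<forall>x\<in>U. f differentiable (at x)" and 2: "\<And>i. cont_diff (Suc n) U (pd i f)"
    using Suc.prems by (simp, subst (asm) cont_diff.simps(2), blast)
  show ?case
    unfolding cont_diff.simps(2)[of n] using 1 Suc.IH[OF 2] by blast
qed

lemma cont_diff_cong:
  assumes "open U" "\<And>x. x \<in> U \<Longrightarrow> f x = g x"
  shows "cont_diff n U f \<longleftrightarrow> cont_diff n U g"
  using assms(2)
proof (induction n arbitrary: f g)
  case 0
  then show ?case by (simp cong: continuous_on_cong)
next
  case (Suc n)
  note d = differentiable_cong_open[OF assms(1) _ Suc.prems]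
  have "cont_diff n U (pd i f) \<longleftrightarrow> cont_diff n U (pd i g)" for i
    by (rule Suc.IH) (simp add: d(2))
  then show ?case using d(1) by auto
qed

lemma cont_diff_subset: "cont_diff n U f \<Longrightarrow> V \<subseteq> U \<Longrightarrow> cont_diff n V f"
  by (induction n arbitrary: f) (auto intro: continuous_on_subset)

lemma cont_diff_local:
  assumes "\<And>x. x \<in> U \<Longrightarrow> \<exists>V. open V \<and> x \<in> V \<and> cont_diff n V f"
  shows "cont_diff n U f"
  using assms
proof (induction n arbitrary: f)
  case 0
  have "isCont f x" if x: "x \<in> U" for x
    using 0[OF x] by (metis cont_diff.simps(1) continuous_on_eq_continuous_at)
  then show ?case by (simp add: continuous_at_imp_continuous_on)
next
  case (Suc n)
  have "f differentiable (at x)" if "x \<in> U" for x using Suc.prems[OF that] by auto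
  moreover have "cont_diff n U (pd i f)" for i
    using Suc.prems by (intro Suc.IH) (metis cont_diff.simps(2))
  ultimately show ?case by simp
qed

lemma cont_diff_const: "cont_diff n U (\<lambda>x. c)"
  by (induction n arbitrary: c) auto

lemma cont_diff_coordinate: "cont_diff n U (\<lambda>x. x $ i)"
proof -
  have d: "((\<lambda>x. x $ i) has_derivative (\<lambda>v. v $ i)) (at x)" for x :: tvec
    by (rule bounded_linear_imp_has_derivative) (rule bounded_linear_vec_nth)
  show ?thesis
    by (cases n) (auto intro!: cont_diff_const continuous_intros differentiableI d
      simp: frechet_derivative_eqI[OF d])
qed

lemma cont_diff_add:
  assumes "open U" "cont_diff n U f" "cont_diff n U g"
  shows "cont_diff n U (\<lambda>x. f x + g x)"
  using assms(2,3)
proof (induction n arbitrary: f g)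
  case 0
  then show ?case by (auto intro: continuous_intros)
next
  case (Suc n)
  have d: "frechet_derivative (\<lambda>x. f x + g x) (at x) =
      (\<lambda>v. frechet_derivative f (at x) v + frechet_derivative g (at x) v)" if "x \<in> U" for x
    using Suc.prems that
    by (intro frechet_derivative_eqI has_derivative_add) (auto simp: frechet_derivative_works[symmetric])
  have "cont_diff n U (pd i (\<lambda>x. f x + g x))" for i
    using Suc by (subst cont_diff_cong[OF assms(1), where g="\<lambda>x. pd i f x + pd i g x"]) (simp_all add: d)
  then show ?case using Suc.prems by auto
qed

lemma cont_diff_mult:
  assumes "open U" "cont_diff n U f" "cont_diff n U g"
  shows "cont_diff n U (\<lambda>x. f x * g x)"
  using assms(2,3)
proof (induction n arbitrary: f g)
  case 0
  then show ?case by (auto intro: continuous_intros)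
next
  case (Suc n)
  have d: "frechet_derivative (\<lambda>x. f x * g x) (at x) =
      (\<lambda>v. f x * frechet_derivative g (at x) v + frechet_derivative f (at x) v * g x)" if "x \<in> U" for x
    using Suc.prems that
    by (intro frechet_derivative_eqI has_derivative_mult) (auto simp: frechet_derivative_works[symmetric])
  have "cont_diff n U (\<lambda>x. f x * pd i g x + pd i f x * g x)" for i
    using Suc.prems cont_diff_SucD[OF Suc.prems(1)] cont_diff_SucD[OF Suc.prems(2)]
    by (intro cont_diff_add[OF assms(1)] Suc.IH) auto
  then have "cont_diff n U (pd i (\<lambda>x. f x * g x))" for i
    by (subst cont_diff_cong[OF assms(1), where g="\<lambda>x. f x * pd i g x + pd i f x * g x"]) (simp_all add: d)
  then show ?case using Suc.prems by auto
qed

lemma cont_diff_sum: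
  assumes "open U" "\<And>a. a \<in> A \<Longrightarrow> cont_diff n U (f a)"
  shows "cont_diff n U (\<lambda>x. \<Sum>a\<in>A. f a x)"
  using assms(2)
  by (induction A rule: infinite_finite_induct) (simp_all add: cont_diff_const cont_diff_add[OF assms(1)])

lemma pd_compose:
  fixes h :: "tvec \<Rightarrow> tvec"
  assumes "\<And>j. (\<lambda>x. h x $ j) differentiable (at x)" "f differentiable (at (h x))"
  shows "(f \<circ> h) differentiable (at x)"
    "frechet_derivative (f \<circ> h) (at x) v
       = (SUM7 j. pd j f (h x) * frechet_derivative (\<lambda>x. h x $ j) (at x) v)"
proof -
  note h = differentiable_vec7[OF assms(1)]
  have *: "(f \<circ> h has_derivative frechet_derivative f (at (h x)) \<circ>
      (\<lambda>v. \<chi> i. frechet_derivative (\<lambda>x. h x $ i) (at x) v)) (at x)"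
    using assms(2) by (intro diff_chain_at h) (simp add: frechet_derivative_works)
  show "(f \<circ> h) differentiable (at x)"
    "frechet_derivative (f \<circ> h) (at x) v
       = (SUM7 j. pd j f (h x) * frechet_derivative (\<lambda>x. h x $ j) (at x) v)"
    by (rule differentiableI[OF *])
      (simp add: frechet_derivative_eqI[OF *], subst frechet_derivative_coordinates[OF assms(2)],
        simp add: mult.commute)
qed

lemma cont_diff_compose:
  fixes h :: "tvec \<Rightarrow> tvec"
  assumes "open U" "open V" "h ` U \<subseteq> V"
    "\<And>j. cont_diff n U (\<lambda>x. h x $ j)" "cont_diff n V f"
  shows "cont_diff n U (f \<circ> h)"
  using assms(4,5)
proof (induction n arbitrary: f)
  case 0
  have "continuous_on U h"
    using 0 by (auto intro!: continuous_on_vec_lambda[of U "\<lambda>i x. h x $ i", simplified])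
  then show ?case using 0 assms(3) by (auto intro: continuous_on_compose2)
next
  case (Suc n)
  have d: "(f \<circ> h) differentiable (at x)"
    "pd i (f \<circ> h) x = (SUM7 j. (pd j f \<circ> h) x * pd i (\<lambda>x. h x $ j) x)" if "x \<in> U" for x i
    using Suc.prems that assms(3) by (auto intro!: pd_compose simp: pd_compose)
  have "cont_diff n U (\<lambda>x. SUM7 j. (pd j f \<circ> h) x * pd i (\<lambda>x. h x $ j) x)" for i
    using Suc.prems cont_diff_SucD[OF Suc.prems(1)]
    by (intro cont_diff_sum cont_diff_mult assms(1) Suc.IH) auto
  then have "cont_diff n U (pd i (f \<circ> h))" for i
    by (subst cont_diff_cong[OF assms(1) d(2)])
  then show ?case using d(1) unfolding cont_diff.simps(2) by blast
qed

lemma cont_diff_real_compose: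
  assumes "open U" "cont_diff n U f" "f ` U \<subseteq> T" "F \<in> \<F>"
    and family: "\<And>F. F \<in> \<F> \<Longrightarrow> \<exists>F'\<in>\<F>. \<forall>t\<in>T. (F has_real_derivative F' t) (at t)"
  shows "cont_diff n U (F \<circ> f)"
  using assms(2,4)
proof (induction n arbitrary: F)
  case 0
  then obtain F' where "\<forall>t\<in>T. (F has_real_derivative F' t) (at t)" using family by blast
  then have "continuous_on T F" by (metis DERIV_isCont continuous_at_imp_continuous_on)
  then show ?case using 0 assms(3) by (auto intro: continuous_on_compose2)
next
  case (Suc n)
  obtain F' where F': "F' \<in> \<F>" "\<forall>t\<in>T. (F has_real_derivative F' t) (at t)"
    using family Suc.prems by blast
  have d: "((F \<circ> f) has_derivative (\<lambda>v. F' (f x) * frechet_derivative f (at x) v)) (at x)"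
    if "x \<in> U" for x
  proof -
    have "(F has_derivative (*) (F' (f x))) (at (f x))"
      using F'(2) that assms(3) by (auto simp: has_field_derivative_def)
    moreover have "(f has_derivative frechet_derivative f (at x)) (at x)"
      using Suc.prems(1) that by (simp add: frechet_derivative_works)
    ultimately show ?thesis using diff_chain_at by (fastforce simp: o_def)
  qed
  have "cont_diff n U (\<lambda>x. (F' \<circ> f) x * pd i f x)" for i
    using Suc.prems F'(1) cont_diff_SucD[OF Suc.prems(1)] by (intro cont_diff_mult assms(1) Suc.IH) auto
  then have "cont_diff n U (pd i (F \<circ> f))" for i
    by (subst cont_diff_cong[OF assms(1), where g="\<lambda>x. (F' \<circ> f) x * pd i f x"])
      (simp_all add: frechet_derivative_eqI[OF d])
  then show ?case using d unfolding cont_diff.simps(2) by (blast intro: differentiableI)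
qed

lemma cont_diff_inverse:
  assumes "open U" "cont_diff n U f" "\<And>x. x \<in> U \<Longrightarrow> f x \<noteq> 0"
  shows "cont_diff n U (\<lambda>x. inverse (f x))"
proof -
  define \<F> :: "(real \<Rightarrow> real) set" where "\<F> = {\<lambda>t. c * inverse t ^ k | c k. True}"
  have fam: "\<exists>F'\<in>\<F>. \<forall>t\<in>- {0}. (F has_real_derivative F' t) (at t)" if F: "F \<in> \<F>" for F
  proof -
    obtain c k where F: "F = (\<lambda>t. c * inverse t ^ k)" using F by (auto simp: \<F>_def)
    have "(F has_real_derivative - (c * of_nat k) * inverse t ^ Suc k) (at t)" if "t \<noteq> 0" for t
    proof -
      have "(F has_real_derivative c * (of_nat k * (- (inverse t ^ Suc (Suc 0)) * inverse t ^ (k - Suc 0)))) (at t)"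
        unfolding F using that by (intro DERIV_cmult DERIV_power DERIV_inverse)
      then show ?thesis by (cases k) (simp_all add: algebra_simps)
    qed
    moreover have "(\<lambda>t. - (c * of_nat k) * inverse t ^ Suc k) \<in> \<F>"
      unfolding \<F>_def by blast
    ultimately show ?thesis by (intro bexI[where x="\<lambda>t. - (c * of_nat k) * inverse t ^ Suc k"]) simp_all
  qed
  have inv: "inverse \<in> \<F>"
    unfolding \<F>_def by (rule CollectI, rule exI[of _ 1], rule exI[of _ 1], rule conjI[OF _ TrueI], rule ext, simp)
  have "cont_diff n U (inverse \<circ> f)"
    by (rule cont_diff_real_compose[OF assms(1,2) _ inv fam]) (use assms(3) in auto)
  then show ?thesis by (simp add: o_def)
qed

text \<open>The functions \<open>p(1/t) exp(-1/t)\<close>, extended by zero: with polynomial factors the class is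
  closed under differentiation, which makes smoothness an induction.\<close>
definition flat_exp :: "real poly \<Rightarrow> real \<Rightarrow> real" where
  "flat_exp p t = (if t > 0 then poly p (inverse t) * exp (- inverse t) else 0)"

lemma poly_times_exp_tendsto_0: "((\<lambda>x::real. poly p x * exp (- x)) \<longlongrightarrow> 0) at_top"
proof -
  have "((\<lambda>x::real. \<Sum>i\<le>degree p. coeff p i * (x ^ i / exp x)) \<longlongrightarrow> (\<Sum>i\<le>degree p. coeff p i * 0)) at_top"
    by (intro tendsto_intros tendsto_power_div_exp_0)
  then show ?thesis
    by (simp add: poly_altdef exp_minus divide_inverse sum_distrib_right mult.assoc)
qed

lemma flat_exp_derivative:
  "(flat_exp p has_real_derivative flat_exp ([:0,0,1:] * (p - pderiv p)) t) (at t)"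
proof -
  consider "t > 0" | "t < 0" | "t = 0" by linarith
  then show ?thesis
  proof cases
    case 1
    have "((\<lambda>t. poly p (inverse t) * exp (- inverse t)) has_real_derivative
        flat_exp ([:0,0,1:] * (p - pderiv p)) t) (at t)"
      using 1 unfolding flat_exp_def
      by (auto intro!: derivative_eq_intros DERIV_chain2[OF poly_DERIV] simp: algebra_simps power2_eq_square)
    then show ?thesis
      by (rule has_field_derivative_transform_within_open[where S="{0<..}"])
        (use 1 in \<open>auto simp: flat_exp_def\<close>)
  next
    case 2
    have "((\<lambda>t. 0) has_real_derivative flat_exp ([:0,0,1:] * (p - pderiv p)) t) (at t)"
      using 2 by (auto simp: flat_exp_def)
    then show ?thesis
      by (rule has_field_derivative_transform_within_open[where S="{..<0}"])
        (use 2 in \<open>auto simp: flat_exp_def\<close>)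
  next
    case 3
    have "((\<lambda>t. poly ([:0,1:] * p) (inverse t) * exp (- inverse t)) \<longlongrightarrow> 0) (at_right (0::real))"
      using filterlim_compose[OF poly_times_exp_tendsto_0 filterlim_inverse_at_top_right] .
    then have "((\<lambda>t. flat_exp p t / t) \<longlongrightarrow> 0) (at_right 0)"
      by (rule Lim_transform_eventually)
        (auto simp: flat_exp_def eventually_at_right_less field_simps intro!: eventually_at_rightI[of 0 1])
    moreover have "((\<lambda>t. flat_exp p t / t) \<longlongrightarrow> 0) (at_left 0)"
      by (rule Lim_transform_eventually[OF tendsto_const])
        (auto simp: flat_exp_def intro!: eventually_at_leftI[of "-1" 0])
    ultimately show ?thesis
      unfolding 3 has_field_derivative_iff filterlim_split_at
      by (simp add: flat_exp_def filterlim_split_at)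
  qed
qed

lemma cont_diff_flat_exp:
  assumes "open U" "cont_diff n U f"
  shows "cont_diff n U (\<lambda>x. flat_exp 1 (f x))"
proof -
  have "cont_diff n U (flat_exp 1 \<circ> f)"
    by (rule cont_diff_real_compose[OF assms, where T=UNIV and \<F>="range flat_exp"])
      (use flat_exp_derivative in blast)+
  then show ?thesis by (simp add: o_def)
qed

lemma flat_exp_1: "flat_exp 1 t \<ge> 0" "flat_exp 1 t > 0 \<longleftrightarrow> t > 0" "t \<le> 0 \<Longrightarrow> flat_exp 1 t = 0"
  by (auto simp: flat_exp_def)

text \<open>A quotient \<open>F(u) / (F(u) + F(v))\<close> with the flat function \<open>F = flat_exp 1\<close>: \<open>u\<close> is positive
  inside the ball of radius \<open>r\<close> and \<open>v\<close> outside the ball of radius \<open>r/2\<close>, so that the denominator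
  has no zero.\<close>
lemma smooth_on_bump:
  fixes x0 :: tvec and r :: real
  assumes "r > 0"
  obtains \<beta> where "smooth_on UNIV \<beta>" "\<And>x. dist x x0 < r / 2 \<Longrightarrow> \<beta> x = 1"
    "\<And>x. dist x x0 \<ge> r \<Longrightarrow> \<beta> x = 0"
proof -
  define u where "u x = r\<^sup>2 + - 1 * (SUM7 i. (x $ i + - x0 $ i) * (x $ i + - x0 $ i))" for x
  have u: "u x = r\<^sup>2 - (dist x x0)\<^sup>2" for x
    by (simp add: u_def dist_norm norm_vec_def L2_set_def sum_nonneg power2_eq_square)
  define v where "v x = 3 * r\<^sup>2 / 4 + - 1 * u x" for x
  define \<beta> where "\<beta> x = flat_exp 1 (u x) * inverse (flat_exp 1 (u x) + flat_exp 1 (v x))" for x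
  have pos: "flat_exp 1 (u x) + flat_exp 1 (v x) > 0" for x
  proof (cases "u x > 0")
    case False
    moreover have "r\<^sup>2 > 0" using assms by simp
    ultimately have "v x > 0" unfolding v_def by linarith
    then show ?thesis using flat_exp_1(1)[of "u x"] flat_exp_1(2)[of "v x"] by linarith
  next
    case True
    then show ?thesis using flat_exp_1(1)[of "v x"] flat_exp_1(2)[of "u x"] by linarith
  qed
  have "cont_diff n UNIV u" for n
    unfolding u_def by (intro cont_diff_add cont_diff_mult cont_diff_sum cont_diff_const cont_diff_coordinate) auto
  then have "cont_diff n UNIV \<beta>" for n
    unfolding \<beta>_def v_def using pos unfolding v_def
    by (intro cont_diff_mult cont_diff_inverse cont_diff_add cont_diff_flat_exp cont_diff_const)
      (auto simp: less_le)
  then have "smooth_on UNIV \<beta>" by (simp add: smooth_on_def)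
  moreover have "\<beta> x = 1" if "dist x x0 < r / 2" for x
  proof -
    have "(dist x x0)\<^sup>2 < (r/2)\<^sup>2" using that by (intro power_strict_mono) auto
    then have "u x > 3 * r\<^sup>2 / 4" by (simp add: u power_divide)
    then have "flat_exp 1 (v x) = 0" by (simp add: v_def flat_exp_1)
    then show ?thesis using pos[of x] by (simp add: \<beta>_def)
  qed
  moreover have "\<beta> x = 0" if "dist x x0 \<ge> r" for x
  proof -
    have "(dist x x0)\<^sup>2 \<ge> r\<^sup>2" using that assms by (intro power_mono) auto
    then show ?thesis by (simp add: \<beta>_def u flat_exp_1)
  qed
  ultimately show ?thesis using that by blast
qed

subsection \<open>Symmetry of second derivatives\<close>

lemma partial_mean_value:
  fixes f :: "tvec \<Rightarrow> real" and t :: real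
  assumes t: "t > 0" and d: "\<And>s. 0 \<le> s \<Longrightarrow> s \<le> t \<Longrightarrow> f differentiable (at (x + s *\<^sub>R axis i 1))"
  obtains s where "0 < s" "s < t" "f (x + t *\<^sub>R axis i 1) - f x = t * pd i f (x + s *\<^sub>R axis i 1)"
proof -
  have dd: "((\<lambda>s. f (x + s *\<^sub>R axis i 1)) has_real_derivative pd i f (x + s *\<^sub>R axis i 1)) (at s)"
    if s: "0 \<le> s" "s \<le> t" for s
  proof -
    have "(f has_derivative frechet_derivative f (at (x + s *\<^sub>R axis i 1))) (at (x + s *\<^sub>R axis i 1))"
      using d[OF s] by (simp add: frechet_derivative_works)
    moreover have "((\<lambda>s. x + s *\<^sub>R axis i 1) has_derivative (\<lambda>h. h *\<^sub>R axis i 1)) (at s)"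
      by (auto intro!: derivative_eq_intros)
    ultimately have "(f \<circ> (\<lambda>s. x + s *\<^sub>R axis i 1) has_derivative
        frechet_derivative f (at (x + s *\<^sub>R axis i 1)) \<circ> (\<lambda>h. h *\<^sub>R axis i 1)) (at s)"
      by (intro diff_chain_at) auto
    moreover have "frechet_derivative f (at (x + s *\<^sub>R axis i 1)) \<circ> (\<lambda>h. h *\<^sub>R axis i 1)
       = (*) (pd i f (x + s *\<^sub>R axis i 1))"
      using linear_frechet_derivative[OF d[OF s]] by (auto simp: linear_scale o_def)
    ultimately show ?thesis by (simp add: has_field_derivative_def o_def)
  qed
  obtain s where "0 < s" "s < t"
    "f (x + t *\<^sub>R axis i 1) - f (x + 0 *\<^sub>R axis i 1) = (t - 0) * pd i f (x + s *\<^sub>R axis i 1)"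
    using MVT2[OF t, of "\<lambda>s. f (x + s *\<^sub>R axis i 1)" "\<lambda>s. pd i f (x + s *\<^sub>R axis i 1)"] dd by blast
  then show ?thesis by (intro that) auto
qed

text \<open>Apply the mean value theorem to the second difference in each of the two directions.\<close>
lemma second_difference:
  fixes f :: "tvec \<Rightarrow> real" and t :: real
  assumes U: "ball x r \<subseteq> U" and f: "cont_diff 2 U f" and t: "t > 0" "2 * t < r"
  obtains y where "dist x y < 2 * t"
    "f (x + t *\<^sub>R axis i 1 + t *\<^sub>R axis j 1) - f (x + t *\<^sub>R axis i 1) - f (x + t *\<^sub>R axis j 1) + f x
       = t * t * pd j (pd i f) y"
proof -
  have d1: "f differentiable (at y)" and d2: "pd i f differentiable (at y)" if "y \<in> U" for y
    using f that by (auto simp: numeral_2_eq_2)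
  have near: "dist x (x + s *\<^sub>R axis i 1 + s' *\<^sub>R axis j 1) \<le> s + s'" if "s \<ge> 0" "s' \<ge> 0" for s s' :: real
  proof -
    have "dist x (x + s *\<^sub>R axis i 1 + s' *\<^sub>R axis j 1) = norm (s *\<^sub>R axis i 1 + s' *\<^sub>R (axis j 1 :: tvec))"
      by (simp add: dist_norm norm_minus_commute add.assoc, simp add: add.commute)
    also have "\<dots> \<le> s + s'"
      by (rule order.trans[OF norm_triangle_ineq]) (use that in \<open>simp add: norm_axis_1\<close>)
    finally show ?thesis .
  qed
  have inU: "x + s *\<^sub>R axis i 1 + s' *\<^sub>R axis j 1 \<in> U" if "0 \<le> s" "s \<le> t" "0 \<le> s'" "s' \<le> t" for s s'
    using near[OF that(1,3)] that t U by (intro subsetD[OF U]) auto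
  define h where "h z = f (z + t *\<^sub>R axis j 1) - f z" for z
  have dsh: "((\<lambda>z. f (z + t *\<^sub>R axis j 1)) has_derivative frechet_derivative f (at (z + t *\<^sub>R axis j 1))) (at z)"
    if "z + t *\<^sub>R axis j 1 \<in> U" for z
  proof -
    have "(f has_derivative frechet_derivative f (at (z + t *\<^sub>R axis j 1))) (at (z + t *\<^sub>R axis j 1))"
      using d1[OF that] by (simp add: frechet_derivative_works)
    then have "(f \<circ> (\<lambda>z. z + t *\<^sub>R axis j 1) has_derivative frechet_derivative f (at (z + t *\<^sub>R axis j 1)) \<circ> (\<lambda>h. h)) (at z)"
      by (intro diff_chain_at) (auto intro!: derivative_eq_intros)
    then show ?thesis by (simp add: o_def)
  qed
  have hd: "(h has_derivative (\<lambda>v. frechet_derivative f (at (z + t *\<^sub>R axis j 1)) v - frechet_derivative f (at z) v)) (at z)"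
    if "z + t *\<^sub>R axis j 1 \<in> U" "z \<in> U" for z
    unfolding h_def using d1[OF that(2)]
    by (intro has_derivative_diff dsh that) (simp add: frechet_derivative_works)
  have "h differentiable (at (x + s *\<^sub>R axis i 1))" if "0 \<le> s" "s \<le> t" for s
    using hd inU[OF that, of t] inU[OF that, of 0] t by (auto intro: differentiableI)
  then obtain s where s: "0 < s" "s < t" "h (x + t *\<^sub>R axis i 1) - h x = t * pd i h (x + s *\<^sub>R axis i 1)"
    using partial_mean_value[OF t(1), of h x i] by blast
  have "pd i h (x + s *\<^sub>R axis i 1)
      = pd i f (x + s *\<^sub>R axis i 1 + t *\<^sub>R axis j 1) - pd i f (x + s *\<^sub>R axis i 1)"
    using frechet_derivative_eqI[OF hd] inU[of s t] inU[of s 0] s t by auto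
  moreover obtain s' where s': "0 < s'" "s' < t"
    "pd i f (x + s *\<^sub>R axis i 1 + t *\<^sub>R axis j 1) - pd i f (x + s *\<^sub>R axis i 1)
      = t * pd j (pd i f) (x + s *\<^sub>R axis i 1 + s' *\<^sub>R axis j 1)"
    using partial_mean_value[OF t(1), of "pd i f" "x + s *\<^sub>R axis i 1" j] d2 inU[of s] s by auto
  ultimately have "h (x + t *\<^sub>R axis i 1) - h x = t * t * pd j (pd i f) (x + s *\<^sub>R axis i 1 + s' *\<^sub>R axis j 1)"
    using s(3) by simp
  moreover have "dist x (x + s *\<^sub>R axis i 1 + s' *\<^sub>R axis j 1) < 2 * t"
    using near[of s s'] s s' by auto
  ultimately show ?thesis using that by (auto simp: h_def algebra_simps)
qed

text \<open>The second difference is symmetric in the two directions and, divided by \<open>t\<^sup>2\<close>, converges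
  to either mixed derivative.\<close>
lemma mixed_partials_commute:
  fixes f :: "tvec \<Rightarrow> real"
  assumes "open U" "x \<in> U" "cont_diff 2 U f"
  shows "pd i (pd j f) x = pd j (pd i f) x"
proof (rule ccontr)
  assume ne: "\<not> ?thesis"
  define e where "e = \<bar>pd i (pd j f) x - pd j (pd i f) x\<bar> / 2"
  have e: "e > 0" using ne by (simp add: e_def)
  have c: "continuous_on U (pd i (pd j f))" for i j
    using assms(3) by (simp add: numeral_2_eq_2)
  have ex: "\<exists>\<delta>>0. \<forall>y. dist x y < \<delta> \<longrightarrow> \<bar>pd i (pd j f) y - pd i (pd j f) x\<bar> < e" for i j
  proof -
    have "continuous (at x) (pd i (pd j f))"
      using c assms(1,2) by (simp add: continuous_on_eq_continuous_at)
    then obtain d where "d > 0" "\<forall>y. dist y x < d \<longrightarrow> dist (pd i (pd j f) y) (pd i (pd j f) x) < e"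
      using e unfolding continuous_at_eps_delta by blast
    then show ?thesis by (intro exI[of _ d]) (simp add: dist_real_def dist_commute)
  qed
  obtain \<delta>1 where \<delta>1: "\<delta>1 > 0" "\<And>y. dist x y < \<delta>1 \<Longrightarrow> \<bar>pd i (pd j f) y - pd i (pd j f) x\<bar> < e"
    using ex by blast
  obtain \<delta>2 where \<delta>2: "\<delta>2 > 0" "\<And>y. dist x y < \<delta>2 \<Longrightarrow> \<bar>pd j (pd i f) y - pd j (pd i f) x\<bar> < e"
    using ex by blast
  obtain r where r: "r > 0" "ball x r \<subseteq> U" using assms(1,2) openE by blast
  define t where "t = min r (min \<delta>1 \<delta>2) / 4"
  have t: "t > 0" "2 * t < r" "2 * t < \<delta>1" "2 * t < \<delta>2" using r \<delta>1 \<delta>2 by (auto simp: t_def)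
  obtain y where y: "dist x y < 2 * t"
    "f (x + t *\<^sub>R axis i 1 + t *\<^sub>R axis j 1) - f (x + t *\<^sub>R axis i 1) - f (x + t *\<^sub>R axis j 1) + f x
       = t * t * pd j (pd i f) y"
    using second_difference[OF r(2) assms(3) t(1,2)] by blast
  obtain z where z: "dist x z < 2 * t"
    "f (x + t *\<^sub>R axis j 1 + t *\<^sub>R axis i 1) - f (x + t *\<^sub>R axis j 1) - f (x + t *\<^sub>R axis i 1) + f x
       = t * t * pd i (pd j f) z"
    using second_difference[OF r(2) assms(3) t(1,2)] by blast
  have "x + t *\<^sub>R axis j 1 + t *\<^sub>R axis i 1 = x + t *\<^sub>R axis i 1 + t *\<^sub>R axis j 1" by (simp add: add_ac)
  then have "t * t * pd j (pd i f) y = t * t * pd i (pd j f) z" using y(2) z(2) by (simp add: algebra_simps)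
  then have "pd j (pd i f) y = pd i (pd j f) z" using t(1) by simp
  then show False using \<delta>1(2)[of z] \<delta>2(2)[of y] y(1) z(1) t unfolding e_def by (auto simp: abs_if split: if_splits)
qed

section \<open>Smooth functions and vector fields on a manifold\<close>

context smooth_manifold7
begin

abbreviation ch_inv :: "'a set \<times> ('a \<Rightarrow> tvec) \<Rightarrow> tvec \<Rightarrow> 'a" where
  "ch_inv c \<equiv> inv_into (fst c) (snd c)"

lemma chart_at: "chart_at p \<in> atlas" "p \<in> fst (chart_at p)"
proof -
  have "\<exists>c. c \<in> atlas \<and> p \<in> fst c" using charts_cover by blast
  then have "chart_at p \<in> atlas \<and> p \<in> fst (chart_at p)"
    unfolding chart_at_def by (rule someI_ex)
  then show "chart_at p \<in> atlas" "p \<in> fst (chart_at p)" by auto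
qed

lemma chart_inverse:
  assumes "c \<in> atlas"
  shows "q \<in> fst c \<Longrightarrow> ch_inv c (snd c q) = q"
    "x \<in> snd c ` fst c \<Longrightarrow> snd c (ch_inv c x) = x"
    "x \<in> snd c ` fst c \<Longrightarrow> ch_inv c x \<in> fst c"
  using chart_homeomorphism[OF assms] by (auto simp: homeomorphism_def)

lemma chart_image_open:
  assumes "c \<in> atlas" "open U"
  shows "open (snd c ` (fst c \<inter> U))"
proof -
  have "snd c ` (fst c \<inter> U) = snd c ` fst c \<inter> ch_inv c -` U"
    using chart_inverse[OF assms(1)] by force
  moreover have "continuous_on (snd c ` fst c) (ch_inv c)"
    using chart_homeomorphism[OF assms(1)] by (auto simp: homeomorphism_def)
  ultimately show ?thesis
    using continuous_open_preimage chart_open[OF assms(1)] assms(2) by metis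
qed

lemma chart_preimage_open:
  assumes "c \<in> atlas" "open V"
  shows "open (fst c \<inter> snd c -` V)"
  using chart_homeomorphism[OF assms(1)] chart_open[OF assms(1)] assms(2)
  by (auto simp: homeomorphism_def intro: continuous_open_preimage)

lemma smooth_transition_cont_diff:
  assumes "c \<in> atlas" "c' \<in> atlas"
  shows "cont_diff n (snd c ` (fst c \<inter> fst c')) (\<lambda>x. snd c' (ch_inv c x) $ i)"
  using smooth_transitions[OF assms] by (simp add: smooth_on_def)

lemma smooth_fun_on_subset: "smooth_fun_on U f \<Longrightarrow> V \<subseteq> U \<Longrightarrow> smooth_fun_on V f"
  unfolding smooth_fun_on_def smooth_on_def
  by (meson cont_diff_subset Int_mono image_mono order_refl)

text \<open>One chart around each point suffices, since transition maps are smooth.\<close>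
lemma smooth_fun_onI_chart:
  assumes "\<And>q. q \<in> U \<Longrightarrow> \<exists>c\<in>atlas. \<exists>V. open V \<and> q \<in> V \<and> V \<subseteq> fst c \<and> smooth_on (snd c ` V) (f \<circ> ch_inv c)"
  shows "smooth_fun_on U f"
  unfolding smooth_fun_on_def smooth_on_def
proof (intro ballI allI cont_diff_local)
  fix c' n x assume c': "c' \<in> atlas" and x: "x \<in> snd c' ` (fst c' \<inter> U)"
  then obtain q where q: "q \<in> fst c'" "q \<in> U" "x = snd c' q" by auto
  obtain c V where c: "c \<in> atlas" "open V" "q \<in> V" "V \<subseteq> fst c" "smooth_on (snd c ` V) (f \<circ> ch_inv c)"
    using assms[OF q(2)] by blast
  let ?W = "snd c' ` (fst c' \<inter> V)"
  have oW: "open ?W" using chart_image_open c c' by auto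
  have oV: "open (snd c ` V)" using chart_image_open[OF c(1,2)] c(4) by (simp add: Int_absorb1)
  let ?h = "\<lambda>x. snd c (ch_inv c' x)"
  have "cont_diff n ?W ((f \<circ> ch_inv c) \<circ> ?h)"
  proof (rule cont_diff_compose[OF oW oV])
    show "?h ` ?W \<subseteq> snd c ` V" using chart_inverse[OF c'] by auto
    show "cont_diff n ?W (\<lambda>x. ?h x $ j)" for j
      using smooth_transition_cont_diff[OF c' c(1)] by (rule cont_diff_subset) (use c(4) in auto)
    show "cont_diff n (snd c ` V) (f \<circ> ch_inv c)" using c(5) by (simp add: smooth_on_def)
  qed
  then have "cont_diff n ?W (f \<circ> ch_inv c')"
    by (rule iffD1[OF cont_diff_cong[OF oW], rotated])
      (use chart_inverse[OF c'] chart_inverse[OF c(1)] c(4) in auto)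
  then show "\<exists>V. open V \<and> x \<in> V \<and> cont_diff n V (f \<circ> ch_inv c')"
    using oW q c(3) by blast
qed

lemma smooth_fun_on_chartD:
  assumes "smooth_fun_on U f" "c \<in> atlas"
  shows "cont_diff n (snd c ` (fst c \<inter> U)) (f \<circ> ch_inv c)"
  using assms by (auto simp: smooth_fun_on_def smooth_on_def)

lemma smooth_fun_on_local:
  assumes "\<And>q. q \<in> U \<Longrightarrow> \<exists>V. open V \<and> q \<in> V \<and> smooth_fun_on V f"
  shows "smooth_fun_on U f"
proof (rule smooth_fun_onI_chart)
  fix q assume "q \<in> U"
  then obtain V where V: "open V" "q \<in> V" "smooth_fun_on V f" using assms by blast
  have "smooth_on (snd (chart_at q) ` (fst (chart_at q) \<inter> V)) (f \<circ> ch_inv (chart_at q))"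
    using V(3) chart_at by (auto simp: smooth_fun_on_def)
  then show "\<exists>c\<in>atlas. \<exists>V. open V \<and> q \<in> V \<and> V \<subseteq> fst c \<and> smooth_on (snd c ` V) (f \<circ> ch_inv c)"
    using chart_at[of q] V chart_open[OF chart_at(1)]
    by (intro bexI[of _ "chart_at q"] exI[of _ "fst (chart_at q) \<inter> V"]) auto
qed

lemma smooth_fun_on_cong:
  assumes "open U" "\<And>q. q \<in> U \<Longrightarrow> f q = g q"
  shows "smooth_fun_on U f \<longleftrightarrow> smooth_fun_on U g"
proof -
  have "cont_diff n (snd c ` (fst c \<inter> U)) (f \<circ> ch_inv c) \<longleftrightarrow> cont_diff n (snd c ` (fst c \<inter> U)) (g \<circ> ch_inv c)"
    if "c \<in> atlas" for c n
    by (rule cont_diff_cong[OF chart_image_open[OF that assms(1)]])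
      (use chart_inverse[OF that] assms(2) in auto)
  then show ?thesis by (auto simp: smooth_fun_on_def smooth_on_def)
qed

lemma smooth_fun_on_const: "smooth_fun_on U (\<lambda>q. r)"
  by (simp add: smooth_fun_on_def smooth_on_def o_def cont_diff_const)

lemma smooth_fun_on_add:
  assumes "open U" "smooth_fun_on U f" "smooth_fun_on U g"
  shows "smooth_fun_on U (\<lambda>q. f q + g q)"
  unfolding smooth_fun_on_def smooth_on_def comp_def
  using smooth_fun_on_chartD[OF assms(2)] smooth_fun_on_chartD[OF assms(3)]
  by (auto intro!: cont_diff_add chart_image_open assms(1) simp: comp_def)

lemma smooth_fun_on_mult:
  assumes "open U" "smooth_fun_on U f" "smooth_fun_on U g"
  shows "smooth_fun_on U (\<lambda>q. f q * g q)"
  unfolding smooth_fun_on_def smooth_on_def comp_def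
  using smooth_fun_on_chartD[OF assms(2)] smooth_fun_on_chartD[OF assms(3)]
  by (auto intro!: cont_diff_mult chart_image_open assms(1) simp: comp_def)

lemma smooth_fun_on_inverse:
  assumes "open U" "smooth_fun_on U f" "\<And>q. q \<in> U \<Longrightarrow> f q \<noteq> 0"
  shows "smooth_fun_on U (\<lambda>q. inverse (f q))"
proof -
  have "cont_diff n (snd c ` (fst c \<inter> U)) (\<lambda>x. inverse ((f \<circ> ch_inv c) x))" if "c \<in> atlas" for c n
    using smooth_fun_on_chartD[OF assms(2) that] assms(3) chart_inverse[OF that]
    by (intro cont_diff_inverse chart_image_open that assms(1)) (auto simp: comp_def)
  then show ?thesis by (simp add: smooth_fun_on_def smooth_on_def comp_def)
qed

lemma smooth_fun_on_sum:
  assumes "open U" "\<And>a. a \<in> A \<Longrightarrow> smooth_fun_on U (f a)"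
  shows "smooth_fun_on U (\<lambda>q. \<Sum>a\<in>A. f a q)"
  using assms(2) by (induction A rule: infinite_finite_induct)
    (simp_all add: smooth_fun_on_const smooth_fun_on_add[OF assms(1)])

lemma smooth_fun_on_prod:
  assumes "open U" "\<And>a. a \<in> A \<Longrightarrow> smooth_fun_on U (f a)"
  shows "smooth_fun_on U (\<lambda>q. \<Prod>a\<in>A. f a q)"
  using assms(2) by (induction A rule: infinite_finite_induct)
    (simp_all add: smooth_fun_on_const smooth_fun_on_mult[OF assms(1)])

lemma smooth_fun_on_diff:
  assumes "open U" "smooth_fun_on U f" "smooth_fun_on U g"
  shows "smooth_fun_on U (\<lambda>q. f q - g q)"
  using smooth_fun_on_add[OF assms(1,2) smooth_fun_on_mult[OF assms(1) smooth_fun_on_const assms(3)], of "-1"]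
  by simp

lemma smooth_funs_const: "(\<lambda>q. r) \<in> smooth_funs"
  and smooth_funs_add: "f \<in> smooth_funs \<Longrightarrow> g \<in> smooth_funs \<Longrightarrow> (\<lambda>q. f q + g q) \<in> smooth_funs"
  and smooth_funs_diff: "f \<in> smooth_funs \<Longrightarrow> g \<in> smooth_funs \<Longrightarrow> (\<lambda>q. f q - g q) \<in> smooth_funs"
  and smooth_funs_mult: "f \<in> smooth_funs \<Longrightarrow> g \<in> smooth_funs \<Longrightarrow> (\<lambda>q. f q * g q) \<in> smooth_funs"
  and smooth_funs_sum: "(\<And>a. a \<in> A \<Longrightarrow> h a \<in> smooth_funs) \<Longrightarrow> (\<lambda>q. \<Sum>a\<in>A. h a q) \<in> smooth_funs"
  by (simp_all add: smooth_funs_def smooth_fun_on_const smooth_fun_on_add smooth_fun_on_mult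
      smooth_fun_on_diff smooth_fun_on_sum)

lemma smooth_funs_on: "f \<in> smooth_funs \<Longrightarrow> smooth_fun_on U f"
  by (auto simp: smooth_funs_def intro: smooth_fun_on_subset)

lemma smooth_fun_on_coordinate:
  assumes "c \<in> atlas"
  shows "smooth_fun_on (fst c) (\<lambda>q. snd c q $ i)"
proof -
  have "cont_diff n (snd c' ` (fst c' \<inter> fst c)) ((\<lambda>q. snd c q $ i) \<circ> ch_inv c')" if "c' \<in> atlas" for c' n
    using smooth_transition_cont_diff[OF that assms] by (simp add: comp_def)
  then show ?thesis by (simp add: smooth_fun_on_def smooth_on_def)
qed

subsection \<open>Derivatives of functions\<close>

lemma smooth_fun_on_differentiable:
  assumes "open U" "p \<in> U" "smooth_fun_on U f" "c \<in> atlas" "p \<in> fst c"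
  shows "(f \<circ> ch_inv c) differentiable (at (snd c p))"
  using smooth_fun_on_chartD[OF assms(3,4), of 1] assms(2,5) by (auto simp: comp_def)

lemma dfun_cong:
  assumes "open U" "p \<in> U" "\<And>q. q \<in> U \<Longrightarrow> f q = g q"
  shows "dfun f p = dfun g p"
  unfolding dfun_def using assms chart_inverse[OF chart_at(1)] chart_at(2)
  by (intro ext differentiable_cong_open(2)[OF chart_image_open[OF chart_at(1) assms(1)], THEN fun_cong]) auto

lemma deriv_along_cong:
  assumes "open U" "p \<in> U" "\<And>q. q \<in> U \<Longrightarrow> f q = g q"
  shows "deriv_along X f p = deriv_along X g p"
  unfolding deriv_along_def using dfun_cong[OF assms] by simp

text \<open>\<open>dfun\<close> is defined in the chart chosen at the point; the chain rule gives it in any other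
  chart.\<close>
lemma dfun_chart:
  assumes "open U" "p \<in> U" "smooth_fun_on U f" "c \<in> atlas" "p \<in> fst c"
  shows "dfun f p v = (SUM7 k. pd k (f \<circ> ch_inv c) (snd c p) * dfun (\<lambda>q. snd c q $ k) p v)"
proof -
  let ?d = "chart_at p"
  let ?h = "\<lambda>x. snd c (ch_inv ?d x)"
  let ?W = "snd ?d ` (fst ?d \<inter> fst c)"
  have W: "open ?W" "snd ?d p \<in> ?W"
    using chart_image_open chart_at chart_open[OF assms(4)] assms(5) by auto
  have eq: "(f \<circ> ch_inv ?d) x = ((f \<circ> ch_inv c) \<circ> ?h) x" if "x \<in> ?W" for x
    using that chart_inverse[OF chart_at(1)] chart_inverse[OF assms(4)] by auto
  have hp: "?h (snd ?d p) = snd c p" using chart_inverse[OF chart_at(1)] chart_at by simp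
  have "frechet_derivative ((f \<circ> ch_inv c) \<circ> ?h) (at (snd ?d p)) v
      = (SUM7 k. pd k (f \<circ> ch_inv c) (?h (snd ?d p)) * frechet_derivative (\<lambda>x. ?h x $ k) (at (snd ?d p)) v)"
    using smooth_fun_on_differentiable[OF assms] hp
      smooth_fun_on_differentiable[OF _ assms(5) smooth_fun_on_coordinate[OF assms(4)] chart_at(1) chart_at(2)]
      chart_open[OF assms(4)]
    by (intro pd_compose(2)) (auto simp: comp_def)
  moreover have "frechet_derivative (f \<circ> ch_inv ?d) (at (snd ?d p))
      = frechet_derivative ((f \<circ> ch_inv c) \<circ> ?h) (at (snd ?d p))"
    by (rule differentiable_cong_open(2)[OF W]) (rule eq)
  ultimately show ?thesis
    unfolding dfun_def by (simp only: hp) (simp add: comp_def)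
qed

lemma dfun_own_coordinate: "dfun (\<lambda>q. snd (chart_at p) q $ j) p v = v $ j"
proof -
  let ?d = "chart_at p"
  have "frechet_derivative ((\<lambda>q. snd ?d q $ j) \<circ> ch_inv ?d) (at (snd ?d p))
      = frechet_derivative (\<lambda>x. x $ j) (at (snd ?d p))"
    using chart_open[OF chart_at(1), of p] chart_at(2) chart_inverse[OF chart_at(1)]
    by (intro differentiable_cong_open(2)[where U="snd ?d ` fst ?d"]) auto
  also have "\<dots> = (\<lambda>v. v $ j)"
    by (intro frechet_derivative_eqI bounded_linear_imp_has_derivative bounded_linear_vec_nth)
  finally show ?thesis by (simp add: dfun_def)
qed

lemma dfun_linear:
  assumes "open U" "p \<in> U" "smooth_fun_on U f"
  shows "linear (dfun f p)"
  unfolding dfun_def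
  using linear_frechet_derivative[OF smooth_fun_on_differentiable[OF assms chart_at]] by simp

lemma dfun_const: "dfun (\<lambda>q. r) p v = 0"
  by (simp add: dfun_def comp_def)

lemma dfun_add:
  assumes "open U" "p \<in> U" "smooth_fun_on U f" "smooth_fun_on U g"
  shows "dfun (\<lambda>q. f q + g q) p v = dfun f p v + dfun g p v"
proof -
  note d = smooth_fun_on_differentiable[OF assms(1,2) _ chart_at, THEN iffD1[OF frechet_derivative_works]]
  show ?thesis
    using frechet_derivative_eqI[OF has_derivative_add[OF d[OF assms(3)] d[OF assms(4)]]]
    by (simp add: dfun_def comp_def)
qed

lemma dfun_mult:
  assumes "open U" "p \<in> U" "smooth_fun_on U f" "smooth_fun_on U g"
  shows "dfun (\<lambda>q. f q * g q) p v = f p * dfun g p v + dfun f p v * g p"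
proof -
  note d = smooth_fun_on_differentiable[OF assms(1,2) _ chart_at, THEN iffD1[OF frechet_derivative_works]]
  show ?thesis
    using frechet_derivative_eqI[OF has_derivative_mult[OF d[OF assms(3)] d[OF assms(4)]]]
      chart_inverse(1)[OF chart_at]
    by (simp add: dfun_def comp_def)
qed

lemma dfun_sum:
  assumes "open U" "p \<in> U" "\<And>a. a \<in> A \<Longrightarrow> smooth_fun_on U (f a)"
  shows "dfun (\<lambda>q. \<Sum>a\<in>A. f a q) p v = (\<Sum>a\<in>A. dfun (f a) p v)"
  using assms(3)
proof (induction A rule: infinite_finite_induct)
  case (insert a A)
  then have "smooth_fun_on U (\<lambda>q. \<Sum>a\<in>A. f a q)" by (intro smooth_fun_on_sum assms(1)) auto
  with insert show ?case by (simp add: dfun_add[OF assms(1,2)])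
qed (simp_all add: dfun_const)

lemma deriv_along_add:
  assumes "open U" "p \<in> U" "smooth_fun_on U f" "smooth_fun_on U g"
  shows "deriv_along X (\<lambda>q. f q + g q) p = deriv_along X f p + deriv_along X g p"
  using dfun_add[OF assms] by (simp add: deriv_along_def)

lemma deriv_along_mult:
  assumes "open U" "p \<in> U" "smooth_fun_on U f" "smooth_fun_on U g"
  shows "deriv_along X (\<lambda>q. f q * g q) p = f p * deriv_along X g p + deriv_along X f p * g p"
  using dfun_mult[OF assms] by (simp add: deriv_along_def)

lemma deriv_along_sum:
  assumes "open U" "p \<in> U" "\<And>a. a \<in> A \<Longrightarrow> smooth_fun_on U (f a)"
  shows "deriv_along X (\<lambda>q. \<Sum>a\<in>A. f a q) p = (\<Sum>a\<in>A. deriv_along X (f a) p)"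
  using dfun_sum[OF assms] by (simp add: deriv_along_def)

lemma deriv_along_const: "deriv_along X (\<lambda>q. r) p = 0"
  by (simp add: deriv_along_def dfun_const)

lemma deriv_along_diff:
  assumes "open U" "p \<in> U" "smooth_fun_on U f" "smooth_fun_on U g"
  shows "deriv_along X (\<lambda>q. f q - g q) p = deriv_along X f p - deriv_along X g p"
  using deriv_along_add[OF assms(1,2,3) smooth_fun_on_mult[OF assms(1) smooth_fun_on_const assms(4)], of X "-1"]
    deriv_along_mult[OF assms(1,2) smooth_fun_on_const assms(4), of X "-1"]
  by (simp add: deriv_along_const)

lemma smooth_fun_on_pd:
  assumes "open U" "smooth_fun_on U f" "c \<in> atlas" "U \<subseteq> fst c"
  shows "smooth_fun_on U (\<lambda>q. pd k (f \<circ> ch_inv c) (snd c q))"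
proof (rule smooth_fun_onI_chart)
  fix q assume q: "q \<in> U"
  have o: "open (snd c ` U)" using chart_image_open[OF assms(3,1)] assms(4) by (simp add: Int_absorb1)
  have "cont_diff n (snd c ` U) (pd k (f \<circ> ch_inv c))" for n
    using smooth_fun_on_chartD[OF assms(2,3), of "Suc n"] assms(4) by (simp add: Int_absorb1)
  then have "cont_diff n (snd c ` U) ((\<lambda>q. pd k (f \<circ> ch_inv c) (snd c q)) \<circ> ch_inv c)" for n
    by (rule iffD1[OF cont_diff_cong[OF o], rotated]) (use chart_inverse[OF assms(3)] assms(4) in auto)
  then have "smooth_on (snd c ` U) ((\<lambda>q. pd k (f \<circ> ch_inv c) (snd c q)) \<circ> ch_inv c)"
    by (simp add: smooth_on_def)
  then show "\<exists>c'\<in>atlas. \<exists>V. open V \<and> q \<in> V \<and> V \<subseteq> fst c' \<and>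
      smooth_on (snd c' ` V) ((\<lambda>q. pd k (f \<circ> ch_inv c) (snd c q)) \<circ> ch_inv c')"
    using assms q by blast
qed

lemma vector_field_coordinate:
  "X \<in> vector_fields \<Longrightarrow> c \<in> atlas \<Longrightarrow> smooth_fun_on (fst c) (deriv_along X (\<lambda>q. snd c q $ i))"
  by (simp add: vector_fields_def)

lemma deriv_along_smooth:
  assumes "open U" "X \<in> vector_fields" "smooth_fun_on U f"
  shows "smooth_fun_on U (deriv_along X f)"
proof (rule smooth_fun_on_local)
  fix p assume p: "p \<in> U"
  let ?c = "chart_at p"
  let ?V = "U \<inter> fst ?c"
  have V: "open ?V" "p \<in> ?V" using chart_open[OF chart_at(1)] chart_at(2) assms(1) p by auto
  have "smooth_fun_on ?V (\<lambda>q. SUM7 k. pd k (f \<circ> ch_inv ?c) (snd ?c q) * deriv_along X (\<lambda>q. snd ?c q $ k) q)"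
    by (intro smooth_fun_on_sum smooth_fun_on_mult V smooth_fun_on_pd chart_at
        smooth_fun_on_subset[OF vector_field_coordinate[OF assms(2) chart_at(1)]] smooth_fun_on_subset[OF assms(3)]) auto
  then have "smooth_fun_on ?V (deriv_along X f)"
    by (rule iffD1[OF smooth_fun_on_cong[OF V(1)], rotated])
      (simp add: deriv_along_def dfun_chart[OF assms(1) _ assms(3) chart_at(1)[of p]])
  then show "\<exists>V. open V \<and> p \<in> V \<and> smooth_fun_on V (deriv_along X f)" using V by blast
qed

lemma deriv_along_smooth_funs: "X \<in> vector_fields \<Longrightarrow> f \<in> smooth_funs \<Longrightarrow> deriv_along X f \<in> smooth_funs"
  using deriv_along_smooth by (auto simp: smooth_funs_def)

text \<open>In a chart the second-order parts of the two iterated derivatives agree by symmetry of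
  second derivatives; the first-order parts are the components of the bracket.\<close>
lemma deriv_along_lie_bracket:
  assumes "open U" "p \<in> U" "smooth_fun_on U f" and X: "X \<in> vector_fields" and Y: "Y \<in> vector_fields"
  shows "deriv_along X (deriv_along Y f) p - deriv_along Y (deriv_along X f) p = deriv_along (lie_bracket X Y) f p"
proof -
  let ?c = "chart_at p"
  let ?V = "U \<inter> fst ?c"
  let ?F = "f \<circ> ch_inv ?c"
  define P where "P k q = pd k ?F (snd ?c q)" for k q
  define co where "co Z k = deriv_along Z (\<lambda>q. snd ?c q $ k)" for Z k
  have V: "open ?V" "p \<in> ?V" using chart_open[OF chart_at(1)] chart_at(2) assms(1,2) by auto
  have P: "smooth_fun_on ?V (P k)" for k
    unfolding P_def by (intro V smooth_fun_on_pd chart_at smooth_fun_on_subset[OF assms(3)]) auto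
  have co: "smooth_fun_on ?V (co Z k)" if "Z \<in> vector_fields" for Z k
    unfolding co_def by (intro smooth_fun_on_subset[OF vector_field_coordinate[OF that chart_at(1)]]) auto
  have e: "deriv_along Z f q = (SUM7 k. P k q * co Z k q)" if "q \<in> ?V" for q Z
    using dfun_chart[OF assms(1) _ assms(3) chart_at(1), of q p] that by (simp add: deriv_along_def P_def co_def)
  have PP: "deriv_along Z (P k) p = (SUM7 l. pd l (pd k ?F) (snd ?c p) * co Z l p)" for Z k
  proof -
    have o: "open (snd ?c ` ?V)" using chart_image_open[OF chart_at(1) V(1), of p] by (simp add: Int_absorb1)
    have "pd l (P k \<circ> ch_inv ?c) (snd ?c p) = pd l (pd k ?F) (snd ?c p)" for l
      by (subst differentiable_cong_open(2)[OF o, where g="pd k ?F"])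
        (use V chart_inverse[OF chart_at(1)] in \<open>auto simp: P_def\<close>)
    then show ?thesis
      using dfun_chart[OF V P chart_at(1), of p k] V by (simp add: deriv_along_def co_def)
  qed
  have XY: "deriv_along X (deriv_along Y f) p =
     (SUM7 k. P k p * deriv_along X (co Y k) p) + (SUM7 k l. pd l (pd k ?F) (snd ?c p) * (co X l p * co Y k p))"
    if X: "X \<in> vector_fields" and Y: "Y \<in> vector_fields" for X Y
  proof -
    have "deriv_along X (deriv_along Y f) p = deriv_along X (\<lambda>q. SUM7 k. P k q * co Y k q) p"
      by (rule deriv_along_cong[OF V]) (rule e)
    then show ?thesis
    using V P co[OF Y] by (simp add: deriv_along_sum[OF V] smooth_fun_on_mult deriv_along_mult[OF V] PP
        sum.distrib sum_distrib_right mult.assoc)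
  qed
  have "cont_diff 2 (snd ?c ` (fst ?c \<inter> U)) ?F" by (rule smooth_fun_on_chartD[OF assms(3) chart_at(1)])
  then have sym: "pd l (pd k ?F) (snd ?c p) = pd k (pd l ?F) (snd ?c p)" for k l
    using V by (intro mixed_partials_commute[OF chart_image_open[OF chart_at(1) assms(1)]]) auto
  have "(SUM7 k l. pd l (pd k ?F) (snd ?c p) * (co X l p * co Y k p))
      = (SUM7 k l. pd l (pd k ?F) (snd ?c p) * (co Y l p * co X k p))"
    by (subst sum.swap) (simp only: sym mult.commute)
  then have "deriv_along X (deriv_along Y f) p - deriv_along Y (deriv_along X f) p
      = (SUM7 k. P k p * (deriv_along X (co Y k) p - deriv_along Y (co X k) p))"
    by (simp add: XY X Y right_diff_distrib sum_subtractf)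
  also have "\<dots> = (SUM7 k. P k p * co (lie_bracket X Y) k p)"
    by (simp add: co_def deriv_along_def dfun_own_coordinate lie_bracket_def Let_def)
  also have "\<dots> = deriv_along (lie_bracket X Y) f p" using e V by simp
  finally show ?thesis .
qed

subsection \<open>Vector fields\<close>

lemma vector_fieldI_local:
  assumes "\<And>q. \<exists>V Y. open V \<and> q \<in> V \<and> Y \<in> vector_fields \<and> (\<forall>x\<in>V. X x = Y x)"
  shows "X \<in> vector_fields"
  unfolding vector_fields_def
proof (safe intro!: smooth_fun_on_local)
  fix a b i q assume c: "(a, b) \<in> atlas" and q: "q \<in> fst (a, b)"
  obtain V Y where V: "open V" "q \<in> V" "Y \<in> vector_fields" "\<forall>x\<in>V. X x = Y x" using assms by blast
  let ?V = "V \<inter> a"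
  have o: "open ?V" "q \<in> ?V" using V chart_open[OF c] q by auto
  have "smooth_fun_on ?V (deriv_along Y (\<lambda>q. b q $ i))"
    using vector_field_coordinate[OF V(3) c, of i] by (auto intro: smooth_fun_on_subset)
  then have "smooth_fun_on ?V (deriv_along X (\<lambda>q. b q $ i))"
    by (rule iffD1[OF smooth_fun_on_cong[OF o(1)], rotated]) (use V(4) in \<open>simp add: deriv_along_def\<close>)
  then show "\<exists>V. open V \<and> q \<in> V \<and> smooth_fun_on V (deriv_along X (\<lambda>q. snd (a, b) q $ i))"
    using o by auto
qed

lemma coordinate_dfun_linear: "c \<in> atlas \<Longrightarrow> q \<in> fst c \<Longrightarrow> linear (dfun (\<lambda>q. snd c q $ i) q)"
  using dfun_linear[OF _ _ smooth_fun_on_coordinate] chart_open by blast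

lemma vector_fields_add: "X \<in> vector_fields \<Longrightarrow> Y \<in> vector_fields \<Longrightarrow> X + Y \<in> vector_fields"
proof -
  assume X: "X \<in> vector_fields" and Y: "Y \<in> vector_fields"
  have "smooth_fun_on (fst c) (deriv_along (X + Y) (\<lambda>q. snd c q $ i))" if c: "c \<in> atlas" for c i
    by (rule iffD1[OF smooth_fun_on_cong, rotated 2, OF smooth_fun_on_add[OF _
          vector_field_coordinate[OF X c] vector_field_coordinate[OF Y c]]])
      (use chart_open[OF c] in \<open>auto simp: deriv_along_def linear_add[OF coordinate_dfun_linear[OF c]]\<close>)
  then show ?thesis by (simp add: vector_fields_def)
qed

lemma vector_fields_scale:
  assumes f: "f \<in> smooth_funs" and X: "X \<in> vector_fields"
  shows "(\<lambda>q. f q *\<^sub>R X q) \<in> vector_fields"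
proof -
  have "smooth_fun_on (fst c) (deriv_along (\<lambda>q. f q *\<^sub>R X q) (\<lambda>q. snd c q $ i))" if c: "c \<in> atlas" for c i
    by (rule iffD1[OF smooth_fun_on_cong, rotated 2, OF smooth_fun_on_mult[OF _
          smooth_funs_on[OF f] vector_field_coordinate[OF X c]]])
      (use chart_open[OF c] in \<open>auto simp: deriv_along_def linear_scale[OF coordinate_dfun_linear[OF c]]\<close>)
  then show ?thesis by (simp add: vector_fields_def)
qed

lemma vector_fields_zero: "(\<lambda>q. 0) \<in> vector_fields"
proof -
  have "smooth_fun_on (fst c) (deriv_along (\<lambda>q. 0) (\<lambda>q. snd c q $ i))" if c: "c \<in> atlas" for c i
    by (rule iffD1[OF smooth_fun_on_cong, rotated 2, OF smooth_fun_on_const[of _ 0]])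
      (use chart_open[OF c] in \<open>auto simp: deriv_along_def linear_0[OF coordinate_dfun_linear[OF c]]\<close>)
  then show ?thesis by (simp add: vector_fields_def)
qed

lemma vector_fields_sum: "(\<And>a. a \<in> A \<Longrightarrow> X a \<in> vector_fields) \<Longrightarrow> (\<lambda>q. \<Sum>a\<in>A. X a q) \<in> vector_fields"
  by (induction A rule: infinite_finite_induct)
    (use vector_fields_add in \<open>auto simp: vector_fields_zero plus_fun_def\<close>)

lemma vector_fields_diff:
  "X \<in> vector_fields \<Longrightarrow> Y \<in> vector_fields \<Longrightarrow> (\<lambda>q. X q - Y q) \<in> vector_fields"
  using vector_fields_add[of X "\<lambda>q. (-1) *\<^sub>R Y q"] vector_fields_scale[OF smooth_funs_const, of Y "-1"]
  by (simp add: plus_fun_def)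

subsection \<open>Cut-off functions and coordinate fields\<close>

text \<open>A bump function on the model space, extended by zero: its support is the image of a closed
  ball, hence compact, hence closed since the manifold is Hausdorff.\<close>
lemma cutoff_exists:
  assumes "open U" "p \<in> U"
  obtains \<beta> N W where "\<beta> \<in> smooth_funs" "open N" "p \<in> N" "N \<subseteq> U" "\<And>q. q \<in> N \<Longrightarrow> \<beta> q = 1"
    "open W" "W \<union> U = UNIV" "\<And>q. q \<in> W \<Longrightarrow> \<beta> q = 0"
proof -
  let ?c = "chart_at p"
  let ?S = "snd ?c ` (fst ?c \<inter> U)"
  have S: "open ?S" "snd ?c p \<in> ?S" using chart_image_open[OF chart_at(1) assms(1)] chart_at(2) assms(2) by auto
  then obtain r where r: "r > 0" "cball (snd ?c p) r \<subseteq> ?S" using open_contains_cball by blast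
  obtain b where b: "smooth_on UNIV b" "\<And>x. dist x (snd ?c p) < r / 2 \<Longrightarrow> b x = 1"
    "\<And>x. dist x (snd ?c p) \<ge> r \<Longrightarrow> b x = 0" using smooth_on_bump[OF r(1), of "snd ?c p"] by blast
  define K where "K = ch_inv ?c ` cball (snd ?c p) r"
  have "compact K"
    unfolding K_def using chart_homeomorphism[OF chart_at(1), of p] r(2)
    by (intro compact_continuous_image) (auto simp: homeomorphism_def intro: continuous_on_subset)
  then have W: "open (- K)" by (simp add: compact_imp_closed open_Compl)
  have KU: "K \<subseteq> fst ?c \<inter> U"
  proof
    fix q assume "q \<in> K"
    then obtain x where x: "x \<in> ?S" "q = ch_inv ?c x" unfolding K_def using r(2) by blast
    then obtain q' where "q' \<in> fst ?c \<inter> U" "x = snd ?c q'" by blast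
    then show "q \<in> fst ?c \<inter> U" using x(2) chart_inverse(1)[OF chart_at(1), of q' p] by auto
  qed
  define \<beta> where "\<beta> q = (if q \<in> fst ?c then b (snd ?c q) else 0)" for q
  have z: "\<beta> q = 0" if "q \<notin> K" for q
  proof (cases "q \<in> fst ?c \<and> dist (snd ?c q) (snd ?c p) \<le> r")
    case True
    then have "q \<in> K" unfolding K_def using chart_inverse(1)[OF chart_at(1)]
      by (metis dist_commute imageI mem_cball)
    then show ?thesis using that by simp
  qed (use b(3) in \<open>auto simp: \<beta>_def\<close>)
  have o: "open (fst ?c)" using chart_open[OF chart_at(1)] by simp
  have "smooth_on (snd ?c ` fst ?c) (\<beta> \<circ> ch_inv ?c)"
  proof -
    have "cont_diff n (snd ?c ` fst ?c) (\<beta> \<circ> ch_inv ?c) \<longleftrightarrow> cont_diff n (snd ?c ` fst ?c) b" for n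
      by (rule cont_diff_cong) (use chart_open[OF chart_at(1), of p] chart_inverse[OF chart_at(1)] in \<open>auto simp: \<beta>_def\<close>)
    then show ?thesis using b(1) unfolding smooth_on_def by (meson cont_diff_subset subset_UNIV)
  qed
  then have "smooth_fun_on (fst ?c) \<beta>"
    using o chart_at(1) by (intro smooth_fun_onI_chart) blast
  moreover have "smooth_fun_on (- K) \<beta>"
    by (rule iffD2[OF smooth_fun_on_cong[OF W] smooth_fun_on_const[of _ 0]]) (simp add: z)
  ultimately have "\<beta> \<in> smooth_funs"
    unfolding smooth_funs_def using KU o W by (auto intro!: smooth_fun_on_local)
  moreover define N where "N = fst ?c \<inter> snd ?c -` ball (snd ?c p) (r/2)"
  have "open N" "p \<in> N" unfolding N_def using chart_preimage_open[OF chart_at(1)] chart_at(2) r(1) by auto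
  moreover have N1: "\<beta> q = 1" if "q \<in> N" for q
    using that b(2) by (auto simp: N_def \<beta>_def dist_commute)
  moreover have "N \<subseteq> U" using N1 z KU by force
  moreover have "- K \<union> U = UNIV" using KU by blast
  ultimately show ?thesis using W z by (intro that[of \<beta> N "- K"]) auto
qed

lemma cutoff_extend:
  assumes "open U" "open W" "W \<union> U = UNIV" "\<beta> \<in> smooth_funs" "\<And>q. q \<in> W \<Longrightarrow> \<beta> q = 0" "smooth_fun_on U f"
  shows "(\<lambda>q. \<beta> q * f q) \<in> smooth_funs"
proof -
  have "smooth_fun_on U (\<lambda>q. \<beta> q * f q)"
    by (rule smooth_fun_on_mult[OF assms(1) smooth_funs_on[OF assms(4)] assms(6)])
  moreover have "smooth_fun_on W (\<lambda>q. \<beta> q * f q)"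
    by (rule iffD2[OF smooth_fun_on_cong[OF assms(2)] smooth_fun_on_const[of _ 0]]) (simp add: assms(5))
  ultimately show ?thesis
    unfolding smooth_funs_def using assms(1-3) by (blast intro: smooth_fun_on_local)
qed

text \<open>Tangent vectors at \<open>q\<close> are stored as components in \<open>chart_at q\<close>, so the \<open>k\<close>-th coordinate
  field of \<open>c\<close> is a column of the Jacobian of the change of charts.\<close>
definition coord_field :: "'a set \<times> ('a \<Rightarrow> tvec) \<Rightarrow> 7 \<Rightarrow> 'a \<Rightarrow> tvec" where
  "coord_field c k q = (\<chi> i. pd k (\<lambda>x. snd (chart_at q) (ch_inv c x) $ i) (snd c q))"

lemma dfun_coord_field:
  assumes "open U" "q \<in> U" "smooth_fun_on U f" "c \<in> atlas" "q \<in> fst c"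
  shows "dfun f q (coord_field c k q) = pd k (f \<circ> ch_inv c) (snd c q)"
proof -
  let ?d = "chart_at q"
  let ?h = "\<lambda>x. snd ?d (ch_inv c x)"
  let ?W = "snd c ` (fst c \<inter> fst ?d)"
  have W: "open ?W" "snd c q \<in> ?W"
    using chart_image_open[OF assms(4)] chart_open[OF chart_at(1)] chart_at assms(5) by auto
  have eq: "(f \<circ> ch_inv c) x = ((f \<circ> ch_inv ?d) \<circ> ?h) x" if "x \<in> ?W" for x
    using that chart_inverse[OF chart_at(1)] chart_inverse[OF assms(4)] by auto
  have hq: "?h (snd c q) = snd ?d q" using chart_inverse[OF assms(4)] assms(5) by simp
  have "pd k ((f \<circ> ch_inv ?d) \<circ> ?h) (snd c q)
      = (SUM7 j. pd j (f \<circ> ch_inv ?d) (?h (snd c q)) * pd k (\<lambda>x. ?h x $ j) (snd c q))"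
    using smooth_fun_on_differentiable[OF assms(1-3) chart_at(1) chart_at(2)] hq
      smooth_fun_on_differentiable[OF _ chart_at(2) smooth_fun_on_coordinate[OF chart_at(1)] assms(4,5)]
      chart_open[OF chart_at(1)]
    by (intro pd_compose(2)) (auto simp: comp_def)
  moreover have "frechet_derivative (f \<circ> ch_inv c) (at (snd c q))
      = frechet_derivative ((f \<circ> ch_inv ?d) \<circ> ?h) (at (snd c q))"
    by (rule differentiable_cong_open(2)[OF W]) (rule eq)
  ultimately have "pd k (f \<circ> ch_inv c) (snd c q) = (SUM7 j. pd j (f \<circ> ch_inv ?d) (snd ?d q) * coord_field c k q $ j)"
    by (simp only: hq coord_field_def vec_lambda_beta)
  then show ?thesis
    by (subst dfun_def, subst frechet_derivative_coordinates)
      (use smooth_fun_on_differentiable[OF assms(1-3) chart_at(1) chart_at(2)] in \<open>simp_all add: mult.commute\<close>)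
qed

lemma coord_field_expansion:
  assumes "c \<in> atlas" "q \<in> fst c"
  shows "v = (SUM7 k. dfun (\<lambda>x. snd c x $ k) q v *\<^sub>R coord_field c k q)"
proof (subst vec_eq_iff, rule allI)
  fix i
  have "v $ i = dfun (\<lambda>x. snd (chart_at q) x $ i) q v" by (simp add: dfun_own_coordinate)
  also have "\<dots> = (SUM7 k. pd k ((\<lambda>x. snd (chart_at q) x $ i) \<circ> ch_inv c) (snd c q) * dfun (\<lambda>x. snd c x $ k) q v)"
    using chart_open[OF chart_at(1)] chart_at(2)
    by (intro dfun_chart[OF _ _ smooth_fun_on_coordinate[OF chart_at(1)] assms]) auto
  finally show "v $ i = (SUM7 k. dfun (\<lambda>x. snd c x $ k) q v *\<^sub>R coord_field c k q) $ i"
    by (simp add: coord_field_def comp_def mult.commute)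
qed

text \<open>The coordinate fields of a chart times a cut-off function; near the point, where the
  cut-off is one, the coefficient functions are the differentials of the coordinates.\<close>
lemma local_frame_exists:
  obtains X :: "7 \<Rightarrow> 'a \<Rightarrow> tvec" and co :: "7 \<Rightarrow> 'a \<Rightarrow> tvec \<Rightarrow> real" and N where
    "\<And>k. X k \<in> vector_fields" "open N" "p \<in> N"
    "\<And>q v. q \<in> N \<Longrightarrow> v = (SUM7 k. co k q v *\<^sub>R X k q)"
    "\<And>k Y. Y \<in> vector_fields \<Longrightarrow> smooth_fun_on N (\<lambda>q. co k q (Y q))"
    "\<And>q k. q \<in> N \<Longrightarrow> linear (co k q)"
proof -
  let ?c = "chart_at p"
  have o: "open (fst ?c)" "p \<in> fst ?c" using chart_open[OF chart_at(1)] chart_at by auto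
  obtain \<beta> N W where b: "\<beta> \<in> smooth_funs" "open N" "p \<in> N" "N \<subseteq> fst ?c" "\<And>q. q \<in> N \<Longrightarrow> \<beta> q = 1"
    "open W" "W \<union> fst ?c = UNIV" "\<And>q. q \<in> W \<Longrightarrow> \<beta> q = 0" using cutoff_exists[OF o] by blast
  define X where "X k q = (if q \<in> fst ?c then \<beta> q *\<^sub>R coord_field ?c k q else 0)" for k q
  have X: "X k \<in> vector_fields" for k
    unfolding vector_fields_def
  proof (safe intro!: smooth_fun_on_local)
    fix a b' i q assume c: "(a, b') \<in> atlas" and q: "q \<in> fst (a, b')"
    let ?f = "\<lambda>q. b' q $ i"
    have sf: "smooth_fun_on a ?f" using smooth_fun_on_coordinate[OF c] by simp
    have oa: "open a" using chart_open[OF c] by simp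
    have "q \<in> W \<or> q \<in> fst ?c" using b(7) by blast
    then show "\<exists>V. open V \<and> q \<in> V \<and> smooth_fun_on V (deriv_along (X k) (\<lambda>q. snd (a, b') q $ i))"
    proof
      assume qW: "q \<in> W"
      have "smooth_fun_on (W \<inter> a) (deriv_along (X k) ?f)"
        using oa b(6) b(8) linear_0[OF dfun_linear[OF oa _ sf]]
        by (intro iffD2[OF smooth_fun_on_cong smooth_fun_on_const[of _ 0]]) (auto simp: X_def deriv_along_def)
      then show ?thesis using qW q oa b(6) by (intro exI[of _ "W \<inter> a"]) auto
    next
      assume qc: "q \<in> fst ?c"
      let ?V = "a \<inter> fst ?c"
      have V: "open ?V" using oa o by auto
      have "smooth_fun_on ?V (\<lambda>q. \<beta> q * pd k (?f \<circ> ch_inv ?c) (snd ?c q))"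
        by (intro smooth_fun_on_mult smooth_funs_on b(1) V smooth_fun_on_pd chart_at smooth_fun_on_subset[OF sf]) auto
      then have "smooth_fun_on ?V (deriv_along (X k) ?f)"
        by (rule iffD1[OF smooth_fun_on_cong[OF V], rotated])
          (simp add: X_def deriv_along_def linear_scale[OF dfun_linear[OF oa _ sf]]
            dfun_coord_field[OF oa _ sf chart_at(1)])
      then show ?thesis using q qc V by (intro exI[of _ ?V]) auto
    qed
  qed
  define co where "co k q v = dfun (\<lambda>x. snd ?c x $ k) q v" for k q v
  show ?thesis
  proof (rule that[of X N co])
    show "v = (SUM7 k. co k q v *\<^sub>R X k q)" if "q \<in> N" for q v
      using coord_field_expansion[OF chart_at(1), of q p v] that b(4,5) by (auto simp: X_def co_def)
    show "smooth_fun_on N (\<lambda>q. co k q (Y q))" if "Y \<in> vector_fields" for k Y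
      using vector_field_coordinate[OF that chart_at(1), of p k] b(4)
      by (auto simp: co_def deriv_along_def[abs_def] intro: smooth_fun_on_subset)
    show "linear (co k q)" if "q \<in> N" for k q
      using coordinate_dfun_linear[OF chart_at(1), of q p k] that b(4) by (auto simp: co_def[abs_def])
  qed (use X b in auto)
qed

lemma ext: "ext p v \<in> vector_fields" "ext p v p = v"
proof -
  obtain X :: "7 \<Rightarrow> 'a \<Rightarrow> tvec" and co :: "7 \<Rightarrow> 'a \<Rightarrow> tvec \<Rightarrow> real" and N
    where X: "\<And>k. X k \<in> vector_fields" "open N" "p \<in> N"
    "\<And>q v. q \<in> N \<Longrightarrow> v = (SUM7 k. co k q v *\<^sub>R X k q)"
    "\<And>k Y. Y \<in> vector_fields \<Longrightarrow> smooth_fun_on N (\<lambda>q. co k q (Y q))" "\<And>q k. q \<in> N \<Longrightarrow> linear (co k q)"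
    by (rule local_frame_exists[of p]) (rule that)
  have "(\<lambda>q. SUM7 k. co k p v *\<^sub>R X k q) \<in> vector_fields \<and> (SUM7 k. co k p v *\<^sub>R X k p) = v"
    using X(4)[OF X(3), of v] by (auto intro!: vector_fields_sum vector_fields_scale smooth_funs_const X(1))
  then have "\<exists>Y. Y \<in> vector_fields \<and> Y p = v"
    by (intro exI[of _ "\<lambda>q. SUM7 k. co k p v *\<^sub>R X k q"])
  then have "ext p v \<in> vector_fields \<and> ext p v p = v" unfolding ext_def by (rule someI_ex)
  then show "ext p v \<in> vector_fields" "ext p v p = v" by auto
qed

text \<open>The witness is a coordinate function times a cut-off.\<close>
lemma dfun_separates:
  assumes "v \<noteq> 0"
  obtains f where "f \<in> smooth_funs" "dfun f p v \<noteq> 0"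
proof -
  let ?c = "chart_at p"
  have o: "open (fst ?c)" "p \<in> fst ?c" using chart_open[OF chart_at(1)] chart_at by auto
  obtain \<beta> N W where b: "\<beta> \<in> smooth_funs" "open N" "p \<in> N" "N \<subseteq> fst ?c" "\<And>q. q \<in> N \<Longrightarrow> \<beta> q = 1"
    "open W" "W \<union> fst ?c = UNIV" "\<And>q. q \<in> W \<Longrightarrow> \<beta> q = 0" using cutoff_exists[OF o] by blast
  obtain i where i: "v $ i \<noteq> 0" using assms by (auto simp: vec_eq_iff)
  have "(\<lambda>q. \<beta> q * snd ?c q $ i) \<in> smooth_funs"
    using cutoff_extend[OF o(1) b(6,7,1,8) smooth_fun_on_coordinate[OF chart_at(1)]] by blast
  moreover have "dfun (\<lambda>q. \<beta> q * snd ?c q $ i) p v = v $ i"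
    using dfun_cong[OF b(2,3), of "\<lambda>q. \<beta> q * snd ?c q $ i" "\<lambda>q. snd ?c q $ i"] b(5)
    by (simp add: dfun_own_coordinate)
  ultimately show ?thesis using that i by metis
qed

text \<open>Multiplied by the square of a cut-off, a field is a combination of global frame fields with
  globally defined coefficients, so only its value at the point matters.\<close>
lemma tensorial:
  fixes \<Phi> :: "('a \<Rightarrow> tvec) \<Rightarrow> 'w::real_vector"
  assumes add: "\<And>X Y. X \<in> vector_fields \<Longrightarrow> Y \<in> vector_fields \<Longrightarrow> \<Phi> (X + Y) = \<Phi> X + \<Phi> Y"
    and scale: "\<And>f X. f \<in> smooth_funs \<Longrightarrow> X \<in> vector_fields \<Longrightarrow> \<Phi> (\<lambda>q. f q *\<^sub>R X q) = f p *\<^sub>R \<Phi> X"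
    and X: "X \<in> vector_fields" and Y: "Y \<in> vector_fields" and eq: "X p = Y p"
  shows "\<Phi> X = \<Phi> Y"
proof -
  have zero: "\<Phi> Z = 0" if Z: "Z \<in> vector_fields" "Z p = 0" for Z
  proof -
    obtain E :: "7 \<Rightarrow> 'a \<Rightarrow> tvec" and co :: "7 \<Rightarrow> 'a \<Rightarrow> tvec \<Rightarrow> real" and N
      where E: "\<And>k. E k \<in> vector_fields" "open N" "p \<in> N"
      "\<And>q v. q \<in> N \<Longrightarrow> v = (SUM7 k. co k q v *\<^sub>R E k q)"
      "\<And>k Y. Y \<in> vector_fields \<Longrightarrow> smooth_fun_on N (\<lambda>q. co k q (Y q))" "\<And>q k. q \<in> N \<Longrightarrow> linear (co k q)"
      by (rule local_frame_exists[of p]) (rule that)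
    obtain \<beta> M W where b: "\<beta> \<in> smooth_funs" "open M" "p \<in> M" "M \<subseteq> N" "\<And>q. q \<in> M \<Longrightarrow> \<beta> q = 1"
      "open W" "W \<union> N = UNIV" "\<And>q. q \<in> W \<Longrightarrow> \<beta> q = 0" using cutoff_exists[OF E(2,3)] by blast
    define f where "f k q = \<beta> q * co k q (Z q)" for k q
    have f: "f k \<in> smooth_funs" for k
      unfolding f_def using cutoff_extend[OF E(2) b(6,7,1,8) E(5)[OF Z(1)]] by blast
    have Zf: "(\<lambda>q. \<beta> q *\<^sub>R Z q) = (\<lambda>q. SUM7 k. f k q *\<^sub>R E k q)"
    proof
      fix q
      consider "q \<in> N" | "q \<in> W" using b(7) by blast
      then show "\<beta> q *\<^sub>R Z q = (SUM7 k. f k q *\<^sub>R E k q)"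
      proof cases
        case 1
        show ?thesis by (subst E(4)[OF 1, of "Z q"]) (simp add: f_def scaleR_sum_right)
      qed (simp add: f_def b(8))
    qed
    have sum: "\<Phi> (\<lambda>q. \<Sum>k\<in>A. f k q *\<^sub>R E k q) = (\<Sum>k\<in>A. f k p *\<^sub>R \<Phi> (E k))" for A
    proof (induction A rule: infinite_finite_induct)
      case (insert k A)
      have "\<Phi> ((\<lambda>q. f k q *\<^sub>R E k q) + (\<lambda>q. \<Sum>k\<in>A. f k q *\<^sub>R E k q)) = f k p *\<^sub>R \<Phi> (E k) + (\<Sum>k\<in>A. f k p *\<^sub>R \<Phi> (E k))"
        by (subst add) (auto intro!: vector_fields_sum vector_fields_scale f E(1) simp: scale[OF f E(1)] insert)
      then show ?case using insert by (simp add: plus_fun_def)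
    qed (use scale[OF smooth_funs_const[of 0] vector_fields_zero] in simp_all)
    have "\<Phi> Z = \<Phi> (\<lambda>q. \<beta> q *\<^sub>R Z q)" using scale[OF b(1) Z(1)] b(3,5) by simp
    also have "\<dots> = (SUM7 k. f k p *\<^sub>R \<Phi> (E k))" unfolding Zf by (rule sum)
    also have "\<dots> = 0" using Z(2) linear_0[OF E(6)[OF E(3)]] by (simp add: f_def)
    finally show ?thesis .
  qed
  have "\<Phi> (\<lambda>q. X q - Y q) = 0" using zero[OF vector_fields_diff[OF X Y]] eq by simp
  moreover have "\<Phi> ((\<lambda>q. X q - Y q) + Y) = \<Phi> (\<lambda>q. X q - Y q) + \<Phi> Y"
    by (rule add[OF vector_fields_diff[OF X Y] Y])
  moreover have "(\<lambda>q. X q - Y q) + Y = X" by (simp add: plus_fun_def)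
  ultimately show ?thesis by simp
qed

end

section \<open>Tensor fields and their covariant derivative\<close>

context smooth_manifold7
begin

abbreviation ev :: "'a \<Rightarrow> ('a \<Rightarrow> tvec) list \<Rightarrow> tvec list" where
  "ev p Xs \<equiv> map (\<lambda>X. X p) Xs"

lemma ev_ext: "ev p (map (ext p) vs) = vs"
  by (simp add: ext comp_def)

lemma ext_set: "set (map (ext p) vs) \<subseteq> vector_fields"
  by (auto simp: ext)

lemma set_list_update_VF:
  "set Xs \<subseteq> vector_fields \<Longrightarrow> X \<in> vector_fields \<Longrightarrow> set (Xs[i := X]) \<subseteq> vector_fields"
  using set_update_subset_insert by fastforce

text \<open>Replace the fields one argument at a time.\<close>
lemma tensorial_list:
  fixes \<Phi> :: "('a \<Rightarrow> tvec) list \<Rightarrow> 'w::real_vector"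
  assumes add: "\<And>Xs i X Y. length Xs = n \<Longrightarrow> set Xs \<subseteq> vector_fields \<Longrightarrow> i < n \<Longrightarrow> X \<in> vector_fields \<Longrightarrow>
      Y \<in> vector_fields \<Longrightarrow> \<Phi> (Xs[i := X + Y]) = \<Phi> (Xs[i := X]) + \<Phi> (Xs[i := Y])"
    and scale: "\<And>Xs i f X. length Xs = n \<Longrightarrow> set Xs \<subseteq> vector_fields \<Longrightarrow> i < n \<Longrightarrow> X \<in> vector_fields \<Longrightarrow>
      f \<in> smooth_funs \<Longrightarrow> \<Phi> (Xs[i := \<lambda>q. f q *\<^sub>R X q]) = f p *\<^sub>R \<Phi> (Xs[i := X])"
    and X: "length Xs = n" "set Xs \<subseteq> vector_fields" and Y: "length Ys = n" "set Ys \<subseteq> vector_fields"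
    and eq: "ev p Xs = ev p Ys"
  shows "\<Phi> Xs = \<Phi> Ys"
proof -
  have "\<Phi> (take k Ys @ drop k Xs) = \<Phi> Xs" if "k \<le> n" for k
    using that
  proof (induction k)
    case (Suc k)
    let ?Z = "take k Ys @ drop k Xs"
    have len: "length ?Z = n" using X Y Suc by simp
    have sub: "set ?Z \<subseteq> vector_fields"
      using X(2) Y(2) by (auto dest: in_set_takeD in_set_dropD)
    have XYk: "Xs ! k \<in> vector_fields" "Ys ! k \<in> vector_fields" "(Xs ! k) p = (Ys ! k) p"
      using X Y Suc.prems nth_mem[of k Xs] nth_mem[of k Ys] arg_cong[OF eq, of "\<lambda>l. l ! k"] by auto
    have "\<Phi> (?Z[k := Xs ! k]) = \<Phi> (?Z[k := Ys ! k])"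
      by (rule tensorial[where \<Phi>="\<lambda>X. \<Phi> (?Z[k := X])"])
        (use add[OF len sub] scale[OF len sub] XYk Suc.prems in auto)
    moreover have "?Z[k := Xs ! k] = ?Z"
      using X Y Suc.prems by (intro list_update_same_conv[THEN iffD2]) (auto simp: nth_append)
    moreover have "?Z[k := Ys ! k] = take (Suc k) Ys @ drop (Suc k) Xs"
      using X Y Suc.prems
      by (intro nth_equalityI) (auto simp: nth_append nth_list_update min_def not_less less_Suc_eq)
    ultimately show ?case using Suc by simp
  qed simp
  from this[of n] X Y show ?thesis by simp
qed

definition multilin :: "nat \<Rightarrow> (tvec list \<Rightarrow> real) \<Rightarrow> bool" where
  "multilin n F \<longleftrightarrow> (\<forall>vs i. length vs = n \<longrightarrow> i < n \<longrightarrow> linear (\<lambda>x. F (vs[i := x])))"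

definition tensor :: "nat \<Rightarrow> ('a, real) forms \<Rightarrow> bool" where
  "tensor n T \<longleftrightarrow> (\<forall>p. multilin n (T p)) \<and>
     (\<forall>Xs. length Xs = n \<longrightarrow> set Xs \<subseteq> vector_fields \<longrightarrow> (\<lambda>q. T q (ev q Xs)) \<in> smooth_funs)"

lemma multilinD: "multilin n F \<Longrightarrow> length vs = n \<Longrightarrow> i < n \<Longrightarrow> linear (\<lambda>x. F (vs[i := x]))"
  by (simp add: multilin_def)

lemma tensor_multilin: "tensor n T \<Longrightarrow> multilin n (T p)"
  by (simp add: tensor_def)

lemma tensor_smooth:
  "tensor n T \<Longrightarrow> length Xs = n \<Longrightarrow> set Xs \<subseteq> vector_fields \<Longrightarrow> (\<lambda>q. T q (ev q Xs)) \<in> smooth_funs"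
  by (simp add: tensor_def)

lemma multilin_from_fields:
  assumes F: "\<And>Xs. length Xs = n \<Longrightarrow> set Xs \<subseteq> vector_fields \<Longrightarrow> F (ev p Xs) = \<Phi> Xs"
    and add: "\<And>Xs i X Y. length Xs = n \<Longrightarrow> set Xs \<subseteq> vector_fields \<Longrightarrow> i < n \<Longrightarrow> X \<in> vector_fields \<Longrightarrow>
      Y \<in> vector_fields \<Longrightarrow> \<Phi> (Xs[i := X + Y]) = \<Phi> (Xs[i := X]) + \<Phi> (Xs[i := Y])"
    and scale: "\<And>Xs i f X. length Xs = n \<Longrightarrow> set Xs \<subseteq> vector_fields \<Longrightarrow> i < n \<Longrightarrow> X \<in> vector_fields \<Longrightarrow>
      f \<in> smooth_funs \<Longrightarrow> \<Phi> (Xs[i := \<lambda>q. f q *\<^sub>R X q]) = f p * \<Phi> (Xs[i := X])"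
  shows "multilin n F"
  unfolding multilin_def
proof (intro allI impI linearI)
  fix vs :: "tvec list" and i x y assume n: "length vs = n" "i < n"
  let ?Xs = "map (ext p) vs"
  have F': "F (vs[i := Z p]) = \<Phi> (?Xs[i := Z])" if "Z \<in> vector_fields" for Z
  proof -
    have "vs[i := Z p] = ev p (?Xs[i := Z])" by (simp add: map_update ext comp_def)
    then show ?thesis
      using F[of "?Xs[i := Z]"] set_list_update_VF[OF ext_set that, of p vs i] n by simp
  qed
  show "F (vs[i := x + y]) = F (vs[i := x]) + F (vs[i := y])"
    using F'[of "ext p x + ext p y"] F'[of "ext p x"] F'[of "ext p y"] n
    by (simp add: ext vector_fields_add add ext_set del: list.set_map set_map)
  show "F (vs[i := r *\<^sub>R x]) = r *\<^sub>R F (vs[i := x])" for r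
    using F'[of "\<lambda>q. r *\<^sub>R ext p x q"] F'[of "ext p x"] n
      scale[OF _ ext_set n(2) ext(1) smooth_funs_const[of r], of p vs p x]
    by (simp add: ext vector_fields_scale smooth_funs_const)
qed

lemma multilin_add: "multilin n F \<Longrightarrow> length vs = n \<Longrightarrow> i < n \<Longrightarrow> F (vs[i := x + y]) = F (vs[i := x]) + F (vs[i := y])"
  using linear_add[OF multilinD] by blast

lemma multilin_scale: "multilin n F \<Longrightarrow> length vs = n \<Longrightarrow> i < n \<Longrightarrow> F (vs[i := r *\<^sub>R x]) = r * F (vs[i := x])"
  using linear_scale[OF multilinD] by fastforce

lemma multilin_diff: "multilin n F \<Longrightarrow> length vs = n \<Longrightarrow> i < n \<Longrightarrow> F (vs[i := x - y]) = F (vs[i := x]) - F (vs[i := y])"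
  using linear_diff[OF multilinD] by blast

lemma multilin_sum: "multilin n F \<Longrightarrow> length vs = n \<Longrightarrow> i < n \<Longrightarrow>
    F (vs[i := (\<Sum>a\<in>A. c a *\<^sub>R x a)]) = (\<Sum>a\<in>A. c a * F (vs[i := x a]))"
  using linear_sum[OF multilinD, of n F vs i "\<lambda>a. c a *\<^sub>R x a" A] by (simp add: multilin_scale)

end

context riemannian_manifold7
begin

lemma lie_bracket_nab:
  "X \<in> vector_fields \<Longrightarrow> Y \<in> vector_fields \<Longrightarrow> lie_bracket X Y = (\<lambda>q. nab X Y q - nab Y X q)"
  by (simp add: nab_torsion_free[symmetric] fun_diff_def)

lemma lie_bracket_field: "X \<in> vector_fields \<Longrightarrow> Y \<in> vector_fields \<Longrightarrow> lie_bracket X Y \<in> vector_fields"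
  by (simp add: lie_bracket_nab vector_fields_diff nab_vector_field)

definition nabla :: "('a, real) forms \<Rightarrow> ('a, real) forms" where
  "nabla T p vs = cov_deriv deriv_along T p (hd vs) (tl vs)"

definition nabla_field :: "('a, real) forms \<Rightarrow> 'a \<Rightarrow> ('a \<Rightarrow> tvec) list \<Rightarrow> real" where
  "nabla_field T p Zs = deriv_along (hd Zs) (\<lambda>q. T q (ev q (tl Zs))) p
     - (\<Sum>i<length (tl Zs). T p ((ev p (tl Zs))[i := nab (hd Zs) (tl Zs ! i) p]))"

lemma nabla_Cons:
  "nabla T p (v # vs) = nabla_field T p (map (ext p) (v # vs))"
  unfolding nabla_def nabla_field_def cov_deriv_def using ev_ext[of p vs]
  by (simp add: comp_def)

lemma nabla_field_slot:
  assumes "length Xs = n" "i < n"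
  shows "nabla_field T p (V # Xs[i := X]) = deriv_along V (\<lambda>q. T q ((ev q Xs)[i := X q])) p
     - (T p ((ev p Xs)[i := nab V X p])
        + (\<Sum>j\<in>{..<n} - {i}. T p ((ev p Xs)[j := nab V (Xs ! j) p, i := X p])))"
proof -
  have "(\<Sum>j<n. T p ((ev p (Xs[i := X]))[j := nab V (Xs[i := X] ! j) p]))
     = T p ((ev p (Xs[i := X]))[i := nab V (Xs[i := X] ! i) p])
       + (\<Sum>j\<in>{..<n} - {i}. T p ((ev p (Xs[i := X]))[j := nab V (Xs[i := X] ! j) p]))"
    using assms by (intro sum.remove) auto
  also have "(\<Sum>j\<in>{..<n} - {i}. T p ((ev p (Xs[i := X]))[j := nab V (Xs[i := X] ! j) p]))
     = (\<Sum>j\<in>{..<n} - {i}. T p ((ev p Xs)[j := nab V (Xs ! j) p, i := X p]))"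
    by (intro sum.cong refl) (auto simp: map_update list_update_swap)
  also have "T p ((ev p (Xs[i := X]))[i := nab V (Xs[i := X] ! i) p]) = T p ((ev p Xs)[i := nab V X p])"
    using assms by (simp add: map_update)
  finally show ?thesis using assms by (simp add: nabla_field_def map_update)
qed

text \<open>In an old argument, the derivative of a coefficient enters twice with opposite signs:
  through the value of the tensor and through the derivative of the field.\<close>
lemma nabla_field_tensorial:
  assumes T: "tensor n T" and Zs: "length Zs = Suc n" "set Zs \<subseteq> vector_fields" and i: "i < Suc n"
    and X: "X \<in> vector_fields"
  shows "Y \<in> vector_fields \<Longrightarrow> nabla_field T p (Zs[i := X + Y]) = nabla_field T p (Zs[i := X]) + nabla_field T p (Zs[i := Y])" (is "_ \<Longrightarrow> ?A")
    and "f \<in> smooth_funs \<Longrightarrow> nabla_field T p (Zs[i := \<lambda>q. f q *\<^sub>R X q]) = f p *\<^sub>R nabla_field T p (Zs[i := X])" (is "_ \<Longrightarrow> ?S")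
proof -
  obtain V Xs where Z: "Zs = V # Xs" using Zs(1) by (cases Zs) auto
  have V: "V \<in> vector_fields" and Xs: "length Xs = n" "set Xs \<subseteq> vector_fields" using Zs Z by auto
  have XsV: "Xs ! j \<in> vector_fields" if "j < n" for j using Xs that nth_mem by blast
  note ml = tensor_multilin[OF T]
  have sm: "smooth_fun_on UNIV (\<lambda>q. T q ((ev q Xs)[i := X q]))" if "X \<in> vector_fields" for X i
    using tensor_smooth[OF T, of "Xs[i := X]"] set_list_update_VF[OF Xs(2) that] Xs(1)
    by (simp add: smooth_funs_def map_update)
  have sm0: "smooth_fun_on UNIV (\<lambda>q. T q (ev q Xs))"
    using tensor_smooth[OF T Xs] by (simp add: smooth_funs_def)
  have lin: "linear (dfun (\<lambda>q. T q (ev q Xs)) p)" by (rule dfun_linear[OF _ _ sm0]) auto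
  show ?A if Y: "Y \<in> vector_fields"
  proof (cases i)
    case 0
    have "T p ((ev p Xs)[j := nab (X + Y) (Xs ! j) p]) = T p ((ev p Xs)[j := nab X (Xs ! j) p])
        + T p ((ev p Xs)[j := nab Y (Xs ! j) p])" if "j < n" for j
      using nab_add_left[OF X Y XsV[OF that]] multilin_add[OF ml] Xs that by simp
    then show ?thesis using Xs
      by (simp add: 0 Z nabla_field_def sum.distrib deriv_along_def linear_add[OF lin])
  next
    case (Suc k)
    then have k: "k < n" using i by simp
    have "(\<lambda>q. T q ((ev q Xs)[k := X q + Y q])) = (\<lambda>q. T q ((ev q Xs)[k := X q]) + T q ((ev q Xs)[k := Y q]))"
      using multilin_add[OF ml] Xs k by simp
    moreover have "nab V (X + Y) p = nab V X p + nab V Y p" using nab_add_right[OF V X Y] by simp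
    ultimately show ?thesis
      using Xs k deriv_along_add[OF _ _ sm[OF X, of k] sm[OF Y, of k], of p V]
      by (simp add: Suc Z nabla_field_slot multilin_add[OF ml] sum.distrib)
  qed
  show ?S if f: "f \<in> smooth_funs"
  proof (cases i)
    case 0
    have "T p ((ev p Xs)[j := nab (\<lambda>q. f q *\<^sub>R X q) (Xs ! j) p]) = f p * T p ((ev p Xs)[j := nab X (Xs ! j) p])" if "j < n" for j
      using nab_scale_left[OF f X XsV[OF that]] multilin_scale[OF ml] Xs that by simp
    then show ?thesis using Xs
      by (simp add: 0 Z nabla_field_def sum_distrib_left deriv_along_def linear_scale[OF lin] right_diff_distrib)
  next
    case (Suc k)
    then have k: "k < n" using i by simp
    have "(\<lambda>q. T q ((ev q Xs)[k := f q *\<^sub>R X q])) = (\<lambda>q. f q * T q ((ev q Xs)[k := X q]))"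
      using multilin_scale[OF ml] Xs k by simp
    moreover have "nab V (\<lambda>q. f q *\<^sub>R X q) p = deriv_along V f p *\<^sub>R X p + f p *\<^sub>R nab V X p"
      using nab_leibniz[OF f V X] by simp
    ultimately show ?thesis
      using Xs k deriv_along_mult[OF _ _ smooth_funs_on[OF f] sm[OF X, of k], of p V]
      by (simp add: Suc Z nabla_field_slot multilin_add[OF ml] multilin_scale[OF ml] sum_distrib_left algebra_simps)
  qed
qed

lemma nabla_eq:
  assumes T: "tensor n T" and "length Xs = n" "set Xs \<subseteq> vector_fields" "V \<in> vector_fields"
  shows "nabla T p (V p # ev p Xs) = nabla_field T p (V # Xs)"
  unfolding nabla_Cons
proof (rule tensorial_list[where n="Suc n" and \<Phi>="nabla_field T p"])
  show "ev p (map (ext p) (V p # ev p Xs)) = ev p (V # Xs)" by (simp only: ev_ext) simp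
qed (use nabla_field_tensorial[OF T] assms in \<open>auto simp: ext\<close>)

lemma nabla_eq':
  assumes T: "tensor n T" and "length Zs = Suc n" "set Zs \<subseteq> vector_fields"
  shows "nabla T p (ev p Zs) = nabla_field T p Zs"
  using nabla_eq[OF T, of "tl Zs" "hd Zs" p] assms by (cases Zs) auto

lemma tensor_nabla: 
  assumes T: "tensor n T" shows "tensor (Suc n) (nabla T)"
  unfolding tensor_def
proof (intro conjI allI impI)
  show "multilin (Suc n) (nabla T p)" for p
    by (rule multilin_from_fields[where \<Phi>="nabla_field T p", OF nabla_eq'[OF T]])
      (use nabla_field_tensorial[OF T] in auto)
next
  fix Zs assume Zs: "length Zs = Suc n" "set Zs \<subseteq> vector_fields"
  then obtain V Xs where Z: "Zs = V # Xs" and V: "V \<in> vector_fields" "length Xs = n" "set Xs \<subseteq> vector_fields"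
    by (cases Zs) auto
  have "(\<lambda>q. T q ((ev q Xs)[i := nab V (Xs ! i) q])) \<in> smooth_funs" if "i < n" for i
  proof -
    have "Xs ! i \<in> vector_fields" using V that nth_mem by blast
    then show ?thesis
      using tensor_smooth[OF T, of "Xs[i := nab V (Xs ! i)]"] V(2)
        set_list_update_VF[OF V(3) nab_vector_field[OF V(1)]] by (simp add: map_update)
  qed
  then have "(\<lambda>q. deriv_along V (\<lambda>q. T q (ev q Xs)) q - (\<Sum>i<n. T q ((ev q Xs)[i := nab V (Xs ! i) q]))) \<in> smooth_funs"
    using V deriv_along_smooth_funs[OF V(1) tensor_smooth[OF T V(2,3)]]
    by (intro smooth_funs_diff smooth_funs_sum) auto
  then show "(\<lambda>q. nabla T q (ev q Zs)) \<in> smooth_funs"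
    using V by (simp add: nabla_eq'[OF T Zs]) (simp add: Z nabla_field_def)
qed

section \<open>Curvature\<close>

lemma curvature_tensorial:
  fixes p :: 'a
  assumes Zs: "length Zs = 3" "set Zs \<subseteq> vector_fields" and i: "i < 3"
    and X: "X \<in> vector_fields"
  defines "R \<equiv> \<lambda>Zs. curvature_field (Zs ! 0) (Zs ! 1) (Zs ! 2) p"
  shows "Y \<in> vector_fields \<Longrightarrow> R (Zs[i := X + Y]) = R (Zs[i := X]) + R (Zs[i := Y])" (is "_ \<Longrightarrow> ?A")
    and "f \<in> smooth_funs \<Longrightarrow> R (Zs[i := \<lambda>q. f q *\<^sub>R X q]) = f p *\<^sub>R R (Zs[i := X])" (is "_ \<Longrightarrow> ?S")
proof -
  obtain U V W where Z: "Zs = [U, V, W]" using Zs(1) by (auto simp: numeral_3_eq_3 length_Suc_conv)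
  have VF: "U \<in> vector_fields" "V \<in> vector_fields" "W \<in> vector_fields" using Zs Z by auto
  have i: "i = 0 \<or> i = 1 \<or> i = 2" using i by auto
  note simps = curvature_field_def lie_bracket_nab nab_vector_field vector_fields_add vector_fields_scale
    vector_fields_diff lie_bracket_field
  have cf: "curvature_field X Y Z p = nab X (nab Y Z) p - nab Y (nab X Z) p - (nab (nab X Y) Z p - nab (nab Y X) Z p)"
    if "X \<in> vector_fields" "Y \<in> vector_fields" "Z \<in> vector_fields" for X Y Z
  proof -
    have "nab ((\<lambda>q. nab X Y q - nab Y X q) + nab Y X) Z p = nab (\<lambda>q. nab X Y q - nab Y X q) Z p + nab (nab Y X) Z p"
      using that by (subst nab_add_left) (auto intro: vector_fields_diff nab_vector_field)
    moreover have "(\<lambda>q. nab X Y q - nab Y X q) + nab Y X = nab X Y" by (simp add: plus_fun_def)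
    ultimately show ?thesis using that by (simp add: curvature_field_def lie_bracket_nab)
  qed
  have l: "nab (\<lambda>q. f q *\<^sub>R X q + g q *\<^sub>R Y q) Z p = f p *\<^sub>R nab X Z p + g p *\<^sub>R nab Y Z p"
    if "f \<in> smooth_funs" "g \<in> smooth_funs" "X \<in> vector_fields" "Y \<in> vector_fields" "Z \<in> vector_fields" for f g X Y Z p
    using nab_add_left[of "\<lambda>q. f q *\<^sub>R X q" "\<lambda>q. g q *\<^sub>R Y q" Z] that
    by (simp add: vector_fields_scale plus_fun_def nab_scale_left)
  have r: "nab Z (\<lambda>q. f q *\<^sub>R X q + g q *\<^sub>R Y q) p
      = deriv_along Z f p *\<^sub>R X p + f p *\<^sub>R nab Z X p + (deriv_along Z g p *\<^sub>R Y p + g p *\<^sub>R nab Z Y p)"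
    if "f \<in> smooth_funs" "g \<in> smooth_funs" "X \<in> vector_fields" "Y \<in> vector_fields" "Z \<in> vector_fields" for f g X Y Z p
    using nab_add_right[of Z "\<lambda>q. f q *\<^sub>R X q" "\<lambda>q. g q *\<^sub>R Y q"] that
    by (simp add: vector_fields_scale plus_fun_def nab_leibniz)
  show ?A if Y: "Y \<in> vector_fields"
    using i VF X Y
    by (auto simp: R_def Z cf vector_fields_add nab_add_left nab_add_right nab_vector_field)
  show ?S if f: "f \<in> smooth_funs"
  proof -
    have fX: "(\<lambda>q. f q *\<^sub>R X q) \<in> vector_fields" using f X vector_fields_scale by blast
    have df: "deriv_along Z f \<in> smooth_funs" if "Z \<in> vector_fields" for Z
      using deriv_along_smooth_funs that f by blast
    have br: "deriv_along U (deriv_along V f) p - deriv_along V (deriv_along U f) p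
       = deriv_along (nab U V) f p - deriv_along (nab V U) f p"
    proof -
      have "linear (dfun f p)" by (rule dfun_linear[OF _ _ smooth_funs_on[OF f, of UNIV]]) auto
      then show ?thesis
        using deriv_along_lie_bracket[OF _ _ smooth_funs_on[OF f] VF(1,2), of UNIV p]
        by (simp add: lie_bracket_nab VF deriv_along_def linear_diff)
    qed
    have c0: "R ([\<lambda>q. f q *\<^sub>R X q, V, W]) = f p *\<^sub>R R [X, V, W]"
      using VF X f fX df
      by (simp add: R_def cf nab_scale_left nab_leibniz nab_vector_field l vector_fields_scale) (simp add: algebra_simps)
    have c1: "R ([U, \<lambda>q. f q *\<^sub>R X q, W]) = f p *\<^sub>R R [U, X, W]"
      using VF X f fX df
      by (simp add: R_def cf nab_scale_left nab_leibniz nab_vector_field l vector_fields_scale) (simp add: algebra_simps)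
    have c2: "R ([U, V, \<lambda>q. f q *\<^sub>R X q]) = f p *\<^sub>R R [U, V, X]"
    proof -
      have "deriv_along U (deriv_along V f) p *\<^sub>R X p - deriv_along V (deriv_along U f) p *\<^sub>R X p
        = deriv_along (nab U V) f p *\<^sub>R X p - deriv_along (nab V U) f p *\<^sub>R X p"
        by (simp only: scaleR_left_diff_distrib[symmetric] br)
      then show ?thesis
      using VF X f fX df
      by (simp add: R_def cf nab_scale_left nab_leibniz nab_vector_field r vector_fields_scale)
        (simp add: algebra_simps)
    qed
    show ?thesis using i c0 c1 c2 by (auto simp: Z)
  qed
qed

lemma curvature_cong:
  assumes "X \<in> vector_fields" "Y \<in> vector_fields" "Z \<in> vector_fields"
    "X' \<in> vector_fields" "Y' \<in> vector_fields" "Z' \<in> vector_fields"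
    "X p = X' p" "Y p = Y' p" "Z p = Z' p"
  shows "curvature_field X Y Z p = curvature_field X' Y' Z' p"
proof -
  let ?R = "\<lambda>Zs. curvature_field (Zs ! 0) (Zs ! 1) (Zs ! 2) p"
  have "?R [X, Y, Z] = ?R [X', Y', Z']"
    by (rule tensorial_list[where n=3 and p=p and \<Phi>="?R"])
      (rule curvature_tensorial; assumption | use assms in simp)+
  then show ?thesis by simp
qed

lemma curvature_linear: "linear (\<lambda>z. curvature_field (ext p u) (ext p v) (ext p z) p)"
proof (rule linearI)
  show "curvature_field (ext p u) (ext p v) (ext p (y + z)) p =
    curvature_field (ext p u) (ext p v) (ext p y) p + curvature_field (ext p u) (ext p v) (ext p z) p" for y z
    using curvature_tensorial(1)[of "[ext p u, ext p v, ext p 0]" 2 "ext p y" "ext p z" p]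
      curvature_cong[of "ext p u" "ext p v" "ext p (y + z)" "ext p u" "ext p v" "ext p y + ext p z" p]
    by (simp add: ext vector_fields_add)
  show "curvature_field (ext p u) (ext p v) (ext p (r *\<^sub>R y)) p =
    r *\<^sub>R curvature_field (ext p u) (ext p v) (ext p y) p" for y r
    using curvature_tensorial(2)[of "[ext p u, ext p v, ext p 0]" 2 "ext p y" "\<lambda>_. r" p]
      curvature_cong[of "ext p u" "ext p v" "ext p (r *\<^sub>R y)" "ext p u" "ext p v" "\<lambda>q. r *\<^sub>R ext p y q" p]
    by (simp add: ext vector_fields_scale smooth_funs_const)
qed

lemma Blinfun_linear:
  fixes f :: "tvec \<Rightarrow> 'w::real_normed_vector"
  shows "linear f \<Longrightarrow> blinfun_apply (Blinfun f) = f"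
  by (simp add: bounded_linear_Blinfun_apply linear_conv_bounded_linear)

lemma Riem_fields:
  assumes "X \<in> vector_fields" "Y \<in> vector_fields" "Z \<in> vector_fields"
  shows "blinfun_apply (Riem p (X p) (Y p)) (Z p) = curvature_field X Y Z p"
  unfolding Riem_def
  using Blinfun_linear[OF curvature_linear[of p "X p" "Y p"]]
    curvature_cong[of "ext p (X p)" "ext p (Y p)" "ext p (Z p)" X Y Z p] assms by (simp add: ext)

abbreviation Rm :: "'a \<Rightarrow> tvec \<Rightarrow> tvec \<Rightarrow> tvec \<Rightarrow> tvec" where
  "Rm p u v w \<equiv> blinfun_apply (Riem p u v) w"

lemma Rm_ext: "Rm p u v w = curvature_field (ext p u) (ext p v) (ext p w) p"
  using Riem_fields[OF ext(1) ext(1) ext(1), of p p u p v p w] by (simp add: ext)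

text \<open>Expand both second derivatives along vector fields. The twofold derivatives of the value
  combine to a derivative along the bracket, the terms that differentiate two distinct arguments
  are symmetric in \<open>u\<close> and \<open>v\<close>, and what remains on each single argument is the curvature.\<close>
lemma ricci_identity:
  assumes T: "tensor n T" and len: "length ws = n"
  shows "nabla (nabla T) p (u # v # ws) - nabla (nabla T) p (v # u # ws)
     = - (\<Sum>i<n. T p (ws[i := Rm p u v (ws ! i)]))"
proof -
  define Ws where "Ws = map (ext p) ws"
  have Ws: "length Ws = n" "set Ws \<subseteq> vector_fields" "ev p Ws = ws"
    unfolding Ws_def using len ev_ext ext_set by auto
  have WsV: "Ws ! i \<in> vector_fields" if "i < n" for i using Ws that nth_mem by blast
  define t where "t Xs q = T q (ev q Xs)" for Xs q
  have ts: "smooth_fun_on UNIV (t Xs)" if "length Xs = n" "set Xs \<subseteq> vector_fields" for Xs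
    using tensor_smooth[OF T that] by (simp add: smooth_funs_def t_def[abs_def])
  note sub = set_list_update_VF[OF Ws(2)]
  define D where "D U V i j = t ((Ws[i := nab U (Ws ! i)])[j := nab V (Ws[i := nab U (Ws ! i)] ! j)]) p" for U V i j
  have nf: "nabla_field T q (V # Xs) = deriv_along V (t Xs) q - (\<Sum>i<n. t (Xs[i := nab V (Xs ! i)]) q)"
    if "length Xs = n" for V Xs q
    using that by (simp add: nabla_field_def t_def[abs_def] map_update)
  have second: "nabla (nabla T) p (U p # V p # ws) =
      deriv_along U (deriv_along V (t Ws)) p - (\<Sum>i<n. deriv_along U (t (Ws[i := nab V (Ws ! i)])) p)
      - (deriv_along (nab U V) (t Ws) p - (\<Sum>i<n. t (Ws[i := nab (nab U V) (Ws ! i)]) p))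
      - (\<Sum>i<n. deriv_along V (t (Ws[i := nab U (Ws ! i)])) p) + (\<Sum>i<n. \<Sum>j<n. D U V i j)"
    if U: "U \<in> vector_fields" and V: "V \<in> vector_fields" for U V
  proof -
    have "nabla (nabla T) p (U p # V p # ws) = nabla_field (nabla T) p (U # V # Ws)"
      using nabla_eq'[OF tensor_nabla[OF T], of "U # V # Ws" p] Ws U V by simp
    also have "\<dots> = deriv_along U (\<lambda>q. nabla T q (V q # ev q Ws)) p
        - (nabla T p (nab U V p # ws) + (\<Sum>i<n. nabla T p (V p # ws[i := nab U (Ws ! i) p])))"
      using Ws by (simp add: nabla_field_def sum.lessThan_Suc_shift del: sum.lessThan_Suc)
    also have "(\<lambda>q. nabla T q (V q # ev q Ws)) = (\<lambda>q. deriv_along V (t Ws) q - (\<Sum>i<n. t (Ws[i := nab V (Ws ! i)]) q))"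
      using nabla_eq[OF T Ws(1,2) V] nf[OF Ws(1)] by simp
    also have "deriv_along U \<dots> p = deriv_along U (deriv_along V (t Ws)) p
        - (\<Sum>i<n. deriv_along U (t (Ws[i := nab V (Ws ! i)])) p)"
      using ts sub nab_vector_field V WsV Ws
      by (subst deriv_along_diff[of UNIV]; (subst deriv_along_sum[of UNIV])?)
        (auto intro!: deriv_along_smooth smooth_fun_on_sum)
    also have "nabla T p (nab U V p # ws) = deriv_along (nab U V) (t Ws) p - (\<Sum>i<n. t (Ws[i := nab (nab U V) (Ws ! i)]) p)"
      using nabla_eq[OF T Ws(1,2) nab_vector_field[OF U V], of p] nf[OF Ws(1)] Ws(3) by simp
    also have "(\<Sum>i<n. nabla T p (V p # ws[i := nab U (Ws ! i) p]))
        = (\<Sum>i<n. deriv_along V (t (Ws[i := nab U (Ws ! i)])) p - (\<Sum>j<n. D U V i j))"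
    proof (rule sum.cong[OF refl])
      fix i assume "i \<in> {..<n}"
      then have "set (Ws[i := nab U (Ws ! i)]) \<subseteq> vector_fields" using sub nab_vector_field U WsV by blast
      then show "nabla T p (V p # ws[i := nab U (Ws ! i) p])
          = deriv_along V (t (Ws[i := nab U (Ws ! i)])) p - (\<Sum>j<n. D U V i j)"
        using nabla_eq[OF T _ _ V, of "Ws[i := nab U (Ws ! i)]" p] nf[of "Ws[i := nab U (Ws ! i)]" p V] Ws(1,3)
        by (simp add: map_update D_def)
    qed
    finally show ?thesis by (simp add: sum_subtractf)
  qed
  let ?U = "ext p u" and ?V = "ext p v"
  have UV: "?U \<in> vector_fields" "?V \<in> vector_fields" "?U p = u" "?V p = v" by (auto simp: ext)
  have "deriv_along ?U (deriv_along ?V (t Ws)) p - deriv_along ?V (deriv_along ?U (t Ws)) p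
      = deriv_along (nab ?U ?V) (t Ws) p - deriv_along (nab ?V ?U) (t Ws) p"
  proof -
    have "linear (dfun (t Ws) p)" by (rule dfun_linear[OF _ _ ts[OF Ws(1,2)]]) auto
    then show ?thesis
      using deriv_along_lie_bracket[OF _ _ ts[OF Ws(1,2)] UV(1,2), of p]
      by (simp add: lie_bracket_nab UV deriv_along_def linear_diff)
  qed
  moreover have "(\<Sum>i<n. \<Sum>j<n. D ?U ?V i j) - (\<Sum>i<n. \<Sum>j<n. D ?V ?U i j) = (\<Sum>i<n. D ?U ?V i i - D ?V ?U i i)"
  proof -
    have "(\<Sum>i<n. \<Sum>j<n. D ?U ?V i j) - (\<Sum>i<n. \<Sum>j<n. D ?V ?U i j) = (\<Sum>i<n. \<Sum>j<n. D ?U ?V i j - D ?V ?U j i)"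
      by (subst (2) sum.swap) (simp add: sum_subtractf)
    also have "\<dots> = (\<Sum>i<n. \<Sum>j<n. if j = i then D ?U ?V i i - D ?V ?U i i else 0)"
      by (intro sum.cong refl) (auto simp: D_def list_update_swap)
    also have "\<dots> = (\<Sum>i<n. D ?U ?V i i - D ?V ?U i i)" by (simp add: sum.delta)
    finally show ?thesis .
  qed
  ultimately have "nabla (nabla T) p (u # v # ws) - nabla (nabla T) p (v # u # ws)
     = (\<Sum>i<n. t (Ws[i := nab (nab ?U ?V) (Ws ! i)]) p) - (\<Sum>i<n. t (Ws[i := nab (nab ?V ?U) (Ws ! i)]) p)
       + (\<Sum>i<n. D ?U ?V i i - D ?V ?U i i)"
    using second[OF UV(1,2)] second[OF UV(2,1)] UV(3,4) by simp
  also have "\<dots> = (\<Sum>i<n. - T p (ws[i := Rm p u v (ws ! i)]))"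
    unfolding sum_subtractf[symmetric] sum.distrib[symmetric]
  proof (rule sum.cong[OF refl])
    fix i assume i: "i \<in> {..<n}"
    let ?W = "Ws ! i"
    have W: "?W \<in> vector_fields" "?W p = ws ! i" using WsV i Ws by auto
    note ml = multilin_diff[OF tensor_multilin[OF T] len]
    have "nab (nab ?U ?V) ?W p - nab (nab ?V ?U) ?W p = nab (lie_bracket ?U ?V) ?W p"
    proof -
      have "nab (lie_bracket ?U ?V + nab ?V ?U) ?W p = nab (lie_bracket ?U ?V) ?W p + nab (nab ?V ?U) ?W p"
        using UV W by (subst nab_add_left) (auto intro: lie_bracket_field nab_vector_field)
      moreover have "lie_bracket ?U ?V + nab ?V ?U = nab ?U ?V" using UV by (simp add: lie_bracket_nab plus_fun_def)
      ultimately show ?thesis by simp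
    qed
    then have R: "- Rm p u v (ws ! i) = nab (nab ?U ?V) ?W p - nab (nab ?V ?U) ?W p + nab ?V (nab ?U ?W) p - nab ?U (nab ?V ?W) p"
      using Riem_fields[OF UV(1,2) W(1), of p] UV(3,4) W(2) by (simp add: curvature_field_def)
    have "t (Ws[i := Z]) p = T p (ws[i := Z p])" for Z by (simp add: t_def map_update Ws(3))
    moreover have "D U V i i = t (Ws[i := nab V (nab U ?W)]) p" for U V using i Ws(1) by (simp add: D_def)
    moreover have "T p (ws[i := - Rm p u v (ws ! i)]) = - T p (ws[i := Rm p u v (ws ! i)])"
      using linear_neg[OF multilinD[OF tensor_multilin[OF T] len, of i]] i by auto
    ultimately show "t (Ws[i := nab (nab ?U ?V) ?W]) p - t (Ws[i := nab (nab ?V ?U) ?W]) p + (D ?U ?V i i - D ?V ?U i i)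
        = - T p (ws[i := Rm p u v (ws ! i)])"
      using R ml[of i] multilin_add[OF tensor_multilin[OF T] len, of i] i by simp
  qed
  finally show ?thesis by (simp add: sum_negf)
qed

end

section \<open>Algebra of tensor fields and curvature symmetries\<close>

context smooth_manifold7
begin

lemma tensor_cong:
  assumes "tensor n T" "\<And>p vs. length vs = n \<Longrightarrow> T p vs = S p vs"
  shows "tensor n S"
proof -
  have "multilin n (S p)" for p
    using tensor_multilin[OF assms(1), of p] assms(2)[of _ p] by (simp add: multilin_def)
  moreover have "(\<lambda>q. S q (ev q Xs)) \<in> smooth_funs" if "length Xs = n" "set Xs \<subseteq> vector_fields" for Xs
    using tensor_smooth[OF assms(1) that] assms(2) that by simp
  ultimately show ?thesis by (simp add: tensor_def)
qed

lemma tensor_add: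
  assumes "tensor n S" "tensor n T" shows "tensor n (\<lambda>p vs. S p vs + T p vs)"
  using assms by (auto simp: tensor_def multilin_def smooth_funs_add linear_compose_add)

lemma tensor_fmult:
  assumes "f \<in> smooth_funs" "tensor n T" shows "tensor n (\<lambda>p vs. f p * T p vs)"
  using assms by (auto simp: tensor_def multilin_def smooth_funs_mult linear_compose_scale_right
      linear_iff algebra_simps)

lemma tensor_cmult: "tensor n T \<Longrightarrow> tensor n (\<lambda>p vs. c * T p vs)"
  by (rule tensor_fmult[OF smooth_funs_const])

lemma tensor_diff:
  assumes "tensor n S" "tensor n T" shows "tensor n (\<lambda>p vs. S p vs - T p vs)"
  using tensor_add[OF assms(1) tensor_cmult[OF assms(2), of "-1"]] by simp

lemma tensor_zero: "tensor n (\<lambda>p vs. 0)"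
  by (simp add: tensor_def multilin_def smooth_funs_const linear_zero)

text \<open>Reordering the arguments: position \<open>i\<close> of the new tensor reads position \<open>\<sigma> ! i\<close>.\<close>
definition reorder :: "nat list \<Rightarrow> ('a, real) forms \<Rightarrow> ('a, real) forms" where
  "reorder \<sigma> T p ws = T p (map (\<lambda>i. ws ! i) \<sigma>)"

lemma map_nth_list_update:
  assumes "distinct \<sigma>" "set \<sigma> = {..<n}" "length ws = n" "j < length \<sigma>"
  shows "map (\<lambda>i. ws[\<sigma> ! j := x] ! i) \<sigma> = (map (\<lambda>i. ws ! i) \<sigma>)[j := x]"
proof (rule nth_equalityI)
  fix i assume i: "i < length (map (\<lambda>i. ws[\<sigma> ! j := x] ! i) \<sigma>)"
  have "\<sigma> ! j < n" using assms nth_mem[of j \<sigma>] by auto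
  then show "map (\<lambda>i. ws[\<sigma> ! j := x] ! i) \<sigma> ! i = (map (\<lambda>i. ws ! i) \<sigma>)[j := x] ! i"
    using i assms by (auto simp: nth_list_update nth_eq_iff_index_eq)
qed simp

lemma tensor_reorder:
  assumes T: "tensor n T" and \<sigma>: "distinct \<sigma>" "set \<sigma> = {..<n}"
  shows "tensor n (reorder \<sigma> T)"
proof -
  have len: "length \<sigma> = n" using distinct_card[OF \<sigma>(1)] \<sigma>(2) by simp
  have "multilin n (reorder \<sigma> T p)" for p
    unfolding multilin_def reorder_def
  proof (intro allI impI)
    fix vs :: "tvec list" and i assume vs: "length vs = n" "i < n"
    then obtain j where j: "j < length \<sigma>" "\<sigma> ! j = i" using \<sigma>(2) by (metis in_set_conv_nth lessThan_iff)
    show "linear (\<lambda>x. T p (map (\<lambda>k. vs[i := x] ! k) \<sigma>))"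
      using multilinD[OF tensor_multilin[OF T], of "map (\<lambda>i. vs ! i) \<sigma>" j p]
        map_nth_list_update[OF \<sigma> vs(1) j(1)] j len by simp
  qed
  moreover have "(\<lambda>q. reorder \<sigma> T q (ev q Xs)) \<in> smooth_funs" if Xs: "length Xs = n" "set Xs \<subseteq> vector_fields" for Xs
  proof -
    have "set (map (\<lambda>i. Xs ! i) \<sigma>) \<subseteq> vector_fields" using Xs \<sigma>(2) nth_mem by force
    then have "(\<lambda>q. T q (ev q (map (\<lambda>i. Xs ! i) \<sigma>))) \<in> smooth_funs"
      using tensor_smooth[OF T, of "map (\<lambda>i. Xs ! i) \<sigma>"] len by simp
    moreover have "reorder \<sigma> T q (ev q Xs) = T q (ev q (map (\<lambda>i. Xs ! i) \<sigma>))" for q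
    proof -
      have "map (\<lambda>i. ev q Xs ! i) \<sigma> = ev q (map (\<lambda>i. Xs ! i) \<sigma>)"
        using Xs(1) \<sigma>(2) by auto
      then show ?thesis by (simp only: reorder_def)
    qed
    ultimately show ?thesis by simp
  qed
  ultimately show ?thesis by (simp add: tensor_def)
qed

end

context riemannian_manifold7
begin

lemma nabla_ext:
  assumes "length vs = n"
  shows "nabla T p (v # vs) = deriv_along (ext p v) (\<lambda>q. T q (ev q (map (ext p) vs))) p
     - (\<Sum>i<n. T p (vs[i := nab (ext p v) (ext p (vs ! i)) p]))"
  using assms ev_ext[of p vs] by (simp add: nabla_Cons nabla_field_def comp_def)

lemma nabla_cong:
  assumes "\<And>p vs. length vs = n \<Longrightarrow> T p vs = S p vs" "length vs = n"
  shows "nabla T p (v # vs) = nabla S p (v # vs)"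
  using assms by (simp add: nabla_ext[OF assms(2)])

lemma tensor_smooth_ext:
  assumes "tensor n T" "length vs = n"
  shows "smooth_fun_on UNIV (\<lambda>q. T q (ev q (map (ext p) vs)))"
  using tensor_smooth[OF assms(1), of "map (ext p) vs"] assms(2) ext_set[of p vs] by (simp add: smooth_funs_def)

lemma nabla_add:
  assumes "tensor n S" "tensor n T" "length vs = n"
  shows "nabla (\<lambda>p vs. S p vs + T p vs) p (v # vs) = nabla S p (v # vs) + nabla T p (v # vs)"
  using deriv_along_add[OF _ _ tensor_smooth_ext[OF assms(1,3), of p] tensor_smooth_ext[OF assms(2,3), of p], of p "ext p v"]
  by (simp add: nabla_ext[OF assms(3)] sum.distrib)

lemma nabla_fmult:
  assumes "f \<in> smooth_funs" "tensor n T" "length vs = n"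
  shows "nabla (\<lambda>p vs. f p * T p vs) p (v # vs) = dfun f p v * T p vs + f p * nabla T p (v # vs)"
  using deriv_along_mult[OF _ _ smooth_funs_on[OF assms(1)] tensor_smooth_ext[OF assms(2,3), of p], of p "ext p v"]
    ev_ext[of p vs]
  by (simp add: nabla_ext[OF assms(3)] sum_distrib_left right_diff_distrib) (simp add: deriv_along_def ext)

lemma nabla_cmult:
  assumes "tensor n T" "length vs = n"
  shows "nabla (\<lambda>p vs. c * T p vs) p (v # vs) = c * nabla T p (v # vs)"
  using nabla_fmult[OF smooth_funs_const assms, of c p v] by (simp add: dfun_const)

lemma nabla_diff:
  assumes "tensor n S" "tensor n T" "length vs = n"
  shows "nabla (\<lambda>p vs. S p vs - T p vs) p (v # vs) = nabla S p (v # vs) - nabla T p (v # vs)"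
  using nabla_add[OF assms(1) tensor_cmult[OF assms(2), of "-1"] assms(3), of p v] nabla_cmult[OF assms(2,3), of "-1" p v]
  by simp

lemma nabla_zero: "nabla (\<lambda>p vs. 0) p (v # vs) = 0"
  by (simp add: nabla_ext[OF refl] deriv_along_const)

lemma nabla_reorder:
  assumes T: "tensor n T" and \<sigma>: "distinct \<sigma>" "set \<sigma> = {..<n}" and vs: "length vs = n"
  shows "nabla (reorder \<sigma> T) p (v # vs) = nabla T p (v # map (\<lambda>i. vs ! i) \<sigma>)"
proof -
  have len: "length \<sigma> = n" using distinct_card[OF \<sigma>(1)] \<sigma>(2) by simp
  have ev: "reorder \<sigma> T q (ev q (map (ext p) vs)) = T q (ev q (map (ext p) (map (\<lambda>i. vs ! i) \<sigma>)))" for q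
  proof -
    have "map (\<lambda>i. ev q (map (ext p) vs) ! i) \<sigma> = ev q (map (ext p) (map (\<lambda>i. vs ! i) \<sigma>))"
      using vs \<sigma>(2) by auto
    then show ?thesis by (simp only: reorder_def)
  qed
  have len': "length (map (\<lambda>i. vs ! i) \<sigma>) = n" using len by simp
  have "(\<Sum>i<n. reorder \<sigma> T p (vs[i := nab (ext p v) (ext p (vs ! i)) p]))
     = (\<Sum>j<n. reorder \<sigma> T p (vs[\<sigma> ! j := nab (ext p v) (ext p (vs ! (\<sigma> ! j))) p]))"
  proof (rule sum.reindex_bij_betw[symmetric])
    show "bij_betw (\<lambda>j. \<sigma> ! j) {..<n} {..<n}"
      by (rule bij_betw_nth[OF \<sigma>(1)]) (simp_all only: len \<sigma>(2))
  qed
  also have "\<dots> = (\<Sum>j<n. T p ((map (\<lambda>i. vs ! i) \<sigma>)[j := nab (ext p v) (ext p (map (\<lambda>i. vs ! i) \<sigma> ! j)) p]))"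
  proof (rule sum.cong[OF refl])
    fix j assume "j \<in> {..<n}"
    then have j: "j < length \<sigma>" using len by simp
    show "reorder \<sigma> T p (vs[\<sigma> ! j := nab (ext p v) (ext p (vs ! (\<sigma> ! j))) p])
        = T p ((map (\<lambda>i. vs ! i) \<sigma>)[j := nab (ext p v) (ext p (map (\<lambda>i. vs ! i) \<sigma> ! j)) p])"
      unfolding reorder_def map_nth_list_update[OF \<sigma> vs j] using j by simp
  qed
  finally show ?thesis
    by (simp only: nabla_ext[OF vs] nabla_ext[OF len'] ev)
qed

lemma Rm_linear3: "linear (Rm p u v)"
  by (rule bounded_linear.linear[OF blinfun.bounded_linear_right])

lemma Rm_antisym: "Rm p v u w = - Rm p u v w"
proof -
  have "lie_bracket (ext p v) (ext p u) = (\<lambda>q. (-1) *\<^sub>R lie_bracket (ext p u) (ext p v) q)"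
    using ext by (simp add: lie_bracket_nab)
  then show ?thesis
    using nab_scale_left[OF smooth_funs_const lie_bracket_field[OF ext(1) ext(1)] ext(1), of "-1" p u p v p w]
    by (simp add: Rm_ext curvature_field_def)
qed

lemma Rm_linear1: "linear (\<lambda>u. Rm p u v w)"
proof (rule linearI)
  show "Rm p (y + z) v w = Rm p y v w + Rm p z v w" for y z
    using curvature_tensorial(1)[of "[ext p 0, ext p v, ext p w]" 0 "ext p y" "ext p z" p]
      curvature_cong[of "ext p (y + z)" "ext p v" "ext p w" "ext p y + ext p z" "ext p v" "ext p w" p]
    by (simp add: ext vector_fields_add Rm_ext)
  show "Rm p (r *\<^sub>R y) v w = r *\<^sub>R Rm p y v w" for y r
    using curvature_tensorial(2)[of "[ext p 0, ext p v, ext p w]" 0 "ext p y" "\<lambda>_. r" p]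
      curvature_cong[of "ext p (r *\<^sub>R y)" "ext p v" "ext p w" "\<lambda>q. r *\<^sub>R ext p y q" "ext p v" "ext p w" p]
    by (simp add: ext vector_fields_scale smooth_funs_const Rm_ext)
qed

lemma Rm_linear2: "linear (\<lambda>v. Rm p u v w)"
  using linear_compose_neg[OF Rm_linear1[of p u w]] by (simp add: Rm_antisym[of p u _ w] comp_def)

lemma g_linear: "linear (g p x)" "linear (\<lambda>x. g p x y)"
  using metric_bilinear[of p] by (auto simp: bilinear_def)

definition metric_form :: "('a, real) forms" where
  "metric_form p vs = g p (vs ! 0) (vs ! 1)"

lemma length_2_iff: "length xs = 2 \<longleftrightarrow> (\<exists>a b. xs = [a, b])"
  by (auto simp: numeral_2_eq_2 length_Suc_conv)

lemma tensor_metric: "tensor 2 metric_form"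
proof -
  have "multilin 2 (metric_form p)" for p
    unfolding multilin_def metric_form_def
    by (auto simp: length_2_iff less_Suc_eq numeral_2_eq_2 g_linear)
  moreover have "(\<lambda>q. metric_form q (ev q Xs)) \<in> smooth_funs"
    if "length Xs = 2" "set Xs \<subseteq> vector_fields" for Xs
    using that by (auto simp: metric_form_def length_2_iff metric_smooth)
  ultimately show ?thesis by (simp add: tensor_def)
qed

lemma nabla_metric: "nabla metric_form p [v, x, y] = 0"
proof -
  have "nabla metric_form p [v, x, y] = nabla_field metric_form p [ext p v, ext p x, ext p y]"
    by (simp add: nabla_Cons)
  also have "\<dots> = 0"
    using nab_metric[OF ext(1) ext(1) ext(1), of p v p x p y p]
    by (simp add: nabla_field_def metric_form_def numeral_2_eq_2 ext)
  finally show ?thesis .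
qed

lemma length_3_iff: "length xs = 3 \<longleftrightarrow> (\<exists>a b c. xs = [a, b, c])"
  by (auto simp: numeral_3_eq_3 length_Suc_conv)

text \<open>The Ricci identity for the parallel metric.\<close>
lemma Rm_skew: "g p (Rm p u v x) y = - g p x (Rm p u v y)"
proof -
  have z: "nabla (nabla metric_form) p (a # b # [x, y]) = 0" for a b
  proof -
    have "nabla (nabla metric_form) p (a # [b, x, y]) = nabla (\<lambda>p vs. 0) p (a # [b, x, y])"
      by (rule nabla_cong[where n=3]) (auto simp: length_3_iff nabla_metric)
    then show ?thesis by (simp add: nabla_zero)
  qed
  show ?thesis
    using ricci_identity[OF tensor_metric, of "[x, y]" p u v] z[of u v] z[of v u]
    by (simp add: metric_form_def numeral_2_eq_2)
qed

text \<open>The first Bianchi identity: apply the Ricci identity to the differential of a function, whose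
  covariant derivative is symmetric, and sum cyclically.\<close>
lemma bianchi: "Rm p u v w + Rm p v w u + Rm p w u v = 0"
proof (rule ccontr)
  assume "Rm p u v w + Rm p v w u + Rm p w u v \<noteq> 0"
  then obtain f where f: "f \<in> smooth_funs" "dfun f p (Rm p u v w + Rm p v w u + Rm p w u v) \<noteq> 0"
    by (rule dfun_separates)
  define F :: "('a, real) forms" where "F q vs = f q" for q vs
  have F: "tensor 0 F" using f(1) by (simp add: tensor_def multilin_def F_def)
  note F1 = tensor_nabla[OF F] and F2 = tensor_nabla[OF tensor_nabla[OF F]]
  have dF: "nabla F p [v] = dfun f p v" for v
    by (simp add: nabla_def cov_deriv_def F_def deriv_along_def ext)
  have sym: "nabla (nabla F) q [a, b] = nabla (nabla F) q [b, a]" for q a b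
    using ricci_identity[OF F, of "[]" q a b] by simp
  have sym3: "nabla (nabla (nabla F)) p [a, b, c] = nabla (nabla (nabla F)) p [a, c, b]" for a b c
  proof -
    have "nabla (reorder [1, 0] (nabla (nabla F))) p (a # [b, c]) = nabla (nabla (nabla F)) p (a # [c, b])"
      using F2 by (subst nabla_reorder[where n=2]) (auto simp: numeral_2_eq_2)
    moreover have "nabla (reorder [1, 0] (nabla (nabla F))) p (a # [b, c]) = nabla (nabla (nabla F)) p (a # [b, c])"
      by (rule nabla_cong[where n=2]) (auto simp: length_2_iff reorder_def sym)
    ultimately show ?thesis by simp
  qed
  have R: "nabla (nabla (nabla F)) p [a, b, c] - nabla (nabla (nabla F)) p [b, a, c] = - dfun f p (Rm p a b c)" for a b c
    using ricci_identity[OF F1, of "[c]" p a b] by (simp add: dF)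
  have lin: "linear (dfun f p)" by (rule dfun_linear[OF _ _ smooth_funs_on[OF f(1)], of UNIV]) auto
  have "dfun f p (Rm p u v w + Rm p v w u + Rm p w u v) = 0"
    using R[of u v w] R[of v w u] R[of w u v] sym3[of u v w] sym3[of v w u] sym3[of w u v]
    by (simp add: linear_add[OF lin])
  then show False using f(2) by simp
qed

text \<open>The four instances of the Bianchi identity at the vertices of an octahedron add up to the
  pair symmetry.\<close>
lemma Rm_pair: "g p (Rm p u v x) y = g p (Rm p x y u) v"
proof -
  define R where "R a b c d = g p (Rm p a b c) d" for a b c d
  have 1: "R b a c d = - R a b c d" "R a b d c = - R a b c d" for a b c d
    using Rm_skew[of p a b d c]
    by (simp_all add: R_def Rm_antisym[of p b a] linear_neg[OF g_linear(2)] metric_sym[of p d])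
  have 2: "R a b c d + R b c a d + R c a b d = 0" for a b c d
    using bianchi[of p a b c] linear_add[OF g_linear(2), of p] linear_0[OF g_linear(2), of p]
    by (simp add: R_def) (metis)
  have "R u v x y = R x y u v"
    using 2[of u v x y] 2[of v x y u] 2[of x y u v] 2[of y u v x]
      1(2)[of v x y u] 1(2)[of x y v u] 1(1)[of x u v y] 1(2)[of u x y v] 1(2)[of y u v x] 1(2)[of u v y x]
      1(1)[of y v u x] 1(2)[of y v x u]
    by linarith
  then show ?thesis by (simp add: R_def)
qed

end

section \<open>Orthonormal bases and contractions\<close>

abbreviation ils :: "nat \<Rightarrow> 7 list set" where
  "ils k \<equiv> {js. length js = k}"

lemma finite_ils: "finite (ils k)"
  using finite_lists_length_eq[of "UNIV :: 7 set" k] by simp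

lemma sum_ils_0: "(\<Sum>js\<in>ils 0. F js) = F []"
  by simp

lemma sum_ils_Suc: "(\<Sum>js\<in>ils (Suc k). F js) = (SUM7 i. \<Sum>js\<in>ils k. F (i # js))"
proof -
  have "(SUM7 i. \<Sum>js\<in>ils k. F (i # js)) = (\<Sum>(i, js)\<in>UNIV \<times> ils k. F (i # js))"
    by (rule sum.cartesian_product)
  also have "\<dots> = (\<Sum>js\<in>ils (Suc k). F js)"
    by (rule sum.reindex_bij_witness[of _ "\<lambda>js. (hd js, tl js)" "\<lambda>(i, js). i # js"])
      (auto simp: length_Suc_conv)
  finally show ?thesis by simp
qed

context smooth_manifold7
begin

lemma multilin_append:
  assumes "multilin (l + k) F" "length zs = l" shows "multilin k (\<lambda>xs. F (zs @ xs))"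
  unfolding multilin_def
proof (intro allI impI)
  fix vs :: "tvec list" and i assume "length vs = k" "i < k"
  then show "linear (\<lambda>x. F (zs @ vs[i := x]))"
    using multilinD[OF assms(1), of "zs @ vs" "l + i"] assms(2) by (simp add: list_update_append)
qed

lemma multilin_Cons: "multilin (Suc k) F \<Longrightarrow> multilin k (\<lambda>xs. F (x # xs))"
  using multilin_append[of 1 k F "[x]"] by simp

lemma multilin_Cons_linear: "multilin (Suc k) F \<Longrightarrow> length xs = k \<Longrightarrow> linear (\<lambda>x. F (x # xs))"
  using multilinD[of "Suc k" F "0 # xs" 0] by simp

lemma multilin_append_left:
  assumes "multilin (l + k) F" "length xs = k" shows "multilin l (\<lambda>zs. F (zs @ xs))"
  unfolding multilin_def
proof (intro allI impI)
  fix vs :: "tvec list" and i assume "length vs = l" "i < l"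
  then show "linear (\<lambda>x. F (vs[i := x] @ xs))"
    using multilinD[OF assms(1), of "vs @ xs" i] assms(2) by (simp add: list_update_append)
qed

end

context riemannian_manifold7
begin

definition orthonormal :: "'a \<Rightarrow> (7 \<Rightarrow> tvec) \<Rightarrow> bool" where
  "orthonormal p b \<longleftrightarrow> (\<forall>i j. g p (b i) (b j) = (if i = j then 1 else 0))"

lemma orthonormal_g: "orthonormal p b \<Longrightarrow> g p (b i) (b j) = (if i = j then 1 else 0)"
  by (simp add: orthonormal_def)

lemma g_sum_left: "g p (\<Sum>a\<in>A. c a *\<^sub>R x a) y = (\<Sum>a\<in>A. c a * g p (x a) y)"
  using linear_sum[OF g_linear(2)[of p y], of "\<lambda>a. c a *\<^sub>R x a" A] by (simp add: linear_scale[OF g_linear(2)])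

lemma orthonormal_expansion:
  assumes b: "orthonormal p b"
  shows "v = (SUM7 i. g p v (b i) *\<^sub>R b i)"
proof -
  let ?L = "\<lambda>c :: tvec. SUM7 i. c $ i *\<^sub>R b i"
  have lin: "linear ?L" by (auto intro!: linearI simp: sum.distrib scaleR_left_distrib scaleR_sum_right)
  have coeff: "g p (?L c) (b j) = c $ j" for c j
    using b by (simp add: g_sum_left orthonormal_g if_distrib cong: if_cong)
  have "inj ?L"
  proof (rule injI)
    fix c d assume eq: "?L c = ?L d"
    have "c $ j = d $ j" for j using coeff[of c j] coeff[of d j] unfolding eq by simp
    then show "c = d" by (simp add: vec_eq_iff)
  qed
  then have "surj ?L" using linear_injective_imp_surjective[OF lin] by blast
  then obtain c where c: "v = ?L c" by (auto simp: surj_def)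
  show ?thesis unfolding c coeff by (rule refl)
qed

lemma orthonormal_expansion_linear:
  fixes h :: "tvec \<Rightarrow> real"
  assumes "orthonormal p b" "linear h"
  shows "h v = (SUM7 i. g p v (b i) * h (b i))"
  by (subst orthonormal_expansion[OF assms(1), of v])
    (simp add: linear_sum[OF assms(2)] linear_scale[OF assms(2)])

lemma orthonormal_parseval: "orthonormal p b \<Longrightarrow> (SUM7 i. g p x (b i) * g p y (b i)) = g p x y"
  using orthonormal_expansion_linear[where h="g p y" and v=x and b=b and p=p, OF _ g_linear(1)] by (simp add: metric_sym mult.commute)

text \<open>Expand the vectors of one basis in the other and use Parseval.\<close>
lemma orthonormal_contraction:
  fixes h :: "tvec \<Rightarrow> tvec \<Rightarrow> real"
  assumes b: "orthonormal p b" "orthonormal p b'" and h: "\<And>x. linear (h x)" "\<And>y. linear (\<lambda>x. h x y)"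
  shows "(SUM7 i. h (b i) (b i)) = (SUM7 i. h (b' i) (b' i))"
proof -
  have "h (b i) (b i) = (SUM7 j k. g p (b' j) (b i) * g p (b' k) (b i) * h (b' j) (b' k))" for i
    by (subst orthonormal_expansion_linear[OF b(2) h(2)], subst orthonormal_expansion_linear[OF b(2) h(1)])
      (simp add: sum_distrib_left mult.assoc metric_sym[of p "b i"])
  then have "(SUM7 i. h (b i) (b i)) =
     (SUM7 i j k. g p (b' j) (b i) * g p (b' k) (b i) * h (b' j) (b' k))" by simp
  also have "\<dots> = (SUM7 j k i. g p (b' j) (b i) * g p (b' k) (b i) * h (b' j) (b' k))"
    by (subst sum.swap, rule sum.cong[OF refl], rule sum.swap)
  also have "\<dots> = (SUM7 j k. (if j = k then 1 else 0) * h (b' j) (b' k))"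
    by (simp only: sum_distrib_right[symmetric] orthonormal_parseval[OF b(1)] orthonormal_g[OF b(2)])
  also have "\<dots> = (SUM7 i. h (b' i) (b' i))"
    by (simp add: if_distrib[where f="\<lambda>x. x * _"] cong: if_cong)
  finally show ?thesis .
qed

lemma multi_contraction:
  assumes b: "orthonormal p b" "orthonormal p b'"
    and H: "\<And>xs. length xs = k \<Longrightarrow> multilin k (H xs)" "\<And>ys. length ys = k \<Longrightarrow> multilin k (\<lambda>xs. H xs ys)"
  shows "(\<Sum>js\<in>ils k. H (map b js) (map b js)) = (\<Sum>js\<in>ils k. H (map b' js) (map b' js))"
  using H
proof (induction k arbitrary: H)
  case (Suc k)
  have l1: "linear (\<lambda>y. H xs (y # ys))" if "length xs = Suc k" "length ys = k" for xs ys
    using multilin_Cons_linear[OF Suc.prems(1)[OF that(1)] that(2)] .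
  have l2: "linear (\<lambda>x. H (x # xs) ys)" if "length xs = k" "length ys = Suc k" for xs ys
    using multilin_Cons_linear[OF Suc.prems(2)[OF that(2)] that(1)] .
  have IH1: "(\<Sum>js\<in>ils k. H (b i # map b js) (b i # map b js)) = (\<Sum>js\<in>ils k. H (b i # map b' js) (b i # map b' js))" for i
    by (rule Suc.IH) (use Suc.prems multilin_Cons in \<open>auto intro: multilin_Cons[where F="\<lambda>xs. H xs _"]\<close>)
  have IH2: "(SUM7 i. H (b i # map b' js) (b i # map b' js)) = (SUM7 i. H (b' i # map b' js) (b' i # map b' js))"
    if "js \<in> ils k" for js
    by (rule orthonormal_contraction[OF b, where h="\<lambda>x y. H (x # map b' js) (y # map b' js)"])
      (use that in \<open>auto intro!: l1 l2\<close>)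
  have "(SUM7 i. \<Sum>js\<in>ils k. H (b i # map b js) (b i # map b js))
      = (SUM7 i. \<Sum>js\<in>ils k. H (b i # map b' js) (b i # map b' js))"
    by (rule sum.cong[OF refl IH1])
  also have "\<dots> = (\<Sum>js\<in>ils k. SUM7 i. H (b i # map b' js) (b i # map b' js))"
    by (rule sum.swap)
  also have "\<dots> = (\<Sum>js\<in>ils k. SUM7 i. H (b' i # map b' js) (b' i # map b' js))"
    by (rule sum.cong[OF refl IH2])
  also have "\<dots> = (SUM7 i. \<Sum>js\<in>ils k. H (b' i # map b' js) (b' i # map b' js))"
    by (rule sum.swap)
  finally show ?case unfolding sum_ils_Suc list.map .
qed simp

text \<open>Rotating an orthonormal basis infinitesimally does not change contractions.\<close>
lemma skew_contraction:
  fixes h :: "tvec \<Rightarrow> tvec \<Rightarrow> real"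
  assumes b: "orthonormal p b" and N: "\<And>i j. g p (N i) (b j) + g p (b i) (N j) = 0"
    and h: "\<And>x. linear (h x)" "\<And>y. linear (\<lambda>x. h x y)"
  shows "(SUM7 i. h (N i) (b i) + h (b i) (N i)) = 0"
proof -
  have "h (N i) (b i) = (SUM7 j. g p (N i) (b j) * h (b j) (b i))" for i
    by (rule orthonormal_expansion_linear[OF b h(2)])
  moreover have "h (b i) (N i) = (SUM7 j. g p (N i) (b j) * h (b i) (b j))" for i
    by (rule orthonormal_expansion_linear[OF b h(1)])
  ultimately have "(SUM7 i. h (N i) (b i) + h (b i) (N i))
      = (SUM7 i j. g p (N i) (b j) * h (b j) (b i)) + (SUM7 i j. g p (N i) (b j) * h (b i) (b j))"
    by (simp add: sum.distrib)
  also have "(SUM7 i j. g p (N i) (b j) * h (b i) (b j)) = (SUM7 i j. g p (N j) (b i) * h (b j) (b i))"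
    by (rule sum.swap)
  also have "(SUM7 i j. g p (N i) (b j) * h (b j) (b i)) + \<dots>
      = (SUM7 i j. (g p (N i) (b j) + g p (b i) (N j)) * h (b j) (b i))"
    by (simp add: sum.distrib distrib_right metric_sym[of p "N _" "b _"])
  finally show ?thesis by (simp add: N)
qed

text \<open>Apply the infinitesimal rotation in one slot after the other.\<close>
lemma multi_skew_contraction:
  assumes b: "orthonormal p b" and N: "\<And>i j. g p (N i) (b j) + g p (b i) (N j) = 0"
    and H: "\<And>xs. length xs = k \<Longrightarrow> multilin k (H xs)" "\<And>ys. length ys = k \<Longrightarrow> multilin k (\<lambda>xs. H xs ys)"
  shows "(\<Sum>js\<in>ils k. \<Sum>s<k. H ((map b js)[s := N (js ! s)]) (map b js) + H (map b js) ((map b js)[s := N (js ! s)])) = 0"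
  using H
proof (induction k arbitrary: H)
  case (Suc k)
  have l1: "linear (\<lambda>y. H xs (y # ys))" if "length xs = Suc k" "length ys = k" for xs ys
    using multilin_Cons_linear[OF Suc.prems(1)[OF that(1)] that(2)] .
  have l2: "linear (\<lambda>x. H (x # xs) ys)" if "length xs = k" "length ys = Suc k" for xs ys
    using multilin_Cons_linear[OF Suc.prems(2)[OF that(2)] that(1)] .
  let ?h = "\<lambda>H js s. H ((map b js)[s := N (js ! s)]) (map b js) + H (map b js) ((map b js)[s := N (js ! s)])"
  have 1: "(\<Sum>js\<in>ils k. \<Sum>s<k. ?h (\<lambda>xs ys. H (b i # xs) (b i # ys)) js s) = 0" for i
    by (rule Suc.IH) (use Suc.prems multilin_Cons in \<open>auto intro: multilin_Cons[where F="\<lambda>xs. H xs _"]\<close>)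
  have 2: "(SUM7 i. H (N i # map b js) (b i # map b js) + H (b i # map b js) (N i # map b js)) = 0"
    if "js \<in> ils k" for js
    by (rule skew_contraction[OF b N, where h="\<lambda>x y. H (x # map b js) (y # map b js)"])
      (use that in \<open>auto intro!: l1 l2\<close>)
  have "(\<Sum>js\<in>ils (Suc k). \<Sum>s<Suc k. ?h H js s)
     = (SUM7 i. \<Sum>js\<in>ils k. H (N i # map b js) (b i # map b js) + H (b i # map b js) (N i # map b js))
     + (SUM7 i. \<Sum>js\<in>ils k. \<Sum>s<k. ?h (\<lambda>xs ys. H (b i # xs) (b i # ys)) js s)"
    unfolding sum_ils_Suc by (simp add: sum.lessThan_Suc_shift sum.distrib del: sum.lessThan_Suc)
  also have "(SUM7 i. \<Sum>js\<in>ils k. H (N i # map b js) (b i # map b js) + H (b i # map b js) (N i # map b js)) = 0"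
    using 2 by (subst sum.swap) simp
  finally show ?case using 1 by simp
qed simp

end

section \<open>Adapted frames\<close>

context smooth_manifold7
begin

lemma smooth_fun_on_det:
  fixes A :: "'a \<Rightarrow> real^'n^'n"
  assumes "open U" "\<And>i j. smooth_fun_on U (\<lambda>q. A q $ i $ j)"
  shows "smooth_fun_on U (\<lambda>q. det (A q))"
  unfolding det_def
  by (intro smooth_fun_on_sum smooth_fun_on_mult smooth_fun_on_const smooth_fun_on_prod assms)

end

context g2_manifold
begin

definition adapted_frame :: "'a \<Rightarrow> (7 \<Rightarrow> 'a \<Rightarrow> tvec) \<Rightarrow> ('a \<Rightarrow> 7 \<Rightarrow> covec) \<Rightarrow> 'a set \<Rightarrow> bool" where
  "adapted_frame p E e N \<longleftrightarrow> (\<forall>i. E i \<in> vector_fields) \<and> open N \<and> p \<in> N \<and>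
     (\<forall>q\<in>N. (\<forall>i j. blinfun_apply (e q i) (E j q) = (if i = j then 1 else 0)) \<and>
       (\<forall>u v. g q u v = (SUM7 i. blinfun_apply (e q i) u * blinfun_apply (e q i) v)) \<and>
       vol q = coframe_wedge (e q) [1,2,3,4,5,6,7] \<and> \<phi> q = standard_G2_form (e q))"

text \<open>The frame dual to an adapted coframe is smooth by Cramer's rule; a cut-off makes its members
  global vector fields.\<close>
lemma adapted_frame_exists:
  obtains E e N where "adapted_frame p E e N"
proof -
  obtain U e where U0: "open U" "p \<in> U"
       "\<forall>X\<in>vector_fields. \<forall>i. smooth_fun_on U (\<lambda>q. blinfun_apply (e q i) (X q))"
       "\<forall>q\<in>U. (\<forall>u v. g q u v = (SUM7 i. blinfun_apply (e q i) u * blinfun_apply (e q i) v)) \<and>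
               vol q = coframe_wedge (e q) [1,2,3,4,5,6,7] \<and> \<phi> q = standard_G2_form (e q)"
    using adapted_coframe[of p] by blast
  have U: "open U" "p \<in> U"
    "\<And>X i. X \<in> vector_fields \<Longrightarrow> smooth_fun_on U (\<lambda>q. blinfun_apply (e q i) (X q))"
    "\<And>q u v. q \<in> U \<Longrightarrow> g q u v = (SUM7 i. blinfun_apply (e q i) u * blinfun_apply (e q i) v)"
    "\<And>q. q \<in> U \<Longrightarrow> vol q = coframe_wedge (e q) [1,2,3,4,5,6,7]"
    "\<And>q. q \<in> U \<Longrightarrow> \<phi> q = standard_G2_form (e q)"
    using U0 by auto
  obtain X :: "7 \<Rightarrow> 'a \<Rightarrow> tvec" and co :: "7 \<Rightarrow> 'a \<Rightarrow> tvec \<Rightarrow> real" and N0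
    where X: "\<And>k. X k \<in> vector_fields" "open N0" "p \<in> N0"
    "\<And>q v. q \<in> N0 \<Longrightarrow> v = (SUM7 k. co k q v *\<^sub>R X k q)"
    "\<And>k Y. Y \<in> vector_fields \<Longrightarrow> smooth_fun_on N0 (\<lambda>q. co k q (Y q))" "\<And>q k. q \<in> N0 \<Longrightarrow> linear (co k q)"
    by (rule local_frame_exists[of p]) (rule that)
  let ?V = "U \<inter> N0"
  have V: "open ?V" "p \<in> ?V" using U X by auto
  obtain \<beta> N W where b: "\<beta> \<in> smooth_funs" "open N" "p \<in> N" "N \<subseteq> ?V" "\<And>q. q \<in> N \<Longrightarrow> \<beta> q = 1"
    "open W" "W \<union> ?V = UNIV" "\<And>q. q \<in> W \<Longrightarrow> \<beta> q = 0" using cutoff_exists[OF V] by blast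
  define M :: "'a \<Rightarrow> real^7^7" where "M q = (\<chi> i k. blinfun_apply (e q i) (X k q))" for q
  have det: "det (M q) \<noteq> 0" if q: "q \<in> ?V" for q
  proof -
    define A :: "real^7^7" where "A = (\<chi> i j. blinfun_apply (e q i) (axis j 1))"
    define C :: "real^7^7" where "C = (\<chi> j k. X k q $ j)"
    have Av: "A *v v = (\<chi> i. blinfun_apply (e q i) v)" for v
    proof -
      have "blinfun_apply (e q i) v = (SUM7 j. blinfun_apply (e q i) (axis j 1) * v $ j)" for i
        by (subst basis_expansion[of v, symmetric])
          (simp add: blinfun.sum_right scalar_mult_eq_scaleR blinfun.scaleR_right mult.commute)
      then show ?thesis by (simp add: A_def matrix_vector_mult_def vec_eq_iff)
    qed
    have "v = 0" if "A *v v = 0" for v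
    proof (rule ccontr)
      assume "v \<noteq> 0"
      then have "g q v v > 0" by (rule metric_pos)
      moreover have "g q v v = 0" using that U(4)[of q v v] q by (simp add: Av vec_eq_iff)
      ultimately show False by simp
    qed
    then have dA: "det A \<noteq> 0"
      by (simp add: invertible_det_nz[symmetric] invertible_left_inverse matrix_left_invertible_ker)
    have "surj ((*v) C)"
    proof (rule surjI[where f="\<lambda>v. \<chi> k. co k q v"])
      fix v
      show "C *v (\<chi> k. co k q v) = v"
      proof -
        have "C *v (\<chi> k. co k q v) = (SUM7 k. co k q v *\<^sub>R X k q)"
          by (simp add: C_def matrix_vector_mult_def vec_eq_iff mult.commute)
        also have "\<dots> = v" using X(4)[of q v] q by simp
        finally show ?thesis .
      qed
    qed
    then have dC: "det C \<noteq> 0"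
      by (simp add: invertible_det_nz[symmetric] invertible_right_inverse matrix_right_invertible_surjective)
    have "M q = A ** C"
    proof -
      have "blinfun_apply (e q i) (X k q) = (A *v X k q) $ i" for i k by (simp add: Av)
      then show ?thesis by (simp add: M_def C_def vec_eq_iff matrix_matrix_mult_def matrix_vector_mult_def)
    qed
    then show ?thesis using dA dC by (simp add: det_mul)
  qed
  define cr where "cr i k q = det (\<chi> a b. if b = k then (axis i 1 :: tvec) $ a else M q $ a $ b) * inverse (det (M q))" for i k q
  have cr: "M q *v (\<chi> k. cr i k q) = axis i 1" if "q \<in> ?V" for q i
    using cramer[OF det[OF that], of "\<chi> k. cr i k q" "axis i 1"]
    by (simp add: cr_def divide_inverse cong: if_cong)
  have Msm: "smooth_fun_on ?V (\<lambda>q. M q $ i $ j)" for i j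
    using U(3)[OF X(1)] by (auto simp: M_def intro: smooth_fun_on_subset)
  have crs: "smooth_fun_on ?V (cr i k)" for i k
    unfolding cr_def
  proof (intro smooth_fun_on_mult smooth_fun_on_det smooth_fun_on_inverse V(1))
    show "smooth_fun_on ?V (\<lambda>q. (\<chi> a b. if b = k then (axis i 1 :: tvec) $ a else M q $ a $ b) $ ia $ j)" for ia j
      by (cases "j = k") (simp_all add: smooth_fun_on_const Msm)
  qed (use Msm det in auto)
  define E where "E i q = (SUM7 k. (\<beta> q * cr i k q) *\<^sub>R X k q)" for i q
  have "E i \<in> vector_fields" for i
    unfolding E_def using cutoff_extend[OF V(1) b(6,7,1,8) crs]
    by (intro vector_fields_sum vector_fields_scale X(1)) blast
  moreover have "blinfun_apply (e q i) (E j q) = (if i = j then 1 else 0)" if q: "q \<in> N" for q i j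
  proof -
    have "blinfun_apply (e q i) (E j q) = (M q *v (\<chi> k. cr j k q)) $ i"
      using b(5)[OF q]
      by (simp add: E_def M_def matrix_vector_mult_def blinfun.sum_right blinfun.scaleR_right mult.commute)
    moreover have "q \<in> ?V" using q b(4) by blast
    ultimately show ?thesis by (simp add: cr axis_def)
  qed
  ultimately show ?thesis
    using b(2-4) U(4-6) by (intro that[of E e N]) (auto simp: adapted_frame_def)
qed

lemma orthonormal_frame:
  assumes "\<And>i j. blinfun_apply (e i) (E j) = (if i = j then 1 else 0)"
    "\<And>u v. g q u v = (SUM7 i. blinfun_apply (e i) u * blinfun_apply (e i) v)"
  shows "orthonormal q E"
  unfolding orthonormal_def
proof (intro allI)
  fix i j
  have "g q (E i) (E j) = (SUM7 k. (if k = i then 1 else 0) * (if k = j then 1 else 0))"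
    using assms by simp
  also have "\<dots> = (if i = j then 1 else 0)"
    by (simp add: if_distrib[where f="\<lambda>x. x * _"] cong: if_cong)
  finally show "g q (E i) (E j) = (if i = j then 1 else 0)" .
qed

lemma adapted_frame_orthonormal:
  assumes "adapted_frame p E e N" "q \<in> N"
  shows "orthonormal q (\<lambda>i. E i q)"
  by (rule orthonormal_frame[of "e q"]) (use assms in \<open>auto simp: adapted_frame_def\<close>)

lemma onb: "orthonormal p (onb p)"
proof -
  obtain E e N where E: "adapted_frame p E e N" by (rule adapted_frame_exists)
  then have "p \<in> N" by (simp add: adapted_frame_def)
  then have "orthonormal p (\<lambda>i. E i p)" by (rule adapted_frame_orthonormal[OF E])
  then have "\<exists>b :: 7 \<Rightarrow> tvec. \<forall>i j. g p (b i) (b j) = (if i = j then 1 else 0)"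
    unfolding orthonormal_def by (rule exI[where x="\<lambda>i. E i p"])
  then show ?thesis
    unfolding onb_def orthonormal_def by (rule someI_ex)
qed

subsection \<open>Contracting two tensors\<close>

text \<open>Contraction of the last \<open>k\<close> arguments of both factors; the first \<open>l\<close> of the remaining
  arguments go to \<open>\<alpha>\<close>. Projections and traces below are instances, which gives their smoothness
  and the Leibniz rule at once.\<close>
definition contract :: "nat \<Rightarrow> nat \<Rightarrow> ('a, real) forms \<Rightarrow> ('a, real) forms \<Rightarrow> ('a, real) forms" where
  "contract l k \<alpha> S p ws =
     (\<Sum>js\<in>ils k. \<alpha> p (take l ws @ map (onb p) js) * S p (drop l ws @ map (onb p) js))"

lemma contract_basis:
  assumes b: "orthonormal p b" and \<alpha>: "multilin (l + k) (\<alpha> p)" and S: "multilin (r + k) (S p)"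
    and ws: "length ws = l + r"
  shows "contract l k \<alpha> S p ws = (\<Sum>js\<in>ils k. \<alpha> p (take l ws @ map b js) * S p (drop l ws @ map b js))"
  unfolding contract_def
proof (rule multi_contraction[OF onb b, where H="\<lambda>xs ys. \<alpha> p (take l ws @ xs) * S p (drop l ws @ ys)"])
  have 1: "multilin k (\<lambda>xs. \<alpha> p (take l ws @ xs))" using multilin_append[OF \<alpha>] ws by simp
  have 2: "multilin k (\<lambda>xs. S p (drop l ws @ xs))" using multilin_append[OF S] ws by simp
  show "multilin k (\<lambda>ys. \<alpha> p (take l ws @ xs) * S p (drop l ws @ ys))" for xs
    using 2 by (simp add: multilin_def linear_iff algebra_simps)
  show "multilin k (\<lambda>xs. \<alpha> p (take l ws @ xs) * S p (drop l ws @ ys))" for ys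
    using 1 by (simp add: multilin_def linear_iff algebra_simps)
qed

lemma sum_lessThan_add: "(\<Sum>i<l + k. h i) = (\<Sum>i<l. h i) + (\<Sum>s<k. h (l + s :: nat) :: real)"
  by (induction k) (simp_all add: add.assoc)

lemma
  assumes \<alpha>: "tensor (l + k) \<alpha>" and S: "tensor (r + k) S"
  shows tensor_contract: "tensor (l + r) (contract l k \<alpha> S)" (is ?T)
    and nabla_contract: "length ws = l + r \<Longrightarrow> nabla (contract l k \<alpha> S) p (v # ws) =
      (\<Sum>js\<in>ils k. nabla \<alpha> p (v # take l ws @ map (onb p) js) * S p (drop l ws @ map (onb p) js)
        + \<alpha> p (take l ws @ map (onb p) js) * nabla S p (v # drop l ws @ map (onb p) js))" (is "_ \<Longrightarrow> ?N")
proof -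
  note ml\<alpha> = tensor_multilin[OF \<alpha>] and mlS = tensor_multilin[OF S]
  have ml: "multilin (l + r) (contract l k \<alpha> S p)" for p
    unfolding multilin_def
  proof (intro allI impI)
    fix vs :: "tvec list" and i assume vs: "length vs = l + r" "i < l + r"
    show "linear (\<lambda>x. contract l k \<alpha> S p (vs[i := x]))"
    proof (cases "i < l")
      case True
      have "linear (\<lambda>x. \<alpha> p ((take l vs)[i := x] @ map (onb p) js))" if "js \<in> ils k" for js
        using multilinD[OF multilin_append_left[OF ml\<alpha>], of "map (onb p) js" "take l vs" i] that vs True by simp
      then show ?thesis
        unfolding contract_def using True
        by (intro linear_compose_sum) (auto simp: take_update_swap linear_iff algebra_simps)
    next
      case False
      have "linear (\<lambda>x. S p ((drop l vs)[i - l := x] @ map (onb p) js))" if "js \<in> ils k" for js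
        using multilinD[OF multilin_append_left[OF mlS], of "map (onb p) js" "drop l vs" "i - l"] that vs False by simp
      then show ?thesis
        unfolding contract_def using False
        by (intro linear_compose_sum) (auto simp: drop_update_swap linear_iff algebra_simps)
    qed
  qed
  have frame: "\<exists>E N. (\<forall>i. E i \<in> vector_fields) \<and> open N \<and> p \<in> N \<and> (\<forall>q\<in>N. orthonormal q (\<lambda>i. E i q))" for p
  proof -
    obtain E e N where E: "adapted_frame p E e N" by (rule adapted_frame_exists)
    then show ?thesis
      using adapted_frame_orthonormal[OF E]
      by (intro exI[of _ E] exI[of _ N]) (auto simp: adapted_frame_def)
  qed
  have loc: "contract l k \<alpha> S q (ev q Xs) = (\<Sum>js\<in>ils k. \<alpha> q (ev q (take l Xs @ map E js)) * S q (ev q (drop l Xs @ map E js)))"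
    if "length Xs = l + r" "orthonormal q (\<lambda>i. E i q)" for E q Xs
    using contract_basis[OF that(2) ml\<alpha> mlS, of "ev q Xs"] that(1)
    by (simp add: take_map drop_map comp_def)
  have sub: "set (take l Xs @ map E js) \<subseteq> vector_fields" "set (drop l Xs @ map E js) \<subseteq> vector_fields"
    if "set Xs \<subseteq> vector_fields" "\<And>i. E i \<in> vector_fields" for Xs E and js :: "7 list"
    using that by (auto dest: in_set_takeD in_set_dropD)
  have sm\<alpha>: "smooth_fun_on U (\<lambda>q. \<alpha> q (ev q (take l Xs @ map E js)))"
    and smS: "smooth_fun_on U (\<lambda>q. S q (ev q (drop l Xs @ map E js)))"
    if "length Xs = l + r" "set Xs \<subseteq> vector_fields" "\<And>i. E i \<in> vector_fields" "js \<in> ils k" for Xs E js U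
  proof -
    show "smooth_fun_on U (\<lambda>q. \<alpha> q (ev q (take l Xs @ map E js)))"
      by (rule smooth_funs_on, rule tensor_smooth[OF \<alpha> _ sub(1)]) (use that in auto)
    show "smooth_fun_on U (\<lambda>q. S q (ev q (drop l Xs @ map E js)))"
      by (rule smooth_funs_on, rule tensor_smooth[OF S _ sub(2)]) (use that in auto)
  qed
  have "(\<lambda>q. contract l k \<alpha> S q (ev q Xs)) \<in> smooth_funs"
    if Xs: "length Xs = l + r" "set Xs \<subseteq> vector_fields" for Xs
    unfolding smooth_funs_def mem_Collect_eq
  proof (rule smooth_fun_on_local)
    fix p
    obtain E N where E: "\<And>i. E i \<in> vector_fields" "open N" "p \<in> N" "\<And>q. q \<in> N \<Longrightarrow> orthonormal q (\<lambda>i. E i q)"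
      using frame[of p] by blast
    have "smooth_fun_on N (\<lambda>q. \<Sum>js\<in>ils k. \<alpha> q (ev q (take l Xs @ map E js)) * S q (ev q (drop l Xs @ map E js)))"
      by (intro smooth_fun_on_sum smooth_fun_on_mult E(2) sm\<alpha> smS Xs E(1))
    then have "smooth_fun_on N (\<lambda>q. contract l k \<alpha> S q (ev q Xs))"
      by (rule iffD1[OF smooth_fun_on_cong[OF E(2)], rotated]) (rule loc[OF Xs(1) E(4), symmetric])
    then show "\<exists>V. open V \<and> p \<in> V \<and> smooth_fun_on V (\<lambda>q. contract l k \<alpha> S q (ev q Xs))" using E by blast
  qed
  with ml show ?T by (simp add: tensor_def)
  show ?N if ws: "length ws = l + r"
  proof -
    define V where "V = ext p v"
    define Ws where "Ws = map (ext p) ws"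
    have Ws: "length Ws = l + r" "set Ws \<subseteq> vector_fields" "ev p Ws = ws" and V: "V \<in> vector_fields" "V p = v"
      unfolding Ws_def V_def using ws ev_ext ext_set by (auto simp: ext)
    obtain E N where E: "\<And>i. E i \<in> vector_fields" "open N" "p \<in> N" "\<And>q. q \<in> N \<Longrightarrow> orthonormal q (\<lambda>i. E i q)"
      using frame[of p] by blast
    define b where "b i = E i p" for i
    define B where "B i = nab V (E i) p" for i
    define y where "y i = nab V (Ws ! i) p" for i
    have b: "orthonormal p b" unfolding b_def using E by blast
    have b_eq: "b = (\<lambda>i. E i p)" by (rule HOL.ext) (rule b_def)
    let ?aE = "\<lambda>js q. \<alpha> q (ev q (take l Ws @ map E js))" and ?sE = "\<lambda>js q. S q (ev q (drop l Ws @ map E js))"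
    let ?a = "\<lambda>js. \<alpha> p (take l ws @ map b js)" and ?s = "\<lambda>js. S p (drop l ws @ map b js)"
    let ?da = "\<lambda>js. nabla \<alpha> p (v # take l ws @ map b js)" and ?ds = "\<lambda>js. nabla S p (v # drop l ws @ map b js)"
    let ?ai = "\<lambda>i js. \<alpha> p ((take l ws)[i := y i] @ map b js)" and ?si = "\<lambda>i js. S p ((drop l ws)[i := y (l + i)] @ map b js)"
    let ?B = "\<lambda>js s. (map b js)[s := B (js ! s)]"
    have skew: "g p (B i) (b j) + g p (b i) (B j) = 0" for i j
    proof -
      have "deriv_along V (\<lambda>q. g q (E i q) (E j q)) p = deriv_along V (\<lambda>q. if i = j then 1 else 0) p"
        by (rule deriv_along_cong[OF E(2,3)]) (simp add: orthonormal_g[OF E(4)])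
      then show ?thesis
        using nab_metric[OF V(1) E(1) E(1), of i j p] by (simp add: deriv_along_const B_def b_def)
    qed
    have D\<alpha>: "deriv_along V (?aE js) p = ?da js
        + (\<Sum>i<l. ?ai i js) + (\<Sum>s<k. \<alpha> p (take l ws @ ?B js s))"
      if js: "js \<in> ils k" for js
    proof -
      have "nabla \<alpha> p (V p # ev p (take l Ws @ map E js)) = nabla_field \<alpha> p (V # take l Ws @ map E js)"
        by (rule nabla_eq[OF \<alpha> _ sub(1)[OF Ws(2) E(1)] V(1)]) (use Ws js in simp)
      then show ?thesis
        using Ws(1) js V(2) unfolding nabla_field_def Ws(3)[symmetric]
        by (simp add: sum_lessThan_add list_update_append nth_append take_map y_def B_def b_eq comp_def)
    qed
    have DS: "deriv_along V (?sE js) p = ?ds js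
        + (\<Sum>i<r. ?si i js) + (\<Sum>s<k. S p (drop l ws @ ?B js s))"
      if js: "js \<in> ils k" for js
    proof -
      have "nabla S p (V p # ev p (drop l Ws @ map E js)) = nabla_field S p (V # drop l Ws @ map E js)"
        by (rule nabla_eq[OF S _ sub(2)[OF Ws(2) E(1)] V(1)]) (use Ws js in simp)
      then show ?thesis
        using Ws(1) js V(2) unfolding nabla_field_def Ws(3)[symmetric]
        by (simp add: sum_lessThan_add list_update_append nth_append drop_map y_def B_def b_eq comp_def)
    qed
    let ?H = "\<lambda>xs ys. \<alpha> p (take l ws @ xs) * S p (drop l ws @ ys)"
    have H0: "(\<Sum>js\<in>ils k. \<Sum>s<k. ?H (?B js s) (map b js) + ?H (map b js) (?B js s)) = 0"
    proof (rule multi_skew_contraction[OF b skew])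
      have 1: "multilin k (\<lambda>xs. \<alpha> p (take l ws @ xs))" using multilin_append[OF ml\<alpha>] ws by simp
      have 2: "multilin k (\<lambda>xs. S p (drop l ws @ xs))" using multilin_append[OF mlS] ws by simp
      show "multilin k (?H xs)" for xs
        using 2 by (simp add: multilin_def linear_iff algebra_simps)
      show "multilin k (\<lambda>xs. ?H xs ys)" for ys
        using 1 by (simp add: multilin_def linear_iff algebra_simps)
    qed
    have upd1: "contract l k \<alpha> S p (ws[i := x]) = (\<Sum>js\<in>ils k. \<alpha> p ((take l ws)[i := x] @ map b js) * ?s js)"
      if "i < l" for i x
      using contract_basis[OF b ml\<alpha> mlS, of "ws[i := x]"] ws that by (simp add: take_update_swap)
    have upd2: "contract l k \<alpha> S p (ws[l + i := x]) = (\<Sum>js\<in>ils k. ?a js * S p ((drop l ws)[i := x] @ map b js))"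
      for i x
      using contract_basis[OF b ml\<alpha> mlS, of "ws[l + i := x]"] ws by (simp add: drop_update_swap)
    have "nabla (contract l k \<alpha> S) p (v # ws)
       = deriv_along V (\<lambda>q. contract l k \<alpha> S q (ev q Ws)) p - (\<Sum>i<l + r. contract l k \<alpha> S p (ws[i := y i]))"
      using nabla_ext[OF ws] ws by (simp add: V_def Ws_def y_def)
    also have "deriv_along V (\<lambda>q. contract l k \<alpha> S q (ev q Ws)) p =
        deriv_along V (\<lambda>q. \<Sum>js\<in>ils k. ?aE js q * ?sE js q) p"
      by (rule deriv_along_cong[OF E(2,3)]) (rule loc[OF Ws(1) E(4)])
    also have "\<dots> = (\<Sum>js\<in>ils k. ?a js * deriv_along V (?sE js) p
        + deriv_along V (?aE js) p * ?s js)"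
    proof (subst deriv_along_sum[OF E(2,3)])
      show "smooth_fun_on N (\<lambda>q. ?aE js q * ?sE js q)" if "js \<in> ils k" for js
        by (intro smooth_fun_on_mult E(2) sm\<alpha> smS Ws E(1) that)
      show "(\<Sum>js\<in>ils k. deriv_along V (\<lambda>q. ?aE js q * ?sE js q) p)
        = (\<Sum>js\<in>ils k. ?a js * deriv_along V (?sE js) p
        + deriv_along V (?aE js) p * ?s js)"
      proof (rule sum.cong[OF refl])
        fix js assume js: "js \<in> ils k"
        have A: "smooth_fun_on N (?aE js)"
          and B: "smooth_fun_on N (?sE js)"
          by (rule sm\<alpha> smS; use Ws E(1) js in auto)+
        have evs: "ev p (take l Ws @ map E js) = take l ws @ map b js" "ev p (drop l Ws @ map E js) = drop l ws @ map b js"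
          by (simp_all add: Ws(3)[symmetric] take_map drop_map b_def)
        show "deriv_along V (\<lambda>q. ?aE js q * ?sE js q) p
          = ?a js * deriv_along V (?sE js) p
          + deriv_along V (?aE js) p * ?s js"
          by (simp only: deriv_along_mult[OF E(2,3) A B] evs)
      qed
    qed
    also have "\<dots> = (\<Sum>js\<in>ils k. ?da js * ?s js
          + ?a js * ?ds js)
        + (\<Sum>i<l. contract l k \<alpha> S p (ws[i := y i])) + (\<Sum>i<r. contract l k \<alpha> S p (ws[l + i := y (l + i)]))
        + (\<Sum>js\<in>ils k. \<Sum>s<k. ?H (?B js s) (map b js) + ?H (map b js) (?B js s))"
    proof -
      define F where "F js = ?da js * ?s js
          + ?a js * ?ds js" for js
      define A where "A js = (\<Sum>i<l. ?ai i js * ?s js)" for js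
      define C where "C js = (\<Sum>i<r. ?a js * ?si i js)" for js
      define h where "h js = (\<Sum>s<k. ?H (?B js s) (map b js) + ?H (map b js) (?B js s))" for js
      have per: "?a js * deriv_along V (?sE js) p
          + deriv_along V (?aE js) p * ?s js
          = F js + A js + C js + h js" if "js \<in> ils k" for js
        unfolding D\<alpha>[OF that] DS[OF that] F_def A_def C_def h_def
        by (simp only: sum.distrib distrib_left distrib_right sum_distrib_left sum_distrib_right add_ac)
      have "(\<Sum>i<l. contract l k \<alpha> S p (ws[i := y i])) = (\<Sum>js\<in>ils k. A js)"
        unfolding A_def by (subst sum.swap) (simp add: upd1)
      moreover have "(\<Sum>i<r. contract l k \<alpha> S p (ws[l + i := y (l + i)])) = (\<Sum>js\<in>ils k. C js)"
        unfolding C_def by (subst sum.swap) (simp add: upd2)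
      moreover have "(\<Sum>js\<in>ils k. F js + A js + C js + h js)
          = (\<Sum>js\<in>ils k. F js) + (\<Sum>js\<in>ils k. A js) + (\<Sum>js\<in>ils k. C js) + (\<Sum>js\<in>ils k. h js)"
        by (simp only: sum.distrib)
      ultimately show ?thesis
        unfolding F_def[symmetric] h_def[symmetric] by (simp only: sum.cong[OF refl per])
    qed
    finally have "nabla (contract l k \<alpha> S) p (v # ws) = (\<Sum>js\<in>ils k. ?da js * ?s js
          + ?a js * ?ds js)"
      unfolding sum_lessThan_add H0 by simp
    also have "\<dots> = (\<Sum>js\<in>ils k. nabla \<alpha> p ((v # take l ws) @ map b js) * ?s js)
          + (\<Sum>js\<in>ils k. ?a js * nabla S p ((v # drop l ws) @ map b js))"
      by (simp add: sum.distrib)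
    also have "(\<Sum>js\<in>ils k. nabla \<alpha> p ((v # take l ws) @ map b js) * ?s js)
        = contract (Suc l) k (nabla \<alpha>) S p (v # ws)"
      using contract_basis[OF b, of "Suc l" k "nabla \<alpha>" r S "v # ws"] tensor_multilin[OF tensor_nabla[OF \<alpha>], of p] mlS[of p] ws by simp
    also have "(\<Sum>js\<in>ils k. ?a js * nabla S p ((v # drop l ws) @ map b js))
        = contract l k \<alpha> (nabla S) p (take l ws @ v # drop l ws)"
      using contract_basis[OF b, of l k \<alpha> "Suc r" "nabla S" "take l ws @ v # drop l ws"]
        tensor_multilin[OF tensor_nabla[OF S], of p] ml\<alpha>[of p] ws by simp
    finally show ?N
      unfolding contract_def[of "Suc l"] contract_def[of l k \<alpha> "nabla S"] using ws by (simp add: sum.distrib)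
  qed
qed

end

section \<open>Algebra of the \<open>G\<^sub>2\<close> three-form\<close>

definition kd :: "7 \<Rightarrow> 7 \<Rightarrow> real" where
  "kd i j = (if i = j then 1 else 0)"

lemma kd_sum:
  "(SUM7 j. kd i j * F j) = F i" "(SUM7 j. kd j i * F j) = F i"
  "(SUM7 j. F j * kd i j) = F i" "(SUM7 j. F j * kd j i) = F i"
  by (simp_all add: kd_def if_distrib[where f="\<lambda>x. x * _"] if_distrib[where f="\<lambda>x. _ * x"] cong: if_cong)

lemma kd_simps: "kd i i = 1" "kd i j = kd j i"
  by (auto simp: kd_def)

lemma sum_rot3:
  fixes F :: "7 \<Rightarrow> 7 \<Rightarrow> 7 \<Rightarrow> real"
  shows "(SUM7 i j n. F i j n) = (SUM7 n i j. F i j n)"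
proof -
  have "(SUM7 i j n. F i j n) = (SUM7 i n j. F i j n)"
    by (intro sum.cong refl sum.swap)
  also have "\<dots> = (SUM7 n i j. F i j n)" by (rule sum.swap)
  finally show ?thesis .
qed

lemma sum_rot4:
  fixes F :: "7 \<Rightarrow> 7 \<Rightarrow> 7 \<Rightarrow> 7 \<Rightarrow> real"
  shows "(SUM7 i j k n. F i j k n) = (SUM7 n i j k. F i j k n)"
proof -
  have "(SUM7 i j k n. F i j k n) = (SUM7 i n j k. F i j k n)"
    by (intro sum.cong refl sum_rot3)
  also have "\<dots> = (SUM7 n i j k. F i j k n)" by (rule sum.swap)
  finally show ?thesis .
qed

text \<open>The components, in an orthonormal basis, of a three-form whose cross product satisfies \<open>|x
  \<times> y|\<^sup>2 = |x|\<^sup>2 |y|\<^sup>2 - \<langle>x, y\<rangle>\<^sup>2\<close>, in polarized form. The \<open>G\<^sub>2\<close> algebra below follows from this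
  identity.\<close>
locale g2_array =
  fixes f :: "7 \<Rightarrow> 7 \<Rightarrow> 7 \<Rightarrow> real"
  assumes f_swap12: "f j i k = - f i j k" and f_swap23: "f i k j = - f i j k"
    and f_polar: "(SUM7 n. f n i j * f n k l) + (SUM7 n. f n k j * f n i l)
      = 2 * (kd i k * kd j l) - kd i j * kd k l - kd k j * kd i l"
begin

definition P where "P i j k l = (SUM7 n. f n i j * f n k l)"

text \<open>Up to sign, the components of the four-form dual to the three-form.\<close>
definition Q where "Q i j k l = P i j k l - kd i k * kd j l + kd i l * kd j k"

lemma f_cycle: "f j k i = f i j k"
  using f_swap12[of j i k] f_swap23[of j i k] by simp

lemma P_Q: "P i j k l = Q i j k l + kd i k * kd j l - kd i l * kd j k"
  by (simp add: Q_def)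

lemma Q_swap12: "Q j i k l = - Q i j k l"
  by (simp add: Q_def P_def f_swap23[of _ j i] sum_negf)

lemma Q_swap34: "Q i j l k = - Q i j k l"
  by (simp add: Q_def P_def f_swap23[of _ l k] sum_negf)

lemma Q_swap13: "Q k j i l = - Q i j k l"
  using f_polar[of i j k l] by (simp add: Q_def P_def kd_simps(2)[of k i] kd_simps(2)[of j i] kd_simps(2)[of j k] algebra_simps)

lemma Q_swap23: "Q i k j l = - Q i j k l"
  using Q_swap12[of k i j l] Q_swap13[of j i k l] Q_swap12[of i j k l] by simp

lemma Q_pair: "Q k l i j = Q i j k l"
  by (simp add: Q_def P_def mult.commute kd_simps(2)[of k i] kd_simps(2)[of l j] kd_simps(2)[of k j] kd_simps(2)[of l i])

lemma Q_cycle: "Q i k l j = Q i j k l"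
  using Q_swap23[of i k j l] Q_swap34[of i k l j] by simp

lemma Q_diag: "Q i i k l = 0" "Q i j k k = 0"
  using Q_swap12[of i i k l] Q_swap34[of i j k k] by auto

lemma f_contract2: "(SUM7 i j. f n i j * f m i j) = 6 * kd n m"
proof -
  have n: "P i j i l = kd j l - kd i j * kd i l" for i j l
    using f_polar[of i j i l] by (simp add: P_def kd_simps)
  have "(SUM7 i j. f n i j * f m i j) = (SUM7 i. P i n i m)"
  proof -
    have "f n i j * f m i j = f j i n * f j i m" for i j
      using f_cycle[of n i j] f_cycle[of m i j] f_swap23[of j n i] f_swap23[of j m i] f_cycle[of j n i] f_cycle[of j m i] by simp
    then show ?thesis unfolding P_def by simp
  qed
  also have "\<dots> = 7 * kd n m - (SUM7 i. kd i n * kd i m)"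
    by (simp add: n sum_subtractf)
  also have "\<dots> = 6 * kd n m" by (simp add: kd_sum)
  finally show ?thesis .
qed

lemma f_Q_contract: "(SUM7 i j. f n i j * Q i j k l) = 4 * f n k l"
proof -
  have "(SUM7 i j. f n i j * P i j k l) = (SUM7 m. (SUM7 i j. f n i j * f m i j) * f m k l)"
    unfolding P_def sum_distrib_left sum_distrib_right
    by (subst sum_rot3) (simp only: mult.assoc)
  also have "\<dots> = 6 * f n k l"
    unfolding f_contract2 by (simp add: mult.assoc sum_distrib_left[symmetric] kd_sum)
  finally have 1: "(SUM7 i j. f n i j * P i j k l) = 6 * f n k l" .
  have 2: "(SUM7 i j. f n i j * (kd i k * kd j l)) = f n k l" for k l
    by (simp add: mult.assoc[symmetric] kd_sum)
  have "(SUM7 i j. f n i j * Q i j k l) = (SUM7 i j. f n i j * P i j k l)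
     - (SUM7 i j. f n i j * (kd i k * kd j l)) + (SUM7 i j. f n i j * (kd i l * kd j k))"
    by (simp add: Q_def algebra_simps sum.distrib sum_subtractf)
  then show ?thesis unfolding 1 2 using f_swap23[of n l k] by simp
qed

lemma Q_contract_L14:
  assumes "\<And>n. (SUM7 k l. f n k l * S k l) = 0" and skew: "\<And>i j. S j i = - S i j"
  shows "(SUM7 k l. Q i j k l * S k l) = - 2 * S i j"
proof -
  have "(SUM7 k l. P i j k l * S k l) = (SUM7 n. f n i j * (SUM7 k l. f n k l * S k l))"
    unfolding P_def sum_distrib_left sum_distrib_right
    by (subst sum_rot3) (simp only: mult.assoc)
  then have 1: "(SUM7 k l. P i j k l * S k l) = 0" by (simp add: assms(1))
  have 2: "(SUM7 k l. kd i k * (kd j l * S k l)) = S i j" for i j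
    by (simp add: sum_distrib_left[symmetric] kd_sum)
  have 3: "(SUM7 k l. kd i l * (kd j k * S k l)) = S j i"
    using 2[of j i] by (simp add: mult.left_commute)
  have "(SUM7 k l. Q i j k l * S k l) = (SUM7 k l. P i j k l * S k l)
      - (SUM7 k l. kd i k * (kd j l * S k l)) + (SUM7 k l. kd i l * (kd j k * S k l))"
    by (simp add: Q_def left_diff_distrib distrib_right sum.distrib sum_subtractf mult.assoc)
  then show ?thesis unfolding 1 2 3 using skew[of j i] by simp
qed

text \<open>The derivation action of the endomorphism \<open>S\<close> on the three-form.\<close>
definition act :: "(7 \<Rightarrow> 7 \<Rightarrow> real) \<Rightarrow> 7 \<Rightarrow> 7 \<Rightarrow> 7 \<Rightarrow> real" where
  "act S i j k = (SUM7 m. S i m * f m j k + S j m * f i m k + S k m * f i j m)"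

lemma act_contract:
  assumes skew: "\<And>i j. S j i = - S i j"
  shows "(SUM7 j k. act S i j k * f n j k) = 4 * S i n + 2 * (SUM7 j m. Q i n j m * S j m)"
proof -
  have 1: "(SUM7 j k m. S i m * f m j k * f n j k) = 6 * S i n"
  proof -
    have "(SUM7 j k m. S i m * f m j k * f n j k) = (SUM7 m. S i m * (SUM7 j k. f m j k * f n j k))"
      unfolding sum_distrib_left
      by (subst sum_rot3) (simp only: mult.assoc)
    then show ?thesis by (simp add: f_contract2 kd_sum mult.left_commute[of _ 6] sum_distrib_left[symmetric])
  qed
  have 2: "(SUM7 j k m. S j m * f i m k * f n j k) = (SUM7 j m. S j m * P i m n j)"
  proof -
    have "f i m k * f n j k = f k i m * f k n j" for k m j
      using f_cycle[of i m k] f_cycle[of n j k] by simp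
    then have "(SUM7 k m. S j m * f i m k * f n j k) = (SUM7 m. S j m * P i m n j)" for j
      by (subst sum.swap) (simp add: P_def sum_distrib_left mult.assoc)
    then show ?thesis by simp
  qed
  have 3: "(SUM7 j k m. S k m * f i j m * f n j k) = (SUM7 j k m. S j m * f i m k * f n j k)"
  proof -
    have *: "S j m * f i k m * f n k j = S j m * f i m k * f n j k" for j k m
      using f_swap23[of i k m] f_swap23[of n k j] by simp
    have "(SUM7 j k m. S k m * f i j m * f n j k) = (SUM7 j k m. S j m * f i k m * f n k j)"
      by (rule sum.swap)
    also have "\<dots> = (SUM7 j k m. S j m * f i m k * f n j k)"
      by (intro sum.cong refl *)
    finally show ?thesis .
  qed
  have 4: "(SUM7 j m. S j m * P i m n j) = (SUM7 j m. Q i n j m * S j m) - S i n"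
  proof -
    have "Q i m n j = Q i n j m" for j m using Q_cycle[of i n j m] by simp
    then have "(SUM7 j m. S j m * P i m n j) = (SUM7 j m. Q i n j m * S j m)
       + (SUM7 j m. kd i n * (kd m j * S j m)) - (SUM7 j m. kd i j * (kd m n * S j m))"
      by (simp add: P_Q algebra_simps sum.distrib sum_subtractf)
    also have "(SUM7 j m. kd i n * (kd m j * S j m)) = kd i n * (SUM7 j. S j j)"
      by (simp add: sum_distrib_left[symmetric] kd_sum)
    also have "(SUM7 j. S j j) = 0"
    proof (rule sum.neutral, rule ballI)
      show "S j j = 0" for j using skew[of j j] by simp
    qed
    also have "(SUM7 j m. kd i j * (kd m n * S j m)) = S i n"
      by (simp add: sum_distrib_left[symmetric] kd_sum)
    finally show ?thesis by simp
  qed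
  have "(SUM7 j k. act S i j k * f n j k) =
     (SUM7 j k m. S i m * f m j k * f n j k) + (SUM7 j k m. S j m * f i m k * f n j k)
     + (SUM7 j k m. S k m * f i j m * f n j k)"
    by (simp add: act_def sum_distrib_right sum.distrib distrib_right)
  then show ?thesis unfolding 1 3 2 4 by simp
qed

text \<open>If \<open>S\<close> annihilates the form, \<open>act_contract\<close> makes it an eigenvector of contraction with
  \<open>Q\<close>, with the eigenvalue of \<open>\<Lambda>\<^sup>2\<^sub>1\<^sub>4\<close>; by \<open>f_Q_contract\<close> its contraction with \<open>f\<close> belongs to a
  different eigenvalue and vanishes.\<close>
lemma act_zero_imp_L14:
  assumes skew: "\<And>i j. S j i = - S i j" and zero: "\<And>i j k. act S i j k = 0"
  shows "(SUM7 i n. f k i n * S i n) = 0"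
proof -
  have S: "S i n = - (1/2) * (SUM7 j m. Q i n j m * S j m)" for i n
    using act_contract[of S, OF skew, where i=i and n=n] zero by simp
  have "(SUM7 i n. f k i n * (SUM7 j m. Q i n j m * S j m))
     = (SUM7 j m. (SUM7 i n. f k i n * Q i n j m) * S j m)"
  proof -
    have "(SUM7 i n j m. F i n j m) = (SUM7 j m i n. F i n j m)"
      for F :: "7 \<Rightarrow> 7 \<Rightarrow> 7 \<Rightarrow> 7 \<Rightarrow> real"
      by (subst sum_rot3, subst sum_rot3) (rule refl)
    then show ?thesis by (simp add: sum_distrib_left sum_distrib_right mult.assoc)
  qed
  also have "\<dots> = 4 * (SUM7 j m. f k j m * S j m)"
    by (simp add: f_Q_contract sum_distrib_left mult.assoc)
  finally have fin: "(SUM7 i n. f k i n * (SUM7 j m. Q i n j m * S j m)) = 4 * (SUM7 j m. f k j m * S j m)" .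
  have "(SUM7 i n. f k i n * (- 2 * S i n)) = 4 * (SUM7 j m. f k j m * S j m)"
  proof -
    have "(SUM7 j m. Q i n j m * S j m) = - 2 * S i n" for i n using S[of i n] by simp
    then show ?thesis using fin by (simp only:)
  qed
  moreover have "(SUM7 i n. f k i n * (- 2 * S i n)) = - 2 * (SUM7 j m. f k j m * S j m)"
    by (simp add: sum_distrib_left mult.left_commute)
  ultimately show ?thesis by linarith
qed

lemma act_swap12: "act S j i k = - act S i j k"
proof -
  have "S j m * f m i k + S i m * f j m k + S k m * f j i m = - (S i m * f m j k + S j m * f i m k + S k m * f i j m)" for m
    using f_swap12[of m i k] f_swap12[of j m k] f_swap12[of j i m] by simp
  then show ?thesis unfolding act_def sum_negf[symmetric] by (rule sum.cong[OF refl])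
qed

lemma act_swap23: "act S i k j = - act S i j k"
proof -
  have "S i m * f m k j + S k m * f i m j + S j m * f i k m = - (S i m * f m j k + S j m * f i m k + S k m * f i j m)" for m
    using f_swap23[of m k j] f_swap23[of i m j] f_swap23[of i k m] by simp
  then show ?thesis unfolding act_def sum_negf[symmetric] by (rule sum.cong[OF refl])
qed

text \<open>The squared norm of the transformed form is a combination of its contractions with \<open>f\<close>, and
  these vanish on \<open>\<Lambda>\<^sup>2\<^sub>1\<^sub>4\<close>.\<close>
lemma L14_imp_act_zero:
  assumes skew: "\<And>i j. S j i = - S i j" and zero: "\<And>n. (SUM7 k l. f n k l * S k l) = 0"
  shows "act S i j k = 0"
proof -
  have c0: "(SUM7 j k. act S i j k * f n j k) = 0" for i n
    using act_contract[of S, OF skew, where i=i and n=n] Q_contract_L14[of S, OF zero skew] by simp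
  define A where "A i j k = (SUM7 m. S i m * f m j k)" for i j k
  have act: "act S i j k = A i j k - A j i k + A k i j" for i j k
  proof -
    have *: "S i m * f m j k + S j m * f i m k + S k m * f i j m = S i m * f m j k - S j m * f m i k + S k m * f m i j" for m
      using f_swap12[of i m k] f_cycle[of i j m] by simp
    show ?thesis unfolding act_def A_def sum.distrib[symmetric] sum_subtractf[symmetric] by (intro sum.cong refl *)
  qed
  have n0: "(SUM7 i j k. act S i j k * A i j k) = 0"
  proof -
    have "(SUM7 j k. act S i j k * A i j k) = (SUM7 m. S i m * (SUM7 j k. act S i j k * f m j k))" for i
      unfolding A_def sum_distrib_left
      by (subst sum_rot3) (simp only: mult.left_commute)
    then show ?thesis by (simp add: c0)
  qed
  have A1: "(SUM7 i j k. act S i j k * A j i k) = - (SUM7 i j k. act S i j k * A i j k)"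
  proof -
    have "act S j i k * A i j k = - (act S i j k * A i j k)" for i j k using act_swap12[of S j i k] by simp
    then show ?thesis by (subst sum.swap) (simp add: sum_negf)
  qed
  have A2: "(SUM7 i j k. act S i j k * A k i j) = (SUM7 i j k. act S i j k * A i j k)"
  proof -
    have *: "act S i j k * A k i j = act S k i j * A k i j" for i j k using act_swap12[of S i k j] act_swap23[of S i j k] by simp
    have "(SUM7 i j k. act S i j k * A k i j) = (SUM7 i j k. act S k i j * A k i j)"
      by (intro sum.cong refl *)
    also have "\<dots> = (SUM7 i k j. act S k i j * A k i j)"
      by (intro sum.cong refl sum.swap)
    also have "\<dots> = (SUM7 k i j. act S k i j * A k i j)" by (rule sum.swap)
    finally show ?thesis .
  qed
  have "(SUM7 i j k. act S i j k * act S i j k) = 0"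
  proof -
    have "act S i j k * act S i j k = act S i j k * A i j k - act S i j k * A j i k + act S i j k * A k i j" for i j k
      by (subst (2) act) (simp add: algebra_simps)
    then have "(SUM7 i j k. act S i j k * act S i j k) = (SUM7 i j k. act S i j k * A i j k)
       - (SUM7 i j k. act S i j k * A j i k) + (SUM7 i j k. act S i j k * A k i j)"
      by (simp only: sum.distrib sum_subtractf)
    then show ?thesis using A1 A2 n0 by simp
  qed
  then show ?thesis
    by (simp add: sum_nonneg_eq_0_iff sum_nonneg)
qed

lemma act_f:
  "act (\<lambda>i j. SUM7 m. f i j m * t m) i j k = 3 * (SUM7 m. t m * Q m i j k)"
proof -
  have s: "(SUM7 a. (SUM7 m. f i a m * t m) * F a) = (SUM7 m. t m * (SUM7 a. f a m i * F a))" for i F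
    unfolding sum_distrib_left sum_distrib_right
    by (subst sum.swap) (intro sum.cong refl, metis f_cycle mult.assoc mult.commute)
  have "act (\<lambda>i j. SUM7 m. f i j m * t m) i j k = (SUM7 m. t m * (P m i j k + P m j k i + P m k i j))"
  proof -
    have "f i m k = f m k i" "f i j m = f m i j" for m using f_cycle[of m k i] f_cycle[of i j m] by auto
    then show ?thesis
      unfolding act_def sum.distrib s by (simp add: P_def distrib_left sum.distrib)
  qed
  also have "\<dots> = (SUM7 m. t m * (3 * Q m i j k))"
  proof (rule sum.cong[OF refl])
    show "t m * (P m i j k + P m j k i + P m k i j) = t m * (3 * Q m i j k)" for m
      using Q_cycle[of m i j k] Q_cycle[of m j k i]
      by (simp add: P_Q kd_simps(2)[of k i] kd_simps(2)[of k j] kd_simps(2)[of j i])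
  qed
  finally show ?thesis by (simp add: sum_distrib_left mult.left_commute)
qed

text \<open>Only the \<open>\<Lambda>\<^sup>2\<^sub>7\<close> component of \<open>S\<close> acts, and \<open>t\<close> is the vector that represents it.\<close>
lemma act_torsion:
  assumes skew: "\<And>i j. S j i = - S i j"
  defines "t \<equiv> \<lambda>n. (1/6) * (SUM7 b c. f n b c * S b c)"
  shows "act S i j k = 3 * (SUM7 m. t m * Q m i j k)"
proof -
  define S' where "S' = (\<lambda>i j. SUM7 m. f i j m * t m)"
  have skew': "S' j i = - S' i j" for i j by (simp add: S'_def f_swap12[of j i] sum_negf)
  have T': "(SUM7 b c. f n b c * S' b c) = 6 * t n" for n
  proof -
    have "(SUM7 b c. f n b c * S' b c) = (SUM7 m. (SUM7 b c. f n b c * f m b c) * t m)"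
      unfolding S'_def sum_distrib_left sum_distrib_right
      by (subst sum_rot3) (intro sum.cong refl, metis f_cycle mult.assoc)
    then show ?thesis by (simp add: f_contract2 mult.assoc sum_distrib_left[symmetric] kd_sum)
  qed
  have "act (\<lambda>i j. S i j - S' i j) i j k = 0"
  proof (rule L14_imp_act_zero)
    show "S j i - S' j i = - (S i j - S' i j)" for i j using skew[of j i] skew'[of j i] by simp
    show "(SUM7 k l. f n k l * (S k l - S' k l)) = 0" for n
      using T'[of n] by (simp add: right_diff_distrib sum_subtractf t_def)
  qed
  moreover have "act (\<lambda>i j. S i j - S' i j) i j k = act S i j k - act S' i j k"
    by (simp add: act_def sum_subtractf[symmetric] algebra_simps)
  ultimately show ?thesis using act_f[of t i j k] by (simp add: S'_def)
qed

lemma Q_Q_contract: "(SUM7 c d. Q m a c d * Q n b c d) = 4 * (kd n m * kd b a) - 4 * (kd n a * kd b m) + 2 * Q m a n b"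
proof -
  have "(SUM7 c d. Q m a c d * P n b c d) = (SUM7 k. f k n b * (SUM7 c d. f k c d * Q c d m a))"
    unfolding P_def sum_distrib_left
    by (subst sum_rot3) (simp add: Q_pair[where i=m and j=a] mult_ac)
  also have "\<dots> = 4 * P n b m a" by (simp add: f_Q_contract P_def sum_distrib_left mult.left_commute)
  finally have 1: "(SUM7 c d. Q m a c d * P n b c d) = 4 * P n b m a" .
  have 2: "(SUM7 c d. Q m a c d * (kd n c * kd b d)) = Q m a n b" for n b
  proof -
    have "(SUM7 c d. Q m a c d * (kd n c * kd b d)) = (SUM7 c. kd n c * (SUM7 d. Q m a c d * kd b d))"
      by (simp add: sum_distrib_left mult.left_commute)
    then show ?thesis by (simp add: kd_sum)
  qed
  have "(SUM7 c d. Q m a c d * Q n b c d) = (SUM7 c d. Q m a c d * P n b c d)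
      - (SUM7 c d. Q m a c d * (kd n c * kd b d)) + (SUM7 c d. Q m a c d * (kd b c * kd n d))"
    by (simp add: Q_def[of n b] right_diff_distrib distrib_left sum.distrib sum_subtractf mult.commute)
  then show ?thesis unfolding 1 2 using Q_swap34[of m a n b] Q_pair[of m a n b] by (simp add: P_Q kd_simps(2)[of b a])
qed

lemma Q_Q_contract3: "(SUM7 b c d. Q m b c d * Q n b c d) = 24 * kd n m"
proof -
  have "(SUM7 b c d. Q m b c d * Q n b c d) = (SUM7 b. 4 * kd n m - 4 * (kd n b * kd b m) + 2 * Q m b n b)"
    by (simp add: Q_Q_contract kd_simps(1))
  also have "\<dots> = 24 * kd n m"
  proof -
    have "Q m b n b = 0" for b using Q_swap23[of m b n b] Q_diag(2)[of m n b] by simp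
    then show ?thesis by (simp add: sum.distrib sum_subtractf sum_distrib_left[symmetric] kd_sum)
  qed
  finally show ?thesis .
qed

text \<open>\<open>Th\<close> is the covariant derivative of the three-form, written with the torsion \<open>t\<close>.
  Contracting the closedness equation with \<open>Q\<close> gives \<open>2 t + 2 (tr t) 1 = X\<close> with \<open>X\<close> skew, whence
  \<open>tr t = 0\<close>; the vanishing divergence says \<open>X = 0\<close>.\<close>
lemma torsion_zero:
  fixes t :: "7 \<Rightarrow> 7 \<Rightarrow> real"
  defines "Th \<equiv> \<lambda>a b c d. 3 * (SUM7 m. t a m * Q m b c d)"
  assumes closed: "\<And>a b c d. Th a b c d - Th b a c d + Th c a b d - Th d a b c = 0"
    and div: "\<And>b c. (SUM7 a. Th a a b c) = 0"
  shows "t a n = 0"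
proof -
  define X where "X a n = (SUM7 b m. t b m * Q m a n b)" for a n
  define tr where "tr = (SUM7 b. t b b)"
  \<comment> \<open>The three permuted terms of the closedness equation all reduce to this contraction.\<close>
  have c: "(SUM7 b c d. Th b a c d * Q n b c d) = 12 * t a n - 12 * kd n a * tr + 6 * X a n" for a n
  proof -
    have "(SUM7 c d. Th b a c d * Q n b c d)
        = 3 * (SUM7 m. t b m * (SUM7 c d. Q m a c d * Q n b c d))" for b
      unfolding Th_def sum_distrib_left sum_distrib_right
      by (subst sum_rot3) (simp add: mult_ac)
    then have "(SUM7 b c d. Th b a c d * Q n b c d)
       = (SUM7 b. 3 * (SUM7 m. t b m * (4 * (kd n m * kd b a) - 4 * (kd n a * kd b m) + 2 * Q m a n b)))"
      by (simp add: Q_Q_contract)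
    also have "\<dots> = (SUM7 b. 12 * kd b a * (SUM7 m. kd n m * t b m) - 12 * kd n a * (SUM7 m. kd b m * t b m)
         + 6 * (SUM7 m. t b m * Q m a n b))"
      by (intro sum.cong refl) (simp add: sum_distrib_left algebra_simps sum.distrib sum_subtractf)
    also have "\<dots> = 12 * t a n - 12 * kd n a * tr + 6 * X a n"
      by (simp add: kd_sum sum.distrib sum_subtractf X_def tr_def mult.assoc sum_distrib_left[symmetric])
    finally show ?thesis .
  qed
  have Th_alt: "Th a b d c = - Th a b c d" "Th a c b d = - Th a b c d" for a b c d
    unfolding Th_def by (simp_all add: Q_swap34[of _ b d c] Q_swap23[of _ c b d] sum_negf)
  have eq: "2 * t a n + 2 * kd n a * tr - X a n = 0" for a n
  proof -
    have 1: "(SUM7 b c d. Th a b c d * Q n b c d) = 72 * t a n"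
    proof -
      have "(SUM7 b c d. Th a b c d * Q n b c d) = 3 * (SUM7 m. t a m * (SUM7 b c d. Q m b c d * Q n b c d))"
        unfolding Th_def sum_distrib_left sum_distrib_right
        by (subst sum_rot4) (simp add: mult_ac)
      then show ?thesis by (simp add: Q_Q_contract3 mult.left_commute[of _ 24] sum_distrib_left[symmetric] kd_sum)
    qed
    have 2: "(SUM7 b c d. Th c a b d * Q n b c d) = - (SUM7 b c d. Th b a c d * Q n b c d)"
    proof -
      have "Th b a c d * Q n c b d = - (Th b a c d * Q n b c d)" for b c d using Q_swap23[of n c b d] by simp
      then show ?thesis by (subst sum.swap) (simp only: sum_negf)
    qed
    have 3: "(SUM7 b c d. Th d a b c * Q n b c d) = (SUM7 b c d. Th b a c d * Q n b c d)"
    proof -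
      have "(SUM7 b c d. Th d a b c * Q n b c d) = (SUM7 b c d. Th d a b c * Q n d b c)"
      proof -
        have *: "Th d a b c * Q n b c d = Th d a b c * Q n d b c" for b c d using Q_cycle[of n b c d] by simp
        show ?thesis by (intro sum.cong refl *)
      qed
      also have "\<dots> = (SUM7 b d c. Th d a b c * Q n d b c)"
        by (intro sum.cong refl sum.swap)
      also have "\<dots> = (SUM7 d b c. Th d a b c * Q n d b c)" by (rule sum.swap)
      finally show ?thesis .
    qed
    have "(SUM7 b c d. (Th a b c d - Th b a c d + Th c a b d - Th d a b c) * Q n b c d) = 0"
      by (simp add: closed)
    then have "72 * t a n - 3 * (12 * t a n - 12 * kd n a * tr + 6 * X a n) = 0"
      unfolding left_diff_distrib distrib_right sum.distrib sum_subtractf 1 2 3 c by (simp add: algebra_simps)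
    then show ?thesis by simp
  qed
  have X_skew: "X n a = - X a n" for a n
    unfolding X_def by (simp only: Q_swap23[where k=n and j=a] mult_minus_right sum_negf)
  have sym: "t a n + t n a + 2 * kd n a * tr = 0" for a n
    using eq[of a n] eq[of n a] X_skew[of n a] kd_simps(2)[of n a] by simp
  have "(SUM7 a. t a a + t a a + 2 * kd a a * tr) = 0" by (simp only: sym sum.neutral_const)
  then have tr0: "tr = 0" by (simp add: kd_simps(1) sum.distrib tr_def[symmetric] sum_distrib_left[symmetric])
  have "(SUM7 b m. t b m * Q m b a n) = 0"
    using div[of a n] unfolding Th_def by (simp add: sum_distrib_left[symmetric])
  moreover have "Q m a n b = Q m b a n" for m b using Q_cycle[of m a n b] .
  ultimately have "X a n = 0" unfolding X_def by (simp only:)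
  then show ?thesis using eq[of a n] tr0 by simp
qed

text \<open>Contraction with \<open>Q\<close> acts on the two-form values as \<open>-2\<close>. Summed over \<open>j\<close>, the contraction
  of \<open>R\<close> with the alternating \<open>Q\<close> vanishes by the Bianchi identity, and \<open>-2\<close> times the Ricci
  tensor is left.\<close>
lemma ricci_flat:
  assumes L14: "\<And>a b n. (SUM7 k l. f n k l * R a b k l) = 0"
    and skew: "\<And>a b c d. R a b d c = - R a b c d"
    and bianchi: "\<And>j q k l. R j q k l + R k q l j + R l q j k = 0"
  shows "(SUM7 j. R j q i j) = 0"
proof -
  have "(SUM7 k l. Q i j k l * R j q k l) = - 2 * R j q i j" for j
    by (rule Q_contract_L14[OF L14 skew])
  then have 1: "(SUM7 j k l. Q i j k l * R j q k l) = - 2 * (SUM7 j. R j q i j)"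
    by (simp add: sum_distrib_left)
  have 2: "(SUM7 j k l. Q i j k l * R k q l j) = (SUM7 j k l. Q i j k l * R j q k l)"
  proof -
    have "(SUM7 j k l. Q i j k l * R k q l j) = (SUM7 j k l. Q i k l j * R k q l j)"
    proof -
      have "Q i j k l * R k q l j = Q i k l j * R k q l j" for j k l using Q_cycle[of i k l j] by simp
      note * = this
      show ?thesis by (intro sum.cong refl *)
    qed
    also have "\<dots> = (SUM7 k j l. Q i k l j * R k q l j)" by (rule sum.swap)
    also have "\<dots> = (SUM7 k l j. Q i k l j * R k q l j)" by (intro sum.cong refl sum.swap)
    finally show ?thesis .
  qed
  have 3: "(SUM7 j k l. Q i j k l * R l q j k) = (SUM7 j k l. Q i j k l * R j q k l)"
  proof -
    have *: "Q i j k l * R l q j k = Q i l j k * R l q j k" for j k l using Q_cycle[of i j k l] by simp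
    have "(SUM7 j k l. Q i j k l * R l q j k) = (SUM7 j k l. Q i l j k * R l q j k)"
      by (intro sum.cong refl *)
    also have "\<dots> = (SUM7 j l k. Q i l j k * R l q j k)" by (intro sum.cong refl sum.swap)
    also have "\<dots> = (SUM7 l j k. Q i l j k * R l q j k)" by (rule sum.swap)
    finally show ?thesis .
  qed
  have "(SUM7 j k l. Q i j k l * (R j q k l + R k q l j + R l q j k)) = 0"
    by (simp add: bianchi)
  then have "3 * (SUM7 j k l. Q i j k l * R j q k l) = 0"
    by (simp add: distrib_left sum.distrib 2 3)
  then show ?thesis using 1 by simp
qed

end

section \<open>Alternating forms\<close>

lemma distinct_7: "distinct [1, 2, 3, 4, 5, 6, 7 :: 7]"
  by simp

lemma set_7: "set [1, 2, 3, 4, 5, 6, 7 :: 7] = UNIV"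
  by (rule card_subset_eq) (simp_all only: distinct_card[OF distinct_7], simp_all)

lemma sum_7: "(\<Sum>i\<in>(UNIV :: 7 set). F i) = F 1 + F 2 + F 3 + F 4 + F 5 + F 6 + (F 7 :: real)"
  unfolding set_7[symmetric] sum.distinct_set_conv_list[OF distinct_7] by simp

lemma coframe_wedge_3:
  "coframe_wedge e [a, b, c] [u, v, w] =
     blinfun_apply (e a) u * blinfun_apply (e b) v * blinfun_apply (e c) w
   - blinfun_apply (e a) u * blinfun_apply (e b) w * blinfun_apply (e c) v
   - blinfun_apply (e a) v * blinfun_apply (e b) u * blinfun_apply (e c) w
   + blinfun_apply (e a) v * blinfun_apply (e b) w * blinfun_apply (e c) u
   + blinfun_apply (e a) w * blinfun_apply (e b) u * blinfun_apply (e c) v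
   - blinfun_apply (e a) w * blinfun_apply (e b) v * blinfun_apply (e c) u"
proof -
  have l: "{..<Suc (Suc (Suc 0))} = {0, Suc 0, Suc (Suc 0)}" by auto
  have f: "finite {1, 2::nat}" "finite {2::nat}" "finite ({} :: nat set)" "0 \<notin> {1, 2::nat}" "1 \<notin> {2::nat}" "2 \<notin> ({} :: nat set)" by auto
  have "coframe_wedge e [a, b, c] [u, v, w] = (\<Sum>\<pi> | \<pi> permutes {0, 1, 2::nat}. of_int (sign \<pi>) *
      (blinfun_apply (e a) ([u, v, w] ! \<pi> 0) * blinfun_apply (e b) ([u, v, w] ! \<pi> 1) * blinfun_apply (e c) ([u, v, w] ! \<pi> 2)))"
    unfolding coframe_wedge_def by (simp add: l mult.assoc numeral_2_eq_2 del: lessThan_Suc)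
  then show ?thesis
    unfolding sum_over_permutations_insert[OF f(1,4)] sum_over_permutations_insert[OF f(2,5)]
        sum_over_permutations_insert[OF f(3,6)] permutes_sing
    by (simp add: sign_swap_id permutation_swap_id sign_compose sign_id swap_id_eq)
qed

text \<open>A polynomial identity in the 28 coordinates of four vectors, once the seven sums are
  written out.\<close>
lemma standard_G2_polar:
  assumes "\<And>i j. blinfun_apply (e i) (E j) = (if i = j then 1 else 0)"
  defines "G \<equiv> \<lambda>u v. SUM7 i. blinfun_apply (e i) u * blinfun_apply (e i) v"
    and "C \<equiv> \<lambda>n x y. standard_G2_form e [E n, x, y]"
  shows "(SUM7 n. C n x y * C n z w) + (SUM7 n. C n z y * C n x w)
    = 2 * (G x z * G y w) - G x y * G z w - G z y * G x w"
proof -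
  define c where "c i u = blinfun_apply (e i) u" for i u
  have cE: "c i (E j) = (if i = j then 1 else 0)" for i j by (simp add: c_def assms(1))
  have C: "C 1 x y = c 2 x * c 3 y - c 3 x * c 2 y + c 4 x * c 5 y - c 5 x * c 4 y + c 6 x * c 7 y - c 7 x * c 6 y"
    "C 2 x y = c 3 x * c 1 y - c 1 x * c 3 y + c 4 x * c 6 y - c 6 x * c 4 y + c 7 x * c 5 y - c 5 x * c 7 y"
    "C 3 x y = c 1 x * c 2 y - c 2 x * c 1 y + c 7 x * c 4 y - c 4 x * c 7 y + c 6 x * c 5 y - c 5 x * c 6 y"
    "C 4 x y = c 5 x * c 1 y - c 1 x * c 5 y + c 6 x * c 2 y - c 2 x * c 6 y + c 3 x * c 7 y - c 7 x * c 3 y"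
    "C 5 x y = c 1 x * c 4 y - c 4 x * c 1 y + c 2 x * c 7 y - c 7 x * c 2 y + c 3 x * c 6 y - c 6 x * c 3 y"
    "C 6 x y = c 7 x * c 1 y - c 1 x * c 7 y + c 2 x * c 4 y - c 4 x * c 2 y + c 5 x * c 3 y - c 3 x * c 5 y"
    "C 7 x y = c 1 x * c 6 y - c 6 x * c 1 y + c 5 x * c 2 y - c 2 x * c 5 y + c 4 x * c 3 y - c 3 x * c 4 y" for x y
    unfolding C_def standard_G2_form_def coframe_wedge_3 c_def[symmetric] cE by simp_all
  have G: "G u v = c 1 u * c 1 v + c 2 u * c 2 v + c 3 u * c 3 v + c 4 u * c 4 v + c 5 u * c 5 v + c 6 u * c 6 v + c 7 u * c 7 v" for u v
    unfolding G_def c_def by (rule sum_7)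
  show ?thesis unfolding sum_7 C G by algebra
qed

lemma alternating_form_linear:
  "alternating_form k \<alpha> \<Longrightarrow> length vs = k \<Longrightarrow> i < k \<Longrightarrow> linear (\<lambda>x. \<alpha> (vs[i := x]))"
  by (simp add: alternating_form_def)

lemma alternating_form_repeat:
  assumes "alternating_form k \<alpha>" "length vs = k" "i < k" "j < k" "i \<noteq> j" "vs ! i = vs ! j"
  shows "\<alpha> vs = 0"
proof -
  have *: "\<alpha> vs = 0" if "a < b" "b < k" "vs ! a = vs ! b" for a b
    using assms(1,2) that unfolding alternating_form_def by blast
  from assms(5) consider "i < j" | "j < i" by linarith
  then show ?thesis using *[of i j] *[of j i] assms(3,4,6) by cases auto
qed

lemma alternating_form_not_distinct:
  assumes "alternating_form k \<alpha>" "length vs = k" "\<not> distinct vs"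
  shows "\<alpha> vs = 0"
  using assms alternating_form_repeat[OF assms(1,2)] by (auto simp: distinct_conv_nth)

lemma alternating_form_swap:
  assumes \<alpha>: "alternating_form k \<alpha>" and vs: "length vs = k" "i < k" "j < k" "i \<noteq> j"
  shows "\<alpha> (vs[i := y, j := x]) = - \<alpha> (vs[i := x, j := y])"
proof -
  have li: "\<alpha> (vs[i := a + b, j := c]) = \<alpha> (vs[i := a, j := c]) + \<alpha> (vs[i := b, j := c])" for a b c
    using linear_add[OF alternating_form_linear[OF \<alpha>, of "vs[j := c]" i]] vs by (simp add: list_update_swap)
  have lj: "\<alpha> (vs[i := c, j := a + b]) = \<alpha> (vs[i := c, j := a]) + \<alpha> (vs[i := c, j := b])" for a b c
    using linear_add[OF alternating_form_linear[OF \<alpha>, of "vs[i := c]" j]] vs by simp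
  have z: "\<alpha> (vs[i := a, j := a]) = 0" for a
    using vs by (intro alternating_form_repeat[OF \<alpha>, of _ i j]) auto
  have "\<alpha> (vs[i := x + y, j := x + y]) = 0" by (rule z)
  then show ?thesis unfolding li lj by (simp add: z)
qed

lemma alternating_form_add:
  "alternating_form k \<alpha> \<Longrightarrow> alternating_form k \<beta> \<Longrightarrow> alternating_form k (\<lambda>vs. \<alpha> vs + \<beta> vs)"
  by (auto simp: alternating_form_def linear_compose_add)

lemma alternating_form_cmult: "alternating_form k \<alpha> \<Longrightarrow> alternating_form k (\<lambda>vs. c * \<alpha> vs)"
  unfolding alternating_form_def by (auto simp: linear_iff algebra_simps)

lemma alternating_form_diff:
  "alternating_form k \<alpha> \<Longrightarrow> alternating_form k \<beta> \<Longrightarrow> alternating_form k (\<lambda>vs. \<alpha> vs - \<beta> vs)"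
  using alternating_form_add[of k \<alpha> "\<lambda>vs. -1 * \<beta> vs"] alternating_form_cmult[of k \<beta> "-1"] by simp

lemma coframe_wedge_alternating: "alternating_form (length js) (coframe_wedge e js)"
  unfolding alternating_form_def
proof (intro conjI allI impI)
  let ?k = "length js"
  show "coframe_wedge e js vs = 0" if "length vs \<noteq> ?k" for vs using that by (simp add: coframe_wedge_def)
  show "linear (\<lambda>x. coframe_wedge e js (vs[i := x]))" if vs: "length vs = ?k" "i < ?k" for vs i
  proof -
    have "linear (\<lambda>x. of_int (sign \<pi>) * (\<Prod>n<?k. blinfun_apply (e (js ! n)) (vs[i := x] ! \<pi> n)) :: real)"
      if \<pi>: "\<pi> permutes {..<?k}" for \<pi>
    proof -
      obtain m where m: "m < ?k" "\<pi> m = i" using permutes_image[OF \<pi>] vs(2) by (metis imageE lessThan_iff)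
      have *: "(\<Prod>n<?k. blinfun_apply (e (js ! n)) (vs[i := x] ! \<pi> n))
          = blinfun_apply (e (js ! m)) x * (\<Prod>n\<in>{..<?k} - {m}. blinfun_apply (e (js ! n)) (vs ! \<pi> n))" for x
      proof -
        have "(\<Prod>n\<in>{..<?k} - {m}. blinfun_apply (e (js ! n)) (vs[i := x] ! \<pi> n))
            = (\<Prod>n\<in>{..<?k} - {m}. blinfun_apply (e (js ! n)) (vs ! \<pi> n))"
        proof (rule prod.cong[OF refl])
          fix n assume "n \<in> {..<?k} - {m}"
          then have "\<pi> n \<noteq> i" using m(2) permutes_inj[OF \<pi>] by (auto dest: injD)
          then show "blinfun_apply (e (js ! n)) (vs[i := x] ! \<pi> n) = blinfun_apply (e (js ! n)) (vs ! \<pi> n)" by simp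
        qed
        then show ?thesis using m vs by (subst prod.remove[of _ m]) auto
      qed
      show ?thesis unfolding * by (rule linearI) (simp_all add: blinfun.add_right blinfun.scaleR_right algebra_simps)
    qed
    then show ?thesis using vs by (simp add: coframe_wedge_def linear_compose_sum)
  qed
  show "coframe_wedge e js vs = 0" if vs: "length vs = ?k" "i < j" "j < ?k" "vs ! i = vs ! j" for vs i j
  proof -
    let ?t = "\<lambda>\<pi>. Transposition.transpose i j \<circ> \<pi>"
    let ?F = "\<lambda>\<pi>. of_int (sign \<pi>) * (\<Prod>n<?k. blinfun_apply (e (js ! n)) (vs ! \<pi> n)) :: real"
    have t: "Transposition.transpose i j permutes {..<?k}" using vs by (auto intro: permutes_swap_id)
    have "(\<Sum>\<pi> | \<pi> permutes {..<?k}. ?F \<pi>) = (\<Sum>\<pi> | \<pi> permutes {..<?k}. ?F (?t \<pi>))"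
      by (rule sum.reindex_bij_witness[of _ ?t ?t]) (auto simp: t permutes_compose comp_assoc[symmetric] fun_eq_iff)
    also have "\<dots> = (\<Sum>\<pi> | \<pi> permutes {..<?k}. - ?F \<pi>)"
    proof (rule sum.cong[OF refl])
      fix \<pi> assume "\<pi> \<in> {\<pi>. \<pi> permutes {..<?k}}"
      then have \<pi>: "permutation \<pi>" using permutation_permutes by blast
      have "sign (?t \<pi>) = - sign \<pi>"
        using vs(2) \<pi> by (simp add: sign_compose permutation_swap_id sign_swap_id)
      moreover have "vs ! ?t \<pi> n = vs ! \<pi> n" for n using vs(4) by (auto simp: Transposition.transpose_def)
      ultimately show "?F (?t \<pi>) = - ?F \<pi>" by simp
    qed
    finally show ?thesis using vs(1) by (simp add: coframe_wedge_def sum_negf)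
  qed
qed

lemma standard_G2_form_alternating: "alternating_form 3 (standard_G2_form e)"
proof -
  have "alternating_form 3 (coframe_wedge e [a, b, c])" for a b c
    using coframe_wedge_alternating[of "[a, b, c]" e] by (simp add: numeral_3_eq_3)
  then show ?thesis
    unfolding standard_G2_form_def[abs_def] by (intro alternating_form_add alternating_form_diff)
qed

text \<open>By transpositions of neighbours.\<close>
lemma alternating_form_move:
  assumes \<alpha>: "alternating_form k \<alpha>"
  shows "length xs = k \<Longrightarrow> s < k \<Longrightarrow> \<alpha> (y # omit s xs) = (-1) ^ s * \<alpha> (xs[s := y])"
proof (induction s arbitrary: xs)
  case 0
  then show ?case by (cases xs) (auto simp: omit_def)
next
  case (Suc s)
  let ?xs = "xs[s := xs ! Suc s, Suc s := xs ! s]"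
  have "omit (Suc s) xs = omit s ?xs"
  proof (rule nth_equalityI)
    fix n assume "n < length (omit (Suc s) xs)"
    then have n: "n < k - 1" using Suc.prems by (simp add: omit_def)
    then show "omit (Suc s) xs ! n = omit s ?xs ! n"
      using Suc.prems by (auto simp: omit_def nth_append nth_list_update min_def not_less less_Suc_eq)
  qed (use Suc.prems in \<open>simp add: omit_def\<close>)
  then have "\<alpha> (y # omit (Suc s) xs) = (-1) ^ s * \<alpha> (?xs[s := y])" using Suc by simp
  also have "?xs[s := y] = xs[s := y, Suc s := xs ! s]" by (simp add: list_update_swap)
  also have "\<alpha> (xs[s := y, Suc s := xs ! s]) = - \<alpha> (xs[s := xs ! s, Suc s := y])"
    using Suc.prems by (intro alternating_form_swap[OF \<alpha>]) auto
  also have "xs[s := xs ! s, Suc s := y] = xs[Suc s := y]" by simp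
  finally show ?case by simp
qed

lemma alternating_form_rotate:
  assumes \<alpha>: "alternating_form (Suc k) \<alpha>" and "length vs = k"
  shows "\<alpha> (y # vs) = (-1) ^ k * \<alpha> (vs @ [y])"
  using alternating_form_move[OF \<alpha>, of "vs @ [undefined]" k y] assms(2)
  by (simp add: omit_def list_update_append)

text \<open>Extend the nonzero difference to a basis.\<close>
lemma linear_functional_separates:
  fixes x y :: "'w::real_vector"
  assumes "\<And>l :: 'w \<Rightarrow> real. linear l \<Longrightarrow> l x = l y"
  shows "x = y"
proof (rule ccontr)
  assume "x \<noteq> y"
  then have "independent {x - y}" by (simp add: dependent_single)
  then obtain l :: "'w \<Rightarrow> real" where l: "linear l" "l (x - y) = 1"
    using linear_independent_extend[of "{x - y}" "\<lambda>_. 1"] by auto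
  then have "l x - l y = 1" by (simp add: linear_diff)
  then show False using assms[OF l(1)] by simp
qed

lemma length_omit: "i < length xs \<Longrightarrow> length (omit i xs) = length xs - 1"
  by (simp add: omit_def)

lemma nth_omit: "i < length xs \<Longrightarrow> s < length xs - 1 \<Longrightarrow> omit i xs ! s = (if s < i then xs ! s else xs ! Suc s)"
  by (auto simp: omit_def nth_append min_def)

lemma omit_omit: "i < j \<Longrightarrow> j < length xs \<Longrightarrow> omit i (omit j xs) = omit (j - 1) (omit i xs)"
  by (rule nth_equalityI) (auto simp: length_omit nth_omit split: if_splits)

lemma map_omit: "map h (omit i xs) = omit i (map h xs)"
  by (simp add: omit_def take_map drop_map)

text \<open>\<open>Y i j\<close> is the derivative of the \<open>j\<close>-th field along the \<open>i\<close>-th. Writing the brackets as \<open>Y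
  i j - Y j i\<close> and moving them into the slot that they came from yields the terms by which a
  covariant derivative corrects the derivative of the value.\<close>
lemma bracket_terms:
  fixes \<alpha> :: "real form"
  assumes \<alpha>: "alternating_form k \<alpha>" and vs: "length vs = Suc k"
  shows "(\<Sum>j<Suc k. \<Sum>i<j. (-1) ^ (i + j) * \<alpha> ((Y i j - Y j i) # omit i (omit j vs)))
    = - (\<Sum>i<Suc k. (-1) ^ i * (\<Sum>s<k. \<alpha> ((omit i vs)[s := Y i (if s < i then s else Suc s)])))"
proof -
  define T where "T i s y = (-1) ^ i * \<alpha> ((omit i vs)[s := y])" for i s y
  have len: "length (omit i vs) = k" if "i < Suc k" for i using that vs by (simp add: length_omit)
  have 1: "(-1) ^ (i + j) * \<alpha> ((Y i j - Y j i) # omit i (omit j vs)) = - T i (j - 1) (Y i j) - T j i (Y j i)"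
    if "i < j" "j < Suc k" for i j
  proof -
    have "linear (\<lambda>x. \<alpha> ((omit j vs)[i := x]))"
      using alternating_form_linear[OF \<alpha>] len that by simp
    then have "\<alpha> ((omit j vs)[i := Y i j - Y j i]) = \<alpha> ((omit j vs)[i := Y i j]) - \<alpha> ((omit j vs)[i := Y j i])"
      by (rule linear_diff)
    then have "\<alpha> ((Y i j - Y j i) # omit i (omit j vs)) = (-1) ^ i * (\<alpha> ((omit j vs)[i := Y i j]) - \<alpha> ((omit j vs)[i := Y j i]))"
      using alternating_form_move[OF \<alpha>, of "omit j vs" i] len that by (simp add: linear_diff)
    moreover have "(-1) ^ i * \<alpha> ((omit j vs)[i := Y i j]) = \<alpha> (Y i j # omit i (omit j vs))"
      using alternating_form_move[OF \<alpha>, of "omit j vs" i] len that by simp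
    moreover have "\<dots> = (-1) ^ (j - 1) * \<alpha> ((omit i vs)[j - 1 := Y i j])"
      using alternating_form_move[OF \<alpha>, of "omit i vs" "j - 1"] len that vs by (simp add: omit_omit)
    ultimately have e: "\<alpha> ((Y i j - Y j i) # omit i (omit j vs))
        = (-1) ^ (j - 1) * \<alpha> ((omit i vs)[j - 1 := Y i j]) - (-1) ^ i * \<alpha> ((omit j vs)[i := Y j i])"
      by (simp add: right_diff_distrib)
    obtain j' where j': "j = Suc j'" using \<open>i < j\<close> by (cases j) auto
    have "(-1 :: real) ^ (i + j) * (-1) ^ (j - 1) = - ((-1) ^ i)"
      by (simp add: j' power_add mult.assoc power_mult_distrib[symmetric])
    moreover have "(-1 :: real) ^ (i + j) * (-1) ^ i = (-1) ^ j"
      by (simp add: power_add mult.commute mult.left_commute power_mult_distrib[symmetric])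
    ultimately show ?thesis
      unfolding e T_def right_diff_distrib mult.assoc[symmetric] by simp
  qed
  have "(\<Sum>j<Suc k. \<Sum>i<j. (-1) ^ (i + j) * \<alpha> ((Y i j - Y j i) # omit i (omit j vs)))
      = (\<Sum>j<Suc k. \<Sum>i<j. - T i (j - 1) (Y i j) - T j i (Y j i))"
    by (intro sum.cong refl) (use 1 in auto)
  also have "\<dots> = - ((\<Sum>j<Suc k. \<Sum>i<j. T i (j - 1) (Y i j)) + (\<Sum>j<Suc k. \<Sum>i<j. T j i (Y j i)))"
    by (simp only: sum_subtractf sum_negf)
  also have "(\<Sum>j<Suc k. \<Sum>i<j. T i (j - 1) (Y i j)) = (\<Sum>i<Suc k. \<Sum>s\<in>{i..<k}. T i s (Y i (Suc s)))"
  proof -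
    have "(\<Sum>j<Suc k. \<Sum>i<j. T i (j - 1) (Y i j)) = (\<Sum>(j, i)\<in>Sigma {..<Suc k} lessThan. T i (j - 1) (Y i j))"
      by (rule sum.Sigma) auto
    also have "\<dots> = (\<Sum>(i, s)\<in>Sigma {..<Suc k} (\<lambda>i. {i..<k}). T i s (Y i (Suc s)))"
      by (rule sum.reindex_bij_witness[of _ "\<lambda>(i, s). (Suc s, i)" "\<lambda>(j, i). (i, j - 1)"]) auto
    also have "\<dots> = (\<Sum>i<Suc k. \<Sum>s\<in>{i..<k}. T i s (Y i (Suc s)))"
      by (rule sum.Sigma[symmetric]) auto
    finally show ?thesis .
  qed
  also have "\<dots> + (\<Sum>j<Suc k. \<Sum>i<j. T j i (Y j i)) = (\<Sum>i<Suc k. \<Sum>s<k. T i s (Y i (if s < i then s else Suc s)))"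
    unfolding sum.distrib[symmetric]
  proof (rule sum.cong[OF refl])
    fix i assume i: "i \<in> {..<Suc k}"
    then have un: "{..<k} = {..<i} \<union> {i..<k}" by auto
    have "(\<Sum>s<k. T i s (Y i (if s < i then s else Suc s)))
        = (\<Sum>s<i. T i s (Y i (if s < i then s else Suc s))) + (\<Sum>s\<in>{i..<k}. T i s (Y i (if s < i then s else Suc s)))"
      unfolding un by (rule sum.union_disjoint) auto
    then show "(\<Sum>s\<in>{i..<k}. T i s (Y i (Suc s))) + (\<Sum>s<i. T i s (Y i s)) = (\<Sum>s<k. T i s (Y i (if s < i then s else Suc s)))"
      by simp
  qed
  finally show ?thesis by (simp add: T_def sum_distrib_left)
qed

context riemannian_manifold7
begin

text \<open>The connection that acts on the form arguments is torsion-free, so the bracket terms are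
  the correction terms of \<open>cov_deriv\<close>, whatever the connection on the values.\<close>
lemma ext_cov_deriv_alternation:
  fixes \<alpha> :: "('a, 'w::real_vector) forms"
  assumes alt: "\<And>l :: 'w \<Rightarrow> real. linear l \<Longrightarrow> alternating_form k (\<lambda>vs. l (\<alpha> p vs))" and vs: "length vs = Suc k"
  shows "ext_cov_deriv nabW \<alpha> p vs = (\<Sum>i<Suc k. (-1) ^ i *\<^sub>R cov_deriv nabW \<alpha> p (vs ! i) (omit i vs))"
proof -
  define Y where "Y i j = nab (ext p (vs ! i)) (ext p (vs ! j)) p" for i j
  let ?A = "\<lambda>i. nabW (ext p (vs ! i)) (\<lambda>q. \<alpha> q (map (\<lambda>X. X q) (omit i (map (ext p) vs)))) p"
  have br: "lie_bracket (map (ext p) vs ! i) (map (ext p) vs ! j) p = Y i j - Y j i" if "i < Suc k" "j < Suc k" for i j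
    using that vs by (simp add: lie_bracket_nab ext Y_def)
  have cov: "cov_deriv nabW \<alpha> p (vs ! i) (omit i vs)
      = ?A i - (\<Sum>s<k. \<alpha> p ((omit i vs)[s := Y i (if s < i then s else Suc s)]))" if "i < Suc k" for i
    using that vs
    by (auto simp: cov_deriv_def length_omit nth_omit Y_def map_omit[symmetric] comp_def intro!: sum.cong)
  have "(\<Sum>j<Suc k. \<Sum>i<j. (-1) ^ (i + j) *\<^sub>R \<alpha> p ((Y i j - Y j i) # omit i (omit j vs)))
      = - (\<Sum>i<Suc k. (-1) ^ i *\<^sub>R (\<Sum>s<k. \<alpha> p ((omit i vs)[s := Y i (if s < i then s else Suc s)])))"
  proof (rule linear_functional_separates)
    fix l :: "'w \<Rightarrow> real" assume l: "linear l"
    show "l (\<Sum>j<Suc k. \<Sum>i<j. (-1) ^ (i + j) *\<^sub>R \<alpha> p ((Y i j - Y j i) # omit i (omit j vs)))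
      = l (- (\<Sum>i<Suc k. (-1) ^ i *\<^sub>R (\<Sum>s<k. \<alpha> p ((omit i vs)[s := Y i (if s < i then s else Suc s)]))))"
      using bracket_terms[OF alt[OF l] vs, of Y]
      by (simp only: linear_neg[OF l] linear_sum[OF l] linear_scale[OF l] real_scaleR_def)
  qed
  then have "(\<Sum>j<Suc k. \<Sum>i<j. (-1) ^ (i + j) *\<^sub>R \<alpha> p (lie_bracket (map (ext p) vs ! i) (map (ext p) vs ! j) p # omit i (omit j vs)))
      = - (\<Sum>i<Suc k. (-1) ^ i *\<^sub>R (\<Sum>s<k. \<alpha> p ((omit i vs)[s := Y i (if s < i then s else Suc s)])))"
    using br by (simp cong: sum.cong_simp)
  then show ?thesis
    using vs unfolding ext_cov_deriv_def Let_def
    by (simp add: cov scaleR_diff_right sum_subtractf cong: sum.cong_simp del: sum.lessThan_Suc)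
qed

end

section \<open>The three-form of a torsion-free \<open>G\<^sub>2\<close> structure is parallel\<close>

lemma alternating_form_prefix:
  assumes "alternating_form (m + k) \<alpha>" "length us = m"
  shows "alternating_form k (\<lambda>vs. \<alpha> (us @ vs))"
  unfolding alternating_form_def
proof (intro conjI allI impI)
  show "\<alpha> (us @ vs) = 0" if "length vs \<noteq> k" for vs
    using assms that unfolding alternating_form_def by auto
  show "linear (\<lambda>x. \<alpha> (us @ vs[i := x]))" if "length vs = k" "i < k" for vs i
    using alternating_form_linear[OF assms(1), of "us @ vs" "m + i"] assms(2) that by (simp add: list_update_append)
  show "\<alpha> (us @ vs) = 0" if "length vs = k" "i < j" "j < k" "vs ! i = vs ! j" for vs i j
    using alternating_form_repeat[OF assms(1), of "us @ vs" "m + i" "m + j"] assms(2) that by (simp add: nth_append)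
qed

lemma alternating_form_suffix:
  assumes "alternating_form (k + m) \<alpha>" "length us = m"
  shows "alternating_form k (\<lambda>vs. \<alpha> (vs @ us))"
  unfolding alternating_form_def
proof (intro conjI allI impI)
  show "\<alpha> (vs @ us) = 0" if "length vs \<noteq> k" for vs
    using assms that unfolding alternating_form_def by auto
  show "linear (\<lambda>x. \<alpha> (vs[i := x] @ us))" if "length vs = k" "i < k" for vs i
    using alternating_form_linear[OF assms(1), of "vs @ us" i] assms(2) that by (simp add: list_update_append)
  show "\<alpha> (vs @ us) = 0" if "length vs = k" "i < j" "j < k" "vs ! i = vs ! j" for vs i j
    using alternating_form_repeat[OF assms(1), of "vs @ us" i j] assms(2) that by (simp add: nth_append)
qed

lemma coframe_wedge_frame:
  assumes "\<And>i j. blinfun_apply (e i) (E j) = (if i = j then 1 else 0)" "length ks = length js"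
  shows "coframe_wedge e js (map E ks) = (\<Sum>\<pi> | \<pi> permutes {..<length js}.
    of_int (sign \<pi>) * (\<Prod>n<length js. if js ! n = ks ! \<pi> n then 1 else 0))"
proof -
  have "(\<Prod>n<length js. blinfun_apply (e (js ! n)) (map E ks ! \<pi> n)) = (\<Prod>n<length js. if js ! n = ks ! \<pi> n then 1 else 0)"
    if \<pi>: "\<pi> permutes {..<length js}" for \<pi>
  proof (rule prod.cong[OF refl])
    fix n assume "n \<in> {..<length js}"
    then show "blinfun_apply (e (js ! n)) (map E ks ! \<pi> n) = (if js ! n = ks ! \<pi> n then 1 else 0)"
      using permutes_in_image[OF \<pi>, of n] assms by simp
  qed
  then show ?thesis using assms(2) by (simp add: coframe_wedge_def)
qed

lemma distinct_7_nth:
  fixes ks :: "7 list"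
  assumes "distinct ks" "length ks = 7"
  obtains t where "t < 7" "ks ! t = m"
proof -
  have "set ks = UNIV" using distinct_card[OF assms(1)] assms(2) by (intro card_subset_eq) auto
  then have "m \<in> set ks" by simp
  then show ?thesis using that assms(2) by (auto simp: in_set_conv_nth)
qed

lemma alternating_form_sum:
  "(\<And>a. a \<in> A \<Longrightarrow> alternating_form k (f a)) \<Longrightarrow> alternating_form k (\<lambda>vs. \<Sum>a\<in>A. f a vs)"
proof (induction A rule: infinite_finite_induct)
  case (insert a A)
  then show ?case using alternating_form_add[of k "f a" "\<lambda>vs. \<Sum>a\<in>A. f a vs"] by simp
qed (auto simp: alternating_form_def linear_zero)

context smooth_manifold7
begin

lemma alternating_multilin: "alternating_form k \<alpha> \<Longrightarrow> multilin k \<alpha>"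
  by (simp add: multilin_def alternating_form_def)

lemma smooth_fun_on_coframe_wedge:
  assumes "open U" "\<And>X i. X \<in> vector_fields \<Longrightarrow> smooth_fun_on U (\<lambda>q. blinfun_apply (e q i) (X q))"
    and Xs: "set Xs \<subseteq> vector_fields"
  shows "smooth_fun_on U (\<lambda>q. coframe_wedge (e q) js (ev q Xs))"
proof (cases "length Xs = length js")
  case True
  have "smooth_fun_on U (\<lambda>q. \<Sum>\<pi> | \<pi> permutes {..<length js}. of_int (sign \<pi>) * (\<Prod>n<length js. blinfun_apply (e q (js ! n)) ((Xs ! \<pi> n) q)))"
  proof (intro smooth_fun_on_sum smooth_fun_on_mult smooth_fun_on_const smooth_fun_on_prod assms(1,2))
    fix \<pi> n assume "\<pi> \<in> {\<pi>. \<pi> permutes {..<length js}}" "n \<in> {..<length js}"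
    then have "\<pi> n < length Xs" using permutes_in_image[of \<pi> "{..<length js}" n] True by auto
    then show "Xs ! \<pi> n \<in> vector_fields" using Xs nth_mem by blast
  qed
  moreover have "(\<Sum>\<pi> | \<pi> permutes {..<length js}. of_int (sign \<pi>) * (\<Prod>n<length js. blinfun_apply (e q (js ! n)) ((Xs ! \<pi> n) q)))
      = coframe_wedge (e q) js (ev q Xs)" for q
  proof -
    have "ev q Xs ! \<pi> n = (Xs ! \<pi> n) q" if "\<pi> permutes {..<length js}" "n < length js" for \<pi> n
      using permutes_in_image[OF that(1), of n] that(2) True by simp
    then show ?thesis using True by (simp add: coframe_wedge_def)
  qed
  ultimately show ?thesis by simp
qed (simp add: coframe_wedge_def smooth_fun_on_const)

end

lemma (in riemannian_manifold7) multilin_basis_zero: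
  assumes b: "orthonormal p b"
  shows "multilin n F \<Longrightarrow> (\<And>ks. ks \<in> ils n \<Longrightarrow> F (map b ks) = 0) \<Longrightarrow> length vs = n \<Longrightarrow> F vs = 0"
proof (induction n arbitrary: F vs)
  case (Suc n)
  obtain v ws where vs: "vs = v # ws" "length ws = n" using Suc.prems(3) by (cases vs) auto
  have "F (b i # ws) = 0" for i
    by (rule Suc.IH[OF multilin_Cons[OF Suc.prems(1)] _ vs(2)]) (use Suc.prems(2)[of "i # _"] in simp)
  then show ?case
    using orthonormal_expansion_linear[OF b multilin_Cons_linear[OF Suc.prems(1) vs(2)], of v] by (simp add: vs)
qed simp

context g2_manifold
begin

lemma adapted_frameD:
  assumes "adapted_frame p E e N"
  shows "E i \<in> vector_fields" "open N" "p \<in> N"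
    "q \<in> N \<Longrightarrow> blinfun_apply (e q i) (E j q) = (if i = j then 1 else 0)"
    "q \<in> N \<Longrightarrow> vol q = coframe_wedge (e q) [1,2,3,4,5,6,7]"
    "q \<in> N \<Longrightarrow> \<phi> q = standard_G2_form (e q)"
    "q \<in> N \<Longrightarrow> g q u v = (SUM7 i. blinfun_apply (e q i) u * blinfun_apply (e q i) v)"
    "q \<in> N \<Longrightarrow> orthonormal q (\<lambda>i. E i q)"
  using assms adapted_frame_orthonormal[OF assms] by (auto simp: adapted_frame_def)

lemma phi_alternating: "alternating_form 3 (\<phi> p)"
proof -
  obtain E e N where E: "adapted_frame p E e N" by (rule adapted_frame_exists)
  show ?thesis
    unfolding adapted_frameD(6)[OF E adapted_frameD(3)[OF E]] by (rule standard_G2_form_alternating)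
qed

lemma vol_alternating: "alternating_form 7 (vol p)"
proof -
  obtain E e N where E: "adapted_frame p E e N" by (rule adapted_frame_exists)
  show ?thesis
    unfolding adapted_frameD(5)[OF E adapted_frameD(3)[OF E]]
    using coframe_wedge_alternating[of "[1,2,3,4,5,6,7]"] by (simp add: eval_nat_numeral)
qed

lemma adapted_coframe_smooth:
  assumes E: "adapted_frame p E e N" and X: "X \<in> vector_fields"
  shows "smooth_fun_on N (\<lambda>q. blinfun_apply (e q i) (X q))"
proof -
  have "smooth_fun_on N (\<lambda>q. g q (E i q) (X q))"
    using metric_smooth[OF adapted_frameD(1)[OF E] X] by (rule smooth_funs_on)
  then show ?thesis
    by (rule iffD1[OF smooth_fun_on_cong[OF adapted_frameD(2)[OF E]], rotated])
      (simp add: adapted_frameD(4,7)[OF E] if_distrib[where f="\<lambda>x. x * _"] cong: if_cong)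
qed

lemma tensor_phi: "tensor 3 \<phi>" and tensor_vol: "tensor 7 vol"
proof -
  have 1: "(\<lambda>q. \<phi> q (ev q Xs)) \<in> smooth_funs" and 2: "(\<lambda>q. vol q (ev q Xs)) \<in> smooth_funs"
    if Xs: "set Xs \<subseteq> vector_fields" for Xs
  proof -
    have "\<exists>V. open V \<and> p \<in> V \<and> smooth_fun_on V (\<lambda>q. \<phi> q (ev q Xs))" for p
    proof -
      obtain E e N where E: "adapted_frame p E e N" by (rule adapted_frame_exists)
      note N = adapted_frameD(2)[OF E]
      note w = smooth_fun_on_coframe_wedge[OF N adapted_coframe_smooth[OF E] Xs]
      have "smooth_fun_on N (\<lambda>q. standard_G2_form (e q) (ev q Xs))"
        unfolding standard_G2_form_def by (intro smooth_fun_on_add smooth_fun_on_diff N w)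
      then have "smooth_fun_on N (\<lambda>q. \<phi> q (ev q Xs))"
        by (rule iffD1[OF smooth_fun_on_cong[OF N], rotated]) (simp add: adapted_frameD(6)[OF E])
      then show ?thesis using adapted_frameD(2,3)[OF E] by blast
    qed
    then show "(\<lambda>q. \<phi> q (ev q Xs)) \<in> smooth_funs" unfolding smooth_funs_def by (auto intro: smooth_fun_on_local)
    have "\<exists>V. open V \<and> p \<in> V \<and> smooth_fun_on V (\<lambda>q. vol q (ev q Xs))" for p
    proof -
      obtain E e N where E: "adapted_frame p E e N" by (rule adapted_frame_exists)
      note N = adapted_frameD(2)[OF E]
      have "smooth_fun_on N (\<lambda>q. vol q (ev q Xs))"
        by (rule iffD1[OF smooth_fun_on_cong[OF N] smooth_fun_on_coframe_wedge[OF N adapted_coframe_smooth[OF E] Xs]])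
          (simp add: adapted_frameD(5)[OF E])
      then show ?thesis using adapted_frameD(2,3)[OF E] by blast
    qed
    then show "(\<lambda>q. vol q (ev q Xs)) \<in> smooth_funs" unfolding smooth_funs_def by (auto intro: smooth_fun_on_local)
  qed
  show "tensor 3 \<phi>" "tensor 7 vol"
    using 1 2 alternating_multilin[OF phi_alternating] alternating_multilin[OF vol_alternating]
    by (auto simp: tensor_def)
qed

lemma phi_swap: "\<phi> p [y, x, z] = - \<phi> p [x, y, z]" "\<phi> p [x, z, y] = - \<phi> p [x, y, z]"
  using alternating_form_swap[OF phi_alternating, of "[x, y, z]" 0 1 p y x]
    alternating_form_swap[OF phi_alternating, of "[x, y, z]" 1 2 p z y] by simp_all

lemma phi_linear: "linear (\<lambda>x. \<phi> p [x, y, z])" "linear (\<lambda>y. \<phi> p [x, y, z])" "linear (\<lambda>z. \<phi> p [x, y, z])"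
  using alternating_form_linear[OF phi_alternating, of "[x, y, z]" 0 p]
    alternating_form_linear[OF phi_alternating, of "[x, y, z]" 1 p]
    alternating_form_linear[OF phi_alternating, of "[x, y, z]" 2 p] by simp_all

lemma phi_polar:
  assumes b: "orthonormal p b"
  shows "(SUM7 n. \<phi> p [b n, x, y] * \<phi> p [b n, z, w]) + (SUM7 n. \<phi> p [b n, z, y] * \<phi> p [b n, x, w])
    = 2 * (g p x z * g p y w) - g p x y * g p z w - g p z y * g p x w"
proof -
  obtain E e N where E: "adapted_frame p E e N" by (rule adapted_frame_exists)
  note p = adapted_frameD(3)[OF E]
  note ob = adapted_frameD(8)[OF E p]
  have ch: "(SUM7 n. \<phi> p [b n, x, y] * \<phi> p [b n, z, w]) = (SUM7 n. \<phi> p [E n p, x, y] * \<phi> p [E n p, z, w])" for x y z w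
    by (rule orthonormal_contraction[OF b ob, where h="\<lambda>u v. \<phi> p [u, x, y] * \<phi> p [v, z, w]"])
      (use phi_linear in \<open>simp_all add: linear_iff algebra_simps\<close>)
  show ?thesis
    unfolding ch unfolding adapted_frameD(6)[OF E p] adapted_frameD(7)[OF E p]
    by (rule standard_G2_polar[where E="\<lambda>i. E i p"]) (rule adapted_frameD(4)[OF E p])
qed

lemma phi_array: "orthonormal p b \<Longrightarrow> g2_array (\<lambda>i j k. \<phi> p [b i, b j, b k])"
proof unfold_locales
  assume b: "orthonormal p b"
  show "\<phi> p [b j, b i, b k] = - \<phi> p [b i, b j, b k]" "\<phi> p [b i, b k, b j] = - \<phi> p [b i, b j, b k]" for i j k
    by (rule phi_swap)+
  show "(SUM7 n. \<phi> p [b n, b i, b j] * \<phi> p [b n, b k, b l]) + (SUM7 n. \<phi> p [b n, b k, b j] * \<phi> p [b n, b i, b l])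
      = 2 * (kd i k * kd j l) - kd i j * kd k l - kd k j * kd i l" for i j k l
    using phi_polar[OF b, of "b i" "b j" "b k" "b l"] by (simp only: kd_def orthonormal_g[OF b])
qed

text \<open>The components of the three-form and of the volume form in an adapted frame are constant, so
  that their covariant derivatives come from rotating the frame.\<close>
lemma adapted_frame_derivatives:
  assumes E: "adapted_frame p E e N"
  defines "b \<equiv> \<lambda>i. E i p" and "w \<equiv> \<lambda>a i m. g p (nab (E a) (E i) p) (E m p)"
  shows "w a m i = - w a i m"
    and "nabla \<phi> p [b a, b i, b j, b k] = g2_array.act (\<lambda>i j k. \<phi> p [b i, b j, b k]) (\<lambda>i m. - w a i m) i j k"
    and "ks \<in> ils 7 \<Longrightarrow> nabla vol p (b a # map b ks) = - (\<Sum>s<7. SUM7 m. w a (ks ! s) m * vol p (map b (ks[s := m])))"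
proof -
  note D = adapted_frameD[OF E]
  have ob: "orthonormal p b" unfolding b_def by (rule D(8)[OF D(3)])
  have B: "nab (E a) (E i) p = (SUM7 m. w a i m *\<^sub>R b m)" for a i
    unfolding w_def using orthonormal_expansion[OF ob, of "nab (E a) (E i) p"] by (simp add: b_def)
  have "deriv_along (E a) (\<lambda>q. g q (E i q) (E m q)) p = deriv_along (E a) (\<lambda>q. if i = m then 1 else 0) p" for a i m
    by (rule deriv_along_cong[OF D(2,3)]) (simp add: orthonormal_g[OF D(8)])
  then show skew: "w a m i = - w a i m" for a i m
    using nab_metric[OF D(1) D(1) D(1), of a i m p]
    by (simp add: deriv_along_const w_def metric_sym[of p "E i p"])
  have c\<phi>: "\<phi> q (ev q [E i, E j, E k]) = \<phi> p (ev p [E i, E j, E k])" if "q \<in> N" for q i j k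
    using that D(3) by (simp add: D(6) standard_G2_form_def coframe_wedge_3 D(4))
  have "nabla \<phi> p (E a p # ev p [E i, E j, E k]) = nabla_field \<phi> p (E a # [E i, E j, E k])"
    by (rule nabla_eq[OF tensor_phi]) (use D(1) in auto)
  also have "deriv_along (E a) (\<lambda>q. \<phi> q (ev q [E i, E j, E k])) p = 0"
    using deriv_along_cong[OF D(2,3) c\<phi>] by (simp add: deriv_along_const)
  then have "nabla_field \<phi> p (E a # [E i, E j, E k])
     = - (\<phi> p [nab (E a) (E i) p, b j, b k] + \<phi> p [b i, nab (E a) (E j) p, b k] + \<phi> p [b i, b j, nab (E a) (E k) p])"
    by (simp add: nabla_field_def b_def numeral_3_eq_3 lessThan_Suc)
  also have "\<dots> = g2_array.act (\<lambda>i j k. \<phi> p [b i, b j, b k]) (\<lambda>i m. - w a i m) i j k"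
    unfolding B g2_array.act_def[OF phi_array[OF ob]]
    by (simp add: linear_sum[OF phi_linear(1)] linear_sum[OF phi_linear(2)] linear_sum[OF phi_linear(3)]
      linear_scale[OF phi_linear(1)] linear_scale[OF phi_linear(2)] linear_scale[OF phi_linear(3)]
      sum.distrib sum_negf sum_subtractf)
  finally show "nabla \<phi> p [b a, b i, b j, b k] = g2_array.act (\<lambda>i j k. \<phi> p [b i, b j, b k]) (\<lambda>i m. - w a i m) i j k"
    by (simp add: b_def)
  show "nabla vol p (b a # map b ks) = - (\<Sum>s<7. SUM7 m. w a (ks ! s) m * vol p (map b (ks[s := m])))" if ks: "ks \<in> ils 7"
  proof -
    have cv: "vol q (ev q (map E ks)) = vol p (ev p (map E ks))" if "q \<in> N" for q
    proof -
      have len: "length ks = length [1, 2, 3, 4, 5, 6, 7 :: 7]" using ks by simp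
      have "coframe_wedge (e q) [1,2,3,4,5,6,7] (map (\<lambda>i. E i q) ks) = coframe_wedge (e p) [1,2,3,4,5,6,7] (map (\<lambda>i. E i p) ks)"
        using coframe_wedge_frame[of "e q" "\<lambda>i. E i q", OF D(4)[OF that] len]
          coframe_wedge_frame[of "e p" "\<lambda>i. E i p", OF D(4)[OF D(3)] len] by (simp only:)
      then show ?thesis by (simp only: D(5)[OF that] D(5)[OF D(3)] map_map comp_def)
    qed
    have "nabla vol p (E a p # ev p (map E ks)) = nabla_field vol p (E a # map E ks)"
      by (rule nabla_eq[OF tensor_vol]) (use D(1) ks in auto)
    moreover have "deriv_along (E a) (\<lambda>q. vol q (ev q (map E ks))) p = 0"
      using deriv_along_cong[OF D(2,3) cv] by (simp add: deriv_along_const)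
    ultimately have "nabla vol p (b a # map b ks) = - (\<Sum>s<7. vol p ((map b ks)[s := nab (E a) (E (ks ! s)) p]))"
      using ks by (simp add: nabla_field_def b_def comp_def)
    also have "(\<Sum>s<7. vol p ((map b ks)[s := nab (E a) (E (ks ! s)) p])) = (\<Sum>s<7. SUM7 m. w a (ks ! s) m * vol p (map b (ks[s := m])))"
    proof (rule sum.cong[OF refl])
      fix s :: nat assume "s \<in> {..<7}"
      then show "vol p ((map b ks)[s := nab (E a) (E (ks ! s)) p]) = (SUM7 m. w a (ks ! s) m * vol p (map b (ks[s := m])))"
        unfolding B using multilin_sum[OF tensor_multilin[OF tensor_vol], of "map b ks" s p] ks by (simp add: map_update)
    qed
    finally show ?thesis .
  qed
qed

text \<open>The matrix that rotates the frame is skew, hence traceless, and a top form sees the trace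
  only.\<close>
lemma nabla_vol_zero:
  assumes "length vs = 7" shows "nabla vol p (v # vs) = 0"
proof -
  obtain E e N where E: "adapted_frame p E e N" by (rule adapted_frame_exists)
  define b where "b i = E i p" for i
  define w where "w a i m = g p (nab (E a) (E i) p) (E m p)" for a i m
  have ob: "orthonormal p b" unfolding b_def using adapted_frameD(3,8)[OF E] by blast
  note skew = adapted_frame_derivatives(1)[OF E, folded w_def]
  have "nabla vol p (map b (a # ks)) = 0" if ks: "ks \<in> ils 7" for a ks
  proof -
    have val: "nabla vol p (map b (a # ks)) = - (\<Sum>s<7. SUM7 m. w a (ks ! s) m * vol p (map b (ks[s := m])))"
      using adapted_frame_derivatives(3)[OF E ks, of a] by (simp add: b_def[abs_def] w_def)
    have nd: "vol p (map b ls) = 0" if "length ls = 7" "\<not> distinct ls" for ls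
      using that by (intro alternating_form_not_distinct[OF vol_alternating]) (auto simp: distinct_map)
    show ?thesis
    proof (cases "distinct ks")
      case True
      have z: "w a (ks ! s) m * vol p (map b (ks[s := m])) = 0" if s: "s < 7" for s m
      proof (cases "m = ks ! s")
        case True
        then show ?thesis using skew[of a "ks ! s" "ks ! s"] by simp
      next
        case False
        have "length ks = 7" using ks by simp
        then obtain t where t: "t < 7" "ks ! t = m" using distinct_7_nth[OF \<open>distinct ks\<close>] by blast
        then have ts: "t \<noteq> s" using False by auto
        then have "ks[s := m] ! s = ks[s := m] ! t" using t s ks by simp
        then have "\<not> distinct (ks[s := m])"
          using nth_eq_iff_index_eq[of "ks[s := m]" s t] t(1) s ks ts by auto
        then show ?thesis using nd[of "ks[s := m]"] ks by simp
      qed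
      show ?thesis unfolding val neg_equal_0_iff_equal by (intro sum.neutral ballI) (use z in auto)
    next
      case False
      then obtain s t where st: "s < 7" "t < 7" "s \<noteq> t" "ks ! s = ks ! t"
        using ks by (auto simp: distinct_conv_nth)
      let ?f = "\<lambda>s. SUM7 m. w a (ks ! s) m * vol p (map b (ks[s := m]))"
      have "?f r = 0" if "r < 7" "r \<noteq> s" "r \<noteq> t" for r
      proof -
        have "ks[r := m] ! s = ks[r := m] ! t" for m using st that ks by simp
        then have "\<not> distinct (ks[r := m])" for m
          using nth_eq_iff_index_eq[of "ks[r := m]" s t] st ks by auto
        then show ?thesis using nd ks by simp
      qed
      then have "(\<Sum>r<7. ?f r) = (\<Sum>r\<in>{s, t}. ?f r)"
        using st by (intro sum.mono_neutral_right) auto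
      also have "\<dots> = ?f s + ?f t" using st by simp
      also have "?f t = - ?f s"
      proof -
        have "vol p (map b (ks[t := m])) = - vol p (map b (ks[s := m]))" for m
        proof -
          have "vol p ((map b ks)[s := b (ks ! s), t := b m]) = - vol p ((map b ks)[s := b m, t := b (ks ! s)])"
            by (rule alternating_form_swap[OF vol_alternating]) (use st ks in auto)
          moreover have "(map b ks)[s := b (ks ! s)] = map b ks"
            using st ks by (intro list_update_same_conv[THEN iffD2]) auto
          moreover have "(map b ks)[s := b m, t := b (ks ! s)] = map b (ks[s := m])"
            using st ks by (simp add: map_update list_update_swap[of s t])
              (metis length_map list_update_id nth_map)
          ultimately show ?thesis by (simp add: map_update)
        qed
        then show ?thesis using st by (simp add: sum_negf)
      qed
      finally show ?thesis unfolding val by simp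
    qed
  qed
  then have "nabla vol p (map b ks) = 0" if "ks \<in> ils 8" for ks using that by (cases ks) auto
  then show ?thesis
    using multilin_basis_zero[OF ob, of 8 "nabla vol p" "v # vs"] tensor_multilin[OF tensor_nabla[OF tensor_vol], of p] assms by simp
qed

lemma vol_nonzero:
  assumes E: "adapted_frame p E e N" and ks: "distinct ks" "length ks = 7"
  shows "vol p (map (\<lambda>i. E i p) ks) \<noteq> 0"
proof -
  note D = adapted_frameD[OF E]
  define js :: "7 list" where "js = [1,2,3,4,5,6,7]"
  have js: "distinct js" "length js = 7" "set js = UNIV" unfolding js_def using distinct_7 set_7 by simp_all
  define \<pi>0 where "\<pi>0 n = (if n < 7 then (THE m. m < 7 \<and> ks ! m = js ! n) else n)" for n
  have \<pi>0: "\<pi>0 n < 7" "ks ! \<pi>0 n = js ! n" if n: "n < 7" for n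
  proof -
    obtain m where m: "m < 7" "ks ! m = js ! n" using distinct_7_nth[OF ks, of "js ! n"] .
    have "\<exists>!m. m < 7 \<and> ks ! m = js ! n"
    proof (rule ex1I[of _ m])
      fix m' assume "m' < 7 \<and> ks ! m' = js ! n"
      then show "m' = m" using m nth_eq_iff_index_eq[OF ks(1), of m' m] ks(2) by simp
    qed (use m in simp)
    from theI'[OF this] show "\<pi>0 n < 7" "ks ! \<pi>0 n = js ! n" using n by (auto simp: \<pi>0_def)
  qed
  have perm: "\<pi>0 permutes {..<7}"
  proof (rule bij_imp_permutes)
    have "inj_on \<pi>0 {..<7}"
    proof (rule inj_onI)
      fix m n assume "m \<in> {..<7}" "n \<in> {..<7}" "\<pi>0 m = \<pi>0 n"
      then have "js ! m = js ! n" "m < 7" "n < 7" using \<pi>0(2)[of m] \<pi>0(2)[of n] by auto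
      then show "m = n" using js by (simp add: nth_eq_iff_index_eq)
    qed
    moreover from this have "\<pi>0 ` {..<7} = {..<7}" by (intro endo_inj_surj) (use \<pi>0(1) in auto)
    ultimately show "bij_betw \<pi>0 {..<7} {..<7}" by (simp add: bij_betw_def)
  qed (simp add: \<pi>0_def)
  let ?F = "\<lambda>\<pi>. of_int (sign \<pi>) * (\<Prod>n<7. if js ! n = ks ! \<pi> n then 1 else 0) :: real"
  have "vol p (map (\<lambda>i. E i p) ks) = (\<Sum>\<pi> | \<pi> permutes {..<7}. ?F \<pi>)"
    unfolding D(5)[OF D(3)] js_def[symmetric]
    using coframe_wedge_frame[of "e p" "\<lambda>i. E i p" ks js, OF D(4)[OF D(3)]] ks js by simp
  also have "\<dots> = (\<Sum>\<pi>\<in>{\<pi>0}. ?F \<pi>)"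
  proof (rule sum.mono_neutral_right)
    show "\<forall>\<pi>\<in>{\<pi>. \<pi> permutes {..<7}} - {\<pi>0}. ?F \<pi> = 0"
    proof
      fix \<pi> assume "\<pi> \<in> {\<pi>. \<pi> permutes {..<7::nat}} - {\<pi>0}"
      then have \<pi>: "\<pi> permutes {..<7}" "\<pi> \<noteq> \<pi>0" by auto
      then obtain n where n: "\<pi> n \<noteq> \<pi>0 n" by auto
      then have n7: "n < 7" using permutes_not_in[OF \<pi>(1), of n] permutes_not_in[OF perm, of n] by (cases "n < 7") auto
      have "\<pi> n < 7" using permutes_in_image[OF \<pi>(1), of n] n7 by auto
      then have "js ! n \<noteq> ks ! \<pi> n" using \<pi>0[OF n7] n ks by (metis nth_eq_iff_index_eq)
      then have "(\<Prod>n<7. if js ! n = ks ! \<pi> n then 1 else 0 :: real) = 0" using n7 by (intro prod_zero) auto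
      then show "?F \<pi> = 0" by simp
    qed
  qed (use perm in \<open>auto simp: finite_permutations\<close>)
  also have "\<dots> = of_int (sign \<pi>0)" using \<pi>0 by simp
  finally show ?thesis by (simp add: sign_def)
qed

end

lemma alternating_form_linear_image:
  assumes "alternating_form k \<alpha>" "linear (l :: real \<Rightarrow> real)"
  shows "alternating_form k (\<lambda>vs. l (\<alpha> vs))"
  using assms linear_compose[OF _ assms(2)] unfolding alternating_form_def
  by (auto simp: linear_0[OF assms(2)] comp_def)

lemma (in riemannian_manifold7) ext_deriv_nabla:
  assumes "alternating_form k (\<alpha> p)" "length vs = Suc k"
  shows "ext_cov_deriv deriv_along \<alpha> p vs = (\<Sum>i<Suc k. (-1) ^ i * nabla \<alpha> p (vs ! i # omit i vs))"
  using ext_cov_deriv_alternation[of k \<alpha> p vs deriv_along] alternating_form_linear_image[OF assms(1)] assms(2)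
  by (simp add: nabla_def del: sum.lessThan_Suc)

context g2_manifold
begin

lemma sum_complement:
  fixes G :: "7 \<Rightarrow> real"
  assumes "set Y \<union> {a, b, c} = UNIV" "distinct [a, b, c]" "\<And>i. i \<in> set Y \<Longrightarrow> G i = 0"
  shows "(SUM7 i. G i) = G a + G b + G c"
proof -
  have "(SUM7 i. G i) = (\<Sum>i\<in>{a, b, c}. G i)"
    using assms(1,3) by (intro sum.mono_neutral_right) auto
  then show ?thesis using assms(2) by (simp add: add.assoc)
qed

text \<open>The factor \<open>G\<close> vanishes on every index of \<open>Y\<close>, so only the six permutations of \<open>a, b, c\<close>
  contribute.\<close>
lemma sum_complementary_triple:
  fixes F G :: "7 list \<Rightarrow> real"
  assumes Y: "set Y \<union> {a, b, c} = UNIV" "distinct [a, b, c]"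
    and F: "\<And>x y z. F [y, x, z] = - F [x, y, z]" "\<And>x y z. F [x, z, y] = - F [x, y, z]"
    and G: "\<And>x y z. G [y, x, z] = - G [x, y, z]" "\<And>x y z. G [x, z, y] = - G [x, y, z]"
    and G0: "\<And>x y z. x \<in> set Y \<Longrightarrow> G [x, y, z] = 0"
  shows "(\<Sum>js\<in>ils 3. F js * G js) = 6 * (F [a, b, c] * G [a, b, c])"
proof -
  define H where "H x y z = F [x, y, z] * G [x, y, z]" for x y z
  have H1: "H y x z = H x y z" and H2: "H x z y = H x y z" for x y z
    unfolding H_def using F(1)[of x y z] G(1)[of x y z] F(2)[of x y z] G(2)[of x y z] by auto
  have Gr: "G [x, x, z] = 0" for x z using G(1)[of x x z] by simp
  then have Hr: "H x x z = 0" for x z by (simp add: H_def)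
  have Hr2: "H x z z = 0" "H x z x = 0" for x z using Hr H1 H2 by metis+
  have Z: "H x y z = 0" if "x \<in> set Y \<or> y \<in> set Y \<or> z \<in> set Y" for x y z
  proof -
    have 0: "H x y z = 0" if "x \<in> set Y" for x y z using G0[OF that] by (simp add: H_def)
    show ?thesis using that 0[of x y z] 0[of y x z] 0[of z x y] H1[of x y z] H2[of x y z] H1[of x z y] by auto
  qed
  have "(\<Sum>js\<in>ils 3. F js * G js) = (SUM7 x y z. H x y z)"
    by (simp add: numeral_3_eq_3 sum_ils_Suc H_def)
  also have "\<dots> = (SUM7 x y. H x y a + H x y b + H x y c)"
    by (intro sum.cong refl sum_complement[OF Y]) (use Z in auto)
  also have "\<dots> = (SUM7 x. H x b a + H x c a + (H x a b + H x c b) + (H x a c + H x b c))"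
    by (intro sum.cong refl, subst sum_complement[OF Y]) (use Z in \<open>auto simp: Hr2\<close>)
  also have "\<dots> = 6 * H a b c"
  proof (subst sum_complement[OF Y])
    show "H x b a + H x c a + (H x a b + H x c b) + (H x a c + H x b c) = 0" if "x \<in> set Y" for x
      using Z that by simp
    have "H a c b = H a b c" "H b a c = H a b c" "H b c a = H a b c" "H c a b = H a b c" "H c b a = H a b c"
      using H1[of a b c] H2[of a b c] H2[of b a c] H1[of a c b] H2[of c a b] by auto
    then show "H a b a + H a c a + (H a a b + H a c b) + (H a a c + H a b c) +
      (H b b a + H b c a + (H b a b + H b c b) + (H b a c + H b b c)) +
      (H c b a + H c c a + (H c a b + H c c b) + (H c a c + H c b c)) = 6 * H a b c"
      by (simp add: Hr Hr2)
  qed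
  finally show ?thesis by (simp add: H_def)
qed

lemma psi_contract: "length vs = 4 \<Longrightarrow> \<psi> p vs = 1/6 * contract 0 3 \<phi> vol p vs"
proof -
  assume vs: "length vs = 4"
  have rot: "vol p (y # ws) = vol p (ws @ [y])" if "length ws = 6" for y ws
    using alternating_form_rotate[of 6 "vol p" ws y] vol_alternating[of p] that by simp
  have "vol p (map (onb p) js @ vs) = vol p (vs @ map (onb p) js)" if "js \<in> ils 3" for js
  proof -
    obtain a b c where "js = [a, b, c]" using \<open>js \<in> ils 3\<close> by (auto simp: numeral_3_eq_3 length_Suc_conv)
    then show ?thesis
      using rot[of "onb p b # onb p c # vs" "onb p a"] rot[of "onb p c # vs @ [onb p a]" "onb p b"]
        rot[of "vs @ [onb p a, onb p b]" "onb p c"] vs by simp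
  qed
  then have "(\<Sum>js\<in>ils 3. \<phi> p (map (onb p) js) * vol p (map (onb p) js @ vs)) = contract 0 3 \<phi> vol p vs"
    unfolding contract_def by simp
  then show ?thesis by (simp add: \<psi>_def hodge3_def fact_numeral)
qed

lemma psi_alternating: "alternating_form 4 (\<psi> p)"
proof -
  have "alternating_form 4 (\<lambda>vs. vol p (map (onb p) js @ vs))" if "js \<in> ils 3" for js
    using that by (intro alternating_form_prefix[where m=3]) (simp_all add: vol_alternating)
  then have "alternating_form 4 (\<lambda>vs. \<Sum>js\<in>ils 3. (\<phi> p (map (onb p) js) / 6) * vol p (map (onb p) js @ vs))"
    by (intro alternating_form_sum alternating_form_cmult)
  moreover have "\<psi> p = (\<lambda>vs. \<Sum>js\<in>ils 3. (\<phi> p (map (onb p) js) / 6) * vol p (map (onb p) js @ vs))"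
    by (rule HOL.ext) (simp add: \<psi>_def hodge3_def fact_numeral sum_divide_distrib)
  ultimately show ?thesis by simp
qed

lemma nabla_psi:
  assumes b: "orthonormal p b" and vs: "length vs = 4"
  shows "nabla \<psi> p (v # vs) = 1/6 * (\<Sum>js\<in>ils 3. nabla \<phi> p (v # map b js) * vol p (vs @ map b js))"
proof -
  have T: "tensor (0 + 3) \<phi>" "tensor (4 + 3) vol" using tensor_phi tensor_vol by auto
  have "nabla \<psi> p (v # vs) = nabla (\<lambda>p vs. 1/6 * contract 0 3 \<phi> vol p vs) p (v # vs)"
    by (rule nabla_cong[OF psi_contract vs])
  also have "\<dots> = 1/6 * nabla (contract 0 3 \<phi> vol) p (v # vs)"
    by (rule nabla_cmult[of 4]) (use tensor_contract[OF T] vs in simp_all)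
  also have "nabla (contract 0 3 \<phi> vol) p (v # vs)
      = (\<Sum>js\<in>ils 3. nabla \<phi> p ([v] @ map (onb p) js) * vol p (vs @ map (onb p) js))"
    using nabla_contract[OF T, of vs p v] vs by (simp add: nabla_vol_zero)
  also have "\<dots> = contract 1 3 (nabla \<phi>) vol p (v # vs)" by (simp add: contract_def)
  also have "\<dots> = (\<Sum>js\<in>ils 3. nabla \<phi> p ([v] @ map b js) * vol p (vs @ map b js))"
    using contract_basis[OF b, of 1 3 "nabla \<phi>" 4 vol "v # vs"] tensor_multilin[OF tensor_nabla[OF T(1)], of p]
      tensor_multilin[OF T(2), of p] vs by simp
  finally show ?thesis by simp
qed

end

context torsion_free_g2_manifold
begin

text \<open>With \<open>\<psi> = *\<phi>\<close> and parallel volume form, \<open>d\<psi>\<close> evaluated on the five frame vectors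
  complementary to \<open>j, k\<close> is a nonzero multiple of the divergence.\<close>
lemma phi_divergence:
  assumes E: "adapted_frame p E e N"
  defines "b \<equiv> \<lambda>i. E i p"
  defines "Th \<equiv> \<lambda>a i j k. nabla \<phi> p [b a, b i, b j, b k]"
  assumes alt: "\<And>a i j k. Th a j i k = - Th a i j k" "\<And>a i j k. Th a i k j = - Th a i j k"
  shows "(SUM7 a. Th a a j k) = 0"
proof (cases "j = k")
  case True
  then have "Th a a j k = 0" for a using alt(2)[of a a j j] by simp
  then show ?thesis by simp
next
  case False
  have ob: "orthonormal p b" unfolding b_def using adapted_frameD(3,8)[OF E] by blast
  obtain xs where xs: "set xs = - {j, k}" "distinct xs" using finite_distinct_list[of "- {j, k}"] by auto
  then have len: "length xs = 5" using distinct_card[OF xs(2)] False by (simp add: Compl_eq_Diff_UNIV card_Diff_subset)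
  define \<beta> where "\<beta> vs = vol p (vs @ [b j, b k])" for vs
  have \<beta>: "alternating_form 5 \<beta>"
    unfolding \<beta>_def by (rule alternating_form_suffix[where m=2]) (simp_all add: vol_alternating)
  let ?xs = "map b xs"
  \<comment> \<open>In the sum over complementary triples, the triple left out by \<open>omit i xs\<close> is \<open>xs ! i, j, k\<close>.\<close>
  have summand: "(-1) ^ i * nabla \<psi> p (?xs ! i # omit i ?xs) = Th (xs ! i) (xs ! i) j k * \<beta> ?xs" if i: "i < 5" for i
  proof -
    let ?Y = "omit i xs"
    have lY: "length ?Y = 4" using len i by (simp add: length_omit)
    have spl: "xs = take i xs @ xs ! i # drop (Suc i) xs" using i len by (simp add: id_take_nth_drop)
    then have "set xs = insert (xs ! i) (set ?Y)" by (metis (no_types, lifting) Un_insert_right list.set(2) omit_def set_append)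
    then have un: "set ?Y \<union> {xs ! i, j, k} = UNIV" using xs(1) by auto
    have dist: "distinct [xs ! i, j, k]" using xs(1) i len False nth_mem[of i xs] by auto
    define F where "F js = nabla \<phi> p (b (xs ! i) # map b js)" for js
    define G where "G js = vol p (map b ?Y @ map b js)" for js
    have G: "alternating_form 3 (\<lambda>vs. vol p (map b ?Y @ vs))"
      by (rule alternating_form_prefix[where m=4]) (simp_all add: vol_alternating lY)
    have "(\<Sum>js\<in>ils 3. F js * G js) = 6 * (F [xs ! i, j, k] * G [xs ! i, j, k])"
    proof (rule sum_complementary_triple[OF un dist])
      show "F [y, x, z] = - F [x, y, z]" "F [x, z, y] = - F [x, y, z]" for x y z
        unfolding F_def list.map by (rule alt[unfolded Th_def])+
      show "G [y, x, z] = - G [x, y, z]" "G [x, z, y] = - G [x, y, z]" for x y z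
        using alternating_form_swap[OF G, of "[b x, b y, b z]" 0 1 "b y" "b x"]
          alternating_form_swap[OF G, of "[b x, b y, b z]" 1 2 "b z" "b y"] by (simp_all add: G_def)
      show "G [x, y, z] = 0" if "x \<in> set ?Y" for x y z
        unfolding G_def using that lY
        by (intro alternating_form_not_distinct[OF vol_alternating]) auto
    qed
    then have "nabla \<psi> p (b (xs ! i) # map b ?Y) = F [xs ! i, j, k] * G [xs ! i, j, k]"
      using nabla_psi[OF ob, of "map b ?Y" "b (xs ! i)"] lY by (simp add: F_def G_def)
    moreover have "G [xs ! i, j, k] = (-1) ^ i * \<beta> ?xs"
    proof -
      have "G [xs ! i, j, k] = \<beta> (map b ?Y @ [b (xs ! i)])" by (simp add: G_def \<beta>_def)
      also have "\<dots> = \<beta> (b (xs ! i) # map b ?Y)"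
        using alternating_form_rotate[of 4 \<beta> "map b ?Y" "b (xs ! i)"] \<beta> lY by simp
      also have "\<dots> = \<beta> (b (xs ! i) # omit i ?xs)" by (simp add: map_omit)
      also have "\<dots> = (-1) ^ i * \<beta> ?xs"
        using alternating_form_move[OF \<beta>, of ?xs i "b (xs ! i)"] len i by (simp add: map_update[symmetric])
      finally show ?thesis .
    qed
    moreover have "F [xs ! i, j, k] = Th (xs ! i) (xs ! i) j k" by (simp add: F_def Th_def)
    ultimately show ?thesis
      using len i by (simp add: map_omit power_mult_distrib[symmetric] mult.left_commute)
  qed
  have "(\<Sum>i<5. (-1) ^ i * nabla \<psi> p (?xs ! i # omit i ?xs)) = 0"
    using ext_deriv_nabla[where \<alpha>=\<psi> and p=p and vs="?xs", OF psi_alternating] len psi_closed by (simp del: sum.lessThan_Suc)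
  then have "(\<Sum>i<5. Th (xs ! i) (xs ! i) j k) * \<beta> ?xs = 0" by (simp add: summand sum_distrib_right)
  moreover have "\<beta> ?xs \<noteq> 0"
    using vol_nonzero[OF E, of "xs @ [j, k]"] xs len False by (simp add: \<beta>_def b_def)
  ultimately have 0: "(\<Sum>i<5. Th (xs ! i) (xs ! i) j k) = 0" by simp
  have "(SUM7 a. Th a a j k) = (\<Sum>a\<in>set xs. Th a a j k)"
  proof (rule sum.mono_neutral_right)
    have "Th j j j k = 0" "Th k k j k = 0" using alt(1)[of j j j k] alt(1)[of k j k k] alt(2)[of k j k k] by auto
    then show "\<forall>a\<in>UNIV - set xs. Th a a j k = 0" using xs(1) by auto
  qed auto
  also have "\<dots> = (\<Sum>i<5. Th (xs ! i) (xs ! i) j k)"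
    using sum.reindex_bij_betw[OF bij_betw_nth[OF xs(2)], of "{..<5}" "set xs" "\<lambda>a. Th a a j k"] len by simp
  finally show ?thesis using 0 by simp
qed

text \<open>The classical fact that a closed and coclosed positive form is parallel. In an adapted
  frame the derivative of \<open>\<phi>\<close> is the action of the connection matrix, hence is given by a torsion
  \<open>t\<close>, to which \<open>torsion_zero\<close> applies.\<close>
theorem nabla_phi_zero:
  assumes "length vs = 3" shows "nabla \<phi> p (v # vs) = 0"
proof -
  obtain E e N where E: "adapted_frame p E e N" by (rule adapted_frame_exists)
  define b where "b i = E i p" for i
  define w where "w a i m = g p (nab (E a) (E i) p) (E m p)" for a i m
  have ob: "orthonormal p b" unfolding b_def using adapted_frameD(3,8)[OF E] by blast
  interpret A: g2_array "\<lambda>i j k. \<phi> p [b i, b j, b k]" by (rule phi_array[OF ob])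
  define Th where "Th a i j k = nabla \<phi> p [b a, b i, b j, b k]" for a i j k
  define t where "t a n = (1/6) * (SUM7 i m. \<phi> p [b n, b i, b m] * - w a i m)" for a n
  have skew: "- w a m i = - (- w a i m)" for a i m
    using adapted_frame_derivatives(1)[OF E, of a m i] by (simp add: w_def)
  have act: "Th a i j k = A.act (\<lambda>i m. - w a i m) i j k" for a i j k
    using adapted_frame_derivatives(2)[OF E, of a i j k] by (simp add: Th_def b_def w_def)
  have Th: "Th a i j k = 3 * (SUM7 m. t a m * A.Q m i j k)" for a i j k
    unfolding act t_def by (rule A.act_torsion[OF skew])
  have alt: "Th a j i k = - Th a i j k" "Th a i k j = - Th a i j k" for a i j k
    unfolding act by (rule A.act_swap12 A.act_swap23)+
  have closed: "Th a i j k - Th i a j k + Th j a i k - Th k a i j = 0" for a i j k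
    using ext_deriv_nabla[where \<alpha>=\<phi> and p=p and vs="[b a, b i, b j, b k]", OF phi_alternating] phi_closed
    by (simp add: omit_def Th_def eval_nat_numeral)
  have "t a n = 0" for a n
  proof (rule A.torsion_zero)
    show "3 * (SUM7 m. t a m * A.Q m i j k) - 3 * (SUM7 m. t i m * A.Q m a j k) + 3 * (SUM7 m. t j m * A.Q m a i k)
      - 3 * (SUM7 m. t k m * A.Q m a i j) = 0" for a i j k
      using closed[of a i j k] by (simp only: Th)
    have "(SUM7 a. nabla \<phi> p [E a p, E a p, E j p, E k p]) = 0" for j k
      by (rule phi_divergence[OF E]) (rule alt[unfolded Th_def b_def])+
    then show "(SUM7 a. 3 * (SUM7 m. t a m * A.Q m a j k)) = 0" for j k
      by (simp only: Th[symmetric], simp only: Th_def b_def)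
  qed
  then have "nabla \<phi> p [b a, b i, b j, b k] = 0" for a i j k using Th[of a i j k] by (simp add: Th_def)
  then have "nabla \<phi> p (map b ks) = 0" if "ks \<in> ils 4" for ks
    using that by (auto simp: eval_nat_numeral length_Suc_conv)
  then show ?thesis
    using multilin_basis_zero[OF ob, of 4 "nabla \<phi> p" "v # vs"] tensor_multilin[OF tensor_nabla[OF tensor_phi], of p] assms by simp
qed

section \<open>Curvature of a torsion-free \<open>G\<^sub>2\<close> structure\<close>

lemma Rm_g_linear:
  "linear (\<lambda>u. g p (Rm p u v w) x)" "linear (\<lambda>v. g p (Rm p u v w) x)"
  "linear (\<lambda>w. g p (Rm p u v w) x)" "linear (\<lambda>x. g p (Rm p u v w) x)"
  using linear_compose[OF Rm_linear1 g_linear(2)] linear_compose[OF Rm_linear2 g_linear(2)]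
    linear_compose[OF Rm_linear3 g_linear(2)] g_linear(1)
  by (simp_all add: comp_def)

text \<open>By the Ricci identity the curvature annihilates the parallel form \<open>\<phi>\<close>, so its endomorphism
  values lie in \<open>\<Lambda>\<^sup>2\<^sub>1\<^sub>4\<close>.\<close>
lemma Rm_L14_values:
  assumes b: "orthonormal p b"
  shows "(SUM7 i j. \<phi> p [b n, b i, b j] * g p (Rm p u v (b i)) (b j)) = 0"
proof -
  interpret A: g2_array "\<lambda>i j k. \<phi> p [b i, b j, b k]" by (rule phi_array[OF b])
  have z: "nabla (nabla \<phi>) p (u # v # ws) = 0" if "length ws = 3" for u v ws
  proof -
    have "nabla (nabla \<phi>) p (u # v # ws) = nabla (\<lambda>p vs. 0) p (u # v # ws)"
      by (rule nabla_cong[where n=4]) (use that in \<open>auto simp: eval_nat_numeral length_Suc_conv nabla_phi_zero\<close>)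
    then show ?thesis by (simp add: nabla_zero)
  qed
  show ?thesis
  proof (rule A.act_zero_imp_L14)
    show "g p (Rm p u v (b j)) (b i) = - g p (Rm p u v (b i)) (b j)" for i j
      using Rm_skew[of p u v "b j" "b i"] metric_sym[of p "b j"] by simp
    show "A.act (\<lambda>i j. g p (Rm p u v (b i)) (b j)) i j k = 0" for i j k
    proof -
      have "(\<Sum>s<3. \<phi> p ([b i, b j, b k][s := Rm p u v ([b i, b j, b k] ! s)])) = 0"
        using ricci_identity[OF tensor_phi, of "[b i, b j, b k]" p u v] z by simp
      then have "\<phi> p [Rm p u v (b i), b j, b k] + \<phi> p [b i, Rm p u v (b j), b k] + \<phi> p [b i, b j, Rm p u v (b k)] = 0"
        by (simp add: numeral_3_eq_3)
      then show ?thesis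
        unfolding A.act_def sum.distrib
          orthonormal_expansion_linear[OF b phi_linear(1), symmetric]
          orthonormal_expansion_linear[OF b phi_linear(2), symmetric]
          orthonormal_expansion_linear[OF b phi_linear(3), symmetric] .
    qed
  qed
qed

text \<open>By pair symmetry the two-form part of the curvature lies in \<open>\<Lambda>\<^sup>2\<^sub>1\<^sub>4\<close> as well. This is why
  curvature terms in form degree disappear under the canonical projections.\<close>
lemma Rm_L14:
  assumes b: "orthonormal p b" and h: "linear h"
  shows "(SUM7 i j. \<phi> p [x, b i, b j] * h (Rm p (b i) (b j) u)) = 0"
proof -
  have 1: "(SUM7 i j. \<phi> p [b n, b i, b j] * g p (Rm p (b i) (b j) u) v) = 0" for n v
    using Rm_L14_values[OF b, of n u v] by (simp add: Rm_pair[of p u v])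
  have 2: "(SUM7 i j. \<phi> p [b n, b i, b j] * h (Rm p (b i) (b j) u)) = 0" for n
  proof -
    have "\<phi> p [b n, b i, b j] * h (Rm p (b i) (b j) u)
        = (SUM7 m. \<phi> p [b n, b i, b j] * g p (Rm p (b i) (b j) u) (b m) * h (b m))" for i j
      by (subst orthonormal_expansion_linear[OF b h]) (simp add: sum_distrib_left mult.assoc)
    then have "(SUM7 i j. \<phi> p [b n, b i, b j] * h (Rm p (b i) (b j) u))
        = (SUM7 m. (SUM7 i j. \<phi> p [b n, b i, b j] * g p (Rm p (b i) (b j) u) (b m)) * h (b m))"
      by (simp add: sum_distrib_right sum_rot3[of "\<lambda>i j m. \<phi> p [b n, b i, b j] * g p (Rm p (b i) (b j) u) (b m) * h (b m)"])
    then show ?thesis by (simp add: 1)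
  qed
  have "linear (\<lambda>x. SUM7 i j. \<phi> p [x, b i, b j] * h (Rm p (b i) (b j) u))"
    using phi_linear(1) by (intro linear_compose_sum ballI) (simp add: linear_iff algebra_simps)
  from orthonormal_expansion_linear[OF b this, of x] show ?thesis by (simp add: 2)
qed

lemma Ricci_zero:
  assumes b: "orthonormal p b"
  shows "(SUM7 j. g p (Rm p (b j) u v) (b j)) = 0"
proof -
  interpret A: g2_array "\<lambda>i j k. \<phi> p [b i, b j, b k]" by (rule phi_array[OF b])
  have 1: "(SUM7 j. g p (Rm p (b j) (b q) (b i)) (b j)) = 0" for q i
  proof (rule A.ricci_flat[where R="\<lambda>j q k l. g p (Rm p (b j) (b q) (b k)) (b l)"])
    show "(SUM7 k l. \<phi> p [b n, b k, b l] * g p (Rm p (b i) (b j) (b k)) (b l)) = 0" for i j n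
      by (rule Rm_L14_values[OF b])
    show "g p (Rm p (b i) (b j) (b l)) (b k) = - g p (Rm p (b i) (b j) (b k)) (b l)" for i j k l
      using Rm_skew[of p "b i" "b j" "b l" "b k"] metric_sym[of p "b l"] by simp
    show "g p (Rm p (b j) (b q) (b k)) (b l) + g p (Rm p (b k) (b q) (b l)) (b j) + g p (Rm p (b l) (b q) (b j)) (b k) = 0" for j q k l
    proof -
      have "g p (Rm p (b k) (b l) (b j) + Rm p (b l) (b j) (b k) + Rm p (b j) (b k) (b l)) (b q) = 0"
        by (simp add: bianchi linear_0[OF g_linear(2)])
      then show ?thesis
        by (simp add: linear_add[OF g_linear(2)] Rm_pair[of p "b j" "b q"] Rm_pair[of p "b k" "b q"] Rm_pair[of p "b l" "b q"])
    qed
  qed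
  have 2: "(SUM7 j. g p (Rm p (b j) u (b i)) (b j)) = 0" for i
    using orthonormal_expansion_linear[OF b, of "\<lambda>u. SUM7 j. g p (Rm p (b j) u (b i)) (b j)" u] Rm_g_linear(2)
    by (simp add: linear_compose_sum 1)
  show ?thesis
    using orthonormal_expansion_linear[OF b, of "\<lambda>v. SUM7 j. g p (Rm p (b j) u v) (b j)" v] Rm_g_linear(3)
    by (simp add: linear_compose_sum 2)
qed

lemma Ricci_zero_vector:
  assumes b: "orthonormal p b"
  shows "(SUM7 j. Rm p u (b j) (b j)) = 0"
proof (rule linear_functional_separates)
  fix h :: "tvec \<Rightarrow> real" assume h: "linear h"
  have "(SUM7 j. g p (Rm p u (b j) (b j)) (b m)) = 0" for m
  proof -
    have "g p (Rm p u (b j) (b j)) (b m) = g p (Rm p (b j) u (b m)) (b j)" for j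
      using Rm_skew[of p u "b j" "b j" "b m"] metric_sym[of p "b j" "Rm p u (b j) (b m)"]
      by (simp add: Rm_antisym[of p u "b j" "b m"] linear_neg[OF g_linear(2)])
    then show ?thesis using Ricci_zero[OF b, of u "b m"] by simp
  qed
  then have "(SUM7 m. (SUM7 j. g p (Rm p u (b j) (b j)) (b m)) * h (b m)) = 0" by simp
  moreover have "h (SUM7 j. Rm p u (b j) (b j)) = (SUM7 j m. g p (Rm p u (b j) (b j)) (b m) * h (b m))"
    unfolding linear_sum[OF h] by (intro sum.cong refl orthonormal_expansion_linear[OF b h])
  moreover have "\<dots> = (SUM7 m. (SUM7 j. g p (Rm p u (b j) (b j)) (b m)) * h (b m))"
    unfolding sum_distrib_right by (rule sum.swap)
  ultimately show "h (SUM7 j. Rm p u (b j) (b j)) = h 0"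
    by (simp add: linear_0[OF h])
qed

end

section \<open>Bundle-valued forms as tensors\<close>

lemma Blinfun2_linear:
  fixes F :: "tvec \<Rightarrow> tvec \<Rightarrow> real"
  assumes "\<And>x. linear (F x)" "\<And>y. linear (\<lambda>x. F x y)"
  shows "blinfun_apply (blinfun_apply (Blinfun (\<lambda>x. Blinfun (F x))) x) y = F x y"
proof -
  have ap: "blinfun_apply (Blinfun (F x)) = F x" for x
    using assms(1)[of x] by (simp add: bounded_linear_Blinfun_apply linear_conv_bounded_linear)
  have "linear (\<lambda>x. Blinfun (F x))"
    by (rule linearI)
      (auto intro!: blinfun_eqI simp: ap blinfun.add_left blinfun.scaleR_left linear_add[OF assms(2)] linear_scale[OF assms(2)])
  then have "blinfun_apply (Blinfun (\<lambda>x. Blinfun (F x))) = (\<lambda>x. Blinfun (F x))"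
    by (simp add: bounded_linear_Blinfun_apply linear_conv_bounded_linear)
  then show ?thesis by (simp add: ap)
qed

context riemannian_manifold7
begin

text \<open>A covector-valued form becomes a tensor whose first argument is the value slot; an
  endomorphism-valued form becomes a tensor with two value slots, by means of the metric.\<close>
definition TG :: "('a, covec) forms \<Rightarrow> ('a, real) forms" where
  "TG m p ws = blinfun_apply (m p (tl ws)) (hd ws)"

definition TE :: "('a, endo) forms \<Rightarrow> ('a, real) forms" where
  "TE a p ws = g p (ws ! 0) (blinfun_apply (a p (drop 2 ws)) (ws ! 1))"

lemma TG_Cons [simp]: "TG m p (z # vs) = blinfun_apply (m p vs) z"
  by (simp add: TG_def)

lemma TE_Cons [simp]: "TE a p (x # y # vs) = g p x (blinfun_apply (a p vs) y)"
  by (simp add: TE_def)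

lemma g_eqI: assumes "\<And>x. g p x u = g p x v" shows "u = v"
proof (rule ccontr)
  assume "u \<noteq> v"
  then have "g p (u - v) (u - v) > 0" by (intro metric_pos) simp
  then show False using assms[of "u - v"] by (simp add: linear_diff[OF g_linear(1)])
qed

lemma nabla_TG_ext:
  assumes "length vs = k"
  shows "nabla (TG m) p (v # z # vs) = deriv_along (ext p v) (\<lambda>q. blinfun_apply (m q (map (\<lambda>x. ext p x q) vs)) (ext p z q)) p
     - blinfun_apply (m p vs) (nab (ext p v) (ext p z) p)
     - (\<Sum>i<k. blinfun_apply (m p (vs[i := nab (ext p v) (ext p (vs ! i)) p])) z)"
  using assms by (simp add: nabla_ext[of "z # vs" "Suc k"] sum.lessThan_Suc_shift comp_def del: sum.lessThan_Suc)

lemma cov_deriv_cotangent: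
  assumes T: "tensor (Suc k) (TG m)" and vs: "length vs = k"
  shows "blinfun_apply (cov_deriv nab_cotangent m p v vs) z = nabla (TG m) p (v # z # vs)"
proof -
  let ?V = "ext p v"
  have pv: "map (\<lambda>x. ext p x p) vs = vs" by (simp add: ext)
  define F where "F z = deriv_along ?V (\<lambda>q. blinfun_apply (m q (map (\<lambda>x. ext p x q) vs)) (ext p z q)) p
      - blinfun_apply (m p vs) (nab ?V (ext p z) p)" for z
  have F: "F z = nabla (TG m) p (v # z # vs) + (\<Sum>i<k. blinfun_apply (m p (vs[i := nab ?V (ext p (vs ! i)) p])) z)" for z
    using nabla_TG_ext[OF vs, of m p v z] by (simp add: F_def)
  have "linear (\<lambda>z. nabla (TG m) p (v # z # vs))"
    using multilinD[OF tensor_multilin[OF tensor_nabla[OF T]], of "v # 0 # vs" 1 p] vs by simp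
  then have "linear F"
    unfolding F by (intro linear_compose_add linear_compose_sum ballI bounded_linear.linear[OF blinfun.bounded_linear_right])
  then have "blinfun_apply (nab_cotangent ?V (\<lambda>q. m q (map (\<lambda>x. ext p x q) vs)) p) = F"
    unfolding nab_cotangent_def pv F_def[symmetric] by (rule Blinfun_linear)
  then show ?thesis
    using vs by (simp add: cov_deriv_def blinfun.diff_left blinfun.sum_left F)
qed

end

context g2_manifold
begin

lemma vector_fieldI_metric:
  assumes "\<And>X. X \<in> vector_fields \<Longrightarrow> (\<lambda>q. g q (X q) (Y q)) \<in> smooth_funs"
  shows "Y \<in> vector_fields"
proof (rule vector_fieldI_local)
  fix p
  obtain E e N where E: "adapted_frame p E e N" by (rule adapted_frame_exists)
  have "Y q = (SUM7 i. g q (E i q) (Y q) *\<^sub>R E i q)" if "q \<in> N" for q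
    using orthonormal_expansion[OF adapted_frameD(8)[OF E that], of "Y q"] by (simp add: metric_sym[of q "Y q"])
  moreover have "(\<lambda>q. SUM7 i. g q (E i q) (Y q) *\<^sub>R E i q) \<in> vector_fields"
    by (intro vector_fields_sum vector_fields_scale assms adapted_frameD(1)[OF E])
  ultimately show "\<exists>V Z. open V \<and> p \<in> V \<and> Z \<in> vector_fields \<and> (\<forall>x\<in>V. Y x = Z x)"
    using adapted_frameD(2,3)[OF E] by blast
qed

lemma TE_vector_field:
  assumes T: "tensor (Suc (Suc k)) (TE a)" and "length Xs = k" "set Xs \<subseteq> vector_fields" "Z \<in> vector_fields"
  shows "(\<lambda>q. blinfun_apply (a q (ev q Xs)) (Z q)) \<in> vector_fields"
proof (rule vector_fieldI_metric)
  fix X assume "X \<in> vector_fields"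
  then show "(\<lambda>q. g q (X q) (blinfun_apply (a q (ev q Xs)) (Z q))) \<in> smooth_funs"
    using tensor_smooth[OF T, of "X # Z # Xs"] assms by simp
qed

lemma nabla_TE_ext:
  assumes T: "tensor (Suc (Suc k)) (TE a)" and vs: "length vs = k"
  shows "nabla (TE a) p (v # x # y # vs) =
      g p x (nab (ext p v) (\<lambda>q. blinfun_apply (a q (map (\<lambda>x. ext p x q) vs)) (ext p y q)) p
        - blinfun_apply (a p vs) (nab (ext p v) (ext p y) p)
        - (\<Sum>i<k. blinfun_apply (a p (vs[i := nab (ext p v) (ext p (vs ! i)) p])) y))"
proof -
  let ?V = "ext p v" and ?Y = "\<lambda>q. blinfun_apply (a q (map (\<lambda>x. ext p x q) vs)) (ext p y q)"
  have Y: "?Y \<in> vector_fields"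
    using TE_vector_field[OF T, of "map (ext p) vs" "ext p y"] vs ext_set[of p vs] by (simp add: ext comp_def)
  have Yp: "?Y p = blinfun_apply (a p vs) y" by (simp add: ext)
  have "nabla (TE a) p (v # x # y # vs) = deriv_along ?V (\<lambda>q. g q (ext p x q) (?Y q)) p
     - g p (nab ?V (ext p x) p) (?Y p) - g p x (blinfun_apply (a p vs) (nab ?V (ext p y) p))
     - (\<Sum>i<k. g p x (blinfun_apply (a p (vs[i := nab ?V (ext p (vs ! i)) p])) y))"
    using vs by (simp add: nabla_ext[of "x # y # vs" "Suc (Suc k)"] sum.lessThan_Suc_shift comp_def Yp del: sum.lessThan_Suc)
  also have "deriv_along ?V (\<lambda>q. g q (ext p x q) (?Y q)) p = g p (nab ?V (ext p x) p) (?Y p) + g p x (nab ?V ?Y p)"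
    using nab_metric[OF ext(1) ext(1) Y, of p v p x p] by (simp add: ext)
  finally show ?thesis
    by (simp add: linear_diff[OF g_linear(1)] linear_sum[OF g_linear(1)])
qed

lemma cov_deriv_End:
  assumes T: "tensor (Suc (Suc k)) (TE a)" and vs: "length vs = k"
  shows "g p x (blinfun_apply (cov_deriv nab_End a p v vs) y) = nabla (TE a) p (v # x # y # vs)"
proof -
  let ?V = "ext p v"
  have pv: "map (\<lambda>x. ext p x p) vs = vs" by (simp add: ext)
  define F where "F y = nab ?V (\<lambda>q. blinfun_apply (a q (map (\<lambda>x. ext p x q) vs)) (ext p y q)) p
      - blinfun_apply (a p vs) (nab ?V (ext p y) p)" for y
  have F: "g p x (F y) = nabla (TE a) p (v # x # y # vs)
      + (\<Sum>i<k. g p x (blinfun_apply (a p (vs[i := nab ?V (ext p (vs ! i)) p])) y))" for x y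
    using nabla_TE_ext[OF assms, of p v x y] by (simp add: F_def linear_diff[OF g_linear(1)] linear_sum[OF g_linear(1)])
  have "linear (\<lambda>y. nabla (TE a) p (v # x # y # vs))" for x
    using multilinD[OF tensor_multilin[OF tensor_nabla[OF T]], of "v # x # 0 # vs" 2 p] vs by (simp add: numeral_2_eq_2)
  then have "linear (\<lambda>y. g p x (F y))" for x
    unfolding F
    by (intro linear_compose_add linear_compose_sum ballI)
      (auto simp: linear_iff blinfun.add_right blinfun.scaleR_right linear_add[OF g_linear(1)] linear_scale[OF g_linear(1)])
  then have lin: "g p x (F (y + y')) = g p x (F y) + g p x (F y')" "g p x (F (r *\<^sub>R y)) = r * g p x (F y)" for x y y' r
    by (simp_all add: linear_iff)
  have "linear F"
    by (rule linearI; rule g_eqI[of p]) (simp_all add: lin linear_add[OF g_linear(1)] linear_scale[OF g_linear(1)])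
  then have "blinfun_apply (nab_End ?V (\<lambda>q. a q (map (\<lambda>x. ext p x q) vs)) p) = F"
    unfolding nab_End_def pv F_def[symmetric] by (rule Blinfun_linear)
  then show ?thesis
    using vs by (simp add: cov_deriv_def blinfun.diff_left blinfun.sum_left F linear_diff[OF g_linear(1)] linear_sum[OF g_linear(1)])
qed

text \<open>The same tensor as \<open>skew_part\<close>, with the argument conventions of \<open>TE\<close>.\<close>
definition TSk :: "('a, endo) forms \<Rightarrow> ('a, real) forms" where
  "TSk a p ws = (1/2) * (TE a p ws - TE a p (ws ! 1 # ws ! 0 # drop 2 ws))"

lemma TSk_Cons [simp]: "TSk a p (x # y # vs) = (1/2) * (TE a p (x # y # vs) - TE a p (y # x # vs))"
  by (simp add: TSk_def)

abbreviation swap01 :: "nat \<Rightarrow> nat list" where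
  "swap01 k \<equiv> Suc 0 # 0 # [2..<Suc (Suc k)]"

lemma swap01: "distinct (swap01 k)" "set (swap01 k) = {..<Suc (Suc k)}"
  by auto

lemma map_nth_swap01: "length vs = k \<Longrightarrow> map (\<lambda>i. (x # y # vs) ! i) (swap01 k) = y # x # vs"
proof -
  assume "length vs = k"
  then have "map (\<lambda>i. (x # y # vs) ! i) [2..<Suc (Suc k)] = vs"
    by (intro nth_equalityI) (simp_all add: nth_Cons' del: upt_Suc)
  then show ?thesis by (simp del: upt_Suc)
qed

lemma reorder_swap01: "length vs = k \<Longrightarrow> reorder (swap01 k) T p (x # y # vs) = T p (y # x # vs)"
  unfolding reorder_def by (subst map_nth_swap01) auto

lemma TSk_reorder: "length ws = Suc (Suc k) \<Longrightarrow> TSk a p ws = (1/2) * (TE a p ws - reorder (swap01 k) (TE a) p ws)"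
proof -
  assume "length ws = Suc (Suc k)"
  then obtain x y vs where "ws = x # y # vs" "length vs = k" by (auto simp: length_Suc_conv)
  then show ?thesis by (simp add: reorder_swap01 del: TE_Cons upt_Suc)
qed

lemma tensor_TSk: "tensor (Suc (Suc k)) (TE a) \<Longrightarrow> tensor (Suc (Suc k)) (TSk a)"
proof -
  assume T: "tensor (Suc (Suc k)) (TE a)"
  have "tensor (Suc (Suc k)) (\<lambda>p ws. (1/2) * (TE a p ws - reorder (swap01 k) (TE a) p ws))"
    by (rule tensor_cmult[OF tensor_diff[OF T tensor_reorder[OF T swap01]]])
  then show ?thesis by (rule tensor_cong) (rule TSk_reorder[symmetric])
qed

lemma nabla_swap01:
  assumes "tensor (Suc (Suc k)) T" "length vs = k"
  shows "nabla (reorder (swap01 k) T) p (v # x # y # vs) = nabla T p (v # y # x # vs)"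
  using nabla_reorder[OF assms(1) swap01, of "x # y # vs" p v] assms(2) by (simp only: map_nth_swap01) simp

lemma nabla_TSk:
  assumes T: "tensor (Suc (Suc k)) (TE a)" and vs: "length vs = k"
  shows "nabla (TSk a) p (v # x # y # vs) = (1/2) * (nabla (TE a) p (v # x # y # vs) - nabla (TE a) p (v # y # x # vs))"
proof -
  have l: "length (x # y # vs) = Suc (Suc k)" using vs by simp
  have "nabla (TSk a) p (v # x # y # vs) = nabla (\<lambda>p ws. (1/2) * (TE a p ws - reorder (swap01 k) (TE a) p ws)) p (v # x # y # vs)"
    by (rule nabla_cong[OF TSk_reorder l])
  also have "\<dots> = (1/2) * (nabla (TE a) p (v # x # y # vs) - nabla (reorder (swap01 k) (TE a)) p (v # x # y # vs))"
    by (subst nabla_cmult[OF tensor_diff[OF T tensor_reorder[OF T swap01]] l], subst nabla_diff[OF T tensor_reorder[OF T swap01] l]) simp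
  finally show ?thesis by (simp only: nabla_swap01[OF T vs])
qed

lemma TE_linear:
  "linear (\<lambda>x. g p x (blinfun_apply (A :: endo) y))" "linear (\<lambda>y. g p x (blinfun_apply A y))"
proof -
  show "linear (\<lambda>x. g p x (blinfun_apply A y))" by (rule g_linear(2))
  show "linear (\<lambda>y. g p x (blinfun_apply A y))"
    by (rule linearI) (simp_all add: blinfun.add_right blinfun.scaleR_right linear_add[OF g_linear(1)] linear_scale[OF g_linear(1)])
qed

lemma skew_part_apply:
  "blinfun_apply (blinfun_apply (skew_part a p vs) x) y = TSk a p (x # y # vs)"
proof -
  let ?S = "\<lambda>x y. (g p x (blinfun_apply (a p vs) y) - g p y (blinfun_apply (a p vs) x)) / 2"
  note [simp] = blinfun.add_right blinfun.scaleR_right linear_add[OF g_linear(1)] linear_scale[OF g_linear(1)]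
    linear_add[OF g_linear(2)] linear_scale[OF g_linear(2)]
  have "linear (?S x)" for x by (rule linearI) (simp_all add: field_simps)
  moreover have "linear (\<lambda>x. ?S x y)" for y by (rule linearI) (simp_all add: field_simps)
  ultimately show ?thesis unfolding skew_part_def by (subst Blinfun2_linear) simp_all
qed

lemma cov_deriv_bilinear:
  assumes T0: "tensor (Suc (Suc k)) (TE a)" and vs: "length vs = k"
  shows "blinfun_apply (blinfun_apply (cov_deriv nab_bilinear (skew_part a) p v vs) x) y = nabla (TSk a) p (v # x # y # vs)"
proof -
  let ?V = "ext p v" and ?S = "skew_part a"
  note T = tensor_TSk[OF T0]
  have pv: "map (\<lambda>x. ext p x p) vs = vs" by (simp add: ext)
  define F where "F x y = deriv_along ?V (\<lambda>q. TSk a q (ext p x q # ext p y q # map (\<lambda>x. ext p x q) vs)) p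
      - TSk a p (nab ?V (ext p x) p # y # vs) - TSk a p (x # nab ?V (ext p y) p # vs)" for x y
  have F: "F x y = nabla (TSk a) p (v # x # y # vs) + (\<Sum>i<k. TSk a p (x # y # vs[i := nab ?V (ext p (vs ! i)) p]))" for x y
    using vs by (simp add: F_def nabla_ext[of "x # y # vs" "Suc (Suc k)"] sum.lessThan_Suc_shift comp_def del: sum.lessThan_Suc TSk_Cons)
  have l: "linear (F x)" "linear (\<lambda>x. F x y)" for x y
  proof -
    note m1 = multilinD[OF tensor_multilin[OF tensor_nabla[OF T]]] and m2 = multilinD[OF tensor_multilin[OF T]]
    show "linear (F x)"
      unfolding F using m1[of "v # x # 0 # vs" 2 p] m2[of "x # 0 # ws" 1 p for ws] vs
      by (intro linear_compose_add linear_compose_sum ballI) (simp_all add: numeral_2_eq_2 del: TSk_Cons)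
    show "linear (\<lambda>x. F x y)"
      unfolding F using m1[of "v # 0 # y # vs" 1 p] m2[of "0 # y # ws" 0 p for ws] vs
      by (intro linear_compose_add linear_compose_sum ballI) (simp_all del: TSk_Cons)
  qed
  have "blinfun_apply (blinfun_apply (nab_bilinear ?V (\<lambda>q. ?S q (map (\<lambda>x. ext p x q) vs)) p) x) y = F x y"
    unfolding nab_bilinear_def pv skew_part_apply F_def[symmetric] by (rule Blinfun2_linear[OF l])
  then show ?thesis
    using vs by (simp add: cov_deriv_def blinfun.diff_left blinfun.sum_left F skew_part_apply del: TSk_Cons)
qed

lemma sharp_apply:
  assumes "\<And>y. linear (\<lambda>x. A x y)" "\<And>x. linear (A x)"
  shows "g p x (blinfun_apply (sharp p A) y) = A x y"
proof -
  define T where "T = Blinfun (\<lambda>y. SUM7 i. A (onb p i) y *\<^sub>R onb p i)"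
  have "linear (\<lambda>y. SUM7 i. A (onb p i) y *\<^sub>R onb p i)"
    by (intro linear_compose_sum ballI) (auto simp: linear_iff linear_add[OF assms(2)] linear_scale[OF assms(2)] algebra_simps)
  then have T: "blinfun_apply T y = (SUM7 i. A (onb p i) y *\<^sub>R onb p i)" for y
    unfolding T_def by (simp add: Blinfun_linear)
  have gT: "g p x (blinfun_apply T y) = A x y" for x y
    unfolding T orthonormal_expansion_linear[OF onb[of p] assms(1), where v=x]
    by (simp add: linear_sum[OF g_linear(1)] linear_scale[OF g_linear(1)] mult.commute)
  have "sharp p A = T"
    unfolding sharp_def
  proof (rule the_equality)
    fix T' assume "\<forall>x y. g p x (blinfun_apply T' y) = A x y"
    then show "T' = T" using gT by (intro blinfun_eqI g_eqI[of p]) simp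
  qed (use gT in simp)
  then show ?thesis using gT by simp
qed

lemma nabla_TG_linear:
  assumes T: "tensor (Suc k) (TG m)" and vs: "length vs = k"
  shows "linear (\<lambda>v. nabla (TG m) p (v # z # vs))" "linear (\<lambda>z. nabla (TG m) p (v # z # vs))"
  using multilinD[OF tensor_multilin[OF tensor_nabla[OF T]], of "0 # z # vs" 0 p]
    multilinD[OF tensor_multilin[OF tensor_nabla[OF T]], of "v # 0 # vs" 1 p] vs by simp_all

lemma KK_apply:
  assumes T: "tensor (Suc k) (TG m)" and vs: "length vs = k"
  shows "g p x (blinfun_apply (KK m p vs) y) = nabla (TG m) p (y # x # vs) - nabla (TG m) p (x # y # vs)"
  unfolding KK_def cov_deriv_cotangent[OF assms]
  by (rule sharp_apply) (intro linear_compose_sub nabla_TG_linear[OF assms])+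

lemma BB_apply:
  assumes T: "tensor (Suc k) (TG m)" and vs: "length vs = k"
  shows "g p x (blinfun_apply (BB m p vs) y) = nabla (TG m) p (x # y # vs)"
  unfolding BB_def cov_deriv_cotangent[OF assms]
  by (rule sharp_apply) (intro nabla_TG_linear[OF assms])+

lemma ell_apply:
  assumes T: "tensor (Suc (Suc k)) (TE a)" and vs: "length vs = k"
  shows "blinfun_apply (ell a p vs) z = - (1/2) * (SUM7 j. nabla (TSk a) p (onb p j # onb p j # z # vs))"
proof -
  have l: "linear (\<lambda>z. nabla (TSk a) p (v # x # z # vs))" for v x
    using multilinD[OF tensor_multilin[OF tensor_nabla[OF tensor_TSk[OF T]]], of "v # x # 0 # vs" 2 p] vs
    by (simp add: numeral_2_eq_2)
  then show ?thesis
    unfolding ell_def cov_deriv_bilinear[OF assms]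
    by (subst Blinfun_linear) (auto intro!: linearI simp: linear_add[OF l] linear_scale[OF l] sum.distrib sum_distrib_left add_divide_distrib algebra_simps sum_negf)
qed

subsection \<open>Canonical forms\<close>

lemma can_forms_alternating: "\<alpha> \<in> can_forms p k \<Longrightarrow> alternating_form k \<alpha>"
proof -
  assume a: "\<alpha> \<in> can_forms p k"
  consider "k = 0 \<or> k = 1" | "k = 2" | "k = 3" | "k > 3" by linarith
  then show ?thesis
  proof cases
    case 2
    then obtain X where "\<alpha> = (\<lambda>vs. \<phi> p (X # vs))" using a by (auto simp: can_forms_def)
    then show ?thesis
      using alternating_form_prefix[of 1 2 "\<phi> p" "[X]"] phi_alternating[of p] 2 by (simp add: numeral_3_eq_3 numeral_2_eq_2)
  next
    case 3
    then obtain c where "\<alpha> = (\<lambda>vs. c * \<phi> p vs)" using a by (auto simp: can_forms_def)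
    then show ?thesis using alternating_form_cmult[OF phi_alternating] 3 by simp
  next
    case 4
    then have "\<alpha> = (\<lambda>vs. 0)" using a by (auto simp: can_forms_def zero_fun_def)
    then show ?thesis by (simp add: alternating_form_def linear_zero)
  qed (use a in \<open>auto simp: can_forms_def\<close>)
qed

lemma phi_wrong_length: "length vs \<noteq> 3 \<Longrightarrow> \<phi> p vs = 0"
  using phi_alternating[of p] by (simp add: alternating_form_def)

lemma phi_head_linear: "linear (\<lambda>x. \<phi> p (x # vs))"
proof (cases "length vs = 2")
  case True
  then show ?thesis using alternating_form_linear[OF phi_alternating, of "0 # vs" 0 p] by simp
qed (simp add: phi_wrong_length linear_zero)

lemma can_forms_add:
  assumes "\<alpha> \<in> can_forms p k" "\<beta> \<in> can_forms p k"
  shows "(\<lambda>vs. \<alpha> vs + \<beta> vs) \<in> can_forms p k"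
proof -
  consider "k = 0 \<or> k = 1" | "k = 2" | "k = 3" | "k > 3" by linarith
  then show ?thesis
  proof cases
    case 2
    then obtain X Y where "\<alpha> = (\<lambda>vs. \<phi> p (X # vs))" "\<beta> = (\<lambda>vs. \<phi> p (Y # vs))" using assms by (auto simp: can_forms_def)
    then have "(\<lambda>vs. \<alpha> vs + \<beta> vs) = (\<lambda>vs. \<phi> p ((X + Y) # vs))" by (simp add: linear_add[OF phi_head_linear])
    then show ?thesis using 2 by (auto simp: can_forms_def)
  next
    case 3
    then obtain c d where "\<alpha> = (\<lambda>vs. c * \<phi> p vs)" "\<beta> = (\<lambda>vs. d * \<phi> p vs)" using assms by (auto simp: can_forms_def)
    then have "(\<lambda>vs. \<alpha> vs + \<beta> vs) = (\<lambda>vs. (c + d) * \<phi> p vs)" by (simp add: distrib_right)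
    then show ?thesis using 3 by (auto simp: can_forms_def)
  qed (use assms alternating_form_add[of k \<alpha> \<beta>] in \<open>auto simp: can_forms_def zero_fun_def\<close>)
qed

lemma can_forms_cmult:
  assumes "\<alpha> \<in> can_forms p k"
  shows "(\<lambda>vs. r * \<alpha> vs) \<in> can_forms p k"
proof -
  consider "k = 0 \<or> k = 1" | "k = 2" | "k = 3" | "k > 3" by linarith
  then show ?thesis
  proof cases
    case 2
    then obtain X where "\<alpha> = (\<lambda>vs. \<phi> p (X # vs))" using assms by (auto simp: can_forms_def)
    then have "(\<lambda>vs. r * \<alpha> vs) = (\<lambda>vs. \<phi> p ((r *\<^sub>R X) # vs))" by (simp add: linear_scale[OF phi_head_linear])
    then show ?thesis using 2 by (auto simp: can_forms_def)
  next
    case 3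
    then obtain c where "\<alpha> = (\<lambda>vs. c * \<phi> p vs)" using assms by (auto simp: can_forms_def)
    then have "(\<lambda>vs. r * \<alpha> vs) = (\<lambda>vs. (r * c) * \<phi> p vs)" by (simp add: mult.assoc)
    then show ?thesis using 3 by (auto simp: can_forms_def)
  qed (use assms alternating_form_cmult[of k \<alpha>] in \<open>auto simp: can_forms_def zero_fun_def\<close>)
qed

lemma can_forms_diff:
  "\<alpha> \<in> can_forms p k \<Longrightarrow> \<beta> \<in> can_forms p k \<Longrightarrow> (\<lambda>vs. \<alpha> vs - \<beta> vs) \<in> can_forms p k"
  using can_forms_add[of \<alpha> p k "\<lambda>vs. -1 * \<beta> vs"] can_forms_cmult[of \<beta> p k "-1"] by simp

lemma can_forms_zero: "(\<lambda>vs. 0) \<in> can_forms p k"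
proof -
  have 2: "\<exists>X. (\<lambda>vs. 0) = (\<lambda>vs. \<phi> p (X # vs))"
    by (rule exI[of _ 0]) (simp add: linear_0[OF phi_head_linear])
  have 3: "\<exists>c. (\<lambda>vs. 0) = (\<lambda>vs. c * \<phi> p vs)"
    by (rule exI[of _ 0]) simp
  have "alternating_form k (\<lambda>vs. 0)" by (simp add: alternating_form_def linear_zero)
  with 2 3 show ?thesis
    unfolding can_forms_def zero_fun_def by (simp only: mem_Collect_eq singleton_iff split: if_split) blast
qed

lemma can_forms_sum: "(\<And>a. a \<in> A \<Longrightarrow> f a \<in> can_forms p k) \<Longrightarrow> (\<lambda>vs. \<Sum>a\<in>A. f a vs) \<in> can_forms p k"
  by (induction A rule: infinite_finite_induct) (auto intro: can_forms_zero can_forms_add)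

subsection \<open>The section spaces\<close>

text \<open>Membership in the section spaces in terms of the associated real tensors, which is the form
  in which the operators preserve it.\<close>
definition G_tensor :: "nat \<Rightarrow> ('a, covec) forms \<Rightarrow> bool" where
  "G_tensor k m \<longleftrightarrow> tensor (Suc k) (TG m) \<and> (\<forall>p z. (\<lambda>vs. TG m p (z # vs)) \<in> can_forms p k)"

definition E_tensor :: "nat \<Rightarrow> ('a, endo) forms \<Rightarrow> bool" where
  "E_tensor k a \<longleftrightarrow> tensor (Suc (Suc k)) (TE a) \<and> (\<forall>p x y. (\<lambda>vs. TE a p (x # y # vs)) \<in> can_forms p k) \<and>
     (\<forall>p vs. (SUM7 i. TE a p (onb p i # onb p i # vs)) = 0)"

definition dual_onb :: "'a \<Rightarrow> 7 \<Rightarrow> covec" where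
  "dual_onb p i = Blinfun (g p (onb p i))"

lemma dual_onb: "blinfun_apply (dual_onb p i) x = g p (onb p i) x"
  by (simp add: dual_onb_def Blinfun_linear[OF g_linear(1)])

lemma covec_expansion: "c = (SUM7 i. blinfun_apply c (onb p i) *\<^sub>R dual_onb p i)"
proof (rule blinfun_eqI)
  fix x
  have "blinfun_apply c x = (SUM7 i. g p x (onb p i) * blinfun_apply c (onb p i))"
    by (rule orthonormal_expansion_linear[OF onb bounded_linear.linear[OF blinfun.bounded_linear_right]])
  then show "blinfun_apply c x = blinfun_apply (SUM7 i. blinfun_apply c (onb p i) *\<^sub>R dual_onb p i) x"
    by (simp add: blinfun.sum_left blinfun.scaleR_left dual_onb metric_sym[of p x] mult.commute)
qed

definition endo_unit :: "'a \<Rightarrow> 7 \<Rightarrow> 7 \<Rightarrow> endo" where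
  "endo_unit p i j = Blinfun (\<lambda>x. g p (onb p j) x *\<^sub>R onb p i)"

lemma endo_unit: "blinfun_apply (endo_unit p i j) x = g p (onb p j) x *\<^sub>R onb p i"
proof -
  have "linear (\<lambda>x. g p (onb p j) x *\<^sub>R onb p i)"
    by (auto simp: linear_iff linear_add[OF g_linear(1)] linear_scale[OF g_linear(1)] scaleR_left_distrib)
  then show ?thesis by (simp add: endo_unit_def Blinfun_linear)
qed

lemma endo_expansion: "A = (SUM7 i j. g p (onb p i) (blinfun_apply A (onb p j)) *\<^sub>R endo_unit p i j)"
proof (rule blinfun_eqI)
  fix x
  have "g p (onb p i) (blinfun_apply A x) = (SUM7 j. g p x (onb p j) * g p (onb p i) (blinfun_apply A (onb p j)))" for i
    by (rule orthonormal_expansion_linear[OF onb TE_linear(2)])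
  then have "blinfun_apply A x = (SUM7 i. (SUM7 j. g p x (onb p j) * g p (onb p i) (blinfun_apply A (onb p j))) *\<^sub>R onb p i)"
    using orthonormal_expansion[OF onb, of "blinfun_apply A x" p] by (simp add: metric_sym[of p "blinfun_apply A x"])
  then show "blinfun_apply A x = blinfun_apply (SUM7 i j. g p (onb p i) (blinfun_apply A (onb p j)) *\<^sub>R endo_unit p i j) x"
    by (simp add: blinfun.sum_left blinfun.scaleR_left endo_unit metric_sym[of p x] scaleR_sum_left mult.commute)
qed

lemma tr7_onb: "tr7 A = (SUM7 i. g p (onb p i) (blinfun_apply A (onb p i)))"
proof -
  have lin: "linear (blinfun_apply A)" by (rule bounded_linear.linear[OF blinfun.bounded_linear_right])
  have "tr7 A = (SUM7 k. blinfun_apply A (axis k 1) $ k)"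
    by (simp add: tr7_def trace_def matrix_def)
  also have "\<dots> = (SUM7 k i j. g p (axis k 1) (onb p j) * g p (onb p i) (blinfun_apply A (onb p j)) * onb p i $ k)"
  proof (rule sum.cong[OF refl])
    fix k
    have "blinfun_apply A (axis k 1) = (SUM7 i j. (g p (onb p i) (blinfun_apply A (onb p j)) * g p (onb p j) (axis k 1)) *\<^sub>R onb p i)"
      by (subst endo_expansion[of A p]) (simp add: blinfun.sum_left blinfun.scaleR_left endo_unit)
    then show "blinfun_apply A (axis k 1) $ k = (SUM7 i j. g p (axis k 1) (onb p j) * g p (onb p i) (blinfun_apply A (onb p j)) * onb p i $ k)"
      by (simp add: metric_sym[of p "axis k 1"] mult.commute)
  qed
  also have "\<dots> = (SUM7 i j. g p (onb p i) (blinfun_apply A (onb p j)) * (SUM7 k. onb p i $ k * g p (axis k 1) (onb p j)))"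
    unfolding sum_distrib_left by (subst sum_rot3[symmetric]) (simp add: mult_ac)
  also have "\<dots> = (SUM7 i j. g p (onb p i) (blinfun_apply A (onb p j)) * g p (onb p i) (onb p j))"
  proof -
    have "(SUM7 k. x $ k * g p (axis k 1) y) = g p x y" for x y
      using g_sum_left[of p "\<lambda>k. x $ k" "\<lambda>k. axis k 1" UNIV y] basis_expansion[of x] by (simp add: scalar_mult_eq_scaleR)
    then show ?thesis by simp
  qed
  also have "\<dots> = (SUM7 i. g p (onb p i) (blinfun_apply A (onb p i)))"
    by (simp add: orthonormal_g[OF onb] if_distrib[where f="\<lambda>x. _ * x"] cong: if_cong)
  finally show ?thesis .
qed

text \<open>A covector is a combination of its values on a basis, so testing with evaluations is as
  good as testing with all linear functionals.\<close>
lemma G_sp_iff: "m \<in> G_sp k \<longleftrightarrow> G_tensor k m"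
proof
  assume m: "m \<in> G_sp k"
  have can: "(\<lambda>vs. TG m p (z # vs)) \<in> can_forms p k" for p z
  proof -
    have "linear (\<lambda>c :: covec. blinfun_apply c z)"
      by (rule bounded_linear.linear[OF blinfun.bounded_linear_left])
    then have "(\<lambda>vs. (\<lambda>c. blinfun_apply c z) (m p vs)) \<in> can_forms p k" using m unfolding can_sections_def by blast
    then show ?thesis by simp
  qed
  have sm: "(\<lambda>q. TG m q (ev q Xs)) \<in> smooth_funs" if l: "length Xs = Suc k" and "set Xs \<subseteq> vector_fields" for Xs
  proof -
    obtain Z Ys where X: "Xs = Z # Ys" using l by (cases Xs) auto
    then have "(\<lambda>q. m q (map (\<lambda>X. X q) Ys)) \<in> cotangent_sections" using m that by (auto simp: can_sections_def)
    then show ?thesis using that X by (simp add: cotangent_sections_def)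
  qed
  have "multilin (Suc k) (TG m p)" for p
    unfolding multilin_def
  proof (intro allI impI)
    fix vs :: "tvec list" and i assume vs: "length vs = Suc k" "i < Suc k"
    then obtain z us where z: "vs = z # us" "length us = k" by (cases vs) auto
    show "linear (\<lambda>x. TG m p (vs[i := x]))"
    proof (cases i)
      case 0
      then show ?thesis using z by (simp add: bounded_linear.linear[OF blinfun.bounded_linear_right])
    next
      case (Suc j)
      then show ?thesis
        using alternating_form_linear[OF can_forms_alternating[OF can[of p z]], of us j] z vs by simp
    qed
  qed
  with sm can show "G_tensor k m" by (simp add: G_tensor_def tensor_def)
next
  assume m: "G_tensor k m"
  have can: "(\<lambda>vs. l (m p vs)) \<in> can_forms p k" if l: "linear l" for l :: "covec \<Rightarrow> real" and p
  proof -
    have "l c = (SUM7 i. l (dual_onb p i) * blinfun_apply c (onb p i))" for c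
      by (subst covec_expansion[of c p]) (simp add: linear_sum[OF l] linear_scale[OF l] mult.commute)
    then have e: "(\<lambda>vs. l (m p vs)) = (\<lambda>vs. SUM7 i. l (dual_onb p i) * TG m p (onb p i # vs))"
      unfolding TG_Cons by (intro HOL.ext)
    have "(\<lambda>vs. SUM7 i. l (dual_onb p i) * TG m p (onb p i # vs)) \<in> can_forms p k"
      using m by (intro can_forms_sum can_forms_cmult) (auto simp: G_tensor_def simp del: TG_Cons)
    then show ?thesis unfolding e .
  qed
  have sm: "(\<lambda>q. m q (map (\<lambda>X. X q) Xs)) \<in> cotangent_sections" if "set Xs \<subseteq> vector_fields" for Xs
    unfolding cotangent_sections_def
  proof safe
    fix Z assume Z: "Z \<in> vector_fields"
    show "(\<lambda>q. blinfun_apply (m q (map (\<lambda>X. X q) Xs)) (Z q)) \<in> smooth_funs"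
    proof (cases "length Xs = k")
      case True
      then show ?thesis using tensor_smooth[of "Suc k" "TG m" "Z # Xs"] m that Z by (simp add: G_tensor_def)
    next
      case False
      have "blinfun_apply (m q vs) z = 0" if "length vs \<noteq> k" for q vs z
        using can_forms_alternating[of "\<lambda>vs. TG m q (z # vs)" q k] m that by (simp add: G_tensor_def alternating_form_def)
      then show ?thesis using False by (simp add: smooth_funs_const)
    qed
  qed
  show "m \<in> G_sp k" unfolding can_sections_def using can sm by blast
qed

lemma E_sp_iff: "a \<in> E_sp k \<longleftrightarrow> E_tensor k a"
proof
  assume a: "a \<in> E_sp k"
  have can: "(\<lambda>vs. TE a p (x # y # vs)) \<in> can_forms p k" for p x y
  proof -
    have "linear (\<lambda>A :: endo. g p x (blinfun_apply A y))"
      using linear_compose[OF bounded_linear.linear[OF blinfun.bounded_linear_left] g_linear(1)] by (simp add: comp_def)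
    then have "(\<lambda>vs. (\<lambda>A. g p x (blinfun_apply A y)) (a p vs)) \<in> can_forms p k" using a unfolding can_sections_def by blast
    then show ?thesis by simp
  qed
  have E0: "(\<lambda>q. a q (map (\<lambda>X. X q) Xs)) \<in> End0_sections" if "set Xs \<subseteq> vector_fields" for Xs
    using a that by (auto simp: can_sections_def)
  have sm: "(\<lambda>q. TE a q (ev q Xs)) \<in> smooth_funs" if l: "length Xs = Suc (Suc k)" and "set Xs \<subseteq> vector_fields" for Xs
  proof -
    obtain X Z Ys where X: "Xs = X # Z # Ys" using l by (auto simp: length_Suc_conv)
    then show ?thesis using E0[of Ys] that by (auto simp: End0_sections_def intro: metric_smooth)
  qed
  have "multilin (Suc (Suc k)) (TE a p)" for p
    unfolding multilin_def
  proof (intro allI impI)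
    fix vs :: "tvec list" and i assume vs: "length vs = Suc (Suc k)" "i < Suc (Suc k)"
    then obtain x y us where z: "vs = x # y # us" "length us = k" by (auto simp: length_Suc_conv)
    consider "i = 0" | "i = 1" | j where "i = Suc (Suc j)" by (metis One_nat_def not0_implies_Suc)
    then show "linear (\<lambda>x. TE a p (vs[i := x]))"
    proof cases
      case (3 j)
      then show ?thesis
        using alternating_form_linear[OF can_forms_alternating[OF can[of p x y]], of us j] z vs by simp
    qed (use z in \<open>simp_all add: TE_linear\<close>)
  qed
  moreover have "(SUM7 i. TE a p (onb p i # onb p i # vs)) = 0" for p vs
  proof -
    have "(\<lambda>q. a q (map (\<lambda>X. X q) (map (ext p) vs))) \<in> End0_sections" by (rule E0[OF ext_set])
    then have "tr7 (a p (map (\<lambda>X. X p) (map (ext p) vs))) = 0" by (simp add: End0_sections_def)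
    then show ?thesis by (simp add: ev_ext tr7_onb[of _ p] del: map_map)
  qed
  ultimately show "E_tensor k a" using sm can by (simp add: E_tensor_def tensor_def)
next
  assume a: "E_tensor k a"
  then have T: "tensor (Suc (Suc k)) (TE a)" by (simp add: E_tensor_def)
  have can: "(\<lambda>vs. l (a p vs)) \<in> can_forms p k" if l: "linear l" for l :: "endo \<Rightarrow> real" and p
  proof -
    have "l A = (SUM7 i j. l (endo_unit p i j) * g p (onb p i) (blinfun_apply A (onb p j)))" for A
      by (subst endo_expansion[of A p]) (simp add: linear_sum[OF l] linear_scale[OF l] mult.commute)
    then have e: "(\<lambda>vs. l (a p vs)) = (\<lambda>vs. SUM7 i j. l (endo_unit p i j) * TE a p (onb p i # onb p j # vs))"
      unfolding TE_Cons by (intro HOL.ext)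
    have "(\<lambda>vs. SUM7 i j. l (endo_unit p i j) * TE a p (onb p i # onb p j # vs)) \<in> can_forms p k"
      using a by (intro can_forms_sum can_forms_cmult) (auto simp: E_tensor_def simp del: TE_Cons)
    then show ?thesis unfolding e .
  qed
  have sm: "(\<lambda>q. a q (map (\<lambda>X. X q) Xs)) \<in> End0_sections" if Xs: "set Xs \<subseteq> vector_fields" for Xs
    unfolding End0_sections_def
  proof safe
    fix Z assume Z: "Z \<in> vector_fields"
    show "(\<lambda>q. blinfun_apply (a q (map (\<lambda>X. X q) Xs)) (Z q)) \<in> vector_fields"
    proof (cases "length Xs = k")
      case True
      then show ?thesis by (rule TE_vector_field[OF T _ Xs Z])
    next
      case False
      have "g q x (blinfun_apply (a q vs) z) = 0" if "length vs \<noteq> k" for q vs x z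
        using can_forms_alternating[of "\<lambda>vs. TE a q (x # z # vs)" q k] a that by (simp add: E_tensor_def alternating_form_def)
      then have "blinfun_apply (a q vs) z = 0" if "length vs \<noteq> k" for q vs z
        using that by (intro g_eqI[of q]) (simp add: linear_0[OF g_linear(1)])
      then show ?thesis using False by (simp add: vector_fields_zero)
    qed
  next
    fix q show "tr7 (a q (map (\<lambda>X. X q) Xs)) = 0"
      using a by (simp add: E_tensor_def tr7_onb[of _ q])
  qed
  show "a \<in> E_sp k" unfolding can_sections_def using can sm by blast
qed

end

section \<open>The canonical projections\<close>

context g2_manifold
begin

text \<open>The inverse of \<open>|\<phi>|\<^sup>2\<close>, summed over all index lists, in degree three, and of \<open>\<Sum>\<^sub>i\<^sub>j \<phi>\<^sub>i\<^sub>j\<^sub>x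
  \<phi>\<^sub>i\<^sub>j\<^sub>y = 6 g(x, y)\<close> in degrees one and two.\<close>
definition proj_norm :: "nat \<Rightarrow> real" where
  "proj_norm k = (if k = 3 then 1/42 else 1/6)"

definition ker :: "'a \<Rightarrow> nat \<Rightarrow> tvec list \<Rightarrow> tvec list \<Rightarrow> real" where
  "ker p k vs us = proj_norm k * (\<Sum>Xs\<in>ils (3 - k). \<phi> p (map (onb p) Xs @ vs) * \<phi> p (map (onb p) Xs @ us))"

text \<open>An explicit formula for the canonical projection in degrees one to three. It makes sense
  for values in any vector space and applies to arguments that are not alternating.\<close>
definition prj :: "nat \<Rightarrow> 'a \<Rightarrow> 'w::real_vector form \<Rightarrow> 'w form" where
  "prj k p F vs = (\<Sum>js\<in>ils k. ker p k vs (map (onb p) js) *\<^sub>R F (map (onb p) js))"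

lemma ker_sym: "ker p k vs us = ker p k us vs"
  by (simp add: ker_def mult.commute)

lemma phi_contract2:
  "(SUM7 i j. \<phi> p [onb p i, onb p j, u] * \<phi> p [onb p i, onb p j, v]) = 6 * g p u v"
proof -
  have "2 * (SUM7 j i. \<phi> p [onb p i, onb p j, u] * \<phi> p [onb p i, onb p j, v])
      = (SUM7 j. 2 * (SUM7 i. \<phi> p [onb p i, onb p j, u] * \<phi> p [onb p i, onb p j, v]))"
    by (rule sum_distrib_left)
  also have "\<dots> = (SUM7 j. 2 * (g p (onb p j) (onb p j) * g p u v) - g p (onb p j) u * g p (onb p j) v - g p (onb p j) u * g p (onb p j) v)"
  proof (rule sum.cong[OF refl])
    fix j
    show "2 * (SUM7 i. \<phi> p [onb p i, onb p j, u] * \<phi> p [onb p i, onb p j, v])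
        = 2 * (g p (onb p j) (onb p j) * g p u v) - g p (onb p j) u * g p (onb p j) v - g p (onb p j) u * g p (onb p j) v"
      using phi_polar[OF onb, of p "onb p j" u "onb p j" v] by simp
  qed
  also have "\<dots> = 12 * g p u v"
    using orthonormal_parseval[OF onb, of p u v]
    by (simp add: sum_subtractf sum_distrib_left[symmetric] sum_distrib_right[symmetric] orthonormal_g[OF onb] metric_sym[of p "onb p _"])
  finally show ?thesis by (subst sum.swap) simp
qed

lemma ils_1: "(\<Sum>js\<in>ils 1. F js) = (SUM7 i. F [i])"
  and ils_2: "(\<Sum>js\<in>ils 2. F js) = (SUM7 i j. F [i, j])"
  and ils_3: "(\<Sum>js\<in>ils 3. F js) = (SUM7 i j k. F [i, j, k])"
  by (simp_all add: numeral_2_eq_2 numeral_3_eq_3 sum_ils_Suc del: length_0_conv Collect_empty_eq) (simp_all add: sum_ils_0)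

lemma phi_rotate: "\<phi> p [x, y, z] = \<phi> p [y, z, x]"
  using phi_swap[of p] by metis

lemma degree_cases: obtains "k = 0" | "k = (1::nat)" | "k = 2" | "k = 3" | "k > 3"
  by linarith

text \<open>The kernel is made of the values of \<open>\<phi>\<close>, and \<open>phi_contract2\<close> evaluates the double
  contraction.\<close>
lemma ker_reproducing:
  assumes \<alpha>: "\<alpha> \<in> can_forms p k" and k: "0 < k" "k \<le> 3"
  shows "(\<Sum>js\<in>ils k. ker p k vs (map (onb p) js) * \<alpha> (map (onb p) js)) = \<alpha> vs"
proof (cases "length vs = k")
  case False
  then have "ker p k vs us = 0" for us using k by (simp add: ker_def phi_wrong_length)
  moreover have "\<alpha> vs = 0" using can_forms_alternating[OF \<alpha>] False by (simp add: alternating_form_def)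
  ultimately show ?thesis by simp
next
  case True
  let ?b = "onb p"
  consider "k = 1" | "k = 2" | "k = 3" using k by linarith
  then show ?thesis
  proof cases
    case 1
    then obtain v where v: "vs = [v]" using True by (auto simp: length_Suc_conv)
    have "linear (\<lambda>x. \<alpha> [x])"
      using alternating_form_linear[OF can_forms_alternating[OF \<alpha>], of "[v]" 0] 1 by simp
    then show ?thesis
      using orthonormal_expansion_linear[OF onb, of "\<lambda>x. \<alpha> [x]" v p]
      by (simp add: 1 v ker_def ils_1[unfolded One_nat_def] ils_2 proj_norm_def phi_contract2)
  next
    case 2
    then obtain X where X: "\<alpha> = (\<lambda>vs. \<phi> p (X # vs))" using \<alpha> by (auto simp: can_forms_def)
    have c: "(SUM7 i j. \<phi> p [x, ?b i, ?b j] * \<phi> p [X, ?b i, ?b j]) = 6 * g p x X" for x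
      using phi_contract2[of p x X] by (simp only: phi_rotate[of p x] phi_rotate[of p X])
    have "(\<Sum>js\<in>ils k. ker p k vs (map ?b js) * \<alpha> (map ?b js))
        = (SUM7 i j x. (1/6) * \<phi> p (?b x # vs) * (\<phi> p [?b x, ?b i, ?b j] * \<phi> p [X, ?b i, ?b j]))"
      by (simp add: 2 X ker_def ils_1[unfolded One_nat_def] ils_2 proj_norm_def sum_distrib_left sum_distrib_right mult_ac)
    also have "\<dots> = (SUM7 x. (1/6) * \<phi> p (?b x # vs) * (SUM7 i j. \<phi> p [?b x, ?b i, ?b j] * \<phi> p [X, ?b i, ?b j]))"
      unfolding sum_distrib_left by (rule sum_rot3)
    also have "\<dots> = (SUM7 x. g p X (?b x) * \<phi> p (?b x # vs))"
      by (simp only: c) (simp add: metric_sym[of p X] mult.commute)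
    also have "\<dots> = \<phi> p (X # vs)"
      by (rule orthonormal_expansion_linear[OF onb phi_head_linear, symmetric])
    finally show ?thesis by (simp add: X)
  next
    case 3
    then obtain c where c: "\<alpha> = (\<lambda>vs. c * \<phi> p vs)" using \<alpha> by (auto simp: can_forms_def)
    have "(\<Sum>js\<in>ils 3. \<phi> p (map ?b js) * \<phi> p (map ?b js)) = 42"
    proof -
      have "(SUM7 l i j. \<phi> p [?b i, ?b j, ?b l] * \<phi> p [?b i, ?b j, ?b l]) = 42"
        by (simp only: phi_contract2) (simp add: orthonormal_g[OF onb])
      then show ?thesis unfolding ils_3 list.map sum_rot3[of "\<lambda>i j l. \<phi> p [?b i, ?b j, ?b l] * \<phi> p [?b i, ?b j, ?b l]"] .
    qed
    moreover have "ker p 3 vs us = (1/42) * \<phi> p vs * \<phi> p us" for us by (simp add: ker_def proj_norm_def)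
    ultimately have e: "(\<Sum>js\<in>ils 3. ((1/42) * \<phi> p vs * c) * (\<phi> p (map ?b js) * \<phi> p (map ?b js))) = c * \<phi> p vs"
      and e': "ker p 3 vs us * (c * \<phi> p us) = ((1/42) * \<phi> p vs * c) * (\<phi> p us * \<phi> p us)" for us
      by (simp_all only: sum_distrib_left[symmetric]) simp_all
    show ?thesis unfolding 3 c by (simp only: e' e)
  qed
qed

lemma phi_prefix_can: "length Ys + k = 3 \<Longrightarrow> 0 < k \<Longrightarrow> (\<lambda>vs. \<phi> p (Ys @ vs)) \<in> can_forms p k"
proof -
  assume Y: "length Ys + k = 3" "0 < k"
  then consider "k = 1" | "k = 2" | "k = 3" by linarith
  then show ?thesis
  proof cases
    case 1
    then show ?thesis
      using alternating_form_prefix[of 2 1 "\<phi> p" Ys] phi_alternating[of p] Y by (simp add: can_forms_def)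
  next
    case 2
    then obtain X where "Ys = [X]" using Y by (auto simp: length_Suc_conv)
    then show ?thesis using 2 by (auto simp: can_forms_def)
  next
    case 3
    then show ?thesis using Y by (auto simp: can_forms_def intro: exI[of _ 1])
  qed
qed

lemma ker_can: "0 < k \<Longrightarrow> k \<le> 3 \<Longrightarrow> (\<lambda>vs. ker p k vs us) \<in> can_forms p k"
proof -
  assume k: "0 < k" "k \<le> 3"
  have "(\<lambda>vs. ker p k vs us) = (\<lambda>vs. proj_norm k * (\<Sum>Xs\<in>ils (3 - k). \<phi> p (map (onb p) Xs @ us) * \<phi> p (map (onb p) Xs @ vs)))"
    by (simp add: ker_def mult.commute)
  also have "\<dots> \<in> can_forms p k"
    using k by (intro can_forms_sum can_forms_cmult phi_prefix_can) auto
  finally show ?thesis .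
qed

lemma prj_can: "0 < k \<Longrightarrow> k \<le> 3 \<Longrightarrow> prj k p F \<in> can_forms p k" for F :: "real form"
proof -
  assume k: "0 < k" "k \<le> 3"
  have "prj k p F = (\<lambda>vs. \<Sum>js\<in>ils k. F (map (onb p) js) * ker p k vs (map (onb p) js))"
    by (simp add: fun_eq_iff prj_def mult.commute)
  also have "\<dots> \<in> can_forms p k" by (intro can_forms_sum can_forms_cmult ker_can k)
  finally show ?thesis .
qed

lemma prj_id: "\<alpha> \<in> can_forms p k \<Longrightarrow> 0 < k \<Longrightarrow> k \<le> 3 \<Longrightarrow> prj k p \<alpha> = \<alpha>"
  by (simp add: fun_eq_iff prj_def ker_reproducing)

lemma linear_prj: "linear l \<Longrightarrow> l (prj k p F vs) = prj k p (\<lambda>us. l (F us)) vs"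
  by (simp add: prj_def linear_sum linear_scale)

lemma prj_symmetric:
  fixes \<beta> F :: "real form"
  assumes "\<beta> \<in> can_forms p k" "0 < k" "k \<le> 3"
  shows "(\<Sum>js\<in>ils k. \<beta> (map (onb p) js) * prj k p F (map (onb p) js)) = (\<Sum>js\<in>ils k. \<beta> (map (onb p) js) * F (map (onb p) js))"
proof -
  let ?b = "map (onb p)"
  have "(\<Sum>js\<in>ils k. \<beta> (?b js) * prj k p F (?b js)) = (\<Sum>js\<in>ils k. \<Sum>ks\<in>ils k. ker p k (?b ks) (?b js) * \<beta> (?b js) * F (?b ks))"
    by (simp add: prj_def sum_distrib_left ker_sym[of p k "?b _" "?b _"] mult_ac)
  also have "\<dots> = (\<Sum>ks\<in>ils k. \<Sum>js\<in>ils k. ker p k (?b ks) (?b js) * \<beta> (?b js) * F (?b ks))"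
    by (rule sum.swap)
  also have "\<dots> = (\<Sum>ks\<in>ils k. \<beta> (?b ks) * F (?b ks))"
    by (simp add: sum_distrib_right[symmetric] ker_reproducing[OF assms])
  finally show ?thesis .
qed

text \<open>A second candidate differs from \<open>prj\<close> by a canonical form orthogonal to itself, after
  composition with any functional; it vanishes on the basis, and then everywhere since \<open>prj\<close>
  reproduces it.\<close>
lemma can_proj_eq:
  fixes \<alpha> :: "('a, 'w::real_vector) forms"
  assumes k: "0 < k" "k \<le> 3"
  shows "can_proj k \<alpha> p = prj k p (\<alpha> p)"
  unfolding can_proj_def
proof (rule the_equality)
  let ?b = "map (onb p)"
  have orth: "form_inner p k \<beta> (\<lambda>vs. l (\<alpha> p vs - prj k p (\<alpha> p) vs)) = 0"
    if "\<beta> \<in> can_forms p k" and l: "linear l" for \<beta> and l :: "'w \<Rightarrow> real"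
    using prj_symmetric[OF that(1) k, of "\<lambda>vs. l (\<alpha> p vs)"]
    by (simp add: form_inner_def linear_diff[OF l] linear_prj[OF l] right_diff_distrib sum_subtractf)
  then show "\<forall>l :: 'w \<Rightarrow> real. linear l \<longrightarrow> (\<lambda>vs. l (prj k p (\<alpha> p) vs)) \<in> can_forms p k \<and>
      (\<forall>\<beta>\<in>can_forms p k. form_inner p k \<beta> (\<lambda>vs. l (\<alpha> p vs - prj k p (\<alpha> p) vs)) = 0)"
    using prj_can[OF k] by (simp add: linear_prj[of "_ :: 'w \<Rightarrow> real"])
  fix \<alpha>' :: "'w form"
  assume a: "\<forall>l :: 'w \<Rightarrow> real. linear l \<longrightarrow> (\<lambda>vs. l (\<alpha>' vs)) \<in> can_forms p k \<and>
      (\<forall>\<beta>\<in>can_forms p k. form_inner p k \<beta> (\<lambda>vs. l (\<alpha> p vs - \<alpha>' vs)) = 0)"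
  show "\<alpha>' = prj k p (\<alpha> p)"
  proof (rule HOL.ext, rule linear_functional_separates)
    fix vs and l :: "'w \<Rightarrow> real" assume l: "linear l"
    define \<delta> where "\<delta> vs = l (\<alpha>' vs) - l (prj k p (\<alpha> p) vs)" for vs
    have \<delta>: "\<delta> \<in> can_forms p k"
      unfolding \<delta>_def linear_prj[OF l] using can_forms_diff[OF _ prj_can[OF k]] a l by blast
    have "form_inner p k \<delta> (\<lambda>vs. l (\<alpha> p vs - prj k p (\<alpha> p) vs)) - form_inner p k \<delta> (\<lambda>vs. l (\<alpha> p vs - \<alpha>' vs)) = 0"
      using orth[OF \<delta> l] a l \<delta> by simp
    then have "(\<Sum>js\<in>ils k. \<delta> (?b js) * \<delta> (?b js)) = 0"
      by (simp add: form_inner_def diff_divide_distrib[symmetric] sum_subtractf[symmetric] right_diff_distrib[symmetric] linear_diff[OF l])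
        (simp add: \<delta>_def)
    then have "\<forall>js\<in>ils k. \<delta> (?b js) * \<delta> (?b js) = 0"
      by (subst (asm) sum_nonneg_eq_0_iff) (auto simp: finite_ils)
    then have "\<delta> vs = 0"
      using fun_cong[OF prj_id[OF \<delta> k], of vs] by (simp add: prj_def)
    then show "l (\<alpha>' vs) = l (prj k p (\<alpha> p) vs)" by (simp add: \<delta>_def)
  qed
qed

lemma can_forms_high: "3 < k \<Longrightarrow> can_forms p k = {\<lambda>vs. 0}"
  by (simp add: can_forms_def zero_fun_def)

lemma can_proj_high:
  fixes \<alpha> :: "('a, 'w::real_vector) forms"
  assumes k: "3 < k"
  shows "can_proj k \<alpha> p = (\<lambda>vs. 0)"
  unfolding can_proj_def
proof (rule the_equality)
  show "\<forall>l :: 'w \<Rightarrow> real. linear l \<longrightarrow> (\<lambda>vs. l 0) \<in> can_forms p k \<and>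
      (\<forall>\<beta>\<in>can_forms p k. form_inner p k \<beta> (\<lambda>vs. l (\<alpha> p vs - 0)) = 0)"
    by (simp add: can_forms_high[OF k] linear_0 form_inner_def)
  fix \<alpha>' :: "'w form"
  assume a: "\<forall>l :: 'w \<Rightarrow> real. linear l \<longrightarrow> (\<lambda>vs. l (\<alpha>' vs)) \<in> can_forms p k \<and>
      (\<forall>\<beta>\<in>can_forms p k. form_inner p k \<beta> (\<lambda>vs. l (\<alpha> p vs - \<alpha>' vs)) = 0)"
  show "\<alpha>' = (\<lambda>vs. 0)"
  proof (rule HOL.ext, rule linear_functional_separates)
    fix vs and l :: "'w \<Rightarrow> real" assume l: "linear l"
    have "(\<lambda>vs. l (\<alpha>' vs)) = (\<lambda>vs. 0)" using a l can_forms_high[OF k, of p] by blast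
    then show "l (\<alpha>' vs) = l 0" using l by (simp add: fun_eq_iff linear_0)
  qed
qed

lemma prj_add: "prj k p (\<lambda>us. F us + G us) vs = prj k p F vs + prj k p G vs"
  by (simp add: prj_def scaleR_add_right sum.distrib)

lemma prj_diff: "prj k p (\<lambda>us. F us - G us) vs = prj k p F vs - prj k p G vs"
  by (simp add: prj_def scaleR_diff_right sum_subtractf)

lemma prj_scale: "prj k p (\<lambda>us. c *\<^sub>R F us) vs = c *\<^sub>R prj k p F vs"
  by (simp add: prj_def scaleR_sum_right mult.commute)

lemma prj_cong: "(\<And>us. length us = k \<Longrightarrow> F us = G us) \<Longrightarrow> prj k p F = prj k p G"
  by (simp add: fun_eq_iff prj_def)

lemma prj_wrong_length: "k \<le> 3 \<Longrightarrow> length vs \<noteq> k \<Longrightarrow> prj k p F vs = 0"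
  by (simp add: prj_def ker_def phi_wrong_length)

text \<open>The contractions with \<open>\<phi>\<close>, which are all that a projection depends on: identities between
  projections are proved on them.\<close>
definition test :: "'a \<Rightarrow> nat \<Rightarrow> 'w::real_vector form \<Rightarrow> tvec list \<Rightarrow> 'w" where
  "test p k F Xs = (\<Sum>js\<in>ils k. \<phi> p (Xs @ map (onb p) js) *\<^sub>R F (map (onb p) js))"

lemma prj_test: "prj k p F vs = proj_norm k *\<^sub>R (\<Sum>Xs\<in>ils (3 - k). \<phi> p (map (onb p) Xs @ vs) *\<^sub>R test p k F (map (onb p) Xs))"
proof -
  have "prj k p F vs = (\<Sum>js\<in>ils k. \<Sum>Xs\<in>ils (3 - k).
      (proj_norm k * (\<phi> p (map (onb p) Xs @ vs) * \<phi> p (map (onb p) Xs @ map (onb p) js))) *\<^sub>R F (map (onb p) js))"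
    by (simp add: prj_def ker_def sum_distrib_left scaleR_sum_left)
  also have "\<dots> = (\<Sum>Xs\<in>ils (3 - k). \<Sum>js\<in>ils k.
      (proj_norm k * (\<phi> p (map (onb p) Xs @ vs) * \<phi> p (map (onb p) Xs @ map (onb p) js))) *\<^sub>R F (map (onb p) js))"
    by (rule sum.swap)
  finally show ?thesis by (simp add: test_def scaleR_sum_right)
qed

lemma prj_eqI:
  assumes "\<And>Xs. length Xs = 3 - k \<Longrightarrow> test p k F Xs = test p k G Xs"
  shows "prj k p F vs = prj k p G vs"
  by (simp add: prj_test assms)

lemma test_diff: "test p k (\<lambda>us. F us - G us) Xs = test p k F Xs - test p k G Xs"
  by (simp add: test_def scaleR_diff_right sum_subtractf)

lemma test_sum: "test p k (\<lambda>us. \<Sum>a\<in>A. F a us) Xs = (\<Sum>a\<in>A. test p k (F a) Xs)"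
  unfolding test_def scaleR_sum_right by (rule sum.swap)

lemma test_cong: "(\<And>us. length us = k \<Longrightarrow> F us = G us) \<Longrightarrow> test p k F Xs = test p k G Xs"
  by (simp add: test_def)

lemma test_prj:
  fixes F :: "real form"
  shows "length Xs + k = 3 \<Longrightarrow> 0 < k \<Longrightarrow> test p k (prj k p F) Xs = test p k F Xs"
  using prj_symmetric[OF phi_prefix_can, of Xs k p F] by (simp add: test_def)

lemma test_Suc: "test p (Suc k) F Xs = (SUM7 i. test p k (\<lambda>us. F (onb p i # us)) (Xs @ [onb p i]))"
  by (simp add: test_def sum_ils_Suc)

definition alt_sum :: "'w::real_vector form \<Rightarrow> 'w form" where
  "alt_sum F vs = (\<Sum>i<length vs. (-1)^i *\<^sub>R F (vs ! i # omit i vs))"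

text \<open>Contracting with the alternating \<open>\<phi>\<close>, each of the \<open>k + 1\<close> summands contributes the same. So
  exterior derivatives and wedge products may be replaced, under a projection, by a single term.\<close>
lemma prj_alt_sum:
  assumes k: "Suc k \<le> 3"
  shows "prj (Suc k) p (alt_sum F) vs = real (Suc k) *\<^sub>R prj (Suc k) p F vs"
proof -
  let ?b = "map (onb p)"
  have "test p (Suc k) (alt_sum F) Xs = test p (Suc k) (\<lambda>us. real (Suc k) *\<^sub>R F us) Xs" if Xs: "length Xs = 3 - Suc k" for Xs
  proof -
    have "alternating_form (length Xs + Suc k) (\<phi> p)" using phi_alternating[of p] Xs k by (simp add: numeral_3_eq_3)
    then have alt: "alternating_form (Suc k) (\<lambda>vs. \<phi> p (Xs @ vs))"
      by (rule alternating_form_prefix) simp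
    have *: "(\<Sum>js\<in>ils (Suc k). \<phi> p (Xs @ ?b js) *\<^sub>R (-1)^i *\<^sub>R F (?b js ! i # omit i (?b js))) = test p (Suc k) F Xs"
      if i: "i < Suc k" for i
    proof -
      have "(-1)^i * \<phi> p (Xs @ ?b js) = \<phi> p (Xs @ ?b (js ! i # omit i js))" if js: "length js = Suc k" for js
      proof -
        have "\<phi> p (Xs @ (?b js ! i # omit i (?b js))) = (-1)^i * \<phi> p (Xs @ ?b js)"
          using alternating_form_move[OF alt, of "?b js" i "?b js ! i"] i js by (simp only: list_update_id length_map)
        then show ?thesis using i js by (simp add: map_omit)
      qed
      then have "(\<Sum>js\<in>ils (Suc k). \<phi> p (Xs @ ?b js) *\<^sub>R (-1)^i *\<^sub>R F (?b js ! i # omit i (?b js)))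
          = (\<Sum>js\<in>ils (Suc k). \<phi> p (Xs @ ?b (js ! i # omit i js)) *\<^sub>R F (?b (js ! i # omit i js)))"
        using i by (intro sum.cong[OF refl]) (simp add: map_omit mult.commute)
      also have "\<dots> = (\<Sum>js\<in>ils (Suc k). \<phi> p (Xs @ ?b js) *\<^sub>R F (?b js))"
      proof (rule sum.reindex_bij_witness[of _ "\<lambda>js. take i (tl js) @ hd js # drop i (tl js)" "\<lambda>js. js ! i # omit i js"])
        fix js :: "7 list" assume "js \<in> ils (Suc k)"
        then obtain j ks where "js = j # ks" "length ks = k" by (auto simp: length_Suc_conv)
        then show "(take i (tl js) @ hd js # drop i (tl js)) ! i # omit i (take i (tl js) @ hd js # drop i (tl js)) = js"
          "take i (tl js) @ hd js # drop i (tl js) \<in> ils (Suc k)"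
          using i by (auto simp: omit_def nth_append)
      qed (use i in \<open>auto simp: omit_def id_take_nth_drop[symmetric]\<close>)
      finally show ?thesis by (simp add: test_def)
    qed
    have "test p (Suc k) (alt_sum F) Xs = (\<Sum>i<Suc k. \<Sum>js\<in>ils (Suc k). \<phi> p (Xs @ ?b js) *\<^sub>R (-1)^i *\<^sub>R F (?b js ! i # omit i (?b js)))"
      unfolding test_def by (subst sum.swap) (simp add: alt_sum_def scaleR_sum_right del: sum.lessThan_Suc)
    also have "\<dots> = real (Suc k) *\<^sub>R test p (Suc k) F Xs" using * by (simp add: scaleR_conv_of_real sum_constant_scaleR)
    finally show ?thesis by (simp add: test_def scaleR_sum_right mult.commute)
  qed
  then have "prj (Suc k) p (alt_sum F) vs = prj (Suc k) p (\<lambda>us. real (Suc k) *\<^sub>R F us) vs" by (rule prj_eqI)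
  then show ?thesis by (simp only: prj_scale)
qed

subsection \<open>Projections of tensors\<close>

text \<open>The projection of the last \<open>k\<close> arguments of a tensor with \<open>r\<close> value slots, as a twofold
  contraction with \<open>\<phi>\<close>.\<close>
definition prjT :: "nat \<Rightarrow> nat \<Rightarrow> ('a, real) forms \<Rightarrow> ('a, real) forms" where
  "prjT r k S p ws = proj_norm k * contract r (3 - k) (contract r k S \<phi>) \<phi> p ws"

lemma phi_block: "length us + length vs = 3 \<Longrightarrow> \<phi> p (us @ vs) = \<phi> p (vs @ us)"
proof -
  assume l: "length us + length vs = 3"
  then obtain a b c where abc: "us @ vs = [a, b, c]" by (metis length_append length_3_iff)
  consider "us = []" | "us = [a]" | "us = [a, b]" | "us = [a, b, c]"
    using abc l by (cases us rule: remdups_adj.cases; auto simp: Cons_eq_append_conv append_eq_Cons_conv)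
  then show ?thesis
    using abc phi_rotate[of p a b c] phi_rotate[of p b c a] by cases auto
qed

lemma prjT_eq:
  assumes "length zs = r" "length vs = k" "k \<le> 3"
  shows "prjT r k S p (zs @ vs) = prj k p (\<lambda>us. S p (zs @ us)) vs"
proof -
  have "contract r k S \<phi> p (zs @ Xs) = test p k (\<lambda>us. S p (zs @ us)) Xs" for Xs
    using assms by (simp add: contract_def test_def mult.commute)
  moreover have "\<phi> p (vs @ map (onb p) Xs) = \<phi> p (map (onb p) Xs @ vs)" if "Xs \<in> ils (3 - k)" for Xs
    using that assms by (intro phi_block) simp
  ultimately show ?thesis
    using assms by (simp add: prjT_def contract_def[of r "3 - k"] prj_test mult.commute)
qed

lemma
  assumes S: "tensor (r + k) S" and k: "k \<le> 3"
  shows tensor_prjT: "tensor (r + k) (prjT r k S)"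
    and contract_tensor_phi: "tensor (r + (3 - k)) (contract r k S \<phi>)"
proof -
  have 1: "tensor ((3 - k) + k) \<phi>" and 2: "tensor (k + (3 - k)) \<phi>" using tensor_phi k by simp_all
  show C: "tensor (r + (3 - k)) (contract r k S \<phi>)" by (rule tensor_contract[OF S 1])
  show "tensor (r + k) (prjT r k S)" unfolding prjT_def by (rule tensor_cmult[OF tensor_contract[OF C 2]])
qed

end

context torsion_free_g2_manifold
begin

text \<open>The Leibniz rule for contractions, \<open>\<phi>\<close> being parallel.\<close>
lemma nabla_prjT:
  assumes S: "tensor (r + k) S" and k: "k \<le> 3" and zs: "length zs = r" and vs: "length vs = k"
  shows "nabla (prjT r k S) p (v # zs @ vs) = prj k p (\<lambda>us. nabla S p (v # zs @ us)) vs"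
proof -
  let ?b = "map (onb p)" and ?C = "contract r k S \<phi>"
  have 1: "tensor ((3 - k) + k) \<phi>" and 2: "tensor (k + (3 - k)) \<phi>" using tensor_phi k by simp_all
  note C = contract_tensor_phi[OF S k]
  have N1: "nabla ?C p (v # zs @ ?b Xs) = test p k (\<lambda>us. nabla S p (v # zs @ us)) (?b Xs)" if "length Xs = 3 - k" for Xs
    using nabla_contract[OF S 1, of "zs @ ?b Xs" p v] zs k that
    by (simp add: test_def nabla_phi_zero mult.commute)
  have "nabla (prjT r k S) p (v # zs @ vs) = proj_norm k * nabla (contract r (3 - k) ?C \<phi>) p (v # zs @ vs)"
    unfolding prjT_def using zs vs by (intro nabla_cmult[OF tensor_contract[OF C 2]]) simp
  also have "nabla (contract r (3 - k) ?C \<phi>) p (v # zs @ vs) = (\<Sum>Xs\<in>ils (3 - k). nabla ?C p (v # zs @ ?b Xs) * \<phi> p (vs @ ?b Xs))"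
    using nabla_contract[OF C 2, of "zs @ vs" p v] zs vs k by (simp add: nabla_phi_zero)
  also have "\<dots> = (\<Sum>Xs\<in>ils (3 - k). \<phi> p (?b Xs @ vs) * test p k (\<lambda>us. nabla S p (v # zs @ us)) (?b Xs))"
    using vs k by (intro sum.cong[OF refl]) (simp add: N1 phi_block[of vs])
  finally show ?thesis by (simp add: prj_test)
qed

end

section \<open>The differentials as tensor operations\<close>

context riemannian_manifold7
begin

lemma nabla_vanish: "(\<And>q us. length us = n \<Longrightarrow> T q us = 0) \<Longrightarrow> length ws = n \<Longrightarrow> nabla T p (v # ws) = 0"
  using nabla_cong[of n T "\<lambda>q us. 0" ws p v] by (simp add: nabla_zero)

text \<open>The covariant derivative with the new argument moved behind the \<open>r\<close> value slots.\<close>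
definition nabla_after :: "nat \<Rightarrow> nat \<Rightarrow> ('a, real) forms \<Rightarrow> ('a, real) forms" where
  "nabla_after r k T = reorder (r # [0..<r] @ [Suc r..<Suc (r + k)]) (nabla T)"

lemma insert_positions:
  "distinct (r # [0..<r] @ [Suc r..<Suc (r + k)])" "set (r # [0..<r] @ [Suc r..<Suc (r + k)]) = {..<Suc (r + k)}"
  by (auto simp del: upt_Suc)

lemma map_nth_insert:
  assumes "length zs = r" "length js = k"
  shows "map (\<lambda>i. (zs @ x # js) ! i) (r # [0..<r] @ [Suc r..<Suc (r + k)]) = x # zs @ js"
proof -
  have "map (\<lambda>i. (zs @ x # js) ! i) [0..<r] = zs"
    using assms by (intro nth_equalityI) (auto simp: nth_append)
  moreover have "map (\<lambda>i. (zs @ x # js) ! i) [Suc r..<Suc (r + k)] = js"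
    using assms by (intro nth_equalityI) (auto simp: nth_append simp del: upt_Suc)
  ultimately show ?thesis using assms by (simp add: nth_append del: upt_Suc)
qed

lemma nabla_after_apply:
  "length zs = r \<Longrightarrow> length js = k \<Longrightarrow> nabla_after r k T p (zs @ x # js) = nabla T p (x # zs @ js)"
  unfolding nabla_after_def reorder_def by (simp only: map_nth_insert)

lemma tensor_nabla_after: "tensor (r + k) T \<Longrightarrow> tensor (r + Suc k) (nabla_after r k T)"
  unfolding nabla_after_def add_Suc_right by (intro tensor_reorder tensor_nabla insert_positions)

lemma nabla_nabla_after:
  assumes "tensor (r + k) T" "length zs = r" "length js = k"
  shows "nabla (nabla_after r k T) p (v # zs @ x # js) = nabla (nabla T) p (v # x # zs @ js)"
  unfolding nabla_after_def
  using nabla_reorder[OF tensor_nabla[OF assms(1)] insert_positions, of "zs @ x # js" p v] assms(2,3)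
  by (simp only: map_nth_insert) simp

end

context g2_manifold
begin

definition trace01 :: "('a, real) forms \<Rightarrow> ('a, real) forms" where
  "trace01 T p ws = (SUM7 i. T p (onb p i # onb p i # ws))"

text \<open>A trace is a contraction with the parallel metric.\<close>
lemma
  assumes T: "tensor (Suc (Suc n)) T"
  shows tensor_trace01: "tensor n (trace01 T)"
    and nabla_trace01: "length ws = n \<Longrightarrow> nabla (trace01 T) p (v # ws) = (SUM7 i. nabla T p (v # onb p i # onb p i # ws))"
proof -
  define \<sigma> where "\<sigma> = [n, Suc n] @ [0..<n]"
  have \<sigma>: "distinct \<sigma>" "set \<sigma> = {..<Suc (Suc n)}" by (auto simp: \<sigma>_def)
  have map: "map (\<lambda>i. (ws @ [x, y]) ! i) \<sigma> = x # y # ws" if "length ws = n" for ws and x y :: tvec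
  proof -
    have "map (\<lambda>i. (ws @ [x, y]) ! i) [0..<n] = ws"
      using that by (intro nth_equalityI) (auto simp: nth_append)
    then show ?thesis using that by (simp add: \<sigma>_def nth_append)
  qed
  have S: "tensor (n + 2) (reorder \<sigma> T)" using tensor_reorder[OF T \<sigma>] by simp
  have M: "tensor (0 + 2) metric_form" using tensor_metric by (simp only: add_0)
  have eq: "contract 0 2 metric_form (reorder \<sigma> T) p ws = trace01 T p ws" if "length ws = n" for p ws
    using that
    by (simp add: contract_def ils_2 metric_form_def orthonormal_g[OF onb] trace01_def reorder_def map
        if_distrib[where f="\<lambda>x. x * _"] cong: if_cong)
  show "tensor n (trace01 T)" using tensor_cong[OF tensor_contract[OF M S]] eq by simp
  show "nabla (trace01 T) p (v # ws) = (SUM7 i. nabla T p (v # onb p i # onb p i # ws))" if ws: "length ws = n"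
  proof -
    have "nabla (trace01 T) p (v # ws) = nabla (contract 0 2 metric_form (reorder \<sigma> T)) p (v # ws)"
      by (rule nabla_cong[OF eq[symmetric] ws])
    also have "\<dots> = (SUM7 i j. g p (onb p i) (onb p j) * nabla (reorder \<sigma> T) p (v # ws @ [onb p i, onb p j]))"
      using nabla_contract[OF M S, of ws p v] ws
      by (simp add: ils_2 nabla_metric metric_form_def)
    also have "\<dots> = (SUM7 i. nabla (reorder \<sigma> T) p (v # ws @ [onb p i, onb p i]))"
      by (simp add: orthonormal_g[OF onb] if_distrib[where f="\<lambda>x. x * _"] cong: if_cong)
    also have "\<dots> = (SUM7 i. nabla T p (v # onb p i # onb p i # ws))"
    proof (rule sum.cong[OF refl])
      fix i
      show "nabla (reorder \<sigma> T) p (v # ws @ [onb p i, onb p i]) = nabla T p (v # onb p i # onb p i # ws)"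
        using nabla_reorder[OF T \<sigma>, of "ws @ [onb p i, onb p i]" p v] ws by (simp only: map) simp
    qed
    finally show ?thesis .
  qed
qed

text \<open>The common generalization of \<open>G_tensor\<close> (\<open>r = 1\<close>) and of \<open>E_tensor\<close> without the trace
  condition (\<open>r = 2\<close>).\<close>
definition can_tensor :: "nat \<Rightarrow> nat \<Rightarrow> ('a, real) forms \<Rightarrow> bool" where
  "can_tensor r k T \<longleftrightarrow> tensor (r + k) T \<and> (\<forall>p zs. length zs = r \<longrightarrow> (\<lambda>vs. T p (zs @ vs)) \<in> can_forms p k)"

lemma can_tensor_wrong_length:
  assumes "can_tensor r k T" "length ws \<noteq> r + k" "r \<le> length ws"
  shows "T p ws = 0"
proof -
  have "(\<lambda>vs. T p (take r ws @ vs)) \<in> can_forms p k" using assms by (simp add: can_tensor_def)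
  then have "alternating_form k (\<lambda>vs. T p (take r ws @ vs))" by (rule can_forms_alternating)
  then have "length (drop r ws) \<noteq> k \<longrightarrow> T p (take r ws @ drop r ws) = 0"
    unfolding alternating_form_def by blast
  then have "T p (take r ws @ drop r ws) = 0" using assms(2,3) by auto
  then show ?thesis by simp
qed

lemma can_tensor_any_degree: "can_tensor r k T \<Longrightarrow> tensor (r + n) T"
proof (cases "n = k")
  case False
  assume "can_tensor r k T"
  then have "0 = T p vs" if "length vs = r + n" for p vs using can_tensor_wrong_length[of r k T vs p] that False by simp
  then show ?thesis by (rule tensor_cong[OF tensor_zero])
qed (simp add: can_tensor_def)

lemma can_forms_0_iff: "\<alpha> \<in> can_forms p 0 \<longleftrightarrow> (\<forall>vs. vs \<noteq> [] \<longrightarrow> \<alpha> vs = 0)"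
  by (auto simp: can_forms_def alternating_form_def)

text \<open>Both \<open>d_G\<close> (with \<open>r = 1\<close>) and \<open>d_E\<close> (with \<open>r = 2\<close>) have this form.\<close>
definition diff_tensor :: "nat \<Rightarrow> nat \<Rightarrow> ('a, real) forms \<Rightarrow> ('a, real) forms" where
  "diff_tensor r k T p ws = real (Suc k) * prjT r (Suc k) (nabla_after r k T) p ws"

lemma diff_tensor_apply:
  assumes "Suc k \<le> 3" "length zs = r" "length vs = Suc k"
  shows "diff_tensor r k T p (zs @ vs) = real (Suc k) * prj (Suc k) p (\<lambda>us. nabla T p (hd us # zs @ tl us)) vs"
proof -
  have "prj (Suc k) p (\<lambda>us. nabla_after r k T p (zs @ us)) = prj (Suc k) p (\<lambda>us. nabla T p (hd us # zs @ tl us))"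
    by (rule prj_cong) (use assms in \<open>auto simp: length_Suc_conv nabla_after_apply\<close>)
  then show ?thesis unfolding diff_tensor_def using assms by (subst prjT_eq) simp_all
qed

lemma can_tensorI_diff:
  assumes T: "tensor (r + k) T" and k: "Suc k \<le> 3"
    and S: "\<And>p zs vs. length zs = r \<Longrightarrow> S p (zs @ vs) = real (Suc k) * prj (Suc k) p (\<lambda>us. nabla T p (hd us # zs @ tl us)) vs"
  shows "can_tensor r (Suc k) S"
  unfolding can_tensor_def
proof (intro conjI allI impI)
  show "tensor (r + Suc k) S"
  proof (rule tensor_cong)
    show "tensor (r + Suc k) (diff_tensor r k T)"
      unfolding diff_tensor_def by (rule tensor_cmult[OF tensor_prjT[OF tensor_nabla_after[OF T] k]])
    fix p and ws :: "tvec list" assume ws: "length ws = r + Suc k"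
    show "diff_tensor r k T p ws = S p ws"
      using diff_tensor_apply[OF k, of "take r ws" r "drop r ws" T p] S[of "take r ws" p "drop r ws"] ws by simp
  qed
  fix p and zs :: "tvec list" assume "length zs = r"
  then show "(\<lambda>vs. S p (zs @ vs)) \<in> can_forms p (Suc k)"
    using can_forms_cmult[OF prj_can[of "Suc k" p "\<lambda>us. nabla T p (hd us # zs @ tl us)"], of "real (Suc k)"] k by (simp add: S)
qed

end

context torsion_free_g2_manifold
begin

text \<open>A canonical form is its own projection, and the projection commutes with the covariant
  derivative.\<close>
lemma nabla_can_forms:
  assumes T: "can_tensor r k T" and zs: "length zs = r"
  shows "(\<lambda>vs. nabla T p (v # zs @ vs)) \<in> can_forms p k"
proof -
  have wrong: "nabla T p (v # zs @ vs) = 0" if "length vs \<noteq> k" for vs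
    by (rule nabla_vanish[of "length (zs @ vs)"]) (use can_tensor_wrong_length[OF T] that zs in auto)
  have main: ?thesis if k: "0 < k" "k \<le> 3"
  proof -
    have T': "tensor (r + k) T" using T by (simp add: can_tensor_def)
    have eq: "T p ws = prjT r k T p ws" if "length ws = r + k" for p ws
    proof -
      have "prj k p (\<lambda>us. T p (take r ws @ us)) = (\<lambda>us. T p (take r ws @ us))"
        using T that by (intro prj_id k) (simp add: can_tensor_def)
      then show ?thesis using prjT_eq[of "take r ws" r "drop r ws" k T p] that k by simp
    qed
    have "nabla T p (v # zs @ vs) = prj k p (\<lambda>us. nabla T p (v # zs @ us)) vs" for vs
    proof (cases "length vs = k")
      case True
      then have "nabla T p (v # zs @ vs) = nabla (prjT r k T) p (v # zs @ vs)"
        using zs by (intro nabla_cong[of "r + k"] eq) simp_all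
      then show ?thesis by (simp add: nabla_prjT[OF T' k(2) zs True])
    qed (simp add: wrong prj_wrong_length[OF k(2)])
    then show ?thesis using prj_can[OF k, of p "\<lambda>us. nabla T p (v # zs @ us)"] by (metis (no_types, lifting) HOL.ext)
  qed
  show ?thesis
  proof (cases k rule: degree_cases)
    case 1
    then show ?thesis using wrong by (simp add: can_forms_0_iff)
  next
    case 5
    have "T q ws = 0" if "length ws = r + k" for q ws
    proof -
      have "(\<lambda>vs. T q (take r ws @ vs)) \<in> can_forms q k" using T that by (simp add: can_tensor_def)
      then have "T q (take r ws @ drop r ws) = 0" unfolding can_forms_high[OF 5] by (simp only: singleton_iff fun_eq_iff)
      then show ?thesis by simp
    qed
    then have "nabla T p (v # zs @ vs) = 0" if "length vs = k" for vs
      using that zs by (intro nabla_vanish[of "r + k"]) auto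
    then show ?thesis using wrong can_forms_zero[of p k] by (metis (no_types, lifting) HOL.ext)
  qed (use main in simp_all)
qed

end

section \<open>Curvature terms in form degree\<close>

lemma antisymmetric_sum:
  fixes P N :: "'i \<Rightarrow> 'i \<Rightarrow> real"
  assumes "\<And>i j. P j i = - P i j"
  shows "2 * (\<Sum>i\<in>A. \<Sum>j\<in>A. P i j * N i j) = (\<Sum>i\<in>A. \<Sum>j\<in>A. P i j * (N i j - N j i))"
proof -
  have "(\<Sum>i\<in>A. \<Sum>j\<in>A. P i j * N i j) = (\<Sum>i\<in>A. \<Sum>j\<in>A. P j i * N j i)" by (rule sum.swap)
  also have "\<dots> = - (\<Sum>i\<in>A. \<Sum>j\<in>A. P i j * N j i)"
    unfolding sum_negf[symmetric] using assms by (intro sum.cong refl) (metis mult_minus_left)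
  finally show ?thesis by (simp add: right_diff_distrib sum_subtractf)
qed

context torsion_free_g2_manifold
begin

lemma phi_append_swap: "\<phi> p (Xs @ y # x # ks) = - \<phi> p (Xs @ x # y # ks)"
proof (cases "length Xs + length ks = 1")
  case True
  then consider a where "Xs = [a]" "ks = []" | a where "Xs = []" "ks = [a]"
    by (cases Xs; cases ks) auto
  then show ?thesis by cases (simp_all add: phi_swap[of p y x] phi_swap(2)[of p _ y x])
qed (simp add: phi_wrong_length)

lemma curvature_phi_contraction:
  assumes "length Xs + length ks = 1" "linear h"
  shows "(SUM7 i j. \<phi> p (Xs @ onb p i # onb p j # ks) * h (Rm p (onb p i) (onb p j) u)) = 0"
proof -
  obtain a where "\<And>x y. \<phi> p (Xs @ x # y # ks) = \<phi> p [a, x, y]"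
  proof (cases Xs)
    case Nil
    then obtain a where "ks = [a]" using assms(1) by (auto simp: length_Suc_conv)
    then show thesis using that[of a] Nil phi_rotate[of p a] by simp
  next
    case (Cons a As)
    then show thesis using that[of a] assms(1) by simp
  qed
  then show ?thesis using Rm_L14[OF onb assms(2)] by simp
qed

text \<open>Antisymmetrizing in \<open>i, j\<close>, the Bianchi identity turns the term into one with both form
  indices of the curvature contracted with \<open>\<phi>\<close>.\<close>
lemma curvature_bianchi_contraction:
  assumes h: "linear h"
  shows "(SUM7 i j. \<phi> p [x, onb p i, onb p j] * h (Rm p y (onb p i) (onb p j))) = 0"
proof -
  have B: "Rm p y i j - Rm p y j i = - Rm p i j y" for i j
    using bianchi[of p y i j] by (simp add: Rm_antisym[of p y j] algebra_simps add_eq_0_iff)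
  have "2 * (SUM7 i j. \<phi> p [x, onb p i, onb p j] * h (Rm p y (onb p i) (onb p j)))
      = (SUM7 i j. \<phi> p [x, onb p i, onb p j] * (h (Rm p y (onb p i) (onb p j)) - h (Rm p y (onb p j) (onb p i))))"
    by (rule antisymmetric_sum) (rule phi_swap)
  also have "\<dots> = - (SUM7 i j. \<phi> p [x, onb p i, onb p j] * h (Rm p (onb p i) (onb p j) y))"
    by (simp only: linear_diff[OF h, symmetric] B linear_neg[OF h] mult_minus_right sum_negf)
  also have "\<dots> = 0" by (simp only: Rm_L14[OF onb h])
  finally show ?thesis by simp
qed

text \<open>Commuting a form index \<open>i\<close> past a derivative along \<open>y\<close> lets the curvature \<open>R(y, i)\<close> act on
  the other form arguments; no canonical projection sees the result.\<close>
lemma curvature_form_part: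
  assumes M: "multilin k M" and Xs: "length Xs + Suc k = 3"
  shows "test p (Suc k) (\<lambda>us. \<Sum>s<k. M ((tl us)[s := Rm p y (hd us) (tl us ! s)])) Xs = 0"
proof -
  let ?b = "onb p"
  consider "k = 0" | "k = 1" | "k = 2" using Xs by linarith
  then show ?thesis
  proof cases
    case 1
    then show ?thesis by (simp add: test_def)
  next
    case 2
    then obtain x where x: "Xs = [x]" using Xs by (auto simp: length_Suc_conv)
    have "linear (\<lambda>u. M [u])" using multilinD[OF M, of "[0]" 0] 2 by simp
    from curvature_bianchi_contraction[OF this] show ?thesis
      by (simp add: test_def 2 x ils_2[unfolded numeral_2_eq_2])
  next
    case 3
    then have x: "Xs = []" using Xs by simp
    have lin: "linear (\<lambda>u. M [u, w])" "linear (\<lambda>u. M [w, u])" for w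
      using multilinD[OF M, of "[0, w]" 0] multilinD[OF M, of "[w, 0]" 1] 3 by simp_all
    have parts: "test p (Suc k) (\<lambda>us. \<Sum>s<k. M ((tl us)[s := Rm p y (hd us) (tl us ! s)])) Xs
        = (SUM7 i j l. \<phi> p [?b i, ?b j, ?b l] * M [Rm p y (?b i) (?b j), ?b l])
        + (SUM7 i j l. \<phi> p [?b i, ?b j, ?b l] * M [?b j, Rm p y (?b i) (?b l)])"
      by (simp add: test_def 3 x ils_3[unfolded numeral_3_eq_3] numeral_2_eq_2 distrib_left sum.distrib)
    have first: "(SUM7 i j l. \<phi> p [?b i, ?b j, ?b l] * M [Rm p y (?b i) (?b j), ?b l])
        = (SUM7 l i j. \<phi> p [?b l, ?b i, ?b j] * M [Rm p y (?b i) (?b j), ?b l])"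
    proof -
      have "\<phi> p [?b i, ?b j, ?b l] = \<phi> p [?b l, ?b i, ?b j]" for i j l by (rule phi_rotate[symmetric])
      then show ?thesis by (subst sum_rot3) simp
    qed
    have e: "\<phi> p [?b i, ?b j, ?b l] * c = - (\<phi> p [?b j, ?b i, ?b l] * c)" for i j l c
      by (simp add: phi_swap(1)[of p "?b i" "?b j" "?b l"])
    have second: "(SUM7 i j l. \<phi> p [?b i, ?b j, ?b l] * M [?b j, Rm p y (?b i) (?b l)])
        = - (SUM7 j i l. \<phi> p [?b j, ?b i, ?b l] * M [?b j, Rm p y (?b i) (?b l)])"
      unfolding sum_negf[symmetric]
      by (subst sum.swap) (intro sum.cong refl e)
    show ?thesis unfolding parts first second by (simp add: curvature_bianchi_contraction[OF lin(1)] curvature_bianchi_contraction[OF lin(2)])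
  qed
qed

section \<open>The diagonal differentials square to zero\<close>

lemma nabla_diff_tensor:
  assumes T: "tensor (r + k) T" and k: "Suc k \<le> 3" and zs: "length zs = r" and vs: "length vs = Suc k"
  shows "nabla (diff_tensor r k T) p (v # zs @ vs)
    = real (Suc k) * prj (Suc k) p (\<lambda>us. nabla (nabla T) p (v # hd us # zs @ tl us)) vs"
proof -
  note S = tensor_nabla_after[OF T]
  have "nabla (diff_tensor r k T) p (v # zs @ vs) = real (Suc k) * nabla (prjT r (Suc k) (nabla_after r k T)) p (v # zs @ vs)"
    unfolding diff_tensor_def using zs vs by (intro nabla_cmult[OF tensor_prjT[OF S k]]) simp
  also have "nabla (prjT r (Suc k) (nabla_after r k T)) p (v # zs @ vs)
      = prj (Suc k) p (\<lambda>us. nabla (nabla_after r k T) p (v # zs @ us)) vs"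
    by (rule nabla_prjT[OF S k zs vs])
  also have "prj (Suc k) p (\<lambda>us. nabla (nabla_after r k T) p (v # zs @ us)) = prj (Suc k) p (\<lambda>us. nabla (nabla T) p (v # hd us # zs @ tl us))"
  proof (rule prj_cong)
    fix us :: "tvec list" assume "length us = Suc k"
    then obtain i js where us: "us = i # js" and js: "length js = k" by (auto simp: length_Suc_conv)
    show "nabla (nabla_after r k T) p (v # zs @ us) = nabla (nabla T) p (v # hd us # zs @ tl us)"
      by (simp add: us nabla_nabla_after[OF T zs js])
  qed
  finally show ?thesis .
qed

text \<open>The inner projection may be dropped under the outer one (\<open>test_prj\<close>). What remains is the
  antisymmetrized second derivative, i.e. the curvature with both form indices contracted with
  \<open>\<phi>\<close>.\<close>
lemma diff_diff_zero:
  assumes T: "tensor (r + k) T" and k: "Suc (Suc k) \<le> 3" and zs: "length zs = r"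
    and S: "\<And>v us. length us = Suc k \<Longrightarrow> nabla S p (v # zs @ us)
      = real (Suc k) * prj (Suc k) p (\<lambda>us. nabla (nabla T) p (v # hd us # zs @ tl us)) us"
  shows "prj (Suc (Suc k)) p (\<lambda>us. nabla S p (hd us # zs @ tl us)) vs = 0"
proof -
  let ?b = "onb p" and ?N = "\<lambda>x y us. nabla (nabla T) p (x # y # zs @ us)"
  have "test p (Suc (Suc k)) (\<lambda>us. nabla S p (hd us # zs @ tl us)) Xs = test p (Suc (Suc k)) (\<lambda>us. 0) Xs"
    if Xs: "length Xs = 3 - Suc (Suc k)" for Xs
  proof -
    \<comment> \<open>For fixed form arguments \<open>ks\<close>, the curvature acts on each slot of \<open>zs @ ks\<close> by a linear map.\<close>
    have inner: "(SUM7 i j. \<phi> p (Xs @ ?b i # ?b j # map ?b ks) * ?N (?b i) (?b j) (map ?b ks)) = 0"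
      if ks: "length ks = k" for ks
    proof -
      let ?ws = "zs @ map ?b ks"
      have lin: "linear (\<lambda>x. T p (?ws[s := x]))" if "s < r + k" for s
        using multilinD[OF tensor_multilin[OF T], of ?ws s p] that zs ks by simp
      have "2 * (SUM7 i j. \<phi> p (Xs @ ?b i # ?b j # map ?b ks) * ?N (?b i) (?b j) (map ?b ks))
          = (SUM7 i j. \<phi> p (Xs @ ?b i # ?b j # map ?b ks) * (?N (?b i) (?b j) (map ?b ks) - ?N (?b j) (?b i) (map ?b ks)))"
        by (rule antisymmetric_sum) (rule phi_append_swap)
      also have "\<dots> = - (SUM7 i j. \<Sum>s<r + k. \<phi> p (Xs @ ?b i # ?b j # map ?b ks) * T p (?ws[s := Rm p (?b i) (?b j) (?ws ! s)]))"
        using ricci_identity[OF T, of ?ws p] zs ks by (simp add: sum_negf sum_distrib_left)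
      also have "(SUM7 i j. \<Sum>s<r + k. \<phi> p (Xs @ ?b i # ?b j # map ?b ks) * T p (?ws[s := Rm p (?b i) (?b j) (?ws ! s)]))
          = (\<Sum>s<r + k. SUM7 i j. \<phi> p (Xs @ ?b i # ?b j # map ?b ks) * T p (?ws[s := Rm p (?b i) (?b j) (?ws ! s)]))"
        by (simp only: sum.swap[of _ "{..<r + k}" UNIV])
      also have "\<dots> = 0"
      proof (rule sum.neutral, rule ballI)
        fix s assume "s \<in> {..<r + k}"
        then show "(SUM7 i j. \<phi> p (Xs @ ?b i # ?b j # map ?b ks) * T p (?ws[s := Rm p (?b i) (?b j) (?ws ! s)])) = 0"
          using Xs ks k by (intro curvature_phi_contraction[where h="\<lambda>x. T p (?ws[s := x])"] lin) auto
      qed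
      finally show ?thesis by simp
    qed
    have "test p (Suc (Suc k)) (\<lambda>us. nabla S p (hd us # zs @ tl us)) Xs
        = (SUM7 i. test p (Suc k) (\<lambda>us. nabla S p (?b i # zs @ us)) (Xs @ [?b i]))"
      by (simp add: test_Suc[of p "Suc k"])
    also have "\<dots> = (SUM7 i. real (Suc k) * test p (Suc k) (\<lambda>us. ?N (?b i) (hd us) (tl us)) (Xs @ [?b i]))"
    proof (rule sum.cong[OF refl])
      fix i
      have "test p (Suc k) (\<lambda>us. nabla S p (?b i # zs @ us)) (Xs @ [?b i])
          = real (Suc k) * test p (Suc k) (prj (Suc k) p (\<lambda>us. ?N (?b i) (hd us) (tl us))) (Xs @ [?b i])"
        by (simp add: test_def S sum_distrib_left mult.left_commute)
      then show "test p (Suc k) (\<lambda>us. nabla S p (?b i # zs @ us)) (Xs @ [?b i])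
          = real (Suc k) * test p (Suc k) (\<lambda>us. ?N (?b i) (hd us) (tl us)) (Xs @ [?b i])"
        using Xs k by (simp add: test_prj)
    qed
    also have "\<dots> = real (Suc k) * (SUM7 i j. \<Sum>ks\<in>ils k. \<phi> p (Xs @ ?b i # ?b j # map ?b ks) * ?N (?b i) (?b j) (map ?b ks))"
      by (simp add: test_def sum_ils_Suc sum_distrib_left)
    also have "(SUM7 i j. \<Sum>ks\<in>ils k. \<phi> p (Xs @ ?b i # ?b j # map ?b ks) * ?N (?b i) (?b j) (map ?b ks))
        = (\<Sum>ks\<in>ils k. SUM7 i j. \<phi> p (Xs @ ?b i # ?b j # map ?b ks) * ?N (?b i) (?b j) (map ?b ks))"
      by (simp only: sum.swap[of _ "ils k" UNIV])
    also have "\<dots> = 0" by (rule sum.neutral) (use inner in simp)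
    finally show ?thesis by (simp add: test_def)
  qed
  then have "prj (Suc (Suc k)) p (\<lambda>us. nabla S p (hd us # zs @ tl us)) vs = prj (Suc (Suc k)) p (\<lambda>us. 0) vs"
    by (rule prj_eqI)
  then show ?thesis by (simp add: prj_def)
qed

end

section \<open>The operators in components\<close>

context g2_manifold
begin

lemma G_tensor_iff: "G_tensor k m \<longleftrightarrow> can_tensor 1 k (TG m)"
proof -
  have "(\<forall>zs :: tvec list. length zs = 1 \<longrightarrow> P zs) \<longleftrightarrow> (\<forall>z. P [z])" for P by (auto simp: length_Suc_conv)
  then show ?thesis by (simp only: G_tensor_def can_tensor_def append_Cons append_Nil plus_1_eq_Suc)
qed

lemma E_tensor_iff: "E_tensor k a \<longleftrightarrow> can_tensor 2 k (TE a) \<and> (\<forall>p vs. (SUM7 i. TE a p (onb p i # onb p i # vs)) = 0)"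
proof -
  have "(\<forall>zs :: tvec list. length zs = 2 \<longrightarrow> P zs) \<longleftrightarrow> (\<forall>x y. P [x, y])" for P by (auto simp: length_2_iff)
  then show ?thesis by (simp only: E_tensor_def can_tensor_def append_Cons append_Nil add_2_eq_Suc conj_assoc)
qed

lemma G_tensor_tensor: "G_tensor k m \<Longrightarrow> tensor (Suc n) (TG m)"
  using can_tensor_any_degree[of 1 k "TG m" n] by (simp add: G_tensor_iff)

lemma E_tensor_tensor: "E_tensor k a \<Longrightarrow> tensor (Suc (Suc n)) (TE a)"
  using can_tensor_any_degree[of 2 k "TE a" n] by (simp add: E_tensor_iff)

lemma d_G_apply:
  assumes m: "G_tensor k m" and k: "Suc k \<le> 3"
  shows "blinfun_apply (d_G k m p vs) z = real (Suc k) * prj (Suc k) p (\<lambda>us. nabla (TG m) p (hd us # z # tl us)) vs"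
proof -
  let ?F = "\<lambda>us. cov_deriv nab_cotangent m p (hd us) (tl us)"
  have "alternating_form k (\<lambda>vs. l (m p vs))" if "linear l" for l :: "covec \<Rightarrow> real"
    using m that unfolding G_sp_iff[symmetric] can_sections_def by (blast intro: can_forms_alternating)
  then have "ext_cov_deriv nab_cotangent m p us = alt_sum ?F us" if "length us = Suc k" for us
    using that by (simp add: ext_cov_deriv_alternation alt_sum_def del: sum.lessThan_Suc)
  then have "prj (Suc k) p (ext_cov_deriv nab_cotangent m p) = prj (Suc k) p (alt_sum ?F)" by (rule prj_cong)
  then have "d_G k m p vs = real (Suc k) *\<^sub>R prj (Suc k) p ?F vs"
    unfolding d_G_def can_proj_eq[OF zero_less_Suc k] by (simp only: prj_alt_sum[OF k])
  moreover have "blinfun_apply (prj (Suc k) p ?F vs) z = prj (Suc k) p (\<lambda>us. blinfun_apply (?F us) z) vs"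
    by (rule linear_prj[OF bounded_linear.linear[OF blinfun.bounded_linear_left]])
  moreover have "prj (Suc k) p (\<lambda>us. blinfun_apply (?F us) z) = prj (Suc k) p (\<lambda>us. nabla (TG m) p (hd us # z # tl us))"
    by (rule prj_cong) (simp add: cov_deriv_cotangent[OF G_tensor_tensor[OF m]])
  ultimately show ?thesis by (simp add: blinfun.scaleR_left)
qed

lemma linear_matrix_entry: "linear (\<lambda>A :: endo. g p x (blinfun_apply A y))"
  using linear_compose[OF bounded_linear.linear[OF blinfun.bounded_linear_left] g_linear(1)] by (simp add: comp_def)

lemma d_E_apply:
  assumes a: "E_tensor k a" and k: "Suc k \<le> 3"
  shows "g p x (blinfun_apply (d_E k a p vs) y) = real (Suc k) * prj (Suc k) p (\<lambda>us. nabla (TE a) p (hd us # x # y # tl us)) vs"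
proof -
  let ?F = "\<lambda>us. cov_deriv nab_End a p (hd us) (tl us)"
  have "alternating_form k (\<lambda>vs. l (a p vs))" if "linear l" for l :: "endo \<Rightarrow> real"
    using a that unfolding E_sp_iff[symmetric] can_sections_def by (blast intro: can_forms_alternating)
  then have "ext_cov_deriv nab_End a p us = alt_sum ?F us" if "length us = Suc k" for us
    using that by (simp add: ext_cov_deriv_alternation alt_sum_def del: sum.lessThan_Suc)
  then have "prj (Suc k) p (ext_cov_deriv nab_End a p) = prj (Suc k) p (alt_sum ?F)" by (rule prj_cong)
  then have "d_E k a p vs = real (Suc k) *\<^sub>R prj (Suc k) p ?F vs"
    unfolding d_E_def can_proj_eq[OF zero_less_Suc k] by (simp only: prj_alt_sum[OF k])
  moreover have "g p x (blinfun_apply (prj (Suc k) p ?F vs) y) = prj (Suc k) p (\<lambda>us. g p x (blinfun_apply (?F us) y)) vs"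
    by (rule linear_prj[OF linear_matrix_entry])
  moreover have "prj (Suc k) p (\<lambda>us. g p x (blinfun_apply (?F us) y)) = prj (Suc k) p (\<lambda>us. nabla (TE a) p (hd us # x # y # tl us))"
    by (rule prj_cong) (simp add: cov_deriv_End[OF E_tensor_tensor[OF a] refl])
  ultimately show ?thesis by (simp add: blinfun.scaleR_left linear_scale[OF g_linear(1)])
qed

lemma f_map_apply:
  assumes k: "Suc k \<le> 3"
  shows "g p x (blinfun_apply (f_map k m p vs) y) = real (Suc k) * prj (Suc k) p
    (\<lambda>us. SUM7 j. blinfun_apply (m p (tl us)) (onb p j) * g p x (Rm p (onb p j) (hd us) y)) vs"
proof -
  let ?F = "\<lambda>us. SUM7 j. blinfun_apply (m p (tl us)) (onb p j) *\<^sub>R Riem p (onb p j) (hd us)"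
  have "ff m p us = alt_sum ?F us" for us
    unfolding ff_def wedge1_def alt_sum_def by (subst sum.swap) (simp add: scaleR_sum_right)
  then have "ff m p = alt_sum ?F" ..
  then have "f_map k m p vs = real (Suc k) *\<^sub>R prj (Suc k) p ?F vs"
    unfolding f_map_def can_proj_eq[OF zero_less_Suc k] by (simp only: prj_alt_sum[OF k])
  moreover have "g p x (blinfun_apply (prj (Suc k) p ?F vs) y) = prj (Suc k) p (\<lambda>us. g p x (blinfun_apply (?F us) y)) vs"
    by (rule linear_prj[OF linear_matrix_entry])
  ultimately show ?thesis
    by (simp add: blinfun.scaleR_left blinfun.sum_left linear_scale[OF g_linear(1)] linear_sum[OF g_linear(1)])
qed

lemma tr_curvature: "tr7 (Riem p z v o\<^sub>L A) = (SUM7 i. g p (onb p i) (Rm p z v (blinfun_apply A (onb p i))))"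
  by (simp add: tr7_onb[of _ p])

lemma tr_curv_wedge_apply:
  "blinfun_apply (Blinfun (\<lambda>z. c * tr_curv_wedge a p z vs)) z = alt_sum (\<lambda>us. c * tr7 (Riem p z (hd us) o\<^sub>L a p (tl us))) vs"
proof -
  have t: "linear (\<lambda>z. tr7 (Riem p z v o\<^sub>L A))" for v A
    unfolding tr_curvature
    by (intro linear_compose_sum ballI linear_compose[OF Rm_linear1 g_linear(1), unfolded comp_def])
  have "linear (\<lambda>z. c * tr_curv_wedge a p z vs)"
    unfolding tr_curv_wedge_def wedge1_def
    by (rule linearI) (simp_all add: linear_add[OF t] linear_scale[OF t] sum.distrib sum_distrib_left algebra_simps)
  then show ?thesis
    by (simp add: Blinfun_linear tr_curv_wedge_def wedge1_def alt_sum_def sum_distrib_left mult.left_commute)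
qed

lemma prj_tr_curv_wedge:
  assumes k: "Suc k \<le> 3"
  shows "blinfun_apply (prj (Suc k) p (\<lambda>us. Blinfun (\<lambda>z. c * tr_curv_wedge a p z us)) vs) z
    = real (Suc k) * prj (Suc k) p (\<lambda>us. c * tr7 (Riem p z (hd us) o\<^sub>L a p (tl us))) vs"
proof -
  have "blinfun_apply (prj (Suc k) p (\<lambda>us. Blinfun (\<lambda>z. c * tr_curv_wedge a p z us)) vs) z
      = prj (Suc k) p (\<lambda>us. blinfun_apply (Blinfun (\<lambda>z. c * tr_curv_wedge a p z us)) z) vs"
    by (rule linear_prj[OF bounded_linear.linear[OF blinfun.bounded_linear_left]])
  also have "\<dots> = real (Suc k) * prj (Suc k) p (\<lambda>us. c * tr7 (Riem p z (hd us) o\<^sub>L a p (tl us))) vs"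
    unfolding tr_curv_wedge_apply prj_alt_sum[OF k] by simp
  finally show ?thesis .
qed

lemma b_map_apply: "Suc k \<le> 3 \<Longrightarrow> blinfun_apply (b_map k a p vs) z
    = real (Suc k) * prj (Suc k) p (\<lambda>us. - (1/4) * tr7 (Riem p z (hd us) o\<^sub>L a p (tl us))) vs"
  unfolding b_map_def bb_def[abs_def] by (simp only: can_proj_eq[OF zero_less_Suc] prj_tr_curv_wedge)

lemma c_map_apply: "Suc k \<le> 3 \<Longrightarrow> blinfun_apply (c_map k m p vs) z
    = real (Suc k) * prj (Suc k) p (\<lambda>us. - (1/2) * tr7 (Riem p z (hd us) o\<^sub>L BB m p (tl us))) vs"
  unfolding c_map_def cc_def[abs_def] by (simp only: can_proj_eq[OF zero_less_Suc] prj_tr_curv_wedge)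

lemma maps_high_degree:
  assumes "3 \<le> k"
  shows "d_G k m = (\<lambda>p vs. 0)" "d_E k a = (\<lambda>p vs. 0)" "f_map k m = (\<lambda>p vs. 0)" "b_map k a = (\<lambda>p vs. 0)" "c_map k m = (\<lambda>p vs. 0)"
  unfolding d_G_def d_E_def f_map_def b_map_def c_map_def
  by (rule HOL.ext, rule can_proj_high, use assms in simp)+

end

section \<open>The operators act on the section spaces\<close>

context g2_manifold
begin

lemma G_tensor_zero: "G_tensor k (\<lambda>p vs. 0)"
proof -
  have "TG (\<lambda>p vs. 0) = (\<lambda>p ws. 0)" by (simp add: fun_eq_iff TG_def)
  then show ?thesis by (simp add: G_tensor_def tensor_zero can_forms_zero)
qed

lemma E_tensor_zero: "E_tensor k (\<lambda>p vs. 0)"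
proof -
  have "TE (\<lambda>p vs. 0) = (\<lambda>p ws. 0)" by (simp add: fun_eq_iff TE_def linear_0[OF g_linear(1)])
  then show ?thesis by (simp add: E_tensor_def tensor_zero can_forms_zero)
qed

lemma G_tensor_d_G: assumes m: "G_tensor k m" shows "G_tensor (Suc k) (d_G k m)"
proof (cases "Suc k \<le> 3")
  case True
  show ?thesis
    unfolding G_tensor_iff
  proof (rule can_tensorI_diff[OF _ True])
    show "tensor (1 + k) (TG m)" using G_tensor_tensor[OF m] by simp
    fix p and zs vs :: "tvec list" assume "length zs = 1"
    then obtain z where "zs = [z]" by (auto simp: length_Suc_conv)
    then show "TG (d_G k m) p (zs @ vs) = real (Suc k) * prj (Suc k) p (\<lambda>us. nabla (TG m) p (hd us # zs @ tl us)) vs"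
      by (simp add: d_G_apply[OF m True])
  qed
next
  case False
  then show ?thesis using G_tensor_zero by (simp add: maps_high_degree)
qed

lemma prj_sum: "prj k p (\<lambda>us. \<Sum>a\<in>A. F a us) vs = (\<Sum>a\<in>A. prj k p (F a) vs)"
  unfolding prj_def scaleR_sum_right by (rule sum.swap)

lemma E_tensor_d_E: assumes a: "E_tensor k a" shows "E_tensor (Suc k) (d_E k a)"
proof (cases "Suc k \<le> 3")
  case True
  have "can_tensor 2 (Suc k) (TE (d_E k a))"
  proof (rule can_tensorI_diff[OF _ True])
    show "tensor (2 + k) (TE a)" using E_tensor_tensor[OF a] by simp
    fix p and zs vs :: "tvec list" assume "length zs = 2"
    then obtain x y where "zs = [x, y]" by (auto simp: length_2_iff)
    then show "TE (d_E k a) p (zs @ vs) = real (Suc k) * prj (Suc k) p (\<lambda>us. nabla (TE a) p (hd us # zs @ tl us)) vs"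
      by (simp add: d_E_apply[OF a True])
  qed
  moreover have "(SUM7 i. TE (d_E k a) p (onb p i # onb p i # vs)) = 0" for p vs
  proof -
    have "(SUM7 i. nabla (TE a) p (v # onb p i # onb p i # ws)) = 0" for v ws
    proof -
      have "(SUM7 i. nabla (TE a) p (v # onb p i # onb p i # ws)) = nabla (trace01 (TE a)) p (v # ws)"
        using nabla_trace01[OF E_tensor_tensor[OF a] refl] by simp
      also have "\<dots> = 0"
        using a by (intro nabla_vanish[OF _ refl]) (simp add: trace01_def E_tensor_def)
      finally show ?thesis .
    qed
    then show ?thesis
      by (simp add: d_E_apply[OF a True] sum_distrib_left[symmetric] prj_sum[symmetric]) (simp add: prj_def)
  qed
  ultimately show ?thesis by (simp add: E_tensor_iff)
next
  case False
  then show ?thesis using E_tensor_zero by (simp add: maps_high_degree)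
qed

lemma can_tensor_TSk: assumes a: "E_tensor k a" shows "can_tensor 2 k (TSk a)"
  unfolding can_tensor_def
proof (intro conjI allI impI)
  show "tensor (2 + k) (TSk a)" using tensor_TSk[OF E_tensor_tensor[OF a]] by simp
  fix p and zs :: "tvec list" assume "length zs = 2"
  then obtain x y where "zs = [x, y]" by (auto simp: length_2_iff)
  moreover have "(\<lambda>vs. (1/2) * (TE a p (x # y # vs) - TE a p (y # x # vs))) \<in> can_forms p k"
    using a by (intro can_forms_cmult can_forms_diff) (simp_all add: E_tensor_def del: TE_Cons)
  ultimately show "(\<lambda>vs. TSk a p (zs @ vs)) \<in> can_forms p k" by simp
qed

lemma TG_ell: assumes a: "E_tensor k a" shows "TG (ell a) p (z # vs) = - (1/2) * trace01 (nabla (TSk a)) p (z # vs)"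
  by (simp add: ell_apply[OF E_tensor_tensor[OF a] refl] trace01_def)

lemma nabla_TG_ell:
  assumes a: "E_tensor k a" and vs: "length vs = k"
  shows "nabla (TG (ell a)) p (w # z # vs) = - (1/2) * (SUM7 j. nabla (nabla (TSk a)) p (w # onb p j # onb p j # z # vs))"
proof -
  have S: "tensor (Suc (Suc (Suc k))) (nabla (TSk a))" by (rule tensor_nabla[OF tensor_TSk[OF E_tensor_tensor[OF a]]])
  have eq: "TG (ell a) q us = - (1/2) * trace01 (nabla (TSk a)) q us" if us: "length us = Suc k" for q us
  proof -
    obtain u us' where "us = u # us'" using us by (cases us) auto
    then show ?thesis by (simp only: TG_ell[OF a])
  qed
  have "nabla (TG (ell a)) p (w # z # vs) = nabla (\<lambda>p us. - (1/2) * trace01 (nabla (TSk a)) p us) p (w # z # vs)"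
    by (rule nabla_cong[OF eq]) (use vs in simp_all)
  also have "\<dots> = - (1/2) * nabla (trace01 (nabla (TSk a))) p (w # z # vs)"
    by (rule nabla_cmult[OF tensor_trace01[OF S]]) (use vs in simp)
  finally show ?thesis using nabla_trace01[OF S, of "z # vs" p w] vs by simp
qed

lemma KK_entry: "G_tensor k m \<Longrightarrow> g p x (blinfun_apply (KK m p vs) y) = nabla (TG m) p (y # x # vs) - nabla (TG m) p (x # y # vs)"
  by (rule KK_apply[OF G_tensor_tensor refl])

lemma BB_entry: "G_tensor k m \<Longrightarrow> g p x (blinfun_apply (BB m p vs) y) = nabla (TG m) p (x # y # vs)"
  by (rule BB_apply[OF G_tensor_tensor refl])

lemma TE_KK_reorder:
  assumes m: "G_tensor k m" and ws: "length ws = Suc (Suc k)"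
  shows "TE (KK m) p ws = reorder (swap01 k) (nabla (TG m)) p ws - nabla (TG m) p ws"
proof -
  obtain x y vs where "ws = x # y # vs" "length vs = k" using ws by (auto simp: length_Suc_conv)
  then show ?thesis by (simp add: reorder_swap01 KK_entry[OF m] del: upt_Suc)
qed

lemma nabla_TE_KK:
  assumes m: "G_tensor k m" and vs: "length vs = k"
  shows "nabla (TE (KK m)) p (v # x # y # vs) = nabla (nabla (TG m)) p (v # y # x # vs) - nabla (nabla (TG m)) p (v # x # y # vs)"
proof -
  have T: "tensor (Suc (Suc k)) (nabla (TG m))" by (rule tensor_nabla[OF G_tensor_tensor[OF m]])
  have l: "length (x # y # vs) = Suc (Suc k)" using vs by simp
  have "nabla (TE (KK m)) p (v # x # y # vs) = nabla (\<lambda>p ws. reorder (swap01 k) (nabla (TG m)) p ws - nabla (TG m) p ws) p (v # x # y # vs)"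
    by (rule nabla_cong[OF TE_KK_reorder[OF m] l])
  also have "\<dots> = nabla (reorder (swap01 k) (nabla (TG m))) p (v # x # y # vs) - nabla (nabla (TG m)) p (v # x # y # vs)"
    by (rule nabla_diff[OF tensor_reorder[OF T swap01] T l])
  finally show ?thesis by (simp only: nabla_swap01[OF T vs])
qed

end

context torsion_free_g2_manifold
begin

lemma G_tensor_ell: assumes a: "E_tensor k a" shows "G_tensor k (ell a)"
  unfolding G_tensor_def
proof (intro conjI allI)
  have S: "tensor (Suc (Suc (Suc k))) (nabla (TSk a))" by (rule tensor_nabla[OF tensor_TSk[OF E_tensor_tensor[OF a]]])
  show "tensor (Suc k) (TG (ell a))"
  proof (rule tensor_cong[OF tensor_cmult[OF tensor_trace01[OF S]]])
    fix p and us :: "tvec list" assume "length us = Suc k"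
    then obtain u us' where "us = u # us'" by (cases us) auto
    then show "- (1/2) * trace01 (nabla (TSk a)) p us = TG (ell a) p us" by (simp only: TG_ell[OF a])
  qed
  fix p z
  have "(\<lambda>vs. nabla (TSk a) p (x # [x, z] @ vs)) \<in> can_forms p k" for x
    by (rule nabla_can_forms[OF can_tensor_TSk[OF a]]) simp
  then have "(\<lambda>vs. - (1/2) * (SUM7 j. nabla (TSk a) p (onb p j # onb p j # z # vs))) \<in> can_forms p k"
    by (intro can_forms_cmult can_forms_sum) simp
  then show "(\<lambda>vs. TG (ell a) p (z # vs)) \<in> can_forms p k" by (simp only: TG_ell[OF a] trace01_def)
qed

lemma E_tensor_KK: assumes m: "G_tensor k m" shows "E_tensor k (KK m)"
  unfolding E_tensor_def
proof (intro conjI allI)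
  have T: "tensor (Suc (Suc k)) (nabla (TG m))" by (rule tensor_nabla[OF G_tensor_tensor[OF m]])
  show "tensor (Suc (Suc k)) (TE (KK m))"
    by (rule tensor_cong[OF tensor_diff[OF tensor_reorder[OF T swap01] T]]) (simp only: TE_KK_reorder[OF m])
  fix p x y
  have "(\<lambda>vs. nabla (TG m) p (u # [v] @ vs)) \<in> can_forms p k" for u v
    using m by (intro nabla_can_forms[of 1]) (simp_all add: G_tensor_iff)
  then show "(\<lambda>vs. TE (KK m) p (x # y # vs)) \<in> can_forms p k"
    by (simp add: KK_entry[OF m] can_forms_diff)
next
  fix p vs show "(SUM7 i. TE (KK m) p (onb p i # onb p i # vs)) = 0"
    by (simp add: KK_entry[OF m])
qed

lemma nabla_TG_d_G:
  assumes m: "G_tensor k m" and k: "Suc k \<le> 3"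
  shows "nabla (TG (d_G k m)) p (v # z # vs) = real (Suc k) * prj (Suc k) p (\<lambda>us. nabla (nabla (TG m)) p (v # hd us # z # tl us)) vs"
proof (cases "length vs = Suc k")
  case True
  have T: "tensor (1 + k) (TG m)" using G_tensor_tensor[OF m] by simp
  have "TG (d_G k m) q ws = diff_tensor 1 k (TG m) q ws" if ws: "length ws = Suc (Suc k)" for q ws
  proof -
    obtain u us where "ws = u # us" "length us = Suc k" using ws by (cases ws) auto
    then show ?thesis using diff_tensor_apply[OF k, of "[u]" 1 us "TG m" q] by (simp add: d_G_apply[OF m k])
  qed
  then have "nabla (TG (d_G k m)) p (v # z # vs) = nabla (diff_tensor 1 k (TG m)) p (v # z # vs)"
    using True by (intro nabla_cong[of "Suc (Suc k)"]) simp_all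
  then show ?thesis using nabla_diff_tensor[OF T k, of "[z]" vs p v] True by simp
next
  case False
  have "nabla (TG (d_G k m)) p (v # z # vs) = 0"
  proof (rule nabla_vanish[OF _ refl])
    fix q and us :: "tvec list" assume "length us = length (z # vs)"
    then show "TG (d_G k m) q us = 0"
      using G_tensor_d_G[OF m] False by (intro can_tensor_wrong_length[of 1 "Suc k"]) (simp_all add: G_tensor_iff)
  qed
  then show ?thesis using False k by (simp add: prj_wrong_length)
qed

lemma TSk_d_E:
  assumes a: "E_tensor k a" and k: "Suc k \<le> 3"
  shows "TSk (d_E k a) p (x # y # vs) = real (Suc k) * prj (Suc k) p (\<lambda>us. nabla (TSk a) p (hd us # x # y # tl us)) vs"
proof -
  have "prj (Suc k) p (\<lambda>us. nabla (TSk a) p (hd us # x # y # tl us)) vs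
      = prj (Suc k) p (\<lambda>us. (1/2) *\<^sub>R (nabla (TE a) p (hd us # x # y # tl us) - nabla (TE a) p (hd us # y # x # tl us))) vs"
    by (simp add: nabla_TSk[OF E_tensor_tensor[OF a] refl])
  then show ?thesis by (simp only: prj_scale prj_diff) (simp add: d_E_apply[OF a k] right_diff_distrib)
qed

lemma nabla_TE_d_E:
  assumes a: "E_tensor k a" and k: "Suc k \<le> 3" and vs: "length vs = Suc k"
  shows "nabla (TE (d_E k a)) p (v # x # y # vs) = real (Suc k) * prj (Suc k) p (\<lambda>us. nabla (nabla (TE a)) p (v # hd us # x # y # tl us)) vs"
proof -
  have T: "tensor (2 + k) (TE a)" using E_tensor_tensor[OF a] by simp
  have "TE (d_E k a) q ws = diff_tensor 2 k (TE a) q ws" if ws: "length ws = Suc (Suc (Suc k))" for q ws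
  proof -
    obtain u w us where "ws = u # w # us" "length us = Suc k" using ws by (auto simp: length_Suc_conv)
    then show ?thesis using diff_tensor_apply[OF k, of "[u, w]" 2 us "TE a" q] by (simp add: d_E_apply[OF a k])
  qed
  then have "nabla (TE (d_E k a)) p (v # x # y # vs) = nabla (diff_tensor 2 k (TE a)) p (v # x # y # vs)"
    using vs by (intro nabla_cong[of "Suc (Suc (Suc k))"]) simp_all
  then show ?thesis using nabla_diff_tensor[OF T k, of "[x, y]" vs p v] vs by simp
qed

lemma nabla_TSk_d_E:
  assumes a: "E_tensor k a" and k: "Suc k \<le> 3"
  shows "nabla (TSk (d_E k a)) p (v # x # y # vs) = real (Suc k) * prj (Suc k) p (\<lambda>us. nabla (nabla (TSk a)) p (v # hd us # x # y # tl us)) vs"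
proof (cases "length vs = Suc k")
  case vs: True
  have T: "tensor (2 + k) (TSk a)" using tensor_TSk[OF E_tensor_tensor[OF a]] by simp
  have "TSk (d_E k a) q ws = diff_tensor 2 k (TSk a) q ws" if ws: "length ws = Suc (Suc (Suc k))" for q ws
  proof -
    obtain u w us where "ws = u # w # us" "length us = Suc k" using ws by (auto simp: length_Suc_conv)
    then show ?thesis using diff_tensor_apply[OF k, of "[u, w]" 2 us "TSk a" q] by (simp add: TSk_d_E[OF a k] del: TSk_Cons)
  qed
  then have "nabla (TSk (d_E k a)) p (v # x # y # vs) = nabla (diff_tensor 2 k (TSk a)) p (v # x # y # vs)"
    using vs by (intro nabla_cong[of "Suc (Suc (Suc k))"]) simp_all
  then show ?thesis using nabla_diff_tensor[OF T k, of "[x, y]" vs p v] vs by simp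
next
  case False
  have "nabla (TSk (d_E k a)) p (v # x # y # vs) = 0"
  proof (rule nabla_vanish[OF _ refl])
    fix q and us :: "tvec list" assume "length us = length (x # y # vs)"
    then show "TSk (d_E k a) q us = 0"
      using can_tensor_TSk[OF E_tensor_d_E[OF a]] False by (intro can_tensor_wrong_length[of 2 "Suc k"]) simp_all
  qed
  then show ?thesis using False k by (simp add: prj_wrong_length)
qed

lemma d_G_d_G: assumes m: "G_tensor k m" shows "d_G (Suc k) (d_G k m) = (\<lambda>p vs. 0)"
proof (cases "Suc (Suc k) \<le> 3")
  case True
  then have k: "Suc k \<le> 3" by simp
  have T: "tensor (1 + k) (TG m)" using G_tensor_tensor[OF m] by simp
  have "blinfun_apply (d_G (Suc k) (d_G k m) p vs) z = 0" for p vs z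
    using diff_diff_zero[OF T True, of "[z]" "TG (d_G k m)" p vs]
    by (simp add: d_G_apply[OF G_tensor_d_G[OF m] True] nabla_TG_d_G[OF m k])
  then show ?thesis by (intro HOL.ext blinfun_eqI) simp
next
  case False
  then show ?thesis by (intro maps_high_degree) simp
qed

lemma d_E_d_E: assumes a: "E_tensor k a" shows "d_E (Suc k) (d_E k a) = (\<lambda>p vs. 0)"
proof (cases "Suc (Suc k) \<le> 3")
  case True
  then have k: "Suc k \<le> 3" by simp
  have T: "tensor (2 + k) (TE a)" using E_tensor_tensor[OF a] by simp
  have "g p x (blinfun_apply (d_E (Suc k) (d_E k a) p vs) y) = 0" for p vs x y
    using diff_diff_zero[OF T True, of "[x, y]" "TE (d_E k a)" p vs]
    by (simp add: d_E_apply[OF E_tensor_d_E[OF a] True] nabla_TE_d_E[OF a k])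
  then have "blinfun_apply (d_E (Suc k) (d_E k a) p vs) y = 0" for p vs y
    by (intro g_eqI[of p]) (simp add: linear_0[OF g_linear(1)])
  then show ?thesis by (intro HOL.ext blinfun_eqI) simp
next
  case False
  then show ?thesis by (intro maps_high_degree) simp
qed

end

section \<open>The homotopy identities\<close>

context g2_manifold
begin

lemma g_expansion: "linear h \<Longrightarrow> h v = (SUM7 l. g p v (onb p l) * h (onb p l))" for h :: "tvec \<Rightarrow> real"
  by (rule orthonormal_expansion_linear[OF onb])

text \<open>The curvature is skew, so its trace product with \<open>A\<close> involves the skew part of \<open>A\<close> only.\<close>
lemma tr_curvature_skew:
  "tr7 (Riem p z v o\<^sub>L A) = (SUM7 j l. g p (Rm p z v (onb p j)) (onb p l) *
     ((1/2) * (g p (onb p j) (blinfun_apply A (onb p l)) - g p (onb p l) (blinfun_apply A (onb p j)))))"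
proof -
  let ?b = "onb p"
  define r a where "r j l = g p (Rm p z v (?b j)) (?b l)" and "a j l = g p (?b j) (blinfun_apply A (?b l))" for j l
  have r: "r l j = - r j l" for j l
    unfolding r_def using Rm_skew[of p z v "?b l" "?b j"] by (simp add: metric_sym[of p "?b l"])
  have "g p (?b j) (Rm p z v (blinfun_apply A (?b j))) = - (SUM7 l. r j l * a l j)" for j
  proof -
    have "g p (?b j) (Rm p z v (blinfun_apply A (?b j))) = - g p (Rm p z v (?b j)) (blinfun_apply A (?b j))"
      using Rm_skew[of p z v "?b j" "blinfun_apply A (?b j)"] by (simp add: metric_sym[of p "?b j"])
    also have "g p (Rm p z v (?b j)) (blinfun_apply A (?b j)) = (SUM7 l. g p (Rm p z v (?b j)) (?b l) * g p (blinfun_apply A (?b j)) (?b l))"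
      by (rule orthonormal_parseval[OF onb, symmetric])
    finally show ?thesis by (simp add: r_def a_def metric_sym[of p "blinfun_apply A _"])
  qed
  then have "tr7 (Riem p z v o\<^sub>L A) = - (SUM7 j l. r j l * a l j)"
    by (simp add: tr_curvature sum_negf)
  moreover have "2 * (SUM7 j l. r j l * a l j) = (SUM7 j l. r j l * (a l j - a j l))"
    by (rule antisymmetric_sum) (rule r)
  moreover have "(SUM7 j l. r j l * (a l j - a j l)) = - 2 * (SUM7 j l. r j l * ((1/2) * (a j l - a l j)))"
    by (simp add: sum_distrib_left algebra_simps sum_negf sum_subtractf)
  ultimately show ?thesis by (simp add: r_def a_def)
qed

text \<open>Antisymmetrizing \<open>g(R(v, e\<^sub>j) z, e\<^sub>l)\<close> in \<open>j, l\<close> gives \<open>-1/2 g(R(z, v) e\<^sub>j, e\<^sub>l)\<close> by the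
  pair symmetry and the Bianchi identity.\<close>
lemma curvature_trace_bianchi:
  fixes A :: endo and p :: 'a
  defines "s \<equiv> \<lambda>x y. (1/2) * (g p x (blinfun_apply A y) - g p y (blinfun_apply A x))"
  shows "(1/2) * (SUM7 j. s (onb p j) (Rm p v (onb p j) z)) = - (1/4) * tr7 (Riem p z v o\<^sub>L A)"
proof -
  let ?b = "onb p"
  define c where "c j l = g p (Rm p v (?b j) z) (?b l)" for j l
  have lin: "linear (s x)" for x
    unfolding s_def by (rule linearI)
      (simp_all add: blinfun.add_right blinfun.scaleR_right linear_add[OF g_linear(1)] linear_scale[OF g_linear(1)]
        linear_add[OF g_linear(2)] linear_scale[OF g_linear(2)] algebra_simps)
  have c: "c j l - c l j = - g p (Rm p z v (?b j)) (?b l)" for j l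
  proof -
    have 1: "c l j = - g p (Rm p (?b j) z v) (?b l)"
      using Rm_pair[of p v "?b l" z "?b j"]
      by (simp add: c_def Rm_antisym[of p z "?b j"] linear_neg[OF g_linear(2)])
    have "g p (Rm p v (?b j) z + Rm p (?b j) z v + Rm p z v (?b j)) (?b l) = 0"
      by (simp add: bianchi linear_0[OF g_linear(2)])
    then show ?thesis by (simp add: 1 linear_add[OF g_linear(2)]) (simp add: c_def)
  qed
  have "(SUM7 j. s (?b j) (Rm p v (?b j) z)) = (SUM7 j l. s (?b j) (?b l) * c j l)"
  proof (rule sum.cong[OF refl])
    fix j
    show "s (?b j) (Rm p v (?b j) z) = (SUM7 l. s (?b j) (?b l) * c j l)"
      using g_expansion[OF lin, of "?b j" "Rm p v (?b j) z" p] by (simp add: c_def mult.commute)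
  qed
  moreover have "2 * (SUM7 j l. s (?b j) (?b l) * c j l) = (SUM7 j l. s (?b j) (?b l) * (c j l - c l j))"
    by (rule antisymmetric_sum) (simp add: s_def algebra_simps)
  moreover have "(SUM7 j l. s (?b j) (?b l) * (c j l - c l j)) = - tr7 (Riem p z v o\<^sub>L A)"
    unfolding tr_curvature_skew c by (simp add: s_def sum_negf mult.commute)
  ultimately show ?thesis by simp
qed

lemma ricci_Cons:
  assumes T: "tensor (Suc k) T" and js: "length js = k"
  shows "nabla (nabla T) p (u # v # z # js) - nabla (nabla T) p (v # u # z # js)
    = - T p (Rm p u v z # js) - (\<Sum>s<k. T p (z # js[s := Rm p u v (js ! s)]))"
  using ricci_identity[OF T, of "z # js" p u v] js by (simp add: sum.lessThan_Suc_shift del: sum.lessThan_Suc)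

lemma ricci_Cons2:
  assumes T: "tensor (Suc (Suc k)) T" and js: "length js = k"
  shows "nabla (nabla T) p (u # v # y # z # js) - nabla (nabla T) p (v # u # y # z # js)
    = - T p (Rm p u v y # z # js) - T p (y # Rm p u v z # js) - (\<Sum>s<k. T p (y # z # js[s := Rm p u v (js ! s)]))"
  using ricci_identity[OF T, of "y # z # js" p u v] js by (simp add: sum.lessThan_Suc_shift del: sum.lessThan_Suc)

lemma test_mult: "test p k (\<lambda>us. c * F us) Xs = c * test p k F Xs" for c :: real
  by (simp add: test_def sum_distrib_left mult_ac)

lemma multilin_TG:
  assumes "tensor (Suc k) (TG m)"
  shows "multilin k (\<lambda>us. blinfun_apply (m p us) z)"
  using multilin_Cons[OF tensor_multilin[OF assms], of p z] by simp

text \<open>The coupling \<open>f\<close> with its frame sum carried out: by the pair symmetry it is \<open>m\<close> evaluated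
  on \<open>R(x, y) v\<close>, which the Bianchi identity splits.\<close>
lemma curvature_coupling:
  fixes c :: covec
  shows "(SUM7 j. blinfun_apply c (onb p j) * g p x (Rm p (onb p j) v y)) = blinfun_apply c (Rm p x v y) - blinfun_apply c (Rm p y v x)"
proof -
  have "g p x (Rm p u v y) = g p (Rm p x y v) u" for u
    using Rm_pair[of p u v y x] Rm_antisym[of p x y v] Rm_skew[of p y x u v]
    by (simp add: metric_sym[of p x] metric_sym[of p u] linear_neg[OF g_linear(2)])
  then have "(SUM7 j. blinfun_apply c (onb p j) * g p x (Rm p (onb p j) v y)) = (SUM7 j. g p (Rm p x y v) (onb p j) * blinfun_apply c (onb p j))"
    by (simp add: mult.commute)
  also have "\<dots> = blinfun_apply c (Rm p x y v)"
    by (rule g_expansion[symmetric]) (rule bounded_linear.linear[OF blinfun.bounded_linear_right])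
  also have "Rm p x y v = Rm p x v y - Rm p y v x"
    using bianchi[of p x y v] by (simp add: Rm_antisym[of p v x] algebra_simps add_eq_0_iff)
  finally show ?thesis by (simp add: blinfun.diff_right)
qed

end

context torsion_free_g2_manifold
begin

text \<open>Both sides are projections of second derivatives of \<open>m\<close>, taken in different orders. The
  commutators act on the value slot, where they give \<open>f\<close> (\<open>curvature_coupling\<close>), and on the form
  arguments, where they project to zero.\<close>
theorem d_E_KK:
  assumes m: "G_tensor k m"
  shows "d_E k (KK m) + f_map k m = KK (d_G k m)"
proof (cases "Suc k \<le> 3")
  case True
  note T = G_tensor_tensor[OF m]
  let ?N = "nabla (nabla (TG m))"
  have "g p x (blinfun_apply ((d_E k (KK m) + f_map k m) p vs) y) = g p x (blinfun_apply (KK (d_G k m) p vs) y)" for p x y vs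
  proof -
    let ?L = "\<lambda>us. ?N p (hd us # y # x # tl us) - ?N p (hd us # x # y # tl us)
        + (SUM7 j. blinfun_apply (m p (tl us)) (onb p j) * g p x (Rm p (onb p j) (hd us) y))"
    let ?R = "\<lambda>us. ?N p (y # hd us # x # tl us) - ?N p (x # hd us # y # tl us)"
    let ?D = "\<lambda>y z us. \<Sum>s<k. blinfun_apply (m p ((tl us)[s := Rm p y (hd us) (tl us ! s)])) z"
    have L: "g p x (blinfun_apply ((d_E k (KK m) + f_map k m) p vs) y) = real (Suc k) * prj (Suc k) p ?L vs"
    proof -
      have "prj (Suc k) p (\<lambda>us. nabla (TE (KK m)) p (hd us # x # y # tl us))
          = prj (Suc k) p (\<lambda>us. ?N p (hd us # y # x # tl us) - ?N p (hd us # x # y # tl us))"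
        by (rule prj_cong) (simp add: nabla_TE_KK[OF m])
      then show ?thesis
        by (simp add: blinfun.add_left linear_add[OF g_linear(1)] d_E_apply[OF E_tensor_KK[OF m] True] f_map_apply[OF True] prj_add distrib_left)
    qed
    have R: "g p x (blinfun_apply (KK (d_G k m) p vs) y) = real (Suc k) * prj (Suc k) p ?R vs"
      by (simp add: KK_entry[OF G_tensor_d_G[OF m]] nabla_TG_d_G[OF m True] prj_diff right_diff_distrib)
    have "prj (Suc k) p ?R vs = prj (Suc k) p ?L vs"
    proof (rule prj_eqI)
      fix Xs :: "tvec list" assume Xs: "length Xs = 3 - Suc k"
      have "?R us - ?L us = ?D x y us - ?D y x us" if us: "length us = Suc k" for us
      proof -
        obtain i js where us: "us = i # js" and js: "length js = k" using us by (auto simp: length_Suc_conv)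
        show ?thesis
          using ricci_Cons[OF T js, of p y i x] ricci_Cons[OF T js, of p x i y]
          unfolding us list.sel curvature_coupling TG_Cons by linarith
      qed
      then have "test p (Suc k) (\<lambda>us. ?R us - ?L us) Xs = test p (Suc k) (\<lambda>us. ?D x y us - ?D y x us) Xs" by (rule test_cong)
      moreover have "test p (Suc k) (?D y z) Xs = 0" for y z
        by (rule curvature_form_part[OF multilin_TG[OF T]]) (use Xs True in simp)
      ultimately show "test p (Suc k) ?R Xs = test p (Suc k) ?L Xs"
        by (simp only: test_diff)
    qed
    then show ?thesis by (simp only: L R)
  qed
  then show ?thesis by (intro HOL.ext blinfun_eqI g_eqI)
next
  case False
  have "g p x (blinfun_apply (KK (d_G k m) p vs) y) = 0" for p x y vs
  proof -
    have "TG (d_G k m) = (\<lambda>p ws. 0)" using False by (simp add: fun_eq_iff TG_def maps_high_degree)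
    then show ?thesis by (simp add: KK_entry[OF G_tensor_d_G[OF m]] nabla_zero)
  qed
  then have "blinfun_apply (KK (d_G k m) p vs) y = 0" for p y vs
    by (intro g_eqI[of p]) (simp add: linear_0[OF g_linear(1)])
  then show ?thesis using False
    by (intro HOL.ext blinfun_eqI) (simp add: maps_high_degree)
qed

text \<open>With \<open>S\<close> the skew part of \<open>a\<close>, the two sides compare \<open>\<nabla>\<^sub>i \<nabla>\<^sub>j S(e\<^sub>j, z)\<close> and \<open>\<nabla>\<^sub>j \<nabla>\<^sub>i
  S(e\<^sub>j, z)\<close>. The curvature acting on \<open>e\<^sub>j\<close> gives the Ricci tensor, which is zero; acting on \<open>z\<close>
  it gives \<open>b\<close>; acting on the form arguments it projects to zero.\<close>
theorem b_map_ell: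
  assumes a: "E_tensor k a"
  shows "b_map k a + ell (d_E k a) = d_G k (ell a)"
proof (cases "Suc k \<le> 3")
  case True
  have T: "tensor (Suc (Suc k)) (TSk a)" by (rule tensor_TSk[OF E_tensor_tensor[OF a]])
  let ?N = "nabla (nabla (TSk a))"
  have "blinfun_apply ((b_map k a + ell (d_E k a)) p vs) z = blinfun_apply (d_G k (ell a) p vs) z" for p z vs
  proof -
    let ?b = "onb p"
    let ?B = "\<lambda>us. - (1/4) * tr7 (Riem p z (hd us) o\<^sub>L a p (tl us))"
    let ?L = "\<lambda>us. - (1/2) * (SUM7 j. ?N p (?b j # hd us # ?b j # z # tl us))"
    let ?R = "\<lambda>us. - (1/2) * (SUM7 j. ?N p (hd us # ?b j # ?b j # z # tl us))"
    let ?D = "\<lambda>j us. \<Sum>s<k. TSk a p (?b j # z # (tl us)[s := Rm p (?b j) (hd us) (tl us ! s)])"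
    have L: "blinfun_apply ((b_map k a + ell (d_E k a)) p vs) z = real (Suc k) * prj (Suc k) p (\<lambda>us. ?B us + ?L us) vs"
    proof -
      have "blinfun_apply (ell (d_E k a) p vs) z = - (1/2) * (SUM7 j. real (Suc k) * prj (Suc k) p (\<lambda>us. ?N p (?b j # hd us # ?b j # z # tl us)) vs)"
        unfolding ell_apply[OF E_tensor_tensor[OF E_tensor_d_E[OF a]] refl] nabla_TSk_d_E[OF a True] ..
      also have "\<dots> = real (Suc k) * prj (Suc k) p (\<lambda>us. - (1/2) *\<^sub>R (SUM7 j. ?N p (?b j # hd us # ?b j # z # tl us))) vs"
        by (simp only: prj_scale prj_sum) (simp add: sum_distrib_left)
      finally have e: "blinfun_apply (ell (d_E k a) p vs) z = real (Suc k) * prj (Suc k) p ?L vs"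
        by (simp only: real_scaleR_def)
      show ?thesis
        by (simp only: plus_fun_apply blinfun.add_left b_map_apply[OF True] e prj_add distrib_left)
    qed
    have R: "blinfun_apply (d_G k (ell a) p vs) z = real (Suc k) * prj (Suc k) p ?R vs"
    proof -
      have "prj (Suc k) p (\<lambda>us. nabla (TG (ell a)) p (hd us # z # tl us)) = prj (Suc k) p ?R"
        by (rule prj_cong) (simp add: nabla_TG_ell[OF a])
      then show ?thesis by (simp add: d_G_apply[OF G_tensor_ell[OF a] True])
    qed
    have "prj (Suc k) p (\<lambda>us. ?B us + ?L us) vs = prj (Suc k) p ?R vs"
    proof (rule prj_eqI)
      fix Xs :: "tvec list" assume Xs: "length Xs = 3 - Suc k"
      have "(?B us + ?L us) - ?R us = (SUM7 j. (1/2) * ?D j us)" if us: "length us = Suc k" for us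
      proof -
        obtain i js where us: "us = i # js" and js: "length js = k" using us by (auto simp: length_Suc_conv)
        have lin: "linear (\<lambda>w. TSk a p (w # z # js))"
          using multilin_Cons_linear[OF tensor_multilin[OF T]] js by (simp del: TSk_Cons)
        have "(SUM7 j. TSk a p (Rm p i (?b j) (?b j) # z # js)) = TSk a p ((SUM7 j. Rm p i (?b j) (?b j)) # z # js)"
          by (rule linear_sum[OF lin, symmetric])
        then have trace: "(SUM7 j. TSk a p (Rm p i (?b j) (?b j) # z # js)) = 0"
          unfolding Ricci_zero_vector[OF onb] linear_0[OF lin] .
        have B: "?B us = (1/2) * (SUM7 j. TSk a p (?b j # Rm p i (?b j) z # js))"
          unfolding us list.sel curvature_trace_bianchi[symmetric] by simp
        have form: "TSk a p (?b j # z # js[s := Rm p i (?b j) (js ! s)]) = - TSk a p (?b j # z # js[s := Rm p (?b j) i (js ! s)])"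
          if "s < k" for j s
        proof -
          have "linear (\<lambda>w. TSk a p (?b j # z # js[s := w]))"
            using multilinD[OF tensor_multilin[OF T], of "?b j # z # js" "Suc (Suc s)" p] js that by (simp del: TSk_Cons)
          from linear_neg[OF this] show ?thesis by (simp only: Rm_antisym[of p i "?b j"])
        qed
        have "?N p (i # ?b j # ?b j # z # js) - ?N p (?b j # i # ?b j # z # js)
            = - TSk a p (Rm p i (?b j) (?b j) # z # js) - TSk a p (?b j # Rm p i (?b j) z # js) + ?D j us" for j
        proof -
          have "(\<Sum>s<k. TSk a p (?b j # z # js[s := Rm p i (?b j) (js ! s)])) = - ?D j us"
            unfolding us list.sel sum_negf[symmetric] by (intro sum.cong refl form) simp
          then show ?thesis using ricci_Cons2[OF T js, of p i "?b j" "?b j" z] by linarith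
        qed
        then have "(SUM7 j. ?N p (i # ?b j # ?b j # z # js)) - (SUM7 j. ?N p (?b j # i # ?b j # z # js))
            = - (SUM7 j. TSk a p (?b j # Rm p i (?b j) z # js)) + (SUM7 j. ?D j us)"
          unfolding sum_subtractf[symmetric] by (simp only: sum.distrib sum_subtractf sum_negf trace)
        then show ?thesis unfolding B sum_distrib_left[symmetric] unfolding us list.sel by argo
      qed
      then have "test p (Suc k) (\<lambda>us. (?B us + ?L us) - ?R us) Xs = test p (Suc k) (\<lambda>us. SUM7 j. (1/2) * ?D j us) Xs"
        by (rule test_cong)
      also have "\<dots> = (SUM7 j. (1/2) * test p (Suc k) (?D j) Xs)"
        unfolding test_sum test_mult ..
      also have "\<dots> = 0"
      proof (rule sum.neutral, rule ballI)
        fix j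
        have "multilin k (\<lambda>us. TSk a p (?b j # z # us))"
          by (rule multilin_Cons[OF multilin_Cons[OF tensor_multilin[OF T]]])
        then have "test p (Suc k) (?D j) Xs = 0"
          by (rule curvature_form_part) (use Xs True in simp)
        then show "(1/2) * test p (Suc k) (?D j) Xs = 0" by simp
      qed
      finally show "test p (Suc k) (\<lambda>us. ?B us + ?L us) Xs = test p (Suc k) ?R Xs"
        by (simp only: test_diff)
    qed
    then show ?thesis by (simp only: L R)
  qed
  then show ?thesis by (intro HOL.ext blinfun_eqI)
next
  case False
  have "TSk (d_E k a) = (\<lambda>p ws. 0)"
    using False by (simp add: fun_eq_iff TSk_def TE_def maps_high_degree linear_0[OF g_linear(1)])
  then have "blinfun_apply (ell (d_E k a) p vs) z = 0" for p z vs
    by (simp add: ell_apply[OF E_tensor_tensor[OF E_tensor_d_E[OF a]] refl] nabla_zero)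
  then show ?thesis using False
    by (intro HOL.ext blinfun_eqI) (simp add: maps_high_degree blinfun.add_left)
qed

text \<open>A pointwise identity: \<open>KK m\<close> is minus twice the skew part of \<open>BB m\<close>.\<close>
theorem b_map_KK:
  assumes m: "G_tensor k m"
  shows "b_map k (KK m) + c_map k m = 0"
proof (cases "Suc k \<le> 3")
  case True
  have "blinfun_apply ((b_map k (KK m) + c_map k m) p vs) z = 0" for p vs z
  proof -
    have e: "- (1/4) * tr7 (Riem p z (hd us) o\<^sub>L KK m p (tl us)) + - (1/2) * tr7 (Riem p z (hd us) o\<^sub>L BB m p (tl us)) = 0" for us
    proof -
      have "tr7 (Riem p z (hd us) o\<^sub>L KK m p (tl us)) = -2 * tr7 (Riem p z (hd us) o\<^sub>L BB m p (tl us))"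
        unfolding tr_curvature_skew KK_entry[OF m] BB_entry[OF m] sum_distrib_left
        by (intro sum.cong refl) (simp add: algebra_simps)
      then show ?thesis by simp
    qed
    have "prj (Suc k) p (\<lambda>us. - (1/4) * tr7 (Riem p z (hd us) o\<^sub>L KK m p (tl us))) vs
      + prj (Suc k) p (\<lambda>us. - (1/2) * tr7 (Riem p z (hd us) o\<^sub>L BB m p (tl us))) vs = 0"
      unfolding prj_add[symmetric] e by (simp add: prj_def)
    then show ?thesis
      by (simp only: plus_fun_apply blinfun.add_left b_map_apply[OF True] c_map_apply[OF True] distrib_left[symmetric])
  qed
  then show ?thesis by (intro HOL.ext blinfun_eqI) simp
next
  case False
  then show ?thesis by (intro HOL.ext blinfun_eqI) (simp add: maps_high_degree)
qed

end

section \<open>Linearity and order of the operators\<close>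

lemma scale_form_add: "scale_form f (a + b) = scale_form f a + scale_form f b"
  by (simp add: scale_form_def fun_eq_iff scaleR_add_right)

lemma scale_form_diff: "scale_form f (a - b) = scale_form f a - scale_form f b"
  by (simp add: scale_form_def fun_eq_iff scaleR_diff_right)

lemma scale_form_minus: "scale_form f (- a) = - scale_form f a"
  by (simp add: scale_form_def fun_eq_iff)

lemma scale_form_zero: "scale_form f 0 = 0"
  by (simp add: scale_form_def fun_eq_iff)

lemma scale_form_commute: "scale_form f (scale_form h a) = scale_form h (scale_form f a)"
  by (simp add: scale_form_def fun_eq_iff mult.commute)

context g2_manifold
begin

lemma TG_add: "TG (m + m') = (\<lambda>p ws. TG m p ws + TG m' p ws)"
  by (simp add: fun_eq_iff TG_def blinfun.add_left)

lemma TG_scale: "TG (scale_form f m) = (\<lambda>p ws. f p * TG m p ws)"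
  by (simp add: fun_eq_iff TG_def scale_form_def blinfun.scaleR_left)

lemma TE_add: "TE (a + a') = (\<lambda>p ws. TE a p ws + TE a' p ws)"
  by (simp add: fun_eq_iff TE_def blinfun.add_left linear_add[OF g_linear(1)])

lemma TE_scale: "TE (scale_form f a) = (\<lambda>p ws. f p * TE a p ws)"
  by (simp add: fun_eq_iff TE_def scale_form_def blinfun.scaleR_left linear_scale[OF g_linear(1)])

lemma TSk_add: "TSk (a + a') = (\<lambda>p ws. TSk a p ws + TSk a' p ws)"
  by (simp add: fun_eq_iff TSk_def TE_add field_simps)

lemma TSk_scale: "TSk (scale_form f a) = (\<lambda>p ws. f p * TSk a p ws)"
  by (simp add: fun_eq_iff TSk_def TE_scale algebra_simps)

lemma G_tensor_add: "G_tensor k m \<Longrightarrow> G_tensor k m' \<Longrightarrow> G_tensor k (m + m')"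
  by (simp add: G_tensor_def TG_add tensor_add can_forms_add del: TG_Cons)

lemma G_tensor_scale: "f \<in> smooth_funs \<Longrightarrow> G_tensor k m \<Longrightarrow> G_tensor k (scale_form f m)"
  by (simp add: G_tensor_def TG_scale tensor_fmult can_forms_cmult del: TG_Cons)

lemma E_tensor_add: "E_tensor k a \<Longrightarrow> E_tensor k a' \<Longrightarrow> E_tensor k (a + a')"
  by (simp add: E_tensor_def TE_add tensor_add can_forms_add sum.distrib del: TE_Cons)

lemma E_tensor_scale: "f \<in> smooth_funs \<Longrightarrow> E_tensor k a \<Longrightarrow> E_tensor k (scale_form f a)"
  by (simp add: E_tensor_def TE_scale tensor_fmult can_forms_cmult sum_distrib_left[symmetric] del: TE_Cons)

lemma G_tensor_diff: "G_tensor k m \<Longrightarrow> G_tensor k m' \<Longrightarrow> G_tensor k (m - m')"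
proof -
  assume "G_tensor k m" "G_tensor k m'"
  then have "G_tensor k (m + scale_form (\<lambda>_. -1) m')" by (intro G_tensor_add G_tensor_scale smooth_funs_const)
  also have "m + scale_form (\<lambda>_. -1) m' = m - m'" by (simp add: scale_form_def fun_eq_iff)
  finally show ?thesis .
qed

lemma E_tensor_diff: "E_tensor k a \<Longrightarrow> E_tensor k a' \<Longrightarrow> E_tensor k (a - a')"
proof -
  assume "E_tensor k a" "E_tensor k a'"
  then have "E_tensor k (a + scale_form (\<lambda>_. -1) a')" by (intro E_tensor_add E_tensor_scale smooth_funs_const)
  also have "a + scale_form (\<lambda>_. -1) a' = a - a'" by (simp add: scale_form_def fun_eq_iff)
  finally show ?thesis .
qed

lemma
  assumes m: "G_tensor k m"
  shows nabla_TG_add: "G_tensor k m' \<Longrightarrow> nabla (TG (m + m')) p (v # z # vs) = nabla (TG m) p (v # z # vs) + nabla (TG m') p (v # z # vs)"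
    and nabla_TG_scale: "f \<in> smooth_funs \<Longrightarrow> nabla (TG (scale_form f m)) p (v # z # vs)
      = dfun f p v * blinfun_apply (m p vs) z + f p * nabla (TG m) p (v # z # vs)"
proof -
  have l: "length (z # vs) = Suc (length vs)" by simp
  show "nabla (TG (m + m')) p (v # z # vs) = nabla (TG m) p (v # z # vs) + nabla (TG m') p (v # z # vs)" if "G_tensor k m'"
    unfolding TG_add by (rule nabla_add[OF G_tensor_tensor[OF m] G_tensor_tensor[OF that] l])
  show "nabla (TG (scale_form f m)) p (v # z # vs) = dfun f p v * blinfun_apply (m p vs) z + f p * nabla (TG m) p (v # z # vs)"
    if "f \<in> smooth_funs"
    using nabla_fmult[OF that G_tensor_tensor[OF m] l] by (simp add: TG_scale)
qed

lemma
  assumes a: "E_tensor k a"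
  shows nabla_TE_add: "E_tensor k a' \<Longrightarrow> nabla (TE (a + a')) p (v # x # y # vs) = nabla (TE a) p (v # x # y # vs) + nabla (TE a') p (v # x # y # vs)"
    and nabla_TE_scale: "nabla (TE (scale_form (\<lambda>_. r) a)) p (v # x # y # vs) = r * nabla (TE a) p (v # x # y # vs)"
    and nabla_TSk_add: "E_tensor k a' \<Longrightarrow> nabla (TSk (a + a')) p (v # x # y # vs) = nabla (TSk a) p (v # x # y # vs) + nabla (TSk a') p (v # x # y # vs)"
    and nabla_TSk_scale: "f \<in> smooth_funs \<Longrightarrow> nabla (TSk (scale_form f a)) p (v # x # y # vs)
      = dfun f p v * TSk a p (x # y # vs) + f p * nabla (TSk a) p (v # x # y # vs)"
proof -
  have l: "length (x # y # vs) = Suc (Suc (length vs))" by simp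
  note E = E_tensor_tensor
  show "nabla (TE (a + a')) p (v # x # y # vs) = nabla (TE a) p (v # x # y # vs) + nabla (TE a') p (v # x # y # vs)" if "E_tensor k a'"
    unfolding TE_add by (rule nabla_add[OF E[OF a] E[OF that] l])
  show "nabla (TE (scale_form (\<lambda>_. r) a)) p (v # x # y # vs) = r * nabla (TE a) p (v # x # y # vs)"
    unfolding TE_scale by (rule nabla_cmult[OF E[OF a] l])
  show "nabla (TSk (a + a')) p (v # x # y # vs) = nabla (TSk a) p (v # x # y # vs) + nabla (TSk a') p (v # x # y # vs)" if "E_tensor k a'"
    unfolding TSk_add by (rule nabla_add[OF tensor_TSk[OF E[OF a]] tensor_TSk[OF E[OF that]] l])
  show "nabla (TSk (scale_form f a)) p (v # x # y # vs) = dfun f p v * TSk a p (x # y # vs) + f p * nabla (TSk a) p (v # x # y # vs)"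
    if "f \<in> smooth_funs"
    unfolding TSk_scale by (rule nabla_fmult[OF that tensor_TSk[OF E[OF a]] l])
qed

lemma d_G_add:
  assumes "G_tensor k m" "G_tensor k m'"
  shows "d_G k (m + m') = d_G k m + d_G k m'"
proof (cases "Suc k \<le> 3")
  case True
  have "blinfun_apply (d_G k (m + m') p vs) z = blinfun_apply ((d_G k m + d_G k m') p vs) z" for p vs z
    by (simp add: d_G_apply[OF G_tensor_add[OF assms] True] d_G_apply[OF assms(1) True] d_G_apply[OF assms(2) True]
        nabla_TG_add[OF assms] prj_add blinfun.add_left distrib_left)
  then show ?thesis by (intro HOL.ext blinfun_eqI)
qed (simp add: maps_high_degree fun_eq_iff)

lemma d_G_scale:
  assumes "G_tensor k m"
  shows "d_G k (real_act r m) = real_act r (d_G k m)"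
proof (cases "Suc k \<le> 3")
  case True
  have "blinfun_apply (d_G k (real_act r m) p vs) z = blinfun_apply (real_act r (d_G k m) p vs) z" for p vs z
    unfolding real_act_def
    by (simp add: d_G_apply[OF G_tensor_scale[OF smooth_funs_const assms] True] nabla_TG_scale[OF assms smooth_funs_const] dfun_const
        prj_scale[where 'b=real, unfolded real_scaleR_def])
      (simp add: scale_form_def blinfun.scaleR_left d_G_apply[OF assms True])
  then show ?thesis by (intro HOL.ext blinfun_eqI)
qed (simp add: maps_high_degree fun_eq_iff real_act_def scale_form_def)

lemma d_E_add:
  assumes "E_tensor k a" "E_tensor k a'"
  shows "d_E k (a + a') = d_E k a + d_E k a'"
proof (cases "Suc k \<le> 3")
  case True
  have "g p x (blinfun_apply (d_E k (a + a') p vs) y) = g p x (blinfun_apply ((d_E k a + d_E k a') p vs) y)" for p vs x y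
    by (simp add: d_E_apply[OF E_tensor_add[OF assms] True] d_E_apply[OF assms(1) True] d_E_apply[OF assms(2) True]
        nabla_TE_add[OF assms] prj_add blinfun.add_left linear_add[OF g_linear(1)] distrib_left)
  then show ?thesis by (intro HOL.ext blinfun_eqI g_eqI)
qed (simp add: maps_high_degree fun_eq_iff)

lemma d_E_scale:
  assumes "E_tensor k a"
  shows "d_E k (real_act r a) = real_act r (d_E k a)"
proof (cases "Suc k \<le> 3")
  case True
  have "g p x (blinfun_apply (d_E k (real_act r a) p vs) y) = g p x (blinfun_apply (real_act r (d_E k a) p vs) y)" for p vs x y
    unfolding real_act_def
    by (simp add: d_E_apply[OF E_tensor_scale[OF smooth_funs_const assms] True] nabla_TE_scale[OF assms]
        prj_scale[where 'b=real, unfolded real_scaleR_def])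
      (simp add: scale_form_def blinfun.scaleR_left linear_scale[OF g_linear(1)] d_E_apply[OF assms True])
  then show ?thesis by (intro HOL.ext blinfun_eqI g_eqI)
qed (simp add: maps_high_degree fun_eq_iff real_act_def scale_form_def)

lemma KK_add:
  assumes "G_tensor k m" "G_tensor k m'"
  shows "KK (m + m') = KK m + KK m'"
proof -
  have "g p x (blinfun_apply (KK (m + m') p vs) y) = g p x (blinfun_apply ((KK m + KK m') p vs) y)" for p vs x y
    by (simp add: KK_entry[OF G_tensor_add[OF assms]] KK_entry[OF assms(1)] KK_entry[OF assms(2)]
        nabla_TG_add[OF assms] blinfun.add_left linear_add[OF g_linear(1)])
  then show ?thesis by (intro HOL.ext blinfun_eqI g_eqI)
qed

lemma ell_entry: "E_tensor k a \<Longrightarrow> blinfun_apply (ell a p vs) z = - (1/2) * (SUM7 j. nabla (TSk a) p (onb p j # onb p j # z # vs))"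
  by (rule ell_apply[OF E_tensor_tensor refl])

lemma ell_add:
  assumes "E_tensor k a" "E_tensor k a'"
  shows "ell (a + a') = ell a + ell a'"
proof -
  have "blinfun_apply (ell (a + a') p vs) z = blinfun_apply ((ell a + ell a') p vs) z" for p vs z
    by (simp add: ell_entry[OF E_tensor_add[OF assms]] ell_entry[OF assms(1)] ell_entry[OF assms(2)]
        nabla_TSk_add[OF assms] blinfun.add_left sum.distrib field_simps)
  then show ?thesis by (intro HOL.ext blinfun_eqI)
qed

text \<open>The commutators with multiplication by a function. They contain no derivative of the
  section, so they are linear over functions: both homotopies have order one.\<close>
definition KK_comm :: "('a \<Rightarrow> real) \<Rightarrow> ('a, covec) forms \<Rightarrow> ('a, endo) forms" where
  "KK_comm f m = KK (scale_form f m) - scale_form f (KK m)"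

definition ell_comm :: "('a \<Rightarrow> real) \<Rightarrow> ('a, endo) forms \<Rightarrow> ('a, covec) forms" where
  "ell_comm f a = ell (scale_form f a) - scale_form f (ell a)"

lemma KK_comm_entry:
  assumes f: "f \<in> smooth_funs" and m: "G_tensor k m"
  shows "g p x (blinfun_apply (KK_comm f m p vs) y) = dfun f p y * blinfun_apply (m p vs) x - dfun f p x * blinfun_apply (m p vs) y"
  by (simp add: KK_comm_def blinfun.diff_left linear_diff[OF g_linear(1)] KK_entry[OF G_tensor_scale[OF f m]] nabla_TG_scale[OF m f])
    (simp add: scale_form_def blinfun.scaleR_left linear_scale[OF g_linear(1)] KK_entry[OF m] right_diff_distrib)

lemma ell_comm_entry:
  assumes f: "f \<in> smooth_funs" and a: "E_tensor k a"
  shows "blinfun_apply (ell_comm f a p vs) z = - (1/2) * (SUM7 j. dfun f p (onb p j) * TSk a p (onb p j # z # vs))"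
  by (simp add: ell_comm_def blinfun.diff_left ell_entry[OF E_tensor_scale[OF f a]] nabla_TSk_scale[OF a f] del: TSk_Cons)
    (simp add: scale_form_def blinfun.scaleR_left ell_entry[OF a] sum.distrib sum_distrib_left[symmetric] field_simps del: TSk_Cons)

lemma KK_comm_scale:
  assumes f: "f \<in> smooth_funs" and h: "h \<in> smooth_funs" and m: "G_tensor k m"
  shows "KK_comm f (scale_form h m) = scale_form h (KK_comm f m)"
proof -
  have "g p x (blinfun_apply (KK_comm f (scale_form h m) p vs) y) = g p x (blinfun_apply (scale_form h (KK_comm f m) p vs) y)" for p vs x y
    by (simp add: KK_comm_entry[OF f G_tensor_scale[OF h m]])
      (simp add: scale_form_def blinfun.scaleR_left linear_scale[OF g_linear(1)] KK_comm_entry[OF f m] algebra_simps)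
  then show ?thesis by (intro HOL.ext blinfun_eqI g_eqI)
qed

lemma ell_comm_scale:
  assumes f: "f \<in> smooth_funs" and h: "h \<in> smooth_funs" and a: "E_tensor k a"
  shows "ell_comm f (scale_form h a) = scale_form h (ell_comm f a)"
proof -
  have "blinfun_apply (ell_comm f (scale_form h a) p vs) z = blinfun_apply (scale_form h (ell_comm f a) p vs) z" for p vs z
    by (simp add: ell_comm_entry[OF f E_tensor_scale[OF h a]] TSk_scale del: TSk_Cons)
      (simp add: scale_form_def blinfun.scaleR_left ell_comm_entry[OF f a] sum_distrib_left mult_ac sum_negf sum_divide_distrib del: TSk_Cons)
  then show ?thesis by (intro HOL.ext blinfun_eqI)
qed

lemma KK_comm_const: "G_tensor k m \<Longrightarrow> KK_comm (\<lambda>_. r) m = 0"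
proof -
  assume m: "G_tensor k m"
  have "g p x (blinfun_apply (KK_comm (\<lambda>_. r) m p vs) y) = g p x (blinfun_apply ((0 :: ('a, endo) forms) p vs) y)" for p vs x y
    by (simp add: KK_comm_entry[OF smooth_funs_const m] dfun_const linear_0[OF g_linear(1)])
  then show ?thesis by (intro HOL.ext blinfun_eqI g_eqI)
qed

lemma ell_comm_const: "E_tensor k a \<Longrightarrow> ell_comm (\<lambda>_. r) a = 0"
proof -
  assume a: "E_tensor k a"
  have "blinfun_apply (ell_comm (\<lambda>_. r) a p vs) z = blinfun_apply ((0 :: ('a, covec) forms) p vs) z" for p vs z
    by (simp add: ell_comm_entry[OF smooth_funs_const a] dfun_const)
  then show ?thesis by (intro HOL.ext blinfun_eqI)
qed

lemma KK_real_act: "G_tensor k m \<Longrightarrow> KK (real_act r m) = real_act r (KK m)"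
  using KK_comm_const[of k m r] by (simp add: KK_comm_def real_act_def)

lemma ell_real_act: "E_tensor k a \<Longrightarrow> ell (real_act r a) = real_act r (ell a)"
  using ell_comm_const[of k a r] by (simp add: ell_comm_def real_act_def)

end

section \<open>The splitting\<close>

text \<open>Since \<open>D = V d W\<close> with mutually inverse module isomorphisms, linearity of \<open>D\<close> and \<open>D D = 0\<close>
  are inherited from \<open>d\<close>; the entries of \<open>D\<close> need not be studied one by one.\<close>
lemma complex_iso_transport:
  assumes C: "\<And>k. module_on act' (C k)" and B: "\<And>k. module_on act (B k)"
    and d: "\<And>k. linear_map_on act' act' (C k) (C (Suc k)) (d k)" and dd: "\<And>k x. x \<in> C k \<Longrightarrow> d (Suc k) (d k x) = 0"
    and V: "\<And>k. linear_map_on act' act (C k) (B k) V" and W: "\<And>k. linear_map_on act act' (B k) (C k) W"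
    and WV: "\<And>k x. x \<in> C k \<Longrightarrow> W (V x) = x" and VW: "\<And>k x. x \<in> B k \<Longrightarrow> V (W x) = x"
    and D: "\<And>k x. x \<in> B k \<Longrightarrow> D k x = V (d k (W x))"
  shows "complex_iso act act' (B, D) (C, d) (\<lambda>k. W)"
proof -
  have dC: "d k x \<in> C (Suc k)" if "x \<in> C k" for k x using d[of k] that by (auto simp: linear_map_on_def)
  have VB: "V x \<in> B k" if "x \<in> C k" for k x using V[of k] that by (auto simp: linear_map_on_def)
  have WC: "W x \<in> C k" if "x \<in> B k" for k x using W[of k] that by (auto simp: linear_map_on_def)
  have add: "x + y \<in> B k" "act r x \<in> B k" if "x \<in> B k" "y \<in> B k" for k x y r
    using B[of k] that by (auto simp: module_on_def)
  have V0: "V 0 = 0"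
  proof -
    have "V (0 + 0) = V 0 + V 0" using V[of 0] C[of 0] unfolding linear_map_on_def module_on_def by blast
    then show ?thesis by simp
  qed
  have "linear_map_on act act (B k) (B (Suc k)) (D k)" for k
    unfolding linear_map_on_def
  proof (intro conjI ballI allI)
    show "D k ` B k \<subseteq> B (Suc k)" using D WC dC VB by auto
    fix x assume x: "x \<in> B k"
    show "D k (x + y) = D k x + D k y" if y: "y \<in> B k" for y
    proof -
      have "W (x + y) = W x + W y" using W[of k] x y by (auto simp: linear_map_on_def)
      moreover have "d k (W x + W y) = d k (W x) + d k (W y)" using d[of k] WC x y by (auto simp: linear_map_on_def)
      moreover have "V (d k (W x) + d k (W y)) = V (d k (W x)) + V (d k (W y))"
        using V[of "Suc k"] dC WC x y by (auto simp: linear_map_on_def)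
      ultimately show ?thesis using add x y by (simp add: D)
    qed
    show "D k (act r x) = act r (D k x)" for r
    proof -
      have "W (act r x) = act' r (W x)" using W[of k] x by (auto simp: linear_map_on_def)
      moreover have "d k (act' r (W x)) = act' r (d k (W x))" using d[of k] WC x by (auto simp: linear_map_on_def)
      moreover have "V (act' r (d k (W x))) = act r (V (d k (W x)))"
        using V[of "Suc k"] dC WC x by (auto simp: linear_map_on_def)
      ultimately show ?thesis using add x by (simp add: D)
    qed
  qed
  moreover have "D (Suc k) (D k x) = 0" if "x \<in> B k" for k x
    using that by (simp add: D VB dC WC WV[OF dC[OF WC]] dd V0)
  ultimately have "is_complex act (B, D)" using B by (simp add: is_complex_def)
  moreover have "is_complex act' (C, d)" using C d dd by (simp add: is_complex_def)
  moreover have "bij_betw W (B k) (C k)" for k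
    by (rule bij_betw_byWitness[of _ V]) (use WV VW VB WC in auto)
  moreover have "W (D k x) = d k (W x)" if "x \<in> B k" for k x
    using that by (simp add: D WV[OF dC[OF WC]])
  ultimately show ?thesis using W by (simp add: complex_iso_def)
qed

lemma real_act_simps:
  "real_act r (a + b) = real_act r a + real_act r b" "real_act r (a - b) = real_act r a - real_act r b"
  "real_act (r + s) a = real_act r a + real_act s a" "real_act (r * s) a = real_act r (real_act s a)"
  "real_act 1 a = a" "real_act 0 a = 0"
  by (simp_all add: real_act_def scale_form_def fun_eq_iff algebra_simps)

context torsion_free_g2_manifold
begin

lemma sections_zero: "0 \<in> G_sp k" "0 \<in> E_sp k"
  using G_tensor_zero[of k] E_tensor_zero[of k] by (simp_all add: G_sp_iff E_sp_iff zero_fun_def)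

lemma sections_add: "m \<in> G_sp k \<Longrightarrow> m' \<in> G_sp k \<Longrightarrow> m + m' \<in> G_sp k" "a \<in> E_sp k \<Longrightarrow> a' \<in> E_sp k \<Longrightarrow> a + a' \<in> E_sp k"
  by (simp_all add: G_sp_iff E_sp_iff G_tensor_add E_tensor_add)

lemma sections_diff: "m \<in> G_sp k \<Longrightarrow> m' \<in> G_sp k \<Longrightarrow> m - m' \<in> G_sp k" "a \<in> E_sp k \<Longrightarrow> a' \<in> E_sp k \<Longrightarrow> a - a' \<in> E_sp k"
  by (simp_all add: G_sp_iff E_sp_iff G_tensor_diff E_tensor_diff)

lemma sections_scale: "f \<in> smooth_funs \<Longrightarrow> m \<in> G_sp k \<Longrightarrow> scale_form f m \<in> G_sp k" "f \<in> smooth_funs \<Longrightarrow> a \<in> E_sp k \<Longrightarrow> scale_form f a \<in> E_sp k"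
  by (simp_all add: G_sp_iff E_sp_iff G_tensor_scale E_tensor_scale)

lemma sections_act: "m \<in> G_sp k \<Longrightarrow> real_act r m \<in> G_sp k" "a \<in> E_sp k \<Longrightarrow> real_act r a \<in> E_sp k"
  unfolding real_act_def by (rule sections_scale[OF smooth_funs_const]; assumption)+

lemma sections_operators:
  "m \<in> G_sp k \<Longrightarrow> d_G k m \<in> G_sp (Suc k)" "a \<in> E_sp k \<Longrightarrow> d_E k a \<in> E_sp (Suc k)"
  "m \<in> G_sp k \<Longrightarrow> KK m \<in> E_sp k" "a \<in> E_sp k \<Longrightarrow> ell a \<in> G_sp k"
  by (simp_all add: G_sp_iff E_sp_iff G_tensor_d_G E_tensor_d_E E_tensor_KK G_tensor_ell)

lemma sections_linear:
  "m \<in> G_sp k \<Longrightarrow> m' \<in> G_sp k \<Longrightarrow> d_G k (m + m') = d_G k m + d_G k m'"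
  "a \<in> E_sp k \<Longrightarrow> a' \<in> E_sp k \<Longrightarrow> d_E k (a + a') = d_E k a + d_E k a'"
  "m \<in> G_sp k \<Longrightarrow> m' \<in> G_sp k \<Longrightarrow> KK (m + m') = KK m + KK m'"
  "a \<in> E_sp k \<Longrightarrow> a' \<in> E_sp k \<Longrightarrow> ell (a + a') = ell a + ell a'"
  "m \<in> G_sp k \<Longrightarrow> d_G k (real_act r m) = real_act r (d_G k m)"
  "a \<in> E_sp k \<Longrightarrow> d_E k (real_act r a) = real_act r (d_E k a)"
  "m \<in> G_sp k \<Longrightarrow> KK (real_act r m) = real_act r (KK m)"
  "a \<in> E_sp k \<Longrightarrow> ell (real_act r a) = real_act r (ell a)"
  by (simp_all add: G_sp_iff E_sp_iff d_G_add d_E_add KK_add ell_add d_G_scale d_E_scale KK_real_act ell_real_act)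

lemma sections_squares: "m \<in> G_sp k \<Longrightarrow> d_G (Suc k) (d_G k m) = 0" "a \<in> E_sp k \<Longrightarrow> d_E (Suc k) (d_E k a) = 0"
  by (simp_all add: G_sp_iff E_sp_iff d_G_d_G d_E_d_E zero_fun_def)

lemma additive_diff:
  fixes F :: "'s::ab_group_add \<Rightarrow> 't::ab_group_add"
  assumes "\<And>x y. x \<in> M \<Longrightarrow> y \<in> M \<Longrightarrow> F (x + y) = F x + F y" "x \<in> M" "y \<in> M" "x - y \<in> M"
  shows "F (x - y) = F x - F y"
  using assms(1)[of "x - y" y] assms(2-4) by simp

lemma d_G_diff: "m \<in> G_sp k \<Longrightarrow> m' \<in> G_sp k \<Longrightarrow> d_G k (m - m') = d_G k m - d_G k m'"
  by (rule additive_diff[where M="G_sp k" and F="d_G k"]) (rule sections_linear(1) sections_diff(1) | assumption)+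

lemma ell_diff: "a \<in> E_sp k \<Longrightarrow> a' \<in> E_sp k \<Longrightarrow> ell (a - a') = ell a - ell a'"
  by (rule additive_diff[where M="E_sp k" and F=ell]) (rule sections_linear(4)[where k=k] sections_diff(2) | assumption)+

definition diag :: "nat \<Rightarrow> ('a, covec) forms \<times> ('a, endo) forms \<times> ('a, covec) forms \<Rightarrow>
    ('a, covec) forms \<times> ('a, endo) forms \<times> ('a, covec) forms" where
  "diag k = map_prod (d_G k) (map_prod (d_E k) (d_G k))"

lemma diag_simp [simp]: "diag k (x, a, m) = (d_G k x, d_E k a, d_G k m)"
  by (simp add: diag_def)

lemma diag_in: "s \<in> B_sp k \<Longrightarrow> diag k s \<in> B_sp (Suc k)"
  by (cases s) (simp add: B_sp_def sections_operators)

lemma V_B_in: "s \<in> B_sp k \<Longrightarrow> V_B s \<in> B_sp k"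
  and W_B_in: "s \<in> B_sp k \<Longrightarrow> W_B s \<in> B_sp k"
  by (auto simp: B_sp_def intro!: sections_add sections_diff sections_operators)

lemma W_V: "s \<in> B_sp k \<Longrightarrow> W_B (V_B s) = s"
  and V_W: "s \<in> B_sp k \<Longrightarrow> V_B (W_B s) = s"
  by (cases s; simp add: B_sp_def sections_linear(4)[where k=k] ell_diff[where k=k] sections_operators)+

text \<open>The off-diagonal entries of this matrix identity are the three homotopy identities.\<close>
theorem D_V:
  assumes "s \<in> B_sp k"
  shows "D_B k (V_B s) = V_B (diag k s)"
proof -
  obtain x a m where s: "s = (x, a, m)" by (cases s)
  have x: "x \<in> G_sp k" and a: "a \<in> E_sp k" and m: "m \<in> G_sp k" using assms by (auto simp: s B_sp_def)
  note K = sections_operators(3)[OF m]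
  have b: "b_map k c = d_G k (ell c) - ell (d_E k c)" if "c \<in> E_sp k" for c
    using b_map_ell[of k c] that by (simp add: E_sp_iff eq_diff_eq)
  have "d_G k (x - ell a) + b_map k (a + KK m) + c_map k m = d_G k x - ell (d_E k a)"
  proof -
    have e1: "b_map k (a + KK m) = b_map k a + b_map k (KK m)"
      using a K by (simp add: b sections_add sections_linear[where k=k] sections_linear(4)[where k="Suc k"] sections_operators)
    have e2: "c_map k m = - b_map k (KK m)" using b_map_KK[of k m] m by (simp only: G_sp_iff add_eq_0_iff)
    have e3: "d_G k (x - ell a) = d_G k x - d_G k (ell a)"
      using x a by (simp add: d_G_diff sections_operators)
    show ?thesis unfolding e1 e2 e3 b[OF a] by simp
  qed
  moreover have "d_E k (a + KK m) + f_map k m = d_E k a + KK (d_G k m)"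
    using d_E_KK[of k m] m a K by (simp add: G_sp_iff[symmetric] sections_linear add.assoc)
  ultimately show ?thesis by (simp add: s)
qed

lemma W_D_V: "s \<in> B_sp k \<Longrightarrow> W_B (D_B k (V_B s)) = diag k s"
  by (simp add: D_V W_V[OF diag_in])

lemma D_eq: "s \<in> B_sp k \<Longrightarrow> D_B k s = V_B (diag k (W_B s))"
  using D_V[OF W_B_in, of s k] by (simp add: V_W)

lemma B_4: "B_sp 4 = {0}"
proof -
  have "m = 0" if "m \<in> G_sp 4" for m
  proof -
    have "(\<lambda>vs. TG m p (z # vs)) = (\<lambda>vs. 0)" for p z
      using that can_forms_high[of 4 p] unfolding G_sp_iff G_tensor_def by auto
    then have "blinfun_apply (m p vs) z = 0" for p vs z by (simp add: fun_eq_iff)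
    then show "m = 0" by (intro HOL.ext blinfun_eqI) simp
  qed
  moreover have "a = 0" if "a \<in> E_sp 4" for a
  proof -
    have "(\<lambda>vs. TE a p (x # y # vs)) = (\<lambda>vs. 0)" for p x y
      using that can_forms_high[of 4 p] unfolding E_sp_iff E_tensor_def by auto
    then have "g p x (blinfun_apply (a p vs) y) = g p x 0" for p vs x y
      by (simp add: fun_eq_iff linear_0[OF g_linear(1)])
    then have "blinfun_apply (a p vs) y = 0" for p vs y by (rule g_eqI)
    then show "a = 0" by (intro HOL.ext blinfun_eqI) simp
  qed
  ultimately show ?thesis using sections_zero[of 4] by (auto simp: B_sp_def zero_prod_def)
qed

lemma V_W_linear:
  "linear_map_on real_act3 real_act3 (B_sp k) (B_sp k) V_B"
  "linear_map_on real_act3 real_act3 (B_sp k) (B_sp k) W_B"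
proof -
  note L = sections_linear[where k=k] and in_sp = sections_operators[where k=k]
  have "V_B (s + t) = V_B s + V_B t \<and> W_B (s + t) = W_B s + W_B t" if "s \<in> B_sp k" "t \<in> B_sp k" for s t
    using that by (cases s; cases t) (simp add: B_sp_def L in_sp algebra_simps)
  moreover have "V_B (real_act3 r s) = real_act3 r (V_B s) \<and> W_B (real_act3 r s) = real_act3 r (W_B s)" if "s \<in> B_sp k" for r s
    using that by (cases s) (simp add: B_sp_def real_act3_def real_act_def[symmetric] real_act_simps L in_sp)
  ultimately show "linear_map_on real_act3 real_act3 (B_sp k) (B_sp k) V_B"
    "linear_map_on real_act3 real_act3 (B_sp k) (B_sp k) W_B"
    using V_B_in W_B_in by (simp_all add: linear_map_on_def image_subset_iff)
qed

lemma real_module: "module_on real_act3 (B_sp k)"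
  unfolding module_on_def
  by (auto simp: B_sp_def zero_prod_def real_act3_def real_act_def[symmetric] real_act_simps sections_zero sections_add sections_act)

lemma diag_add: "s \<in> B_sp k \<Longrightarrow> t \<in> B_sp k \<Longrightarrow> diag k (s + t) = diag k s + diag k t"
  by (cases s; cases t) (simp add: B_sp_def sections_linear)

lemma diag_linear: "linear_map_on real_act3 real_act3 (B_sp k) (B_sp (Suc k)) (diag k)"
proof -
  have "diag k (real_act3 r s) = real_act3 r (diag k s)" if "s \<in> B_sp k" for r s
    using that by (cases s) (simp add: B_sp_def real_act3_def real_act_def[symmetric] sections_linear)
  then show ?thesis using diag_in diag_add by (simp add: linear_map_on_def image_subset_iff)
qed

lemma diag_diag: "s \<in> B_sp k \<Longrightarrow> diag (Suc k) (diag k s) = 0"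
  by (cases s) (simp add: B_sp_def zero_prod_def sections_squares)

theorem real_splitting:
  "complex_iso real_act3 real_act3 (B_sp, D_B)
     (direct_sum (G_sp, d_G) (direct_sum (E_sp, d_E) (G_sp, d_G))) (\<lambda>k. W_B)"
proof -
  have "direct_sum (G_sp, d_G) (direct_sum (E_sp, d_E) (G_sp, d_G)) = (B_sp, diag)"
    by (simp add: direct_sum_def fun_eq_iff B_sp_def diag_def)
  then show ?thesis
    using complex_iso_transport[of real_act3 B_sp real_act3 B_sp diag V_B W_B D_B]
      real_module diag_linear diag_diag V_W_linear W_V V_W D_eq by simp
qed

subsection \<open>The dual-number action\<close>

fun ungroup :: "('w \<times> 'u) \<times> 'v \<Rightarrow> 'u \<times> 'v \<times> 'w" where
  "ungroup ((m, x), a) = (x, a, m)"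

lemma V_W_dual:
  assumes "s \<in> B_sp k"
  shows "V_B (dual_act3 q s) = dual_act3 q (V_B s)" "W_B (dual_act3 q s) = dual_act3 q (W_B s)"
proof -
  note L = sections_linear[where k=k] and in_sp = sections_operators[where k=k] sections_act[where k=k]
  obtain x a m where s: "s = (x, a, m)" by (cases s)
  have "x \<in> G_sp k" "a \<in> E_sp k" "m \<in> G_sp k" using assms by (auto simp: s B_sp_def)
  then show "V_B (dual_act3 q s) = dual_act3 q (V_B s)" "W_B (dual_act3 q s) = dual_act3 q (W_B s)"
    by (cases q; simp add: s real_act_simps(1,2) L in_sp)+
qed

lemma dual_module: "module_on dual_act3 (B_sp k)"
  unfolding module_on_def
proof (intro conjI ballI allI)
  fix x y :: "('a, covec) forms \<times> ('a, endo) forms \<times> ('a, covec) forms" and r s :: dual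
  assume x: "x \<in> B_sp k"
  show "dual_act3 r x \<in> B_sp k" using x by (cases r) (auto simp: B_sp_def sections_add sections_act)
  show "dual_act3 (r + s) x = dual_act3 r x + dual_act3 s x" "dual_act3 (r * s) x = dual_act3 r (dual_act3 s x)"
    by (cases r; cases s; cases x; simp add: real_act_simps algebra_simps)+
  show "dual_act3 1 x = x" by (cases x) (simp add: one_dual_def real_act_simps)
  assume y: "y \<in> B_sp k"
  show "x + y \<in> B_sp k" using x y by (auto simp: B_sp_def sections_add)
  show "dual_act3 r (x + y) = dual_act3 r x + dual_act3 r y"
    by (cases r; cases x; cases y) (simp add: real_act_simps algebra_simps)
qed (simp add: B_sp_def zero_prod_def sections_zero)

theorem dual_splitting:
  "complex_iso dual_act3 dual_act_split (B_sp, D_B)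
     (direct_sum (tensor_dual (G_sp, d_G)) (E_sp, d_E)) (\<lambda>k s. regroup (W_B s))"
proof -
  define C where "C k = (G_sp k \<times> G_sp k) \<times> E_sp k" for k
  define d where "d k = map_prod (map_prod (d_G k) (d_G k)) (d_E k)" for k
  have C: "t \<in> C k \<longleftrightarrow> ungroup t \<in> B_sp k" for t k by (cases t rule: ungroup.cases) (auto simp: C_def B_sp_def)
  have ug: "ungroup (regroup s) = s" for s :: "('a, covec) forms \<times> ('a, endo) forms \<times> ('a, covec) forms" by (cases s) simp
  have gu: "regroup (ungroup t) = t" for t :: "(('a, covec) forms \<times> ('a, covec) forms) \<times> ('a, endo) forms"
    by (cases t rule: ungroup.cases) simp
  have inj: "t = t' \<longleftrightarrow> ungroup t = ungroup t'" for t t' :: "(('a, covec) forms \<times> ('a, covec) forms) \<times> ('a, endo) forms"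
    by (metis gu)
  have u: "ungroup (t + t') = ungroup t + ungroup t'" "ungroup (dual_act_split q t) = dual_act3 q (ungroup t)"
    "ungroup (d k t) = diag k (ungroup t)"
    for t t' :: "(('a, covec) forms \<times> ('a, covec) forms) \<times> ('a, endo) forms" and q k
    by (cases t rule: ungroup.cases; cases t' rule: ungroup.cases; cases q; simp add: d_def)+
  have u0: "ungroup (0 :: (('a, covec) forms \<times> ('a, covec) forms) \<times> ('a, endo) forms) = 0" by (simp add: zero_prod_def)
  have diag_dual: "diag k (dual_act3 q s) = dual_act3 q (diag k s)" if "s \<in> B_sp k" for q s k
    using that by (cases q; cases s) (simp add: B_sp_def sections_linear sections_act)
  have "direct_sum (tensor_dual (G_sp, d_G)) (E_sp, d_E) = (C, d)"
    by (simp add: direct_sum_def tensor_dual_def fun_eq_iff C_def d_def)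
  moreover have "complex_iso dual_act3 dual_act_split (B_sp, D_B) (C, d) (\<lambda>k s. regroup (W_B s))"
  proof (rule complex_iso_transport[where V="\<lambda>t. V_B (ungroup t)" and W="\<lambda>s. regroup (W_B s)"])
    fix k
    note lin = V_W_linear[of k, unfolded linear_map_on_def] diag_linear[of k, unfolded linear_map_on_def]
    show "module_on dual_act3 (B_sp k)" by (rule dual_module)
    then show "module_on dual_act_split (C k)"
      unfolding module_on_def by (simp add: C inj u u0)
    show "linear_map_on dual_act_split dual_act_split (C k) (C (Suc k)) (d k)"
      by (simp add: linear_map_on_def image_subset_iff C inj u diag_dual diag_in diag_add)
    show "linear_map_on dual_act_split dual_act3 (C k) (B_sp k) (\<lambda>t. V_B (ungroup t))"
      using lin(1) by (simp add: linear_map_on_def image_subset_iff C u V_W_dual)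
    show "linear_map_on dual_act3 dual_act_split (B_sp k) (C k) (\<lambda>s. regroup (W_B s))"
      using lin(2) by (simp add: linear_map_on_def image_subset_iff C inj u ug V_W_dual)
    show "d (Suc k) (d k t) = 0" if "t \<in> C k" for t
      using that by (simp add: C inj u u0 diag_diag)
    show "regroup (W_B (V_B (ungroup t))) = t" if "t \<in> C k" for t
      using that by (simp add: C W_V gu)
    show "V_B (ungroup (regroup (W_B s))) = s" if "s \<in> B_sp k" for s
      using that by (simp add: ug V_W)
    show "D_B k s = V_B (ungroup (d k (regroup (W_B s))))" if "s \<in> B_sp k" for s
      using that by (simp add: u ug D_eq)
  qed
  ultimately show ?thesis by simp
qed

subsection \<open>Order of the isomorphisms\<close>

lemma scale3_in: "f \<in> smooth_funs \<Longrightarrow> s \<in> B_sp k \<Longrightarrow> scale3 f s \<in> B_sp k"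
  by (auto simp: B_sp_def sections_scale)

lemma KK_scale: "KK (scale_form f m) = scale_form f (KK m) + KK_comm f m"
  and ell_scale: "ell (scale_form f a) = scale_form f (ell a) + ell_comm f a"
  by (simp_all add: KK_comm_def ell_comm_def)

lemma V_diff_op: "diff_op3 smooth_funs (B_sp k) V_B"
proof -
  have "diff_op_order 1 scale3 scale3 smooth_funs (B_sp k) V_B"
    unfolding One_nat_def diff_op_order.simps
  proof (intro ballI)
    fix f h s assume f: "f \<in> smooth_funs" and h: "h \<in> smooth_funs" and s: "s \<in> B_sp k"
    have comm: "V_B (scale3 f t) - scale3 f (V_B t) = (- ell_comm f (fst (snd t)), KK_comm f (snd (snd t)), 0)" for t
      by (cases t) (simp add: KK_scale ell_scale scale_form_add scale_form_diff)
    show "V_B (scale3 f (scale3 h s)) - scale3 f (V_B (scale3 h s)) = scale3 h (V_B (scale3 f s) - scale3 f (V_B s))"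
      using s unfolding comm
      by (cases s) (simp add: B_sp_def G_sp_iff E_sp_iff ell_comm_scale[OF f h, where k=k] KK_comm_scale[OF f h, where k=k] scale_form_minus scale_form_zero)
  qed
  then show ?thesis using V_W_linear unfolding diff_op3_def by blast
qed

lemma KK_comm_in: "f \<in> smooth_funs \<Longrightarrow> m \<in> G_sp k \<Longrightarrow> KK_comm f m \<in> E_sp k"
  unfolding KK_comm_def by (intro sections_diff sections_scale sections_operators)

text \<open>The entry \<open>ell \<circ> KK\<close> makes the order two. Its second commutator with \<open>f\<close> and \<open>h\<close> is, by the
  Leibniz rule, a sum of products of first commutators (\<open>Q f h\<close>, up to sign), hence linear over
  functions.\<close>
lemma W_diff_op: "diff_op3 smooth_funs (B_sp k) W_B"
proof -
  define Q where "Q f h t = (- (ell_comm f (KK_comm h (snd (snd t))) + ell_comm h (KK_comm f (snd (snd t)))),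
      0 :: ('a, endo) forms, 0 :: ('a, covec) forms)"
    for f h and t :: "('a, covec) forms \<times> ('a, endo) forms \<times> ('a, covec) forms"
  have comm: "W_B (scale3 f (scale3 h t)) - scale3 f (W_B (scale3 h t)) - scale3 h (W_B (scale3 f t) - scale3 f (W_B t)) = Q f h t"
    if f: "f \<in> smooth_funs" and h: "h \<in> smooth_funs" and t: "t \<in> B_sp k" for f h t
  proof -
    obtain x a m where s: "t = (x, a, m)" by (cases t)
    have a: "a \<in> E_sp k" and m: "m \<in> G_sp k" using t by (auto simp: s B_sp_def)
    note K = sections_operators(3)[OF m]
    have sc: "ell_comm f (scale_form h c) = scale_form h (ell_comm f c)" if "c \<in> E_sp k" for c
      using that by (simp add: E_sp_iff ell_comm_scale[OF f h])
    have 1: "KK (scale_form f (scale_form h m)) = scale_form f (scale_form h (KK m)) + scale_form f (KK_comm h m) + scale_form h (KK_comm f m)"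
      using m by (simp add: KK_scale scale_form_add G_sp_iff KK_comm_scale[OF f h])
    have 2: "ell (scale_form f (scale_form h (KK m)) + scale_form f (KK_comm h m) + scale_form h (KK_comm f m))
        = ell (scale_form f (scale_form h (KK m))) + ell (scale_form f (KK_comm h m)) + ell (scale_form h (KK_comm f m))"
      using f h m K by (simp add: sections_linear(4)[where k=k] sections_add sections_scale KK_comm_in)
    have 3: "ell (scale_form u (KK m) + KK_comm u m) = ell (scale_form u (KK m)) + ell (KK_comm u m)" if "u \<in> smooth_funs" for u
      using that m K by (simp add: sections_linear(4)[where k=k] sections_scale KK_comm_in)
    have 4: "ell (KK (scale_form u m)) = ell (scale_form u (KK m)) + ell (KK_comm u m)" if "u \<in> smooth_funs" for u
      by (simp only: KK_scale 3[OF that])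
    have c1: "(scale_form f (scale_form h x) + ell (scale_form f (scale_form h a)) - ell (KK (scale_form f (scale_form h m))))
        - scale_form f (scale_form h x + ell (scale_form h a) - ell (KK (scale_form h m)))
        - scale_form h ((scale_form f x + ell (scale_form f a) - ell (KK (scale_form f m))) - scale_form f (x + ell a - ell (KK m)))
      = - (ell_comm f (KK_comm h m) + ell_comm h (KK_comm f m))"
      unfolding 1 2 4[OF f] 4[OF h]
      by (simp add: ell_scale sc[OF a] sc[OF K] scale_form_add scale_form_diff scale_form_commute[of h f])
    have c2: "(scale_form f (scale_form h a) - KK (scale_form f (scale_form h m))) - scale_form f (scale_form h a - KK (scale_form h m))
        - scale_form h ((scale_form f a - KK (scale_form f m)) - scale_form f (a - KK m)) = 0"
      unfolding 1 by (simp add: KK_scale scale_form_add scale_form_diff scale_form_minus scale_form_commute[of h f])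
    have c3: "scale_form f (scale_form h m) - scale_form f (scale_form h m) - scale_form h (scale_form f m - scale_form f m) = 0"
      by (simp add: scale_form_zero)
    show ?thesis
      unfolding s Q_def scale3.simps W_B.simps minus_prod_def fst_conv snd_conv c1 c2 c3 ..
  qed
  have "diff_op_order 2 scale3 scale3 smooth_funs (B_sp k) W_B"
    unfolding numeral_2_eq_2 diff_op_order.simps
  proof (intro ballI)
    fix f h u s assume f: "f \<in> smooth_funs" and h: "h \<in> smooth_funs" and u: "u \<in> smooth_funs" and s: "s \<in> B_sp k"
    have "Q f h (scale3 u s) = scale3 u (Q f h s)"
    proof -
      obtain x a m where s': "s = (x, a, m)" by (cases s)
      then have m: "m \<in> G_sp k" using s by (simp add: B_sp_def)
      have "ell_comm p (KK_comm q (scale_form u m)) = scale_form u (ell_comm p (KK_comm q m))"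
        if "p \<in> smooth_funs" "q \<in> smooth_funs" for p q
        using that m KK_comm_in[OF that(2) m] u by (simp add: G_sp_iff E_sp_iff KK_comm_scale ell_comm_scale)
      then show ?thesis by (simp add: Q_def s' f h scale_form_minus scale_form_zero scale_form_add scale_form_diff)
    qed
    then show "W_B (scale3 f (scale3 h (scale3 u s))) - scale3 f (W_B (scale3 h (scale3 u s)))
        - scale3 h (W_B (scale3 f (scale3 u s)) - scale3 f (W_B (scale3 u s)))
      = scale3 u (W_B (scale3 f (scale3 h s)) - scale3 f (W_B (scale3 h s)) - scale3 h (W_B (scale3 f s) - scale3 f (W_B s)))"
      by (simp only: comm[OF f h s] comm[OF f h scale3_in[OF u s]])
  qed
  then show ?thesis using V_W_linear unfolding diff_op3_def by blast
qed

end

theorem theorem7p1: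
  fixes atlas :: "('a::{t2_space, second_countable_topology} set \<times> ('a \<Rightarrow> tvec)) set"
    and g :: "'a \<Rightarrow> tvec \<Rightarrow> tvec \<Rightarrow> real"
    and nab :: "('a \<Rightarrow> tvec) \<Rightarrow> ('a \<Rightarrow> tvec) \<Rightarrow> 'a \<Rightarrow> tvec"
    and \<phi> vol :: "('a, real) forms"
  assumes "torsion_free_g2_manifold atlas g nab \<phi> vol"
  shows
    "let Gsp = g2_manifold.can_sections atlas \<phi> (smooth_manifold7.cotangent_sections atlas);
         Esp = g2_manifold.can_sections atlas \<phi> (smooth_manifold7.End0_sections atlas);
         d = g2_manifold.d_G atlas g nab \<phi>;
         e = g2_manifold.d_E atlas g nab \<phi>;
         B = g2_manifold.B_sp atlas \<phi>;
         D = g2_manifold.D_B atlas g nab \<phi>;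
         V = g2_manifold.V_B atlas g nab;
         W = g2_manifold.W_B atlas g nab;
         \<epsilon> = Dual 0 1
     in
       (\<forall>k\<le>3.
          (\<forall>s\<in>B k. V s \<in> B k \<and> W s \<in> B k \<and> W (V s) = s \<and> V (W s) = s) \<and>
          diff_op3 (smooth_manifold7.smooth_funs atlas) (B k) V \<and>
          diff_op3 (smooth_manifold7.smooth_funs atlas) (B k) W \<and>
          (\<forall>s\<in>B k. W (D k (V s)) = map_prod (d k) (map_prod (e k) (d k)) s) \<and>
          (\<forall>s\<in>B k. V (dual_act3 \<epsilon> s) = dual_act3 \<epsilon> (V s) \<and> W (dual_act3 \<epsilon> s) = dual_act3 \<epsilon> (W s))) \<and>
       B 4 = {0} \<and>
       complex_iso real_act3 real_act3
         (B, D) (direct_sum (Gsp, d) (direct_sum (Esp, e) (Gsp, d))) (\<lambda>k. W) \<and>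
       complex_iso dual_act3 dual_act_split
         (B, D) (direct_sum (tensor_dual (Gsp, d)) (Esp, e)) (\<lambda>k s. regroup (W s))"
proof -
  interpret torsion_free_g2_manifold atlas g nab \<phi> vol by (rule assms)
  show ?thesis
    unfolding Let_def
    by (intro conjI allI impI ballI V_B_in W_B_in W_V V_W V_diff_op W_diff_op W_D_V[unfolded diag_def] V_W_dual B_4 real_splitting dual_splitting)
qed

end
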